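(* The following hold. (a) Start the discrete harmonic process (generator $L^{d}$, semigroup $S(t)$) from a product $\bigotimes_{i\in V}\nu_{\theta_i}$ of geometric distributions $\nu_\theta(n)=\left(\frac{\theta}{1+\theta}\right)^n\frac{1}{1+\theta}$, $n\in\mathbb{N}$, with $\theta\in(0,\infty)^V$. Then at time $t>0$ its distribution is $$\Big(\bigotimes_{i\in V}\nu_{\theta_i}\Big)S(t)=\mathbb{E}_\theta\Big(\bigotimes_{i\in V}\nu_{\theta_i(t)}\Big),$$ where $(\theta(t),t\ge0)$ is the hidden parameter process with generator $\mathcal{L}$ started from $\theta$. Equivalently, with the geometric intertwiner $\mathcal{G}f(\theta)=\int f(\eta)\big(\bigotimes_{i\in V}\nu_{\theta_i}\big)[d\eta]$ for integrable $f:\mathbb{N}^V\to\mathbb{R}$, one has $\mathcal{G}(L^{d}f)=\mathcal{L}(\mathcal{G}f)$. (b) Start the continuous harmonic process (generator $L^{c}$, semigroup $S(t)$) from a product $\bigotimes_{i\in V}\nu_{\theta_i}$ of exponential distributions $\nu_\theta(dx)=\frac1\theta e^{-x/\theta}dx$ on $[0,\infty)$, with $\theta\in(0,\infty)^V$. Then at time $t>0$ its distribution is $$\Big(\bigotimes_{i\in V}\nu_{\theta_i}\Big)S(t)=\mathbb{E}_\theta\Big(\bigotimes_{i\in V}\nu_{\theta_i(t)}\Big),$$ where $(\theta(t),t\ge0)$ is the same hidden parameter process with generator $\mathcal{L}$ started from $\theta$. Equivalently, with the exponential intertwiner $\mathcal{G}f(\theta)=\int f(\zeta)\big(\bigotimes_{i\in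 V}\nu_{\theta_i}\big)[d\zeta]$ for integrable $f:[0,\infty)^V\to\mathbb{R}$, one has $\mathcal{G}(L^{c}f)=\mathcal{L}(\mathcal{G}f)$.
   Context: $\mathbb{N}=\{0,1,2,\dots\}$. $V$ is a finite set, $p(i,j)=p(j,i)\ge 0$ ($i,j\in V$) are symmetric edge weights which are irreducible: any two vertices are joined by a finite path along which $p>0$. Sums $\sum_{i,j}$ run over ordered pairs of distinct vertices. $\delta_i$ is the configuration with value $1$ at $i$ and $0$ elsewhere. Discrete harmonic process: Markov process on $\mathbb{N}^V$ with generator $$L^{d}f(\eta)=\sum_{i,j\in V}p(i,j)\Big(\sum_{k=1}^{\eta_i}\tfrac1k\big(f(\eta-k\delta_i+k\delta_j)-f(\eta)\big)+\sum_{k=1}^{\eta_j}\tfrac1k\big(f(\eta-k\delta_j+k\delta_i)-f(\eta)\big)\Big).$$ Continuous harmonic process: Markov process on $[0,\infty)^V$ with generator $$L^{c}f(\zeta)=\sum_{i,j\in V}p(i,j)\int_0^1\frac{du}{u}\Big(\big(f(\zeta-u\zeta_i\delta_i+u\zeta_i\delta_j)-f(\zeta)\big)+\big(f(\zeta-u\zeta_j\delta_j+u\zeta_j\delta_i)-f(\zeta)\big)\Big).$$ Hidden parameter process: Markov process on $[0,\infty)^V$ with generator $$\mathcal{L}f(\theta)=\sum_{i,j\in V}p(i,j)\int_0^1\frac{du}{u}\Big(\big(f(\theta-u\theta_i\delta_i+u\theta_j\delta_i)-f(\theta)\big)+\big(f(\theta-u\theta_j\delta_j+u\theta_i\delta_j)-f(\theta)\big)\Big).$$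 $\mu S(t)$ is the law at time $t$ of the process started from $\mu$; $\mathbb{E}_\theta(\bigotimes_i\nu_{\theta_i(t)})$ is the measure $A\mapsto\mathbb{E}_\theta[(\bigotimes_i\nu_{\theta_i(t)})(A)]$. The generator identities are understood for functions $f$ for which both sides are well defined.
   Formalization: In (b), the identity 𝒢(L^c f)=ℒ(𝒢f) is stated for f integrable under all product laws such that the double integral over ζ and du/u converges absolutely for each jump direction; if L^c f is only defined a.e. and integrable, the identity can fail. *)

theory Defs
  imports "HOL-Probability.Probability"
begin

section \<open>Markov processes with a given generator\<close>

text \<open>
  A process with state space \<open>E\<close> is a family of probability measures \<open>Pr x\<close>, one for each
  starting point \<open>x\<close>, together with the random variables \<open>X t\<close> for \<open>t \<ge> 0\<close>.
\<close>

definition transition ::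
  "'x measure \<Rightarrow> ('x \<Rightarrow> 'w measure) \<Rightarrow> (real \<Rightarrow> 'w \<Rightarrow> 'x) \<Rightarrow> real \<Rightarrow> 'x \<Rightarrow> 'x measure" where
  "transition E Pr X t x = distr (Pr x) E (X t)"

definition natural_filtration ::
  "'x measure \<Rightarrow> 'w measure \<Rightarrow> (real \<Rightarrow> 'w \<Rightarrow> 'x) \<Rightarrow> real \<Rightarrow> 'w measure" where
  "natural_filtration E M X s =
     sigma (space M) (\<Union>r\<in>{0..s}. {X r -` A \<inter> space M | A. A \<in> sets E})"

definition markov_process ::
  "'x measure \<Rightarrow> ('x \<Rightarrow> 'w measure) \<Rightarrow> (real \<Rightarrow> 'w \<Rightarrow> 'x) \<Rightarrow> bool" where
  "markov_process E Pr X \<longleftrightarrow>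
     (\<forall>x\<in>space E. prob_space (Pr x) \<and> (\<forall>t\<ge>0. X t \<in> Pr x \<rightarrow>\<^sub>M E) \<and> (AE \<omega> in Pr x. X 0 \<omega> = x)) \<and>
     (\<forall>t\<ge>0. transition E Pr X t \<in> E \<rightarrow>\<^sub>M prob_algebra E) \<and>
     (\<forall>x\<in>space E. \<forall>s\<ge>0. \<forall>t\<ge>0. \<forall>A\<in>sets E.
        AE \<omega> in Pr x.
          real_cond_exp (Pr x) (natural_filtration E (Pr x) X s) (\<lambda>\<omega>. indicator A (X (s + t) \<omega>)) \<omega>
          = measure (transition E Pr X t (X s \<omega>)) A)"

text \<open>
  \<open>L\<close> is the generator on the test functions \<open>D\<close>:
  \<open>d/dt S(t) f = S(t) (L f)\<close> pointwise for all \<open>t \<ge> 0\<close>, with \<open>S(t) f x = E\<^sub>x [f (X t)]\<close>. The derivative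
  at \<open>t = 0\<close> is one-sided and reads \<open>lim (S(t) f - f) / t = L f\<close>.
\<close>

definition has_generator_on ::
  "'x measure \<Rightarrow> ('x \<Rightarrow> 'w measure) \<Rightarrow> (real \<Rightarrow> 'w \<Rightarrow> 'x) \<Rightarrow>
     ('x \<Rightarrow> real) set \<Rightarrow> (('x \<Rightarrow> real) \<Rightarrow> 'x \<Rightarrow> real) \<Rightarrow> bool" where
  "has_generator_on E Pr X D L \<longleftrightarrow>
     (\<forall>f\<in>D. \<forall>x\<in>space E. \<forall>t\<ge>0.
        ((\<lambda>s. \<integral>\<omega>. f (X s \<omega>) \<partial>Pr x) has_real_derivative (\<integral>\<omega>. L f (X t \<omega>) \<partial>Pr x)) (at t within {0..}))"

text \<open>The law \<open>\<mu> S(t)\<close> at time \<open>t\<close> of the process started from \<open>\<mu>\<close>.\<close>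

definition law_at ::
  "'x measure \<Rightarrow> ('x \<Rightarrow> 'w measure) \<Rightarrow> (real \<Rightarrow> 'w \<Rightarrow> 'x) \<Rightarrow> 'x measure \<Rightarrow> real \<Rightarrow> 'x measure" where
  "law_at E Pr X \<mu> t = \<mu> \<bind> transition E Pr X t"

section \<open>Edge weights and state spaces\<close>

definition symmetric_irreducible_weights :: "('v::finite \<Rightarrow> 'v \<Rightarrow> real) \<Rightarrow> bool" where
  "symmetric_irreducible_weights p \<longleftrightarrow>
     (\<forall>i j. p i j = p j i) \<and> (\<forall>i j. 0 \<le> p i j) \<and> (\<forall>i j. (\<lambda>a b. 0 < p a b)\<^sup>*\<^sup>* i j)"

definition orthant :: "(real^'v::finite) set" where
  "orthant = {x. \<forall>i. 0 \<le> x $ i}"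

definition pos_orthant :: "(real^'v::finite) set" where
  "pos_orthant = {x. \<forall>i. 0 < x $ i}"

abbreviation orthant_borel :: "(real^'v::finite) measure" where
  "orthant_borel \<equiv> restrict_space borel orthant"

definition finite_support_functions :: "('x \<Rightarrow> real) set" where
  "finite_support_functions = {f. finite {x. f x \<noteq> 0}}"

text \<open>
  Continuously differentiable functions with compact support. As test functions on the orthant,
  only their values there matter, so the compact support may meet the boundary of the orthant.
\<close>

definition C1_compact_support :: "(real^'v::finite \<Rightarrow> real) set" where
  "C1_compact_support =
     {f. (\<exists>g. continuous_on UNIV g \<and> (\<forall>x. (f has_derivative (\<lambda>h. g x \<bullet> h)) (at x))) \<and>
         compact (closure {x. f x \<noteq> 0})}"

section \<open>The three generators\<close>

definition move_particles :: "'v \<Rightarrow> 'v \<Rightarrow> nat \<Rightarrow> ('v \<Rightarrow> nat) \<Rightarrow> ('v \<Rightarrow> nat)" where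
  "move_particles i j k \<eta> = \<eta>(i := \<eta> i - k, j := \<eta> j + k)"

definition discrete_generator ::
  "('v::finite \<Rightarrow> 'v \<Rightarrow> real) \<Rightarrow> (('v \<Rightarrow> nat) \<Rightarrow> real) \<Rightarrow> ('v \<Rightarrow> nat) \<Rightarrow> real" where
  "discrete_generator p f \<eta> =
     (\<Sum>i\<in>UNIV. \<Sum>j\<in>UNIV - {i}. p i j *
        ((\<Sum>k=1..\<eta> i. 1 / real k * (f (move_particles i j k \<eta>) - f \<eta>)) +
         (\<Sum>k=1..\<eta> j. 1 / real k * (f (move_particles j i k \<eta>) - f \<eta>))))"

definition move_mass :: "'v::finite \<Rightarrow> 'v \<Rightarrow> real \<Rightarrow> real^'v \<Rightarrow> real^'v" where
  "move_mass i j u \<zeta> = \<zeta> - (u * \<zeta> $ i) *\<^sub>R axis i 1 + (u * \<zeta> $ i) *\<^sub>R axis j 1"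

definition continuous_generator ::
  "('v::finite \<Rightarrow> 'v \<Rightarrow> real) \<Rightarrow> (real^'v \<Rightarrow> real) \<Rightarrow> real^'v \<Rightarrow> real" where
  "continuous_generator p f \<zeta> =
     (\<Sum>i\<in>UNIV. \<Sum>j\<in>UNIV - {i}. p i j *
        (LBINT u:{0<..<1}. 1 / u *
           ((f (move_mass i j u \<zeta>) - f \<zeta>) + (f (move_mass j i u \<zeta>) - f \<zeta>))))"

definition move_parameter :: "'v::finite \<Rightarrow> 'v \<Rightarrow> real \<Rightarrow> real^'v \<Rightarrow> real^'v" where
  "move_parameter i j u \<theta> = \<theta> - (u * \<theta> $ i) *\<^sub>R axis i 1 + (u * \<theta> $ j) *\<^sub>R axis i 1"

definition hidden_generator ::
  "('v::finite \<Rightarrow> 'v \<Rightarrow> real) \<Rightarrow> (real^'v \<Rightarrow> real) \<Rightarrow> real^'v \<Rightarrow> real" where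
  "hidden_generator p f \<theta> =
     (\<Sum>i\<in>UNIV. \<Sum>j\<in>UNIV - {i}. p i j *
        (LBINT u:{0<..<1}. 1 / u *
           ((f (move_parameter i j u \<theta>) - f \<theta>) + (f (move_parameter j i u \<theta>) - f \<theta>))))"

section \<open>The three processes\<close>

definition discrete_harmonic_process ::
  "('v::finite \<Rightarrow> 'v \<Rightarrow> real) \<Rightarrow> (('v \<Rightarrow> nat) \<Rightarrow> 'w measure) \<Rightarrow> (real \<Rightarrow> 'w \<Rightarrow> 'v \<Rightarrow> nat) \<Rightarrow> bool" where
  "discrete_harmonic_process p Pr X \<longleftrightarrow>
     markov_process (count_space UNIV) Pr X \<and>
     has_generator_on (count_space UNIV) Pr X finite_support_functions (discrete_generator p)"

definition continuous_harmonic_process ::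
  "('v::finite \<Rightarrow> 'v \<Rightarrow> real) \<Rightarrow> (real^'v \<Rightarrow> 'w measure) \<Rightarrow> (real \<Rightarrow> 'w \<Rightarrow> real^'v) \<Rightarrow> bool" where
  "continuous_harmonic_process p Pr X \<longleftrightarrow>
     markov_process orthant_borel Pr X \<and>
     has_generator_on orthant_borel Pr X C1_compact_support (continuous_generator p)"

definition hidden_parameter_process ::
  "('v::finite \<Rightarrow> 'v \<Rightarrow> real) \<Rightarrow> (real^'v \<Rightarrow> 'w measure) \<Rightarrow> (real \<Rightarrow> 'w \<Rightarrow> real^'v) \<Rightarrow> bool" where
  "hidden_parameter_process p Pr X \<longleftrightarrow>
     markov_process orthant_borel Pr X \<and>
     has_generator_on orthant_borel Pr X C1_compact_support (hidden_generator p)"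

section \<open>Product measures and intertwiners\<close>

text \<open>
  \<^const>\<open>geometric_pmf\<close> with success probability \<open>q\<close> has weights \<open>(1 - q) ^ n * q\<close> on the
  naturals; \<open>q = 1 / (1 + \<theta>)\<close> gives \<open>(\<theta> / (1 + \<theta>)) ^ n * (1 / (1 + \<theta>))\<close>.
\<close>

definition geometric_product :: "real^'v::finite \<Rightarrow> ('v \<Rightarrow> nat) measure" where
  "geometric_product \<theta> = measure_pmf (Pi_pmf UNIV 0 (\<lambda>i. geometric_pmf (1 / (1 + \<theta> $ i))))"

text \<open>
  \<^const>\<open>exponential_density\<close> takes the rate \<open>1 / \<theta>\<close>. For \<open>\<theta> = 0\<close> we use the weak limit,
  the point mass at 0, so that the product is defined on the whole state space of the hidden
  parameter process.
\<close>

definition exponential_law :: "real \<Rightarrow> real measure" where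
  "exponential_law \<theta> =
     (if \<theta> = 0 then return borel 0 else density lborel (\<lambda>x. ennreal (exponential_density (1 / \<theta>) x)))"

definition exponential_product :: "real^'v::finite \<Rightarrow> (real^'v) measure" where
  "exponential_product \<theta> =
     restrict_space
       (distr (\<Pi>\<^sub>M i\<in>UNIV. exponential_law (\<theta> $ i)) borel (\<lambda>x. \<chi> i. x i)) orthant"

definition geometric_intertwiner ::
  "(('v::finite \<Rightarrow> nat) \<Rightarrow> real) \<Rightarrow> real^'v \<Rightarrow> real" where
  "geometric_intertwiner f \<theta> = (\<integral>\<eta>. f \<eta> \<partial>geometric_product \<theta>)"

definition exponential_intertwiner ::
  "(real^'v::finite \<Rightarrow> real) \<Rightarrow> real^'v \<Rightarrow> real" where
  "exponential_intertwiner f \<theta> = (\<integral>\<zeta>. f \<zeta> \<partial>exponential_product \<theta>)"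

text \<open>
  \<open>exponential_intertwiner (continuous_generator p f) \<theta>\<close> is well defined in the sense that the
  integral over \<open>(\<zeta>, u)\<close> converges absolutely for each kind of jump. Asking only that the inner
  integral exists for almost every \<open>\<zeta>\<close> and is integrable in \<open>\<zeta>\<close> would not do, because a generator
  with kernel \<open>du/u\<close> can lose singular parts of \<open>f\<close> pointwise.
\<close>

definition continuous_generator_integrable ::
  "('v::finite \<Rightarrow> 'v \<Rightarrow> real) \<Rightarrow> (real^'v \<Rightarrow> real) \<Rightarrow> real^'v \<Rightarrow> bool" where
  "continuous_generator_integrable p f \<theta> \<longleftrightarrow>
     (\<forall>i j. i \<noteq> j \<and> 0 < p i j \<longrightarrow>
        integrable (exponential_product \<theta> \<Otimes>\<^sub>M restrict_space lborel {0<..<1})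
          (\<lambda>(\<zeta>, u). 1 / u * (f (move_mass i j u \<zeta>) - f \<zeta>)))"

end

theory Submission
  imports Defs
begin

text \<open>
  The generator \<open>L\<^sup>d\<close> is symmetric for the counting measure, and acting with the hidden generator on
  \<open>\<theta> \<mapsto> \<Prod>\<^sub>i \<nu>(\<xi>\<^sub>i, \<theta>\<^sub>i)\<close> (geometric weights) gives the same result as acting with \<open>L\<^sup>d\<close> on \<open>\<xi>\<close>;
  the same holds for the continuous generator acting on products of Poisson weights
  \<open>e\<^sup>-\<^sup>\<zeta> \<zeta>\<^sup>\<xi> / \<xi>!\<close>. Hence the expectations of these functions along each of the three processes
  solve the same linear differential equation, which is closed on the finitely many \<open>\<xi>\<close> with a given number of
  particles and so is solved by an exponential series. In case (a) the geometric weights are the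
  point masses of the claimed law. In case (b), averaging a Poisson weight over an exponential law
  gives a geometric weight, and the expectations of all Poisson weights determine a measure on the orthant
  through its Laplace transform. The weights are not compactly supported, so the martingale property
  reaches them only through \<open>C\<^sup>1\<close> cutoffs on which the generators are uniformly bounded.

  The intertwining relation for a general integrand in case (a) follows by expanding over configurations. In
  case (b) the integrand is not smooth, and the jump of the parameter is instead compared with
  the jump of the mass by Fubini and a shift of coordinates, after removing the small jumps.
\<close>

section \<open>Updates of geometric and Poisson weights\<close>

text \<open>The processes are known only through their generators on compactly supported test
  functions, so uniqueness of the expectations has to come from the duality itself. The obstacle is
  the kernel du/u, which has infinite mass near u = 0: a cutoff must disturb the generator by a
  bounded amount, uniformly in its radius. For the continuous process the total mass is conserved,
  and a cutoff in the total mass commutes with all jumps. Parameter jumps conserve no sum; there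
  each coordinate is cut off, and the uniform bound comes from the decay 1/(1+\<theta>) of the
  geometric weight at the neighbouring vertex. The scale c in front of the arguments serves to
  recover laws on the orthant: Poisson weights at scale c give the Laplace transform at frequencies
  up to c, so c grows with the frequency. A single direction of a parameter jump produces logarithms
  of the parameters; they cancel only when both directions of an edge are added, hence the
  organisation by pairs.\<close>

lemma LBINT_unit_interval:
  fixes h k :: "real \<Rightarrow> real"
  assumes cont: "continuous_on {0..1} h" and int: "(h has_integral I) {0..1}"
    and eq: "\<And>u. 0 < u \<Longrightarrow> u < 1 \<Longrightarrow> k u = h u"
  shows "set_integrable lborel {0<..<1} k" and "(LBINT u:{0<..<1}. k u) = I"
proof -
  have i1: "set_integrable lborel {0..1} h"
    by (rule borel_integrable_atLeastAtMost'[OF cont])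
  have i2: "set_integrable lborel {0<..<1} h"
    by (rule set_integrable_subset[OF i1]) auto
  show "set_integrable lborel {0<..<1} k"
    using i2 by (subst set_integrable_cong[OF refl, of _ _ _ h]) (auto simp: eq)
  have "(LBINT u:{0<..<1}. k u) = (LBINT u:{0<..<1}. h u)"
    by (rule set_lebesgue_integral_cong) (auto simp: eq)
  also have "\<dots> = integral {0<..<1} h"
    by (rule set_borel_integral_eq_integral(2)[OF i2])
  also have "\<dots> = integral {0..1} h"
    by (simp add: integral_open_interval_real)
  also have "\<dots> = I"
    using int by (rule integral_unique)
  finally show "(LBINT u:{0<..<1}. k u) = I" .
qed

text \<open>The integrands have the form (difference)/u with a removable singularity at 0. The
  continuous extension h lives on the closed interval, where antiderivatives apply; the two added
  endpoints are a null set.\<close>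

lemma LBINT_unit_interval_FTC:
  fixes h k F :: "real \<Rightarrow> real"
  assumes cont: "continuous_on {0..1} h"
    and F: "\<And>u. 0 \<le> u \<Longrightarrow> u \<le> 1 \<Longrightarrow> (F has_real_derivative h u) (at u)"
    and eq: "\<And>u. 0 < u \<Longrightarrow> u < 1 \<Longrightarrow> k u = h u"
  shows "set_integrable lborel {0<..<1} k" and "(LBINT u:{0<..<1}. k u) = F 1 - F 0"
proof -
  have "(h has_integral (F 1 - F 0)) {0..1}"
  proof (rule fundamental_theorem_of_calculus)
    fix u :: real assume "u \<in> {0..1}"
    then have "(F has_real_derivative h u) (at u within {0..1})"
      by (auto intro: has_field_derivative_at_within[OF F])
    then show "(F has_vector_derivative h u) (at u within {0..1})"
      by (simp add: has_real_derivative_iff_has_vector_derivative)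
  qed simp
  note * = LBINT_unit_interval[OF cont this eq]
  show "set_integrable lborel {0<..<1} k" and "(LBINT u:{0<..<1}. k u) = F 1 - F 0"
    using * by auto
qed

definition geometric_weight :: "nat \<Rightarrow> real \<Rightarrow> real" where
  "geometric_weight n \<theta> = (\<theta> / (1 + \<theta>)) ^ n * (1 / (1 + \<theta>))"

definition poisson_weight :: "nat \<Rightarrow> real \<Rightarrow> real" where
  "poisson_weight n x = x ^ n / fact n * exp (- x)"

definition tensor :: "(nat \<Rightarrow> real \<Rightarrow> real) \<Rightarrow> ('v::finite \<Rightarrow> nat) \<Rightarrow> real^'v \<Rightarrow> real" where
  "tensor w \<xi> x = (\<Prod>i\<in>UNIV. w (\<xi> i) (x $ i))"

text \<open>The weight of the edge is stripped off. Both directions stay together because the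
  logarithms in the duality with the hidden process cancel only in their sum.\<close>

definition pair_generator ::
  "'v \<Rightarrow> 'v \<Rightarrow> (('v \<Rightarrow> nat) \<Rightarrow> real) \<Rightarrow> ('v \<Rightarrow> nat) \<Rightarrow> real" where
  "pair_generator i j f \<eta> =
     (\<Sum>k=1..\<eta> i. 1 / real k * (f (move_particles i j k \<eta>) - f \<eta>)) +
     (\<Sum>k=1..\<eta> j. 1 / real k * (f (move_particles j i k \<eta>) - f \<eta>))"

lemma discrete_generator_pair:
  "discrete_generator p f \<eta> = (\<Sum>i\<in>UNIV. \<Sum>j\<in>UNIV - {i}. p i j * pair_generator i j f \<eta>)"
  by (simp add: discrete_generator_def pair_generator_def)

text \<open>Put X = s/(1+s) and z = \<theta>/(1+\<theta>) along \<theta>(u) = (1-u)s + ut. The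
  integrand splits into z^n - X^n, which is z - X times a geometric sum, and a multiple of X^n that
  is linear in u before the division by u. Since dz/du = (t-s)/(1+\<theta>)^2, the powers z^(l-1)
  integrate to z^l/l, the origin of the rates 1/l of the discrete generator; the linear part
  integrates to a logarithm.\<close>

lemma geometric_weight_update:
  fixes s t :: real and n :: nat
  assumes s: "0 \<le> s" and t: "0 \<le> t"
  defines "k \<equiv> \<lambda>u. 1 / u * (geometric_weight n ((1 - u) * s + u * t) - geometric_weight n s)"
  shows "set_integrable lborel {0<..<1} k"
    and "(LBINT u:{0<..<1}. k u) =
      1 / (1 + s) * ((\<Sum>l=1..n. (s / (1 + s)) ^ (n - l) * ((t / (1 + t)) ^ l - (s / (1 + s)) ^ l) / real l)
        + (s / (1 + s)) ^ n * (ln (1 + s) - ln (1 + t)))"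
proof -
  define \<theta> where "\<theta> u = (1 - u) * s + u * t" for u
  define z where "z u = \<theta> u / (1 + \<theta> u)" for u
  define X where "X = s / (1 + s)"
  define F where "F u = 1 / (1 + s) * ((\<Sum>l=1..n. X ^ (n - l) * z u ^ l / real l) - X ^ n * ln (1 + \<theta> u))" for u
  define h where "h u = 1 / (1 + s) * ((t - s) / (1 + \<theta> u)\<^sup>2) *
     ((\<Sum>l=1..n. X ^ (n - l) * z u ^ (l - 1)) - X ^ n * (1 + \<theta> u))" for u
  have \<theta>: "0 \<le> \<theta> u" if "0 \<le> u" "u \<le> 1" for u
    using that s t by (auto simp: \<theta>_def)
  have c\<theta>: "continuous_on {0..1} \<theta>"
    unfolding \<theta>_def by (intro continuous_intros)
  have nz: "\<forall>u\<in>{0..1}. 1 + \<theta> u \<noteq> 0" "\<forall>u\<in>{0..1}. (1 + \<theta> u)\<^sup>2 \<noteq> 0"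
    using \<theta> by (force simp: add_nonneg_eq_0_iff)+
  have cont: "continuous_on {0..1} h"
    unfolding h_def z_def by (intro continuous_intros c\<theta> nz)
  have d\<theta>: "(\<theta> has_real_derivative (t - s)) (at u)" for u
    unfolding \<theta>_def[abs_def] by (auto intro!: derivative_eq_intros)
  have dz: "(z has_real_derivative ((t - s) / (1 + \<theta> u)\<^sup>2)) (at u)" if "0 \<le> u" "u \<le> 1" for u
    unfolding z_def[abs_def] using \<theta>[OF that]
    by (auto intro!: derivative_eq_intros d\<theta> simp: divide_simps power2_eq_square) (simp add: algebra_simps)
  have dF: "(F has_real_derivative h u) (at u)" if u: "0 \<le> u" "u \<le> 1" for u
  proof -
    have "((\<lambda>u. \<Sum>l=1..n. X ^ (n - l) * z u ^ l / real l) has_real_derivative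
            (\<Sum>l=1..n. X ^ (n - l) * z u ^ (l - 1) * ((t - s) / (1 + \<theta> u)\<^sup>2))) (at u)"
      by (rule DERIV_sum) (auto intro!: derivative_eq_intros dz u)
    moreover have "((\<lambda>u. X ^ n * ln (1 + \<theta> u)) has_real_derivative
        X ^ n * ((t - s) / (1 + \<theta> u)\<^sup>2 * (1 + \<theta> u))) (at u)"
    proof (rule DERIV_cmult)
      have "((\<lambda>u. ln (1 + \<theta> u)) has_real_derivative (t - s) / (1 + \<theta> u)) (at u)"
        using \<theta>[OF u] by (auto intro!: derivative_eq_intros d\<theta>)
      moreover have "(t - s) / (1 + \<theta> u) = (t - s) / (1 + \<theta> u)\<^sup>2 * (1 + \<theta> u)"
        using \<theta>[OF u] by (simp add: power2_eq_square)
      ultimately show "((\<lambda>u. ln (1 + \<theta> u)) has_real_derivative (t - s) / (1 + \<theta> u)\<^sup>2 * (1 + \<theta> u)) (at u)"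
        by simp
    qed
    ultimately have d: "(F has_real_derivative 1 / (1 + s) * ((\<Sum>l=1..n. X ^ (n - l) * z u ^ (l - 1) * ((t - s) / (1 + \<theta> u)\<^sup>2))
       - X ^ n * ((t - s) / (1 + \<theta> u)\<^sup>2 * (1 + \<theta> u)))) (at u)"
      unfolding F_def[abs_def] by (rule DERIV_cmult[OF DERIV_diff])
    have "h u = 1 / (1 + s) * ((\<Sum>l=1..n. X ^ (n - l) * z u ^ (l - 1) * ((t - s) / (1 + \<theta> u)\<^sup>2))
       - X ^ n * ((t - s) / (1 + \<theta> u)\<^sup>2 * (1 + \<theta> u)))"
      unfolding h_def sum_distrib_right[symmetric] by (simp only: ring_distribs mult_ac)
    with d show ?thesis by simp
  qed
  have eq: "k u = h u" if u: "0 < u" "u < 1" for u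
  proof -
    have \<theta>0: "0 \<le> \<theta> u" using \<theta>[of u] u by auto
    have zX: "z u - X = u * (t - s) / ((1 + \<theta> u) * (1 + s))"
      using \<theta>0 s by (auto simp: z_def X_def divide_simps) (simp add: \<theta>_def algebra_simps)
    have "(\<Sum>l=1..n. X ^ (n - l) * z u ^ (l - 1)) = (\<Sum>l<n. z u ^ l * X ^ (n - Suc l))"
      by (rule sum.reindex_bij_witness[of _ Suc "\<lambda>l. l - 1"]) (auto simp: mult.commute)
    then have geo: "(z u - X) * (\<Sum>l=1..n. X ^ (n - l) * z u ^ (l - 1)) = z u ^ n - X ^ n"
      by (simp add: power_diff_sumr2 mult.commute)
    have coef: "1 / (1 + s) * ((t - s) / (1 + \<theta> u)\<^sup>2) = (z u - X) / (u * (1 + \<theta> u))"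
      unfolding zX using u \<theta>0 s by (simp add: power2_eq_square)
    have "h u = ((z u - X) * (\<Sum>l=1..n. X ^ (n - l) * z u ^ (l - 1)) - X ^ n * ((z u - X) * (1 + \<theta> u))) / (u * (1 + \<theta> u))"
    proof -
      have "d / e * (S - Q * w) = (d * S - Q * (d * w)) / e" for d e S Q w :: real
        by (simp add: algebra_simps diff_divide_distrib)
      then show ?thesis unfolding h_def coef .
    qed
    also have "(z u - X) * (1 + \<theta> u) = u * (t - s) / (1 + s)"
      unfolding zX using \<theta>0 s by (simp add: divide_simps)
    also have "((z u - X) * (\<Sum>l=1..n. X ^ (n - l) * z u ^ (l - 1)) - X ^ n * (u * (t - s) / (1 + s))) / (u * (1 + \<theta> u)) =
        (z u ^ n - X ^ n * (1 + u * (t - s) / (1 + s))) / (u * (1 + \<theta> u))"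
      unfolding geo by (simp add: algebra_simps)
    also have "1 + u * (t - s) / (1 + s) = (1 + \<theta> u) / (1 + s)"
      using s by (simp add: divide_simps) (simp add: \<theta>_def algebra_simps)
    also have "(z u ^ n - X ^ n * ((1 + \<theta> u) / (1 + s))) / (u * (1 + \<theta> u)) = k u"
      using u \<theta>0 s unfolding k_def geometric_weight_def by (simp add: z_def X_def \<theta>_def[symmetric] divide_simps)
    finally show ?thesis ..
  qed
  note * = LBINT_unit_interval_FTC[OF cont dF eq]
  show "set_integrable lborel {0<..<1} k" by (rule *)
  have "(LBINT u:{0<..<1}. k u) = F 1 - F 0" by (rule *)
  also have "\<dots> = 1 / (1 + s) * ((\<Sum>l=1..n. X ^ (n - l) * (z 1 ^ l - z 0 ^ l) / real l)
        + X ^ n * (ln (1 + \<theta> 0) - ln (1 + \<theta> 1)))"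
  proof -
    have "(\<Sum>l=1..n. X ^ (n - l) * (z 1 ^ l - z 0 ^ l) / real l)
        = (\<Sum>l=1..n. X ^ (n - l) * z 1 ^ l / real l) - (\<Sum>l=1..n. X ^ (n - l) * z 0 ^ l / real l)"
      by (simp only: right_diff_distrib diff_divide_distrib sum_subtractf)
    then show ?thesis
      unfolding F_def by (simp only: right_diff_distrib distrib_left)
  qed
  finally show "(LBINT u:{0<..<1}. k u) =
      1 / (1 + s) * ((\<Sum>l=1..n. (s / (1 + s)) ^ (n - l) * ((t / (1 + t)) ^ l - (s / (1 + s)) ^ l) / real l)
        + (s / (1 + s)) ^ n * (ln (1 + s) - ln (1 + t)))"
    by (simp add: X_def z_def \<theta>_def)
qed

text \<open>The two updates contribute multiples of X^n Y^m (ln(1+s) - ln(1+t)) with opposite signs,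
  so the logarithms cancel. Mixing t into s lowers the power of X and raises that of Y: a jump of
  the parameter at i acts on the exponents as particles moving from i to j.\<close>

lemma geometric_weight_pair:
  fixes s t :: real
  assumes s: "0 \<le> s" and t: "0 \<le> t"
  shows "(LBINT u:{0<..<1}. 1 / u * (geometric_weight n ((1 - u) * s + u * t) - geometric_weight n s)) * geometric_weight m t
       + (LBINT u:{0<..<1}. 1 / u * (geometric_weight m ((1 - u) * t + u * s) - geometric_weight m t)) * geometric_weight n s
       = (\<Sum>k=1..n. 1 / real k * (geometric_weight (n - k) s * geometric_weight (m + k) t - geometric_weight n s * geometric_weight m t))
       + (\<Sum>k=1..m. 1 / real k * (geometric_weight (n + k) s * geometric_weight (m - k) t - geometric_weight n s * geometric_weight m t))"
proof -
  define X Y c where "X = s / (1 + s)" and "Y = t / (1 + t)" and "c = 1 / (1 + s) * (1 / (1 + t))"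
  have e: "geometric_weight a s * geometric_weight b t = c * (X ^ a * Y ^ b)" for a b
    by (simp add: geometric_weight_def X_def Y_def c_def)
  have 1: "(\<Sum>k=1..n. 1 / real k * (c * (X ^ (n - k) * Y ^ (m + k)) - c * (X ^ n * Y ^ m)))
     = c * Y ^ m * (\<Sum>k=1..n. X ^ (n - k) * (Y ^ k - X ^ k) / real k)"
    unfolding sum_distrib_left
    by (rule sum.cong) (auto simp: algebra_simps power_add diff_divide_distrib simp flip: power_add)
  have 2: "(\<Sum>k=1..m. 1 / real k * (c * (X ^ (n + k) * Y ^ (m - k)) - c * (X ^ n * Y ^ m)))
     = c * X ^ n * (\<Sum>k=1..m. Y ^ (m - k) * (X ^ k - Y ^ k) / real k)"
    unfolding sum_distrib_left
    by (rule sum.cong) (auto simp: algebra_simps power_add diff_divide_distrib simp flip: power_add)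
  show ?thesis
    unfolding e 1 2 geometric_weight_update(2)[OF s t] geometric_weight_update(2)[OF t s]
    unfolding X_def[symmetric] Y_def[symmetric] geometric_weight_def[of m t] geometric_weight_def[of n s]
    by (simp add: c_def algebra_simps)
qed

text \<open>Euler's Beta integral at integer arguments, by induction on n from u^k (1-u)^(n+1) = u^k
  (1-u)^n - u^(k+1) (1-u)^n.\<close>

lemma has_integral_power_mult_power:
  "((\<lambda>u::real. u ^ k * (1 - u) ^ n) has_integral (fact k * fact n / fact (k + n + 1))) {0..1}"
proof (induction n arbitrary: k)
  case 0
  have "((\<lambda>u::real. u ^ k) has_integral (1 ^ Suc k / real (Suc k) - 0 ^ Suc k / real (Suc k))) {0..1}"
  proof (rule fundamental_theorem_of_calculus)
    fix u :: real
    have "((\<lambda>u. u ^ Suc k / real (Suc k)) has_real_derivative u ^ k) (at u within {0..1})"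
      by (auto intro!: derivative_eq_intros simp del: power_Suc)
    then show "((\<lambda>u. u ^ Suc k / real (Suc k)) has_vector_derivative u ^ k) (at u within {0..1})"
      by (simp only: has_real_derivative_iff_has_vector_derivative)
  qed simp
  then show ?case by simp
next
  case (Suc n)
  have "((\<lambda>u::real. u ^ k * (1 - u) ^ n - u ^ Suc k * (1 - u) ^ n) has_integral
     (fact k * fact n / fact (k + n + 1) - fact (Suc k) * fact n / fact (Suc k + n + 1))) {0..1}"
    by (intro has_integral_diff Suc)
  also have "(\<lambda>u::real. u ^ k * (1 - u) ^ n - u ^ Suc k * (1 - u) ^ n) = (\<lambda>u. u ^ k * (1 - u) ^ Suc n)"
    by (auto simp: algebra_simps)
  also have "(fact k * fact n / fact (k + n + 1) - fact (Suc k) * fact n / fact (Suc k + n + 1) :: real)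
     = fact k * fact (Suc n) / fact (k + Suc n + 1)"
    by (simp add: divide_simps) (simp add: algebra_simps)
  finally show ?case .
qed

text \<open>A jump preserves a + b, so the exponentials factor out and only (1-u)^n (b+ua)^m
  remains. In its binomial expansion the term l = 0 is the only one without a factor u; together
  with the subtracted value at u = 0 it gives the harmonic number of n. For l \<ge> 1 the Beta
  integral reduces the binomial coefficient to 1/l. Mass moving from i to j thus lets particles of
  the exponent move from j to i.\<close>

lemma poisson_weight_update:
  fixes a b :: real and n m :: nat
  defines "k \<equiv> \<lambda>u. 1 / u * (poisson_weight n ((1 - u) * a) * poisson_weight m (b + u * a) - poisson_weight n a * poisson_weight m b)"
  shows "set_integrable lborel {0<..<1} k"
    and "(LBINT u:{0<..<1}. k u) =
      (\<Sum>l=1..m. 1 / real l * (poisson_weight (n + l) a * poisson_weight (m - l) b))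
      - (\<Sum>l=1..n. 1 / real l) * (poisson_weight n a * poisson_weight m b)"
proof -
  define c where "c = exp (- a) * exp (- b) / (fact n * fact m)"
  \<comment> \<open>The factor \<open>u ^ 0\<close> keeps these summands in the shape of the Beta
    integral.\<close>
  define h where "h u = c * ((\<Sum>l=1..m. real (m choose l) * a ^ (n + l) * b ^ (m - l) * (u ^ (l - 1) * (1 - u) ^ n))
     - a ^ n * b ^ m * (\<Sum>l=1..n. u ^ 0 * (1 - u) ^ (l - 1)))" for u
  have cont: "continuous_on {0..1} h"
    unfolding h_def by (intro continuous_intros)
  let ?I = "c * ((\<Sum>l=1..m. real (m choose l) * a ^ (n + l) * b ^ (m - l) * (fact (l - 1) * fact n / fact (l - 1 + n + 1)))
     - a ^ n * b ^ m * (\<Sum>l=1..n. (fact 0 * fact (l - 1) / fact (0 + (l - 1) + 1))))"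
  have int: "(h has_integral ?I) {0..1}"
    unfolding h_def
    by (intro has_integral_mult_right has_integral_diff has_integral_sum has_integral_power_mult_power) auto
  have eq: "k u = h u" if u: "0 < u" "u < 1" for u
  proof -
    have "poisson_weight n ((1 - u) * a) * poisson_weight m (b + u * a)
       = c * (a ^ n * (1 - u) ^ n * (u * a + b) ^ m)"
    proof -
      have "exp (- ((1 - u) * a)) * exp (- (b + u * a)) = exp (- a) * exp (- b)"
        by (simp add: mult_exp_exp algebra_simps)
      then have "((1 - u) * a) ^ n * (b + u * a) ^ m * (exp (- ((1 - u) * a)) * exp (- (b + u * a))) / (fact n * fact m)
          = c * (a ^ n * (1 - u) ^ n * (u * a + b) ^ m)"
        by (simp add: c_def power_mult_distrib add.commute)
      then show ?thesis by (simp add: poisson_weight_def ac_simps)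
    qed
    also have "(u * a + b) ^ m = (\<Sum>l\<le>m. real (m choose l) * (u * a) ^ l * b ^ (m - l))"
      by (rule binomial_ring)
    also have "{..m} = insert 0 {1..m}" by auto
    also have "(\<Sum>l\<in>insert 0 {1..m}. real (m choose l) * (u * a) ^ l * b ^ (m - l))
       = b ^ m + u * (\<Sum>l=1..m. real (m choose l) * a ^ l * b ^ (m - l) * u ^ (l - 1))"
    proof -
      have "(u * a) ^ l = u * (a ^ l * u ^ (l - 1))" if "l \<in> {1..m}" for l
        using that by (cases l) (auto simp: power_mult_distrib)
      then have "(\<Sum>l=1..m. real (m choose l) * (u * a) ^ l * b ^ (m - l))
         = (\<Sum>l=1..m. u * (real (m choose l) * a ^ l * b ^ (m - l) * u ^ (l - 1)))"
        by (intro sum.cong) auto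
      then show ?thesis by (simp add: sum_distrib_left)
    qed
    finally have 1: "poisson_weight n ((1 - u) * a) * poisson_weight m (b + u * a)
       = c * (a ^ n * (1 - u) ^ n * (b ^ m + u * (\<Sum>l=1..m. real (m choose l) * a ^ l * b ^ (m - l) * u ^ (l - 1))))" .
    have 2: "(1 - u) ^ n = 1 - u * (\<Sum>l=1..n. u ^ 0 * (1 - u) ^ (l - 1))"
    proof (induction n)
      case (Suc n)
      have "(1 - u) ^ Suc n = (1 - u) ^ n - u * (1 - u) ^ n" by (simp add: algebra_simps)
      then show ?case using Suc.IH by (simp add: distrib_left del: power_Suc)
    qed simp
    have 3: "poisson_weight n a * poisson_weight m b = c * (a ^ n * b ^ m)"
      by (simp add: poisson_weight_def c_def)
    have "k u = 1 / u * (c * (a ^ n * (((1 - u) ^ n - 1) * b ^ m + (1 - u) ^ n * u * (\<Sum>l=1..m. real (m choose l) * a ^ l * b ^ (m - l) * u ^ (l - 1)))))"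
      unfolding k_def 1 3 by (simp add: algebra_simps)
    also have "(1 - u) ^ n - 1 = - u * (\<Sum>l=1..n. u ^ 0 * (1 - u) ^ (l - 1))"
      using 2 by simp
    also have "1 / u * (c * (a ^ n * (- u * (\<Sum>l=1..n. u ^ 0 * (1 - u) ^ (l - 1)) * b ^ m + (1 - u) ^ n * u * (\<Sum>l=1..m. real (m choose l) * a ^ l * b ^ (m - l) * u ^ (l - 1)))))
       = c * (a ^ n * (1 - u) ^ n * (\<Sum>l=1..m. real (m choose l) * a ^ l * b ^ (m - l) * u ^ (l - 1)) - a ^ n * b ^ m * (\<Sum>l=1..n. u ^ 0 * (1 - u) ^ (l - 1)))"
      using u by (simp add: field_simps)
    also have "\<dots> = h u"
      unfolding h_def by (simp add: sum_distrib_left power_add algebra_simps)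
    finally show ?thesis .
  qed
  note * = LBINT_unit_interval[OF cont int eq]
  show "set_integrable lborel {0<..<1} k" by (rule *)
  have "(LBINT u:{0<..<1}. k u) = ?I" by (rule *)
  also have "\<dots> = c * (\<Sum>l=1..m. real (m choose l) * a ^ (n + l) * b ^ (m - l) * (fact (l - 1) * fact n / fact (n + l)))
     - c * (a ^ n * b ^ m) * (\<Sum>l=1..n. 1 / real l)"
  proof -
    have "fact (l - 1) / fact (0 + (l - 1) + 1) = 1 / real l" if "l \<in> {1..n}" for l
      using that by (cases l) auto
    moreover have "fact (l - 1 + n + 1) = (fact (n + l) :: real)" if "l \<in> {1..m}" for l
      using that by (cases l) (auto simp: add.commute)
    ultimately show ?thesis by (simp add: algebra_simps)
  qed
  also have "c * (a ^ n * b ^ m) = poisson_weight n a * poisson_weight m b"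
    by (simp add: poisson_weight_def c_def)
  also have "c * (\<Sum>l=1..m. real (m choose l) * a ^ (n + l) * b ^ (m - l) * (fact (l - 1) * fact n / fact (n + l)))
     = (\<Sum>l=1..m. 1 / real l * (poisson_weight (n + l) a * poisson_weight (m - l) b))"
    unfolding sum_distrib_left
  proof (rule sum.cong)
    fix l assume l: "l \<in> {1..m}"
    then have 1: "real (m choose l) = fact m / (fact l * fact (m - l))"
      by (simp add: binomial_fact)
    have 2: "(fact l :: real) = real l * fact (l - 1)" using l by (cases l) auto
    show "c * (real (m choose l) * a ^ (n + l) * b ^ (m - l) * (fact (l - 1) * fact n / fact (n + l)))
       = 1 / real l * (poisson_weight (n + l) a * poisson_weight (m - l) b)"
      unfolding 1 2 c_def poisson_weight_def using l by (simp add: field_simps)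
  qed simp
  finally show "(LBINT u:{0<..<1}. k u) =
      (\<Sum>l=1..m. 1 / real l * (poisson_weight (n + l) a * poisson_weight (m - l) b))
      - (\<Sum>l=1..n. 1 / real l) * (poisson_weight n a * poisson_weight m b)" by (simp only: mult.commute)
qed

section \<open>Dualities for products of weights\<close>

lemma tensor_split:
  assumes "i \<noteq> j"
  shows "tensor w \<xi> x = w (\<xi> i) (x $ i) * w (\<xi> j) (x $ j) * (\<Prod>k\<in>UNIV - {i, j}. w (\<xi> k) (x $ k))"
proof -
  have "(UNIV :: 'a set) = insert i (insert j (UNIV - {i, j}))" by auto
  then have "tensor w \<xi> x = (\<Prod>k\<in>insert i (insert j (UNIV - {i, j})). w (\<xi> k) (x $ k))"
    unfolding tensor_def by simp
  then show ?thesis using assms by (simp add: mult.assoc)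
qed

lemma tensor_move_particles:
  assumes "i \<noteq> j"
  shows "tensor w (move_particles i j k \<xi>) x =
    w (\<xi> i - k) (x $ i) * w (\<xi> j + k) (x $ j) * (\<Prod>k\<in>UNIV - {i, j}. w (\<xi> k) (x $ k))"
proof -
  have "(\<Prod>l\<in>UNIV - {i, j}. w (move_particles i j k \<xi> l) (x $ l)) = (\<Prod>l\<in>UNIV - {i, j}. w (\<xi> l) (x $ l))"
    by (rule prod.cong) (auto simp: move_particles_def)
  then show ?thesis
    unfolding tensor_split[OF assms] using assms by (simp add: move_particles_def)
qed

lemma pair_generator_tensor:
  assumes "i \<noteq> j"
  shows "pair_generator i j (\<lambda>\<xi>. tensor w \<xi> x) \<xi> =
    ((\<Sum>k=1..\<xi> i. 1 / real k * (w (\<xi> i - k) (x $ i) * w (\<xi> j + k) (x $ j) - w (\<xi> i) (x $ i) * w (\<xi> j) (x $ j)))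
   + (\<Sum>k=1..\<xi> j. 1 / real k * (w (\<xi> i + k) (x $ i) * w (\<xi> j - k) (x $ j) - w (\<xi> i) (x $ i) * w (\<xi> j) (x $ j))))
   * (\<Prod>k\<in>UNIV - {i, j}. w (\<xi> k) (x $ k))"
proof -
  have ji: "j \<noteq> i" using assms by simp
  have ins: "{j, i} = {i, j}" by auto
  show ?thesis
    unfolding pair_generator_def distrib_right sum_distrib_right tensor_move_particles[OF assms] tensor_move_particles[OF ji] ins
    unfolding tensor_split[OF assms]
    by (intro arg_cong2[of _ _ _ _ "(+)"] sum.cong refl) (simp_all only: left_diff_distrib right_diff_distrib mult_ac)
qed

lemma tensor_move_parameter:
  assumes "i \<noteq> j"
  shows "tensor w \<xi> (c *\<^sub>R move_parameter i j u \<theta>) =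
    w (\<xi> i) (c * ((1 - u) * \<theta> $ i + u * \<theta> $ j)) * w (\<xi> j) (c * \<theta> $ j) * (\<Prod>k\<in>UNIV - {i, j}. w (\<xi> k) (c * \<theta> $ k))"
proof -
  have "(\<Prod>k\<in>UNIV - {i, j}. w (\<xi> k) ((c *\<^sub>R move_parameter i j u \<theta>) $ k)) = (\<Prod>k\<in>UNIV - {i, j}. w (\<xi> k) (c * \<theta> $ k))"
    by (rule prod.cong) (auto simp: move_parameter_def axis_def)
  then show ?thesis
    unfolding tensor_split[OF assms] using assms
    by (simp add: move_parameter_def axis_def algebra_simps)
qed

lemma tensor_move_mass:
  assumes "i \<noteq> j"
  shows "tensor w \<xi> (c *\<^sub>R move_mass i j u \<zeta>) =
    w (\<xi> i) (c * ((1 - u) * \<zeta> $ i)) * w (\<xi> j) (c * (\<zeta> $ j + u * \<zeta> $ i)) * (\<Prod>k\<in>UNIV - {i, j}. w (\<xi> k) (c * \<zeta> $ k))"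
proof -
  have "(\<Prod>k\<in>UNIV - {i, j}. w (\<xi> k) ((c *\<^sub>R move_mass i j u \<zeta>) $ k)) = (\<Prod>k\<in>UNIV - {i, j}. w (\<xi> k) (c * \<zeta> $ k))"
    by (rule prod.cong) (auto simp: move_mass_def axis_def)
  then show ?thesis
    unfolding tensor_split[OF assms] using assms
    by (simp add: move_mass_def axis_def algebra_simps)
qed

lemma hidden_jump_tensor:
  fixes \<theta> :: "real^'v::finite" and \<xi> :: "'v \<Rightarrow> nat"
  assumes ij: "i \<noteq> j" and \<theta>: "\<theta> \<in> orthant" and c: "0 \<le> c"
  defines "k \<equiv> \<lambda>u. 1 / u * (tensor geometric_weight \<xi> (c *\<^sub>R move_parameter i j u \<theta>) - tensor geometric_weight \<xi> (c *\<^sub>R \<theta>))"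
  shows "set_integrable lborel {0<..<1} k"
    and "(LBINT u:{0<..<1}. k u) =
      (LBINT u:{0<..<1}. 1 / u * (geometric_weight (\<xi> i) ((1 - u) * (c * \<theta> $ i) + u * (c * \<theta> $ j)) - geometric_weight (\<xi> i) (c * \<theta> $ i)))
       * geometric_weight (\<xi> j) (c * \<theta> $ j) * (\<Prod>k\<in>UNIV - {i, j}. geometric_weight (\<xi> k) (c * \<theta> $ k))"
proof -
  let ?r = "geometric_weight (\<xi> j) (c * \<theta> $ j) * (\<Prod>k\<in>UNIV - {i, j}. geometric_weight (\<xi> k) (c * \<theta> $ k))"
  let ?g = "\<lambda>u. 1 / u * (geometric_weight (\<xi> i) ((1 - u) * (c * \<theta> $ i) + u * (c * \<theta> $ j)) - geometric_weight (\<xi> i) (c * \<theta> $ i))"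
  have k: "k = (\<lambda>u. ?g u * ?r)"
    unfolding k_def tensor_move_parameter[OF ij] unfolding tensor_split[OF ij]
    by (auto simp: algebra_simps)
  have pos: "0 \<le> c * \<theta> $ i" "0 \<le> c * \<theta> $ j" using \<theta> c by (auto simp: orthant_def)
  show "set_integrable lborel {0<..<1} k"
    unfolding k by (rule set_integrable_mult_left) (rule geometric_weight_update(1)[OF pos])
  show "(LBINT u:{0<..<1}. k u) = (LBINT u:{0<..<1}. ?g u) * geometric_weight (\<xi> j) (c * \<theta> $ j) * (\<Prod>k\<in>UNIV - {i, j}. geometric_weight (\<xi> k) (c * \<theta> $ k))"
    unfolding k by (subst set_integral_mult_left) (simp only: mult.assoc)
qed

lemma hidden_pair_tensor:
  fixes \<theta> :: "real^'v::finite" and \<xi> :: "'v \<Rightarrow> nat"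
  assumes ij: "i \<noteq> j" and \<theta>: "\<theta> \<in> orthant" and c: "0 \<le> c"
  defines "f \<equiv> \<lambda>\<theta>. tensor geometric_weight \<xi> (c *\<^sub>R \<theta>)"
  shows "set_integrable lborel {0<..<1} (\<lambda>u. 1 / u * ((f (move_parameter i j u \<theta>) - f \<theta>) + (f (move_parameter j i u \<theta>) - f \<theta>)))"
    and "(LBINT u:{0<..<1}. 1 / u * ((f (move_parameter i j u \<theta>) - f \<theta>) + (f (move_parameter j i u \<theta>) - f \<theta>)))
       = pair_generator i j (\<lambda>\<xi>. tensor geometric_weight \<xi> (c *\<^sub>R \<theta>)) \<xi>"
proof -
  have pos: "0 \<le> c * \<theta> $ i" "0 \<le> c * \<theta> $ j" using \<theta> c by (auto simp: orthant_def)
  have ji: "j \<noteq> i" using ij by simp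
  have ins: "{j, i} = {i, j}" by auto
  note 1 = hidden_jump_tensor[OF ij \<theta> c, of \<xi>]
  note 2 = hidden_jump_tensor[OF ji \<theta> c, of \<xi>]
  show "set_integrable lborel {0<..<1} (\<lambda>u. 1 / u * ((f (move_parameter i j u \<theta>) - f \<theta>) + (f (move_parameter j i u \<theta>) - f \<theta>)))"
    unfolding f_def ring_distribs(1)[of "1 / _"] by (rule set_integral_add(1)[OF 1(1) 2(1)])
  have "(LBINT u:{0<..<1}. 1 / u * ((f (move_parameter i j u \<theta>) - f \<theta>) + (f (move_parameter j i u \<theta>) - f \<theta>)))
     = (LBINT u:{0<..<1}. 1 / u * (f (move_parameter i j u \<theta>) - f \<theta>)) + (LBINT u:{0<..<1}. 1 / u * (f (move_parameter j i u \<theta>) - f \<theta>))"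
    unfolding f_def ring_distribs(1)[of "1 / _"] by (rule set_integral_add(2)[OF 1(1) 2(1)])
  also have "\<dots> = pair_generator i j (\<lambda>\<xi>. tensor geometric_weight \<xi> (c *\<^sub>R \<theta>)) \<xi>"
    unfolding f_def 1(2) 2(2) pair_generator_tensor[OF ij] ins vector_scaleR_component real_scaleR_def
      geometric_weight_pair[OF pos, symmetric] by (simp only: distrib_right distrib_left mult_ac)
  finally show "(LBINT u:{0<..<1}. 1 / u * ((f (move_parameter i j u \<theta>) - f \<theta>) + (f (move_parameter j i u \<theta>) - f \<theta>)))
       = pair_generator i j (\<lambda>\<xi>. tensor geometric_weight \<xi> (c *\<^sub>R \<theta>)) \<xi>" .
qed

text \<open>\<open>move_parameter\<close> is linear in \<theta> and commutes with scaling, so the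
  duality at scale c is the one at scale 1 read at c\<theta>. The scaled form is what averaging
  Poisson weights at scale c over exponential laws produces.\<close>

lemma hidden_generator_tensor:
  assumes "\<theta> \<in> orthant" and "0 \<le> c"
  shows "hidden_generator p (\<lambda>\<theta>. tensor geometric_weight \<xi> (c *\<^sub>R \<theta>)) \<theta>
     = discrete_generator p (\<lambda>\<xi>. tensor geometric_weight \<xi> (c *\<^sub>R \<theta>)) \<xi>"
  unfolding hidden_generator_def discrete_generator_pair
  by (intro sum.cong refl arg_cong2[of _ _ _ _ "(*)"] hidden_pair_tensor(2)) (use assms in auto)

lemma continuous_jump_tensor:
  fixes \<zeta> :: "real^'v::finite" and c :: real and \<xi> :: "'v \<Rightarrow> nat"
  assumes ij: "i \<noteq> j"
  defines "k \<equiv> \<lambda>u. 1 / u * (tensor poisson_weight \<xi> (c *\<^sub>R move_mass i j u \<zeta>) - tensor poisson_weight \<xi> (c *\<^sub>R \<zeta>))"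
  shows "set_integrable lborel {0<..<1} k"
    and "(LBINT u:{0<..<1}. k u) =
      ((\<Sum>l=1..\<xi> j. 1 / real l * (poisson_weight (\<xi> i + l) (c * \<zeta> $ i) * poisson_weight (\<xi> j - l) (c * \<zeta> $ j)))
      - (\<Sum>l=1..\<xi> i. 1 / real l) * (poisson_weight (\<xi> i) (c * \<zeta> $ i) * poisson_weight (\<xi> j) (c * \<zeta> $ j)))
       * (\<Prod>k\<in>UNIV - {i, j}. poisson_weight (\<xi> k) (c * \<zeta> $ k))"
proof -
  let ?r = "(\<Prod>k\<in>UNIV - {i, j}. poisson_weight (\<xi> k) (c * \<zeta> $ k))"
  let ?g = "\<lambda>u. 1 / u * (poisson_weight (\<xi> i) ((1 - u) * (c * \<zeta> $ i)) * poisson_weight (\<xi> j) (c * \<zeta> $ j + u * (c * \<zeta> $ i))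
     - poisson_weight (\<xi> i) (c * \<zeta> $ i) * poisson_weight (\<xi> j) (c * \<zeta> $ j))"
  have k: "k = (\<lambda>u. ?g u * ?r)"
    unfolding k_def tensor_move_mass[OF ij] unfolding tensor_split[OF ij]
    by (auto simp: algebra_simps)
  show "set_integrable lborel {0<..<1} k"
    unfolding k by (rule set_integrable_mult_left) (rule poisson_weight_update(1))
  show "(LBINT u:{0<..<1}. k u) =
      ((\<Sum>l=1..\<xi> j. 1 / real l * (poisson_weight (\<xi> i + l) (c * \<zeta> $ i) * poisson_weight (\<xi> j - l) (c * \<zeta> $ j)))
      - (\<Sum>l=1..\<xi> i. 1 / real l) * (poisson_weight (\<xi> i) (c * \<zeta> $ i) * poisson_weight (\<xi> j) (c * \<zeta> $ j)))
       * (\<Prod>k\<in>UNIV - {i, j}. poisson_weight (\<xi> k) (c * \<zeta> $ k))"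
    unfolding k by (subst set_integral_mult_left) (simp only: poisson_weight_update(2))
qed

text \<open>A single direction is not one half of \<open>pair_generator\<close>: the jumps from i to
  j give the losses of \<xi> at i but the gains of particles leaving j. Adding the two directions
  matches the gains of one with the losses of the other.\<close>

lemma continuous_generator_tensor:
  "continuous_generator p (\<lambda>\<zeta>. tensor poisson_weight \<xi> (c *\<^sub>R \<zeta>)) \<zeta>
     = discrete_generator p (\<lambda>\<xi>. tensor poisson_weight \<xi> (c *\<^sub>R \<zeta>)) \<xi>"
proof -
  have "(LBINT u:{0<..<1}. 1 / u * ((tensor poisson_weight \<xi> (c *\<^sub>R move_mass i j u \<zeta>) - tensor poisson_weight \<xi> (c *\<^sub>R \<zeta>))
       + (tensor poisson_weight \<xi> (c *\<^sub>R move_mass j i u \<zeta>) - tensor poisson_weight \<xi> (c *\<^sub>R \<zeta>))))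
     = pair_generator i j (\<lambda>\<xi>. tensor poisson_weight \<xi> (c *\<^sub>R \<zeta>)) \<xi>" if ij: "i \<noteq> j" for i j
  proof -
    have ji: "j \<noteq> i" using ij by simp
    have ins: "{j, i} = {i, j}" by auto
    note 1 = continuous_jump_tensor[OF ij, of \<xi> c \<zeta>]
    note 2 = continuous_jump_tensor[OF ji, of \<xi> c \<zeta>]
    have 3: "(\<Sum>k=1..n. 1 / real k * (F k - W)) = (\<Sum>k=1..n. 1 / real k * F k) - (\<Sum>k=1..n. 1 / real k) * W" for n F and W :: real
      by (simp add: right_diff_distrib sum_subtractf sum_distrib_right)
    show ?thesis
      unfolding ring_distribs(1)[of "1 / _"] set_integral_add(2)[OF 1(1) 2(1)] 1(2) 2(2) pair_generator_tensor[OF ij] ins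
        3 vector_scaleR_component real_scaleR_def
      by (simp only: ring_distribs mult_ac add_ac diff_conv_add_uminus minus_add_distrib minus_minus)
  qed
  then show ?thesis
    unfolding continuous_generator_def discrete_generator_pair by (intro sum.cong refl) auto
qed

section \<open>Cutoffs of the weights\<close>

definition C1 :: "(real^'v::finite \<Rightarrow> real) \<Rightarrow> bool" where
  "C1 f \<longleftrightarrow> (\<exists>g. continuous_on UNIV g \<and> (\<forall>x. (f has_derivative (\<lambda>h. g x \<bullet> h)) (at x)))"

lemma C1_const: "C1 (\<lambda>x :: real^'v::finite. c)"
  unfolding C1_def
proof (intro exI conjI allI)
  show "continuous_on UNIV (\<lambda>x::real^'v. 0 :: real^'v)" by simp
  show "((\<lambda>x. c) has_derivative (\<lambda>h. 0 \<bullet> h)) (at x)" for x :: "real^'v"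
    by simp
qed

lemma C1_mult:
  assumes "C1 f" and "C1 f'"
  shows "C1 (\<lambda>x. f x * f' x)"
proof -
  from assms obtain g g' where g: "continuous_on UNIV g" "\<And>x. (f has_derivative (\<lambda>h. g x \<bullet> h)) (at x)"
    and g': "continuous_on UNIV g'" "\<And>x. (f' has_derivative (\<lambda>h. g' x \<bullet> h)) (at x)"
    unfolding C1_def by blast
  have cf: "continuous_on UNIV f" "continuous_on UNIV f'"
    by (auto intro!: continuous_at_imp_continuous_on has_derivative_continuous g g')
  show ?thesis unfolding C1_def
  proof (intro exI conjI allI)
    show "continuous_on UNIV (\<lambda>x. f x *\<^sub>R g' x + f' x *\<^sub>R g x)"
      by (intro continuous_intros cf g g')
    show "((\<lambda>x. f x * f' x) has_derivative (\<lambda>h. (f x *\<^sub>R g' x + f' x *\<^sub>R g x) \<bullet> h)) (at x)" for x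
      by (rule has_derivative_eq_rhs[OF has_derivative_mult[OF g(2) g'(2)]])
         (auto simp: inner_add_left)
  qed
qed

lemma C1_prod:
  assumes "finite A" and "\<And>i. i \<in> A \<Longrightarrow> C1 (f i)"
  shows "C1 (\<lambda>x. \<Prod>i\<in>A. f i x)"
  using assms by (induction A rule: finite_induct) (auto intro: C1_const C1_mult)

lemma C1_inner:
  assumes F: "\<And>x. (F has_real_derivative F' x) (at x)" and F': "continuous_on UNIV F'"
  shows "C1 (\<lambda>x. F (a \<bullet> x))"
  unfolding C1_def
proof (intro exI conjI allI)
  show "continuous_on UNIV (\<lambda>x. F' (a \<bullet> x) *\<^sub>R a)"
    by (intro continuous_intros continuous_on_compose2[OF F']) auto
  fix x
  have "((\<lambda>x. a \<bullet> x) has_derivative (\<lambda>h. a \<bullet> h)) (at x)"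
    by (auto intro!: derivative_eq_intros)
  moreover have "(F has_derivative (\<lambda>h. h * F' (a \<bullet> x))) (at (a \<bullet> x))"
    using F by (simp add: has_field_derivative_def mult_commute_abs)
  ultimately have "((\<lambda>x. F (a \<bullet> x)) has_derivative (\<lambda>h. (a \<bullet> h) * F' (a \<bullet> x))) (at x)"
    by (rule has_derivative_compose)
  then show "((\<lambda>x. F (a \<bullet> x)) has_derivative (\<lambda>h. (F' (a \<bullet> x) *\<^sub>R a) \<bullet> h)) (at x)"
    by (simp add: mult.commute)
qed

lemma C1_component:
  assumes F: "\<And>x. (F has_real_derivative F' x) (at x)" and F': "continuous_on UNIV F'"
  shows "C1 (\<lambda>x. F (c * x $ i))"
proof -
  have e: "(c *\<^sub>R axis i 1) \<bullet> x = c * x $ i" for x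
    by (simp add: inner_axis')
  show ?thesis using C1_inner[OF assms, of "c *\<^sub>R axis i 1"] unfolding e .
qed

lemma C1_component_sum:
  fixes F :: "real \<Rightarrow> real"
  assumes F: "\<And>x. (F has_real_derivative F' x) (at x)" and F': "continuous_on UNIV F'"
  shows "C1 (\<lambda>x :: real^'v::finite. F (c * (\<Sum>i\<in>UNIV. x $ i)))"
proof -
  have e: "(c *\<^sub>R (\<chi> i. 1)) \<bullet> x = c * (\<Sum>i\<in>UNIV. x $ i)" for x :: "real^'v"
    by (simp add: inner_vec_def sum_distrib_left)
  show ?thesis using C1_inner[OF assms, of "c *\<^sub>R (\<chi> i. 1) :: real^'v"] unfolding e .
qed

lemma C1_compact_supportI:
  fixes f :: "real^'v::finite \<Rightarrow> real"
  assumes "C1 f" and "\<And>x. f x \<noteq> 0 \<Longrightarrow> \<forall>i. a \<le> x $ i \<and> x $ i \<le> b"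
  shows "f \<in> C1_compact_support"
proof -
  have "{x. f x \<noteq> 0} \<subseteq> cbox (\<chi> i. a) (\<chi> i. b)"
    using assms(2) by (auto simp: mem_box_cart)
  then have "compact (closure {x. f x \<noteq> 0})"
    by (metis bounded_cbox bounded_subset compact_closure)
  then show ?thesis using assms(1) by (simp add: C1_compact_support_def C1_def)
qed

text \<open>Equal to 1 up to 1 and to 0 from 2 on. The inner square smooths the kink at 1 and the
  outer square the one at 2; polynomial pieces give the explicit derivative bound 4.\<close>

definition cutoff :: "real \<Rightarrow> real" where
  "cutoff x = (max 0 (1 - (max 0 (x - 1))\<^sup>2))\<^sup>2"

definition cutoff' :: "real \<Rightarrow> real" where
  "cutoff' x = - 4 * max 0 (1 - (max 0 (x - 1))\<^sup>2) * max 0 (x - 1)"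

lemma DERIV_max_square: "((\<lambda>x::real. (max 0 x)\<^sup>2) has_real_derivative 2 * max 0 x) (at x)"
proof -
  consider "x = 0" | "x > 0" | "x < 0" by linarith
  then show ?thesis
  proof cases
    case 1
    have "isCont (\<lambda>z::real. max 0 z) 0" by (intro continuous_intros)
    \<comment> \<open>Caratheodory's criterion at 0, from (max 0 z)^2 = max 0 z * z.\<close>
    then show ?thesis unfolding CARAT_DERIV
      by (intro exI[of _ "\<lambda>z. max 0 z"]) (auto simp: 1 max_def power2_eq_square)
  next
    case 2
    have "((\<lambda>x. x\<^sup>2) has_real_derivative 2 * max 0 x) (at x)"
      using 2 by (auto intro!: derivative_eq_intros)
    then show ?thesis
      by (rule has_field_derivative_transform_within_open[of _ _ _ "{0<..}"]) (use 2 in auto)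
  next
    case 3
    have "((\<lambda>x. 0) has_real_derivative 2 * max 0 x) (at x)"
      using 3 by (auto intro!: derivative_eq_intros)
    then show ?thesis
      by (rule has_field_derivative_transform_within_open[of _ _ _ "{..<0}"]) (use 3 in auto)
  qed
qed

lemma DERIV_cutoff: "(cutoff has_real_derivative cutoff' x) (at x)"
proof -
  have 1: "((\<lambda>x. 1 - (max 0 (x - 1))\<^sup>2) has_real_derivative - (2 * max 0 (x - 1))) (at x)"
    using DERIV_diff[OF DERIV_const[of 1] DERIV_chain2[OF DERIV_max_square DERIV_diff[OF DERIV_ident DERIV_const[of 1]]], of x UNIV]
    by simp
  show ?thesis
    using DERIV_chain2[OF DERIV_max_square 1] unfolding cutoff_def[abs_def] cutoff'_def
    by (simp add: algebra_simps)
qed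

lemma continuous_cutoff': "continuous_on A cutoff'"
  unfolding cutoff'_def[abs_def] by (intro continuous_intros)

lemma continuous_cutoff: "continuous_on A cutoff"
  unfolding cutoff_def[abs_def] by (intro continuous_intros)

lemma cutoff_eq_1: "x \<le> 1 \<Longrightarrow> cutoff x = 1"
  by (simp add: cutoff_def)

lemma cutoff_eq_0: "2 \<le> x \<Longrightarrow> cutoff x = 0"
  using power_mono[of 1 "x - 1" 2] by (simp add: cutoff_def)

lemma cutoff_bounds: "0 \<le> cutoff x" "cutoff x \<le> 1"
  by (auto simp: cutoff_def intro!: power_le_one)

lemma cutoff'_eq_0: "x \<le> 1 \<or> 2 \<le> x \<Longrightarrow> cutoff' x = 0"
  using power_mono[of 1 "x - 1" 2] by (auto simp: cutoff'_def)

lemma cutoff'_bound: "\<bar>cutoff' x\<bar> \<le> 4"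
proof (cases "x \<le> 1 \<or> 2 \<le> x")
  case False
  have "max 0 (1 - (max 0 (x - 1))\<^sup>2) * max 0 (x - 1) \<le> 1 * 1"
    by (rule mult_mono) (use False in auto)
  then show ?thesis by (simp add: cutoff'_def abs_mult)
qed (simp add: cutoff'_eq_0)

text \<open>Test functions are C1 on the whole space although only their values on the orthant
  matter. The factor \<open>cutoff (1 - 2 * x)\<close> is 1 for x \<ge> 0 and vanishes from -1/2
  downwards, which keeps the pole of geometric weights at -1 out of reach; the other factor cuts at
  scale R.\<close>

definition truncate :: "(real \<Rightarrow> real) \<Rightarrow> real \<Rightarrow> real \<Rightarrow> real" where
  "truncate h R x = h x * (cutoff (1 - 2 * x) * cutoff (x / R))"

definition truncate' :: "(real \<Rightarrow> real) \<Rightarrow> (real \<Rightarrow> real) \<Rightarrow> real \<Rightarrow> real \<Rightarrow> real" where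
  "truncate' h h' R x = h' x * (cutoff (1 - 2 * x) * cutoff (x / R)) +
     h x * (cutoff' (1 - 2 * x) * - 2 * cutoff (x / R) + cutoff (1 - 2 * x) * (cutoff' (x / R) / R))"

text \<open>For x \<le> -1 nothing is known about h, but there the truncated function is 0 in a
  neighbourhood.\<close>

lemma DERIV_truncate:
  assumes h: "\<And>x. -1 < x \<Longrightarrow> (h has_real_derivative h' x) (at x)" and R: "0 < R"
  shows "(truncate h R has_real_derivative truncate' h h' R x) (at x)"
proof (cases "-1 < x")
  case True
  have 1: "((\<lambda>x. cutoff (1 - 2 * x)) has_real_derivative cutoff' (1 - 2 * x) * - 2) (at x)"
    by (rule DERIV_chain2[OF DERIV_cutoff]) (auto intro!: derivative_eq_intros)
  have 2: "((\<lambda>x. cutoff (x / R)) has_real_derivative cutoff' (x / R) * (1 / R)) (at x)"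
    by (rule DERIV_chain2[OF DERIV_cutoff]) (use R in \<open>auto intro!: derivative_eq_intros\<close>)
  show ?thesis
    unfolding truncate_def[abs_def] truncate'_def
    by (rule DERIV_cong[OF DERIV_mult[OF h[OF True] DERIV_mult[OF 1 2]]]) (simp add: algebra_simps)
next
  case False
  then have "truncate' h h' R x = 0"
    by (simp add: truncate'_def cutoff_eq_0 cutoff'_eq_0)
  then have "((\<lambda>x. 0) has_real_derivative truncate' h h' R x) (at x)" by simp
  then show ?thesis
    by (rule has_field_derivative_transform_within_open[of _ _ _ "{..< - 1 / 2}"])
       (use False in \<open>auto simp: truncate_def cutoff_eq_0\<close>)
qed

lemma continuous_truncate':
  assumes h: "continuous_on {-1<..} h" "continuous_on {-1<..} h'" and R: "0 < R"
  shows "continuous_on UNIV (truncate' h h' R)"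
proof -
  have "continuous_on {-1<..} (truncate' h h' R)"
    unfolding truncate'_def[abs_def]
    by (intro continuous_intros h continuous_on_compose2[OF continuous_cutoff]
        continuous_on_compose2[OF continuous_cutoff']) (use R in auto)
  moreover have "continuous_on {..< - 1 / 2} (truncate' h h' R)"
    by (rule continuous_on_eq[OF continuous_on_const[of _ 0]])
       (auto simp: truncate'_def cutoff_eq_0 cutoff'_eq_0)
  ultimately have "continuous_on ({-1<..} \<union> {..< - 1 / 2}) (truncate' h h' R)"
    by (intro continuous_on_open_Un) auto
  also have "{-1<..} \<union> {..< - 1 / 2} = (UNIV :: real set)" by auto
  finally show ?thesis .
qed

lemma truncate_eq: "0 \<le> x \<Longrightarrow> x \<le> R \<Longrightarrow> truncate h R x = h x"
  by (cases "R = 0") (simp_all add: truncate_def cutoff_eq_1)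

lemma truncate_support:
  assumes "truncate h R x \<noteq> 0" "0 < R" shows "-1 \<le> x \<and> x \<le> 2 * R"
proof (rule ccontr)
  assume "\<not> ?thesis"
  then have "2 \<le> 1 - 2 * x \<or> 2 \<le> x / R" using assms(2) by (auto simp: field_simps)
  with assms(1) show False by (auto simp: truncate_def cutoff_eq_0)
qed

lemma truncate_abs_le: "\<bar>truncate h R x\<bar> \<le> \<bar>h x\<bar>"
proof -
  have "cutoff (1 - 2 * x) * cutoff (x / R) \<le> 1 * 1"
    by (rule mult_mono) (auto simp: cutoff_bounds)
  then have "\<bar>h x\<bar> * (cutoff (1 - 2 * x) * cutoff (x / R)) \<le> \<bar>h x\<bar> * 1"
    by (intro mult_left_mono) auto
  then show ?thesis by (simp add: truncate_def abs_mult cutoff_bounds)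
qed

text \<open>The cutoff at scale R has derivative at most 4/R, supported where x < 2R; there R \<ge>
  1 gives 1 + x \<le> 3R, hence 12/(1+x). The bound is independent of R, and the cutoff costs no
  decay compared with differentiating a function like 1/(1+x).\<close>

lemma truncate'_abs_le:
  assumes R: "1 \<le> R" and x: "0 \<le> x"
  shows "\<bar>truncate' h h' R x\<bar> \<le> \<bar>h' x\<bar> + \<bar>h x\<bar> * (12 / (1 + x))"
proof -
  have e: "truncate' h h' R x = h' x * cutoff (x / R) + h x * (cutoff' (x / R) / R)"
    using x by (simp add: truncate'_def cutoff_eq_1 cutoff'_eq_0)
  have "\<bar>h' x * cutoff (x / R)\<bar> \<le> \<bar>h' x\<bar> * 1"
    unfolding abs_mult by (intro mult_left_mono) (auto simp: cutoff_bounds)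
  moreover have "\<bar>cutoff' (x / R) / R\<bar> \<le> 12 / (1 + x)"
  proof (cases "2 \<le> x / R")
    case True
    then show ?thesis using x by (simp add: cutoff'_eq_0)
  next
    case False
    then have "1 + x \<le> 3 * R" using R by (simp add: field_simps)
    have "\<bar>cutoff' (x / R) / R\<bar> \<le> 4 / R"
      using cutoff'_bound[of "x / R"] R by (simp add: abs_divide divide_right_mono)
    also have "\<dots> \<le> 12 / (1 + x)" using \<open>1 + x \<le> 3 * R\<close> R x by (simp add: field_simps)
    finally show ?thesis .
  qed
  then have "\<bar>h x * (cutoff' (x / R) / R)\<bar> \<le> \<bar>h x\<bar> * (12 / (1 + x))"
    unfolding abs_mult[of "h x"] by (rule mult_left_mono) auto
  ultimately show ?thesis unfolding e by linarith
qed

section \<open>Bounds for truncated geometric weights, uniform in the cutoff radius\<close>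

definition geometric_weight' :: "nat \<Rightarrow> real \<Rightarrow> real" where
  "geometric_weight' n x = real n * (x / (1 + x)) ^ (n - 1) * (1 / (1 + x)\<^sup>2) * (1 / (1 + x)) - (x / (1 + x)) ^ n * (1 / (1 + x)\<^sup>2)"

lemma DERIV_geometric_weight:
  assumes "-1 < x" shows "(geometric_weight n has_real_derivative geometric_weight' n x) (at x)"
proof -
  have 1: "((\<lambda>x. x / (1 + x)) has_real_derivative 1 / (1 + x)\<^sup>2) (at x)"
    using assms by (auto intro!: derivative_eq_intros simp: divide_simps power2_eq_square)
  have 2: "((\<lambda>x. 1 / (1 + x)) has_real_derivative - (1 / (1 + x)\<^sup>2)) (at x)"
    using assms by (auto intro!: derivative_eq_intros simp: divide_simps power2_eq_square)
  have 3: "((\<lambda>x. (x / (1 + x)) ^ n) has_real_derivative real n * (x / (1 + x)) ^ (n - 1) * (1 / (1 + x)\<^sup>2)) (at x)"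
    using DERIV_power[OF 1, of n] by (simp add: mult_ac)
  show ?thesis
    unfolding geometric_weight_def[abs_def] geometric_weight'_def
    by (rule DERIV_cong[OF DERIV_mult[OF 3 2]]) (simp add: algebra_simps)
qed

lemma continuous_geometric_weight': "continuous_on {-1<..} (geometric_weight' n)"
  unfolding geometric_weight'_def[abs_def] by (intro continuous_intros) auto

lemma geometric_weight_bounds:
  assumes "0 \<le> x" shows "0 \<le> geometric_weight n x" "geometric_weight n x \<le> 1 / (1 + x)" "geometric_weight n x \<le> 1"
proof -
  have "(x / (1 + x)) ^ n \<le> 1" using assms by (intro power_le_one) auto
  then have "(x / (1 + x)) ^ n * (1 / (1 + x)) \<le> 1 * (1 / (1 + x))"
    using assms by (intro mult_right_mono) auto
  then show *: "geometric_weight n x \<le> 1 / (1 + x)" by (simp add: geometric_weight_def)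
  also have "\<dots> \<le> 1" using assms by simp
  finally show "geometric_weight n x \<le> 1" .
  show "0 \<le> geometric_weight n x" using assms by (simp add: geometric_weight_def)
qed

lemma geometric_weight'_bound:
  assumes x: "0 \<le> x" shows "\<bar>geometric_weight' n x\<bar> \<le> (real n + 1) / (1 + x)\<^sup>2"
proof -
  have p: "\<bar>(x / (1 + x)) ^ m\<bar> \<le> 1" for m using x by (simp add: power_le_one)
  have q: "\<bar>1 / (1 + x)\<bar> \<le> 1" using x by simp
  have "real n * \<bar>(x / (1 + x)) ^ (n - 1)\<bar> * (1 / (1 + x)\<^sup>2) * \<bar>1 / (1 + x)\<bar> \<le> real n * 1 * (1 / (1 + x)\<^sup>2) * 1"
    by (intro mult_mono p q) auto
  moreover have "\<bar>(x / (1 + x)) ^ n\<bar> * (1 / (1 + x)\<^sup>2) \<le> 1 * (1 / (1 + x)\<^sup>2)"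
    by (intro mult_mono p) auto
  moreover have "\<bar>geometric_weight' n x\<bar> \<le> real n * \<bar>(x / (1 + x)) ^ (n - 1)\<bar> * (1 / (1 + x)\<^sup>2) * \<bar>1 / (1 + x)\<bar>
      + \<bar>(x / (1 + x)) ^ n\<bar> * (1 / (1 + x)\<^sup>2)"
    unfolding geometric_weight'_def
    by (rule order_trans[OF abs_triangle_ineq4]) (simp add: abs_mult)
  ultimately show ?thesis by (simp add: add_divide_distrib)
qed

text \<open>The derivative is at most (n+13)/(1+y)^2, with n+1 from the weight and 12 from the
  cutoff, and 1/(1+y)^2 is minus the derivative of 1/(1+y). Measuring distance in the bounded
  coordinate 1/(1+x) keeps decay in both endpoints, which an ordinary Lipschitz bound would
  lose.\<close>

lemma truncated_geometric_weight_lipschitz: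
  assumes R: "1 \<le> R" and a: "0 \<le> a" and x: "0 \<le> x"
  shows "\<bar>truncate (geometric_weight n) R x - truncate (geometric_weight n) R a\<bar>
     \<le> (real n + 13) * \<bar>1 / (1 + a) - 1 / (1 + x)\<bar>"
proof -
  let ?g = "truncate (geometric_weight n) R" and ?g' = "truncate' (geometric_weight n) (geometric_weight' n) R"
  let ?C = "real n + 13"
  have g: "(?g has_real_derivative ?g' y) (at y)" for y
    using R by (intro DERIV_truncate DERIV_geometric_weight) auto
  have r: "((\<lambda>x. ?C * (1 / (1 + x))) has_real_derivative - (?C / (1 + y)\<^sup>2)) (at y)" if "0 \<le> y" for y
    using that by (auto intro!: derivative_eq_intros simp: divide_simps power2_eq_square)
  have b: "\<bar>?g' y\<bar> \<le> ?C / (1 + y)\<^sup>2" if y: "0 \<le> y" for y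
  proof -
    have "\<bar>?g' y\<bar> \<le> (real n + 1) / (1 + y)\<^sup>2 + 1 / (1 + y) * (12 / (1 + y))"
    proof (rule order_trans[OF truncate'_abs_le[OF R y]], rule add_mono)
      show "\<bar>geometric_weight n y\<bar> * (12 / (1 + y)) \<le> 1 / (1 + y) * (12 / (1 + y))"
        using y geometric_weight_bounds[OF y, of n] by (intro mult_right_mono) auto
    qed (rule geometric_weight'_bound[OF y])
    then show ?thesis by (simp add: power2_eq_square add_divide_distrib)
  qed
  have main: "\<bar>?g y - ?g z\<bar> \<le> ?C * (1 / (1 + z) - 1 / (1 + y))" if z: "0 \<le> z" and zy: "z \<le> y" for y z
  proof -
    \<comment> \<open>Subtracting or adding (n+13)/(1+y) makes the truncated weight
      monotone.\<close>
    have "?g z - ?C * (1 / (1 + z)) \<le> ?g y - ?C * (1 / (1 + y))"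
    proof (rule DERIV_nonneg_imp_nondecreasing[OF zy])
      fix w assume "z \<le> w" "w \<le> y"
      then have w: "0 \<le> w" using z by simp
      have "((\<lambda>x. ?g x - ?C * (1 / (1 + x))) has_real_derivative ?g' w - - (?C / (1 + w)\<^sup>2)) (at w)"
        by (intro DERIV_diff g r w)
      moreover have "0 \<le> ?g' w - - (?C / (1 + w)\<^sup>2)" using b[OF w] by linarith
      ultimately show "\<exists>d. ((\<lambda>x. ?g x - ?C * (1 / (1 + x))) has_real_derivative d) (at w) \<and> 0 \<le> d" by blast
    qed
    moreover have "?g z + ?C * (1 / (1 + z)) \<ge> ?g y + ?C * (1 / (1 + y))"
    proof (rule DERIV_nonpos_imp_nonincreasing[OF zy])
      fix w assume "z \<le> w" "w \<le> y"
      then have w: "0 \<le> w" using z by simp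
      have "((\<lambda>x. ?g x + ?C * (1 / (1 + x))) has_real_derivative ?g' w + - (?C / (1 + w)\<^sup>2)) (at w)"
        by (intro DERIV_add g r w)
      moreover have "?g' w + - (?C / (1 + w)\<^sup>2) \<le> 0" using b[OF w] by linarith
      ultimately show "\<exists>d. ((\<lambda>x. ?g x + ?C * (1 / (1 + x))) has_real_derivative d) (at w) \<and> d \<le> 0" by blast
    qed
    ultimately show ?thesis unfolding right_diff_distrib by linarith
  qed
  show ?thesis
  proof (cases "a \<le> x")
    case True
    have "?C * (1 / (1 + a) - 1 / (1 + x)) \<le> ?C * \<bar>1 / (1 + a) - 1 / (1 + x)\<bar>"
      by (intro mult_left_mono) auto
    with main[OF a True] show ?thesis by linarith
  next
    case False
    then have xa: "x \<le> a" by simp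
    have "?C * (1 / (1 + x) - 1 / (1 + a)) \<le> ?C * \<bar>1 / (1 + a) - 1 / (1 + x)\<bar>"
      by (intro mult_left_mono) auto
    with main[OF x xa] show ?thesis by linarith
  qed
qed

text \<open>By the Lipschitz bound the jump divided by u is at most (n+13)|b-a|/((1+a)(1+x)), where
  x is the updated value; for small u this is unbounded in b. The weight at the neighbour
  contributes 1/(1+b), and |b-a| \<le> (1+a)(1+b). This is what makes coordinatewise cutoffs
  admissible.\<close>

lemma truncated_geometric_jump_bound:
  assumes R: "1 \<le> R" and a: "0 \<le> a" and b: "0 \<le> b" and u: "0 < u" "u < 1"
  shows "\<bar>1 / u * (truncate (geometric_weight n) R ((1 - u) * a + u * b) - truncate (geometric_weight n) R a)
     * truncate (geometric_weight m) R b\<bar> \<le> real n + 13"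
proof -
  define x where "x = (1 - u) * a + u * b"
  have x: "0 \<le> x" using a b u by (simp add: x_def)
  have "1 / (1 + a) - 1 / (1 + x) = (x - a) / ((1 + a) * (1 + x))"
    using a x by (simp add: divide_simps)
  also have "x - a = u * (b - a)" by (simp add: x_def algebra_simps)
  finally have e: "\<bar>1 / (1 + a) - 1 / (1 + x)\<bar> = u * (\<bar>b - a\<bar> / ((1 + a) * (1 + x)))"
    using a x u by (simp add: abs_mult)
  have "\<bar>truncate (geometric_weight m) R b\<bar> \<le> 1 / (1 + b)"
    using truncate_abs_le[of "geometric_weight m" R b] geometric_weight_bounds[OF b, of m] by simp
  then have "\<bar>1 / u * (truncate (geometric_weight n) R x - truncate (geometric_weight n) R a)
     * truncate (geometric_weight m) R b\<bar> \<le> 1 / u * ((real n + 13) * (u * (\<bar>b - a\<bar> / ((1 + a) * (1 + x))))) * (1 / (1 + b))"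
    unfolding abs_mult using a x truncated_geometric_weight_lipschitz[OF R a x, of n] u
    unfolding e by (intro mult_mono) auto
  also have "\<dots> = (real n + 13) * (\<bar>b - a\<bar> / ((1 + a) * (1 + x) * (1 + b)))"
    using u by simp
  also have "\<bar>b - a\<bar> / ((1 + a) * (1 + x) * (1 + b)) \<le> 1"
  proof -
    have "\<bar>b - a\<bar> \<le> (1 + a) * (1 + b)" using a b by (auto simp: abs_if algebra_simps add_nonneg_nonneg intro: order_trans[of _ 0])
    also have "\<dots> \<le> (1 + a) * (1 + b) * (1 + x)" using a b x by simp
    finally show ?thesis using a b x by (simp add: divide_le_eq mult_ac)
  qed
  finally show ?thesis unfolding x_def[symmetric] by (simp add: mult_left_mono)
qed

text \<open>A nonintegrable integrand has integral 0 by convention, and then the bound holds because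
  B is nonnegative.\<close>

lemma LBINT_unit_interval_bound:
  fixes k :: "real \<Rightarrow> real"
  assumes "\<And>u. 0 < u \<Longrightarrow> u < 1 \<Longrightarrow> \<bar>k u\<bar> \<le> B" and "0 \<le> B"
  shows "\<bar>LBINT u:{0<..<1}. k u\<bar> \<le> B"
proof (cases "set_integrable lborel {0<..<1} k")
  case True
  have "norm (LBINT u:{0<..<1}. k u) \<le> (LBINT u:{0<..<1::real}. B)"
    unfolding set_lebesgue_integral_def
  proof (rule order_trans[OF integral_norm_bound integral_mono])
    show "integrable lborel (\<lambda>x::real. indicat_real {0<..<1} x *\<^sub>R B)" by simp
    show "integrable lborel (\<lambda>x. norm (indicat_real {0<..<1} x *\<^sub>R k x))"
      using True by (intro integrable_norm) (simp add: set_integrable_def)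
  qed (use assms in \<open>auto simp: indicator_def\<close>)
  also have "\<dots> = B" by (simp add: set_lebesgue_integral_def)
  finally show ?thesis by simp
next
  case False
  then show ?thesis using assms(2)
    by (simp add: set_lebesgue_integral_def set_integrable_def not_integrable_integral_eq)
qed

lemma tensor_bounds:
  assumes "\<And>i. \<bar>w (\<xi> i) (x $ i)\<bar> \<le> 1"
  shows "\<bar>tensor w \<xi> x\<bar> \<le> 1"
  unfolding tensor_def abs_prod by (rule prod_le_1) (use assms in auto)

lemma symmetric_generator_bound:
  fixes p :: "'v::finite \<Rightarrow> 'v \<Rightarrow> real" and k :: "'v \<Rightarrow> 'v \<Rightarrow> real \<Rightarrow> real"
  assumes "\<And>i j. 0 \<le> p i j"
    and "\<And>i j u. i \<noteq> j \<Longrightarrow> 0 < u \<Longrightarrow> u < 1 \<Longrightarrow> \<bar>k i j u\<bar> \<le> B i j" and "\<And>i j. 0 \<le> B i j"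
  shows "\<bar>\<Sum>i\<in>UNIV. \<Sum>j\<in>UNIV - {i}. p i j * (LBINT u:{0<..<1}. k i j u)\<bar> \<le> (\<Sum>i\<in>UNIV. \<Sum>j\<in>UNIV - {i}. p i j * B i j)"
proof (rule order_trans[OF sum_abs], rule sum_mono, rule order_trans[OF sum_abs], rule sum_mono)
  fix i j :: 'v assume "j \<in> UNIV - {i}"
  then have "\<bar>LBINT u:{0<..<1}. k i j u\<bar> \<le> B i j"
    by (intro LBINT_unit_interval_bound assms) auto
  then show "\<bar>p i j * (LBINT u:{0<..<1}. k i j u)\<bar> \<le> p i j * B i j"
    using assms(1) by (simp add: abs_mult mult_left_mono)
qed

lemma symmetric_generator_cong:
  fixes p :: "'v::finite \<Rightarrow> 'v \<Rightarrow> real" and k :: "'v \<Rightarrow> 'v \<Rightarrow> real \<Rightarrow> real"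
  assumes "\<And>i j u. i \<noteq> j \<Longrightarrow> 0 < u \<Longrightarrow> u < 1 \<Longrightarrow> k i j u = k' i j u"
  shows "(\<Sum>i\<in>UNIV. \<Sum>j\<in>UNIV - {i}. p i j * (LBINT u:{0<..<1}. k i j u)) = (\<Sum>i\<in>UNIV. \<Sum>j\<in>UNIV - {i}. p i j * (LBINT u:{0<..<1}. k' i j u))"
  by (intro sum.cong refl arg_cong2[of _ _ _ _ "(*)"] set_lebesgue_integral_cong) (use assms in auto)

text \<open>Cut off coordinate by coordinate: a parameter jump replaces one coordinate by a mixture
  and preserves no sum, so a cutoff in the total would not commute with the jumps.\<close>

definition hidden_test :: "real \<Rightarrow> real \<Rightarrow> ('v::finite \<Rightarrow> nat) \<Rightarrow> real^'v \<Rightarrow> real" where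
  "hidden_test R c \<xi> \<theta> = tensor (\<lambda>n. truncate (geometric_weight n) R) \<xi> (c *\<^sub>R \<theta>)"

lemma hidden_test_C1_compact_support:
  assumes c: "0 < c" and R: "1 \<le> R"
  shows "hidden_test R c \<xi> \<in> C1_compact_support"
proof (rule C1_compact_supportI)
  show "C1 (hidden_test R c \<xi>)"
    unfolding hidden_test_def[abs_def] tensor_def vector_scaleR_component real_scaleR_def
  proof (rule C1_prod)
    fix i :: 'a
    show "C1 (\<lambda>x. truncate (geometric_weight (\<xi> i)) R (c * x $ i))"
    proof (rule C1_component)
      show "(truncate (geometric_weight (\<xi> i)) R has_real_derivative
          truncate' (geometric_weight (\<xi> i)) (geometric_weight' (\<xi> i)) R x) (at x)" for x
        using R by (intro DERIV_truncate DERIV_geometric_weight) auto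
      have "continuous_on {-1<..} (geometric_weight (\<xi> i))"
        by (auto intro!: continuous_at_imp_continuous_on DERIV_isCont DERIV_geometric_weight)
      then show "continuous_on UNIV (truncate' (geometric_weight (\<xi> i)) (geometric_weight' (\<xi> i)) R)"
        using R by (intro continuous_truncate' continuous_geometric_weight') auto
    qed
  qed simp
  fix x :: "real^'a" assume nz: "hidden_test R c \<xi> x \<noteq> 0"
  show "\<forall>i. - (1 / c) \<le> x $ i \<and> x $ i \<le> 2 * R / c"
  proof
    fix i
    have "truncate (geometric_weight (\<xi> i)) R (c * x $ i) \<noteq> 0"
      using nz by (auto simp: hidden_test_def tensor_def)
    then have "-1 \<le> c * x $ i \<and> c * x $ i \<le> 2 * R"
      using R by (intro truncate_support) auto
    then show "- (1 / c) \<le> x $ i \<and> x $ i \<le> 2 * R / c"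
      using c by (simp add: field_simps)
  qed
qed

lemma move_parameter_component:
  assumes "i \<noteq> j"
  shows "move_parameter i j u \<theta> $ k = (if k = i then (1 - u) * \<theta> $ i + u * \<theta> $ j else \<theta> $ k)"
  using assms by (auto simp: move_parameter_def axis_def algebra_simps)

lemma move_mass_component:
  assumes "i \<noteq> j"
  shows "move_mass i j u \<zeta> $ k = (if k = i then (1 - u) * \<zeta> $ i else if k = j then \<zeta> $ j + u * \<zeta> $ i else \<zeta> $ k)"
  using assms by (auto simp: move_mass_def axis_def algebra_simps)

lemma hidden_test_bound:
  assumes "\<theta> \<in> orthant" "0 \<le> c"
  shows "\<bar>hidden_test R c \<xi> \<theta>\<bar> \<le> 1"
  unfolding hidden_test_def
proof (rule tensor_bounds)
  fix i
  have "0 \<le> c * \<theta> $ i" using assms by (simp add: orthant_def)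
  then show "\<bar>truncate (geometric_weight (\<xi> i)) R ((c *\<^sub>R \<theta>) $ i)\<bar> \<le> 1"
    using truncate_abs_le[of "geometric_weight (\<xi> i)" R "c * \<theta> $ i"] geometric_weight_bounds[of "c * \<theta> $ i" "\<xi> i"]
    by simp
qed

text \<open>The jump changes the factor at i, the factor at j supplies the compensating decay, and
  the other factors are at most 1 in absolute value.\<close>

lemma hidden_test_jump_bound:
  assumes \<theta>: "\<theta> \<in> orthant" and c: "0 \<le> c" and R: "1 \<le> R" and ij: "i \<noteq> j" and u: "0 < u" "u < 1"
  shows "\<bar>1 / u * (hidden_test R c \<xi> (move_parameter i j u \<theta>) - hidden_test R c \<xi> \<theta>)\<bar> \<le> real (\<xi> i) + 13"
proof -
  let ?g = "\<lambda>n. truncate (geometric_weight n) R"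
  let ?P = "\<Prod>k\<in>UNIV - {i, j}. ?g (\<xi> k) (c * \<theta> $ k)"
  have pos: "0 \<le> c * \<theta> $ k" for k using \<theta> c by (simp add: orthant_def)
  have P: "\<bar>?P\<bar> \<le> 1"
    unfolding abs_prod
  proof (rule prod_le_1, safe)
    fix k
    show "\<bar>?g (\<xi> k) (c * \<theta> $ k)\<bar> \<le> 1"
      using truncate_abs_le[of "geometric_weight (\<xi> k)" R "c * \<theta> $ k"] geometric_weight_bounds[OF pos[of k], of "\<xi> k"] by simp
  qed auto
  have "1 / u * (hidden_test R c \<xi> (move_parameter i j u \<theta>) - hidden_test R c \<xi> \<theta>)
     = (1 / u * (?g (\<xi> i) ((1 - u) * (c * \<theta> $ i) + u * (c * \<theta> $ j)) - ?g (\<xi> i) (c * \<theta> $ i)) * ?g (\<xi> j) (c * \<theta> $ j)) * ?P"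
    unfolding hidden_test_def tensor_move_parameter[OF ij] unfolding tensor_split[OF ij]
    by (simp add: algebra_simps)
  also have "\<bar>\<dots>\<bar> \<le> (real (\<xi> i) + 13) * 1"
    unfolding abs_mult[of _ ?P] by (intro mult_mono P truncated_geometric_jump_bound pos R u) auto
  finally show ?thesis by simp
qed

lemma hidden_generator_test_bound:
  assumes p: "\<And>i j. 0 \<le> p i j" and \<theta>: "\<theta> \<in> orthant" and c: "0 \<le> c" and R: "1 \<le> R"
  shows "\<bar>hidden_generator p (hidden_test R c \<xi>) \<theta>\<bar>
     \<le> (\<Sum>i\<in>UNIV. \<Sum>j\<in>UNIV - {i}. p i j * (real (\<xi> i) + real (\<xi> j) + 26))"
  unfolding hidden_generator_def
proof (rule symmetric_generator_bound[OF p])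
  fix i j :: 'a and u :: real assume ij: "i \<noteq> j" and u: "0 < u" "u < 1"
  have ji: "j \<noteq> i" using ij by simp
  show "\<bar>1 / u * (hidden_test R c \<xi> (move_parameter i j u \<theta>) - hidden_test R c \<xi> \<theta> +
           (hidden_test R c \<xi> (move_parameter j i u \<theta>) - hidden_test R c \<xi> \<theta>))\<bar>
       \<le> real (\<xi> i) + real (\<xi> j) + 26"
    unfolding distrib_left
    using hidden_test_jump_bound[OF \<theta> c R ij u, of \<xi>] hidden_test_jump_bound[OF \<theta> c R ji u, of \<xi>] by linarith
qed auto

lemma hidden_test_eq:
  assumes \<theta>: "\<theta> \<in> orthant" and c: "0 \<le> c" and R: "\<And>i. c * \<theta> $ i \<le> R"
  shows "hidden_test R c \<xi> \<theta> = tensor geometric_weight \<xi> (c *\<^sub>R \<theta>)"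
  unfolding hidden_test_def tensor_def
  by (intro prod.cong refl truncate_eq) (use assms in \<open>auto simp: orthant_def\<close>)

lemma move_parameter_orthant:
  assumes "\<theta> \<in> orthant" "i \<noteq> j" "0 \<le> u" "u \<le> 1"
  shows "move_parameter i j u \<theta> \<in> orthant"
  using assms by (auto simp: orthant_def move_parameter_component)

lemma move_mass_orthant:
  assumes "\<zeta> \<in> orthant" "i \<noteq> j" "0 \<le> u" "u \<le> 1"
  shows "move_mass i j u \<zeta> \<in> orthant"
  using assms by (auto simp: orthant_def move_mass_component)

text \<open>Convex combinations of coordinates stay below R, so neither \<theta> nor a point reached
  from it in one jump feels the cutoff. As R grows, the truncated generators therefore converge by
  becoming eventually equal to their limit.\<close>

lemma hidden_generator_test_eq:
  assumes \<theta>: "\<theta> \<in> orthant" and c: "0 \<le> c" and R: "\<And>i. c * \<theta> $ i \<le> R"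
  shows "hidden_generator p (hidden_test R c \<xi>) \<theta> = discrete_generator p (\<lambda>\<xi>. tensor geometric_weight \<xi> (c *\<^sub>R \<theta>)) \<xi>"
proof -
  have m: "hidden_test R c \<xi> (move_parameter i j u \<theta>) = tensor geometric_weight \<xi> (c *\<^sub>R move_parameter i j u \<theta>)"
    if ij: "i \<noteq> j" and u: "0 < u" "u < 1" for i j u
  proof (rule hidden_test_eq[OF move_parameter_orthant[OF \<theta> ij] c])
    fix k
    have "(1 - u) * (c * \<theta> $ i) + u * (c * \<theta> $ j) \<le> (1 - u) * R + u * R"
      using R u by (intro add_mono mult_left_mono) auto
    then show "c * move_parameter i j u \<theta> $ k \<le> R"
      using R by (simp add: move_parameter_component[OF ij] algebra_simps)
  qed (use u in auto)
  have "hidden_generator p (hidden_test R c \<xi>) \<theta> = hidden_generator p (\<lambda>\<theta>. tensor geometric_weight \<xi> (c *\<^sub>R \<theta>)) \<theta>"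
    unfolding hidden_generator_def
    by (rule symmetric_generator_cong) (simp add: m hidden_test_eq[OF \<theta> c R])
  then show ?thesis using hidden_generator_tensor[OF \<theta> c] by simp
qed

text \<open>The cutoff from above acts on the total mass, which every jump preserves. The
  coordinatewise factors only confine the support from below and are 1 on the orthant.\<close>

definition continuous_test :: "real \<Rightarrow> real \<Rightarrow> ('v::finite \<Rightarrow> nat) \<Rightarrow> real^'v \<Rightarrow> real" where
  "continuous_test R c \<xi> \<zeta> = cutoff (c / R * (\<Sum>i\<in>UNIV. \<zeta> $ i)) * tensor (\<lambda>n x. poisson_weight n x * cutoff (1 - 2 * x)) \<xi> (c *\<^sub>R \<zeta>)"

lemma continuous_test_C1_compact_support:
  assumes c: "0 < c" and R: "1 \<le> R"
  shows "continuous_test R c \<xi> \<in> C1_compact_support"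
proof (rule C1_compact_supportI)
  show "C1 (continuous_test R c \<xi>)"
    unfolding continuous_test_def[abs_def] tensor_def vector_scaleR_component real_scaleR_def
  proof (rule C1_mult[OF C1_component_sum[OF DERIV_cutoff continuous_cutoff'] C1_prod])
    fix i :: 'a
    show "C1 (\<lambda>x. poisson_weight (\<xi> i) (c * x $ i) * cutoff (1 - 2 * (c * x $ i)))"
    proof (rule C1_mult[OF C1_component C1_component])
      show "((\<lambda>y. poisson_weight (\<xi> i) y) has_real_derivative
          real (\<xi> i) * x ^ (\<xi> i - 1) / fact (\<xi> i) * exp (- x) + x ^ \<xi> i / fact (\<xi> i) * - exp (- x)) (at x)" for x
        unfolding poisson_weight_def by (auto intro!: derivative_eq_intros simp: diff_divide_distrib)
      show "((\<lambda>y. cutoff (1 - 2 * y)) has_real_derivative cutoff' (1 - 2 * x) * - 2) (at x)" for x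
        by (rule DERIV_chain2[OF DERIV_cutoff]) (auto intro!: derivative_eq_intros)
      show "continuous_on UNIV (\<lambda>x::real. cutoff' (1 - 2 * x) * - 2)"
        by (intro continuous_intros continuous_on_compose2[OF continuous_cutoff']) auto
    qed (intro continuous_intros; simp)
  qed simp
  fix x :: "real^'a" assume nz: "continuous_test R c \<xi> x \<noteq> 0"
  have 1: "-1 \<le> c * x $ i" for i
  proof (rule ccontr)
    assume "\<not> -1 \<le> c * x $ i"
    then have "cutoff (1 - 2 * (c * x $ i)) = 0" by (intro cutoff_eq_0) auto
    moreover have "cutoff (1 - 2 * (c * x $ i)) \<noteq> 0"
      using nz by (auto simp: continuous_test_def tensor_def)
    ultimately show False by simp
  qed
  have 2: "c / R * (\<Sum>i\<in>UNIV. x $ i) \<le> 2"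
    using nz cutoff_eq_0[of "c / R * (\<Sum>i\<in>UNIV. x $ i)"] by (force simp: continuous_test_def)
  show "\<forall>i. - (1 / c) \<le> x $ i \<and> x $ i \<le> (2 * R + real CARD('a)) / c"
  proof
    fix i
    \<comment> \<open>A coordinate is the total minus the others, each of which is at least -1 after
      scaling.\<close>
    have "c * (\<Sum>i\<in>UNIV. x $ i) = c * x $ i + (\<Sum>k\<in>UNIV - {i}. c * x $ k)"
      by (simp add: sum_distrib_left[symmetric] sum.remove[of UNIV i] distrib_left)
    moreover have "(\<Sum>k\<in>UNIV - {i}. c * x $ k) \<ge> (\<Sum>k\<in>UNIV - {i}. - 1)"
      by (rule sum_mono) (use 1 in auto)
    moreover have "(\<Sum>k\<in>UNIV - {i}. - 1) \<ge> - real CARD('a)"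
      by (simp add: card_Diff_singleton_if)
    moreover have "c * (\<Sum>i\<in>UNIV. x $ i) \<le> 2 * R"
      using 2 R by (simp add: field_simps)
    ultimately have "c * x $ i \<le> 2 * R + real CARD('a)" by linarith
    then show "- (1 / c) \<le> x $ i \<and> x $ i \<le> (2 * R + real CARD('a)) / c"
      using c 1[of i] by (simp add: field_simps)
  qed
qed

lemma continuous_test_orthant:
  assumes "\<zeta> \<in> orthant" "0 \<le> c"
  shows "continuous_test R c \<xi> \<zeta> = cutoff (c / R * (\<Sum>i\<in>UNIV. \<zeta> $ i)) * tensor poisson_weight \<xi> (c *\<^sub>R \<zeta>)"
  unfolding continuous_test_def tensor_def
  by (intro arg_cong2[of _ _ _ _ "(*)"] prod.cong refl) (use assms in \<open>auto simp: orthant_def cutoff_eq_1\<close>)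

lemma sum_move_mass:
  assumes "i \<noteq> j"
  shows "(\<Sum>k\<in>UNIV. move_mass i j u \<zeta> $ k) = (\<Sum>k\<in>UNIV. \<zeta> $ k)"
proof -
  have "(\<Sum>k\<in>UNIV. axis l 1 $ k) = (1::real)" for l :: 'a
    by (simp add: axis_def)
  then show ?thesis
    by (simp add: move_mass_def sum.distrib sum_subtractf flip: sum_distrib_left)
qed

text \<open>Jumps conserve the total mass and stay in the orthant, so the cutoff is a constant
  factor for the generator. Boundedness and convergence of the truncated generators follow at
  once.\<close>

lemma continuous_generator_test:
  assumes \<zeta>: "\<zeta> \<in> orthant" and c: "0 \<le> c"
  shows "continuous_generator p (continuous_test R c \<xi>) \<zeta>
     = cutoff (c / R * (\<Sum>i\<in>UNIV. \<zeta> $ i)) * discrete_generator p (\<lambda>\<xi>. tensor poisson_weight \<xi> (c *\<^sub>R \<zeta>)) \<xi>"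
proof -
  let ?\<kappa> = "cutoff (c / R * (\<Sum>i\<in>UNIV. \<zeta> $ i))"
  let ?f = "\<lambda>\<zeta>. tensor poisson_weight \<xi> (c *\<^sub>R \<zeta>)"
  have "continuous_generator p (continuous_test R c \<xi>) \<zeta> = (\<Sum>i\<in>UNIV. \<Sum>j\<in>UNIV - {i}. p i j *
        (LBINT u:{0<..<1}. ?\<kappa> * (1 / u * ((?f (move_mass i j u \<zeta>) - ?f \<zeta>) + (?f (move_mass j i u \<zeta>) - ?f \<zeta>)))))"
    unfolding continuous_generator_def
    by (rule symmetric_generator_cong)
       (simp add: continuous_test_orthant \<zeta> c move_mass_orthant sum_move_mass algebra_simps)
  also have "\<dots> = ?\<kappa> * continuous_generator p ?f \<zeta>"
    unfolding continuous_generator_def sum_distrib_left set_integral_mult_right by (simp only: mult_ac)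
  finally show ?thesis by (simp add: continuous_generator_tensor)
qed

section \<open>Series solution of the dual equation\<close>

definition particle_number :: "('v::finite \<Rightarrow> nat) \<Rightarrow> nat" where
  "particle_number \<xi> = (\<Sum>i\<in>UNIV. \<xi> i)"

lemma particle_number_split:
  assumes "i \<noteq> j" shows "particle_number \<xi> = \<xi> i + (\<xi> j + (\<Sum>k\<in>UNIV - {i, j}. \<xi> k))"
proof -
  have "(UNIV :: 'a set) = insert i (insert j (UNIV - {i, j}))" by auto
  then have "particle_number \<xi> = (\<Sum>k\<in>insert i (insert j (UNIV - {i, j})). \<xi> k)"
    unfolding particle_number_def by simp
  then show ?thesis using assms by simp
qed

lemma le_particle_number: "\<xi> i \<le> particle_number \<xi>"
  unfolding particle_number_def by (rule member_le_sum) auto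

lemma particle_number_move_particles:
  assumes "i \<noteq> j" "k \<le> \<xi> i"
  shows "particle_number (move_particles i j k \<xi>) = particle_number \<xi>"
proof -
  have "(\<Sum>l\<in>UNIV - {i, j}. move_particles i j k \<xi> l) = (\<Sum>l\<in>UNIV - {i, j}. \<xi> l)"
    by (rule sum.cong) (auto simp: move_particles_def)
  then show ?thesis
    unfolding particle_number_split[OF assms(1)] using assms by (simp add: move_particles_def)
qed

text \<open>Bounds the operator norm of the discrete generator, in the supremum norm, on functions
  of configurations with N particles: each of the two directions has at most N terms, each at most
  twice the supremum.\<close>

definition rate_bound :: "('v::finite \<Rightarrow> 'v \<Rightarrow> real) \<Rightarrow> nat \<Rightarrow> real" where
  "rate_bound p N = (\<Sum>i\<in>UNIV. \<Sum>j\<in>UNIV - {i}. p i j * (4 * real N))"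

lemma pair_generator_bound:
  assumes ij: "i \<noteq> j" and g: "\<And>\<xi>'. particle_number \<xi>' = particle_number \<xi> \<Longrightarrow> \<bar>g \<xi>'\<bar> \<le> B"
  shows "\<bar>pair_generator i j g \<xi>\<bar> \<le> 4 * real (particle_number \<xi>) * B"
proof -
  have *: "\<bar>\<Sum>k=1..\<xi> i. 1 / real k * (g (move_particles i j k \<xi>) - g \<xi>)\<bar> \<le> 2 * real (particle_number \<xi>) * B" if ij: "i \<noteq> j" for i j
  proof -
    have B: "0 \<le> B" using g[of \<xi>] by simp
    have "\<bar>\<Sum>k=1..\<xi> i. 1 / real k * (g (move_particles i j k \<xi>) - g \<xi>)\<bar> \<le> (\<Sum>k=1..\<xi> i. 2 * B)"
    proof (rule order_trans[OF sum_abs], rule sum_mono)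
      fix k assume k: "k \<in> {1..\<xi> i}"
      have "\<bar>g (move_particles i j k \<xi>)\<bar> \<le> B" "\<bar>g \<xi>\<bar> \<le> B"
        using k by (auto intro!: g simp: particle_number_move_particles[OF ij])
      then have "\<bar>1 / real k\<bar> * \<bar>g (move_particles i j k \<xi>) - g \<xi>\<bar> \<le> 1 * (2 * B)"
        using k by (intro mult_mono) auto
      then show "\<bar>1 / real k * (g (move_particles i j k \<xi>) - g \<xi>)\<bar> \<le> 2 * B" by (simp add: abs_mult)
    qed
    also have "\<dots> = 2 * real (\<xi> i) * B" by simp
    also have "\<dots> \<le> 2 * real (particle_number \<xi>) * B" using le_particle_number[of \<xi> i] B by (intro mult_right_mono) auto
    finally show ?thesis .
  qed
  show ?thesis
    unfolding pair_generator_def using *[OF ij] *[of j i] ij by (auto simp: algebra_simps)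
qed

lemma discrete_generator_bound:
  assumes p: "\<And>i j. 0 \<le> p i j" and g: "\<And>\<xi>'. particle_number \<xi>' = particle_number \<xi> \<Longrightarrow> \<bar>g \<xi>'\<bar> \<le> B"
  shows "\<bar>discrete_generator p g \<xi>\<bar> \<le> rate_bound p (particle_number \<xi>) * B"
  unfolding discrete_generator_pair rate_bound_def sum_distrib_right
proof (rule order_trans[OF sum_abs], rule sum_mono, rule order_trans[OF sum_abs], rule sum_mono)
  fix i j :: 'a assume "j \<in> UNIV - {i}"
  then have ij: "i \<noteq> j" by auto
  have "\<bar>p i j * pair_generator i j g \<xi>\<bar> \<le> p i j * (4 * real (particle_number \<xi>) * B)"
    unfolding abs_mult using p[of i j] by (intro mult_mono pair_generator_bound[OF ij g]) auto
  then show "\<bar>p i j * pair_generator i j g \<xi>\<bar> \<le> p i j * (4 * real (particle_number \<xi>)) * B" by (simp add: mult.assoc)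
qed

text \<open>The same rate serves at every iteration because the generator only looks at
  configurations with the same number of particles.\<close>

lemma discrete_generator_funpow_bound:
  assumes p: "\<And>i j. 0 \<le> p i j" and g: "\<And>\<xi>. \<bar>g \<xi>\<bar> \<le> 1"
  shows "\<bar>(discrete_generator p ^^ n) g \<xi>\<bar> \<le> rate_bound p (particle_number \<xi>) ^ n"
proof (induction n arbitrary: \<xi>)
  case 0
  then show ?case using g by simp
next
  case (Suc n)
  have "\<bar>discrete_generator p ((discrete_generator p ^^ n) g) \<xi>\<bar> \<le> rate_bound p (particle_number \<xi>) * rate_bound p (particle_number \<xi>) ^ n"
    by (rule discrete_generator_bound[OF p]) (metis Suc)
  then show ?case by simp
qed

lemma DERIV_discrete_generator:
  assumes "\<And>\<xi>. ((\<lambda>t. g t \<xi>) has_real_derivative g' \<xi>) (at t within S)"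
  shows "((\<lambda>t. discrete_generator p (g t) \<xi>) has_real_derivative discrete_generator p g' \<xi>) (at t within S)"
  unfolding discrete_generator_def
  by (intro DERIV_sum DERIV_cmult DERIV_add DERIV_diff assms)

lemma DERIV_discrete_generator_funpow:
  assumes "\<And>\<xi>. ((\<lambda>t. m t \<xi>) has_real_derivative discrete_generator p (m t) \<xi>) (at t within S)"
  shows "((\<lambda>t. (discrete_generator p ^^ n) (m t) \<xi>) has_real_derivative (discrete_generator p ^^ Suc n) (m t) \<xi>) (at t within S)"
proof (induction n arbitrary: \<xi>)
  case 0
  then show ?case using assms by simp
next
  case (Suc n)
  have "((\<lambda>t. discrete_generator p ((discrete_generator p ^^ n) (m t)) \<xi>) has_real_derivative
      discrete_generator p ((discrete_generator p ^^ Suc n) (m t)) \<xi>) (at t within S)"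
    by (rule DERIV_discrete_generator) (rule Suc)
  then show ?case by simp
qed

lemma integrable_discrete_generator:
  assumes "\<And>\<xi>. integrable M (F \<xi>)"
  shows "integrable M (\<lambda>\<omega>. discrete_generator p (\<lambda>\<xi>. F \<xi> \<omega>) \<xi>)"
    and "(\<integral>\<omega>. discrete_generator p (\<lambda>\<xi>. F \<xi> \<omega>) \<xi> \<partial>M) = discrete_generator p (\<lambda>\<xi>. \<integral>\<omega>. F \<xi> \<omega> \<partial>M) \<xi>"
  using assms by (simp_all add: discrete_generator_def)

lemma integrable_discrete_generator_funpow:
  assumes "\<And>\<xi>. integrable M (F \<xi>)"
  shows "integrable M (\<lambda>\<omega>. (discrete_generator p ^^ n) (\<lambda>\<xi>. F \<xi> \<omega>) \<xi>) \<and>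
    (\<integral>\<omega>. (discrete_generator p ^^ n) (\<lambda>\<xi>. F \<xi> \<omega>) \<xi> \<partial>M) = (discrete_generator p ^^ n) (\<lambda>\<xi>. \<integral>\<omega>. F \<xi> \<omega> \<partial>M) \<xi>"
proof (induction n arbitrary: \<xi>)
  case 0
  then show ?case using assms by simp
next
  case (Suc n)
  note * = integrable_discrete_generator[of M "\<lambda>\<xi> \<omega>. (discrete_generator p ^^ n) (\<lambda>\<xi>. F \<xi> \<omega>) \<xi>" p \<xi>]
  show ?case using * Suc by simp
qed

text \<open>The time derivatives of m are the iterates of the generator applied to m, so Taylor's
  formula with integral remainder applies. With K the rate for the particle number of \<xi>, the
  remainder of order q is at most K t (K t)^q / q!. The series depends on m 0 alone, which is the
  uniqueness that identifies the laws later.\<close>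

lemma bounded_solution_series:
  assumes p: "\<And>i j. 0 \<le> p i j"
    and deriv: "\<And>t \<xi>. 0 \<le> t \<Longrightarrow> ((\<lambda>t. m t \<xi>) has_real_derivative discrete_generator p (m t) \<xi>) (at t within {0..})"
    and bound: "\<And>t \<xi>. 0 \<le> t \<Longrightarrow> \<bar>m t \<xi>\<bar> \<le> 1"
    and t: "0 \<le> t"
  shows "(\<lambda>n. t ^ n / fact n * (discrete_generator p ^^ n) (m 0) \<xi>) sums m t \<xi>"
proof -
  define Df where "Df n s = (discrete_generator p ^^ n) (m s) \<xi>" for n s
  define K where "K = rate_bound p (particle_number \<xi>)"
  have K: "0 \<le> K" unfolding K_def rate_bound_def by (intro sum_nonneg mult_nonneg_nonneg p) auto
  have dDf: "(Df n has_vector_derivative Df (Suc n) s) (at s within {0..t})" if "0 \<le> s" for n s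
    using DERIV_subset[OF DERIV_discrete_generator_funpow[of m p s "{0..}" n \<xi>], of "{0..t}"] deriv[OF that]
    by (simp add: Df_def[abs_def] has_real_derivative_iff_has_vector_derivative)
  have Df_bound: "\<bar>Df n s\<bar> \<le> K ^ n" if "0 \<le> s" for n s
    unfolding Df_def K_def by (rule discrete_generator_funpow_bound[OF p bound[OF that]])
  have rem: "\<bar>m t \<xi> - (\<Sum>i<Suc q. t ^ i / fact i * Df i 0)\<bar> \<le> K * t * ((K * t) ^ q / fact q)" for q
  proof -
    have hi: "((\<lambda>x. ((t - x) ^ (Suc q - 1) / fact (Suc q - 1)) *\<^sub>R Df (Suc q) x) has_integral
        m t \<xi> - (\<Sum>i<Suc q. ((t - 0) ^ i / fact i) *\<^sub>R Df i 0)) {0..t}"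
    proof (rule Taylor_has_integral)
      show "Df 0 = (\<lambda>s. m s \<xi>)" by (simp add: Df_def[abs_def])
    qed (use t dDf in auto)
    have "norm (m t \<xi> - (\<Sum>i<Suc q. ((t - 0) ^ i / fact i) *\<^sub>R Df i 0)) \<le> (t ^ q / fact q * K ^ Suc q) * measure lborel {0..t}"
    proof (rule has_integral_bound_real[OF _ _ hi, of _ "{}"])
      show "0 \<le> t ^ q / fact q * K ^ Suc q" using t K by simp
      fix x assume x: "x \<in> {0..t} - {}"
      show "norm (((t - x) ^ (Suc q - 1) / fact (Suc q - 1)) *\<^sub>R Df (Suc q) x) \<le> t ^ q / fact q * K ^ Suc q"
        using x Df_bound[of x "Suc q"]
        by (auto simp: abs_mult power_abs simp del: power_Suc intro!: mult_mono divide_right_mono power_mono)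
    qed simp
    also have "(t ^ q / fact q * K ^ Suc q) * measure lborel {0..t} = K * t * ((K * t) ^ q / fact q)"
      using t by (simp add: power_mult_distrib)
    finally show ?thesis by simp
  qed
  have "(\<lambda>q. K * t * ((K * t) ^ q / fact q)) \<longlonglongrightarrow> K * t * 0"
    by (intro tendsto_mult tendsto_const power_tendsto_0_iff[THEN iffD2] summable_LIMSEQ_zero)
       (use summable_exp[of "K * t"] in \<open>simp add: divide_inverse mult.commute\<close>)
  then have "(\<lambda>q. K * t * ((K * t) ^ q / fact q)) \<longlonglongrightarrow> 0" by simp
  then have "(\<lambda>q. m t \<xi> - (\<Sum>i<Suc q. t ^ i / fact i * Df i 0)) \<longlonglongrightarrow> 0"
    by (rule Lim_null_comparison[rotated]) (intro always_eventually allI, unfold real_norm_def, rule rem)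
  then have "(\<lambda>q. m t \<xi> - (m t \<xi> - (\<Sum>i<Suc q. t ^ i / fact i * Df i 0))) \<longlonglongrightarrow> m t \<xi> - 0"
    by (intro tendsto_diff tendsto_const)
  then have "(\<lambda>q. \<Sum>i<Suc q. t ^ i / fact i * Df i 0) \<longlonglongrightarrow> m t \<xi>" by simp
  then show ?thesis
    unfolding sums_def Df_def by (rule LIMSEQ_imp_Suc)
qed

text \<open>The generator relation is integrated in time before the limit is taken, since pointwise
  derivatives need not survive it. Bounded convergence is applied twice, under the expectation and
  in the time variable.\<close>

lemma generator_extension:
  assumes mp: "markov_process E Pr X" and gen: "has_generator_on E Pr X D L" and x: "x \<in> space E"
    and fD: "\<And>n. f n \<in> D"
    and f: "\<And>n. f n \<in> borel_measurable E" "\<And>n y. y \<in> space E \<Longrightarrow> \<bar>f n y\<bar> \<le> B"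
      "\<And>y. y \<in> space E \<Longrightarrow> (\<lambda>n. f n y) \<longlonglongrightarrow> g y"
    and Lf: "\<And>n. L (f n) \<in> borel_measurable E" "\<And>n y. y \<in> space E \<Longrightarrow> \<bar>L (f n) y\<bar> \<le> B'"
      "\<And>y. y \<in> space E \<Longrightarrow> (\<lambda>n. L (f n) y) \<longlonglongrightarrow> h y"
    and t: "0 \<le> t"
  shows "((\<lambda>s. \<integral>\<omega>. h (X s \<omega>) \<partial>Pr x) has_integral (\<integral>\<omega>. g (X t \<omega>) \<partial>Pr x) - (\<integral>\<omega>. g (X 0 \<omega>) \<partial>Pr x)) {0..t}"
proof -
  interpret prob_space "Pr x" using mp x unfolding markov_process_def by blast
  have X: "X s \<in> Pr x \<rightarrow>\<^sub>M E" if "0 \<le> s" for s using mp x that unfolding markov_process_def by blast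
  have Xs: "X s \<omega> \<in> space E" if "0 \<le> s" "\<omega> \<in> space (Pr x)" for s \<omega>
    using measurable_space[OF X[OF that(1)] that(2)] .
  have lim: "(\<lambda>n. \<integral>\<omega>. F n (X s \<omega>) \<partial>Pr x) \<longlonglongrightarrow> (\<integral>\<omega>. G (X s \<omega>) \<partial>Pr x)" and bd: "\<And>n. \<bar>\<integral>\<omega>. F n (X s \<omega>) \<partial>Pr x\<bar> \<le> C"
    if F: "\<And>n. F n \<in> borel_measurable E" "\<And>n y. y \<in> space E \<Longrightarrow> \<bar>F n y\<bar> \<le> C"
      "\<And>y. y \<in> space E \<Longrightarrow> (\<lambda>n. F n y) \<longlonglongrightarrow> G y" and s: "0 \<le> s" for F :: "nat \<Rightarrow> 'a \<Rightarrow> real" and G C s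
  proof -
    have G: "G \<in> borel_measurable E" by (rule borel_measurable_LIMSEQ_real[where u=F]) (use F in auto)
    show "(\<lambda>n. \<integral>\<omega>. F n (X s \<omega>) \<partial>Pr x) \<longlonglongrightarrow> (\<integral>\<omega>. G (X s \<omega>) \<partial>Pr x)"
      by (rule integral_dominated_convergence[where w="\<lambda>_. C"])
         (use F Xs[OF s] in \<open>auto intro: measurable_compose[OF X[OF s]] G\<close>)
    have i: "integrable (Pr x) (\<lambda>\<omega>. F n (X s \<omega>))" for n
      by (rule integrable_const_bound[of _ C]) (use F Xs[OF s] in \<open>auto intro: measurable_compose[OF X[OF s]]\<close>)
    have "norm (\<integral>\<omega>. F n (X s \<omega>) \<partial>Pr x) \<le> (\<integral>\<omega>. norm (F n (X s \<omega>)) \<partial>Pr x)" for n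
      by (rule integral_norm_bound)
    also have "(\<integral>\<omega>. norm (F n (X s \<omega>)) \<partial>Pr x) \<le> C" for n
      by (rule integral_le_const) (use i F Xs[OF s] in auto)
    finally show "\<bar>\<integral>\<omega>. F n (X s \<omega>) \<partial>Pr x\<bar> \<le> C" for n by simp
  qed
  have 1: "((\<lambda>s. \<integral>\<omega>. L (f n) (X s \<omega>) \<partial>Pr x) has_integral (\<integral>\<omega>. f n (X t \<omega>) \<partial>Pr x) - (\<integral>\<omega>. f n (X 0 \<omega>) \<partial>Pr x)) {0..t}" for n
  proof (rule fundamental_theorem_of_calculus[OF t])
    fix s assume "s \<in> {0..t}"
    then have "((\<lambda>s. \<integral>\<omega>. f n (X s \<omega>) \<partial>Pr x) has_real_derivative (\<integral>\<omega>. L (f n) (X s \<omega>) \<partial>Pr x)) (at s within {0..})"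
      using gen fD[of n] x unfolding has_generator_on_def by auto
    then have "((\<lambda>s. \<integral>\<omega>. f n (X s \<omega>) \<partial>Pr x) has_real_derivative (\<integral>\<omega>. L (f n) (X s \<omega>) \<partial>Pr x)) (at s within {0..t})"
      by (rule DERIV_subset) auto
    then show "((\<lambda>s. \<integral>\<omega>. f n (X s \<omega>) \<partial>Pr x) has_vector_derivative (\<integral>\<omega>. L (f n) (X s \<omega>) \<partial>Pr x)) (at s within {0..t})"
      by (simp add: has_real_derivative_iff_has_vector_derivative)
  qed
  \<comment> \<open>In this form the theorem for gauge integrals also delivers integrability in time
    of the limit.\<close>
  note dc = dominated_convergence[of "\<lambda>n s. \<integral>\<omega>. L (f n) (X s \<omega>) \<partial>Pr x" "{0..t}" "\<lambda>_. B'" "\<lambda>s. \<integral>\<omega>. h (X s \<omega>) \<partial>Pr x"]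
  have i: "(\<lambda>s. \<integral>\<omega>. h (X s \<omega>) \<partial>Pr x) integrable_on {0..t}"
    and c: "(\<lambda>n. integral {0..t} (\<lambda>s. \<integral>\<omega>. L (f n) (X s \<omega>) \<partial>Pr x)) \<longlonglongrightarrow> integral {0..t} (\<lambda>s. \<integral>\<omega>. h (X s \<omega>) \<partial>Pr x)"
    using dc 1 lim[OF Lf] bd[OF Lf] by (auto intro: has_integral_integrable)
  have "(\<lambda>n. (\<integral>\<omega>. f n (X t \<omega>) \<partial>Pr x) - (\<integral>\<omega>. f n (X 0 \<omega>) \<partial>Pr x)) \<longlonglongrightarrow> (\<integral>\<omega>. g (X t \<omega>) \<partial>Pr x) - (\<integral>\<omega>. g (X 0 \<omega>) \<partial>Pr x)"
    by (intro tendsto_diff lim[OF f] t order_refl)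
  with c have "integral {0..t} (\<lambda>s. \<integral>\<omega>. h (X s \<omega>) \<partial>Pr x) = (\<integral>\<omega>. g (X t \<omega>) \<partial>Pr x) - (\<integral>\<omega>. g (X 0 \<omega>) \<partial>Pr x)"
    unfolding integral_unique[OF 1] by (rule LIMSEQ_unique)
  with i show ?thesis by (simp add: has_integral_iff)
qed

text \<open>A common interface for the three processes: d \<xi> may lie outside the test functions
  D, but it is a bounded pointwise limit of them along which the generator converges, boundedly, to
  the discrete generator acting on the index \<xi>.\<close>

definition dual_functions :: "'x measure \<Rightarrow> ('v::finite \<Rightarrow> 'v \<Rightarrow> real) \<Rightarrow> ('x \<Rightarrow> real) set \<Rightarrow>
    (('x \<Rightarrow> real) \<Rightarrow> 'x \<Rightarrow> real) \<Rightarrow> (('v \<Rightarrow> nat) \<Rightarrow> 'x \<Rightarrow> real) \<Rightarrow> bool" where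
  "dual_functions E p D L d \<longleftrightarrow>
     (\<forall>\<xi>. d \<xi> \<in> borel_measurable E) \<and> (\<forall>\<xi>. \<forall>y\<in>space E. \<bar>d \<xi> y\<bar> \<le> 1) \<and>
     (\<forall>\<xi>. \<exists>f B. \<forall>n. f n \<in> D \<and> f n \<in> borel_measurable E \<and> L (f n) \<in> borel_measurable E \<and>
        (\<forall>y\<in>space E. \<bar>f n y\<bar> \<le> B \<and> \<bar>L (f n) y\<bar> \<le> B \<and> (\<lambda>n. f n y) \<longlonglongrightarrow> d \<xi> y \<and>
           (\<lambda>n. L (f n) y) \<longlonglongrightarrow> discrete_generator p (\<lambda>\<xi>. d \<xi> y) \<xi>))"

text \<open>The extended generator relation is only an integral equation. It makes the expectations
  continuous in time; its integrand, a finite combination of them, is then continuous as well, so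
  the equation can be differentiated and the series applies.\<close>

lemma dual_functions_series:
  assumes mp: "markov_process E Pr X" and gen: "has_generator_on E Pr X D L"
    and dual: "dual_functions E p D L d" and p: "\<And>i j. 0 \<le> p i j"
    and x: "x \<in> space E" and t: "0 \<le> t"
  shows "(\<lambda>n. t ^ n / fact n * (discrete_generator p ^^ n) (\<lambda>\<xi>. d \<xi> x) \<xi>) sums (\<integral>\<omega>. d \<xi> (X t \<omega>) \<partial>Pr x)"
proof -
  interpret prob_space "Pr x" using mp x unfolding markov_process_def by blast
  have X: "X s \<in> Pr x \<rightarrow>\<^sub>M E" if "0 \<le> s" for s using mp x that unfolding markov_process_def by blast
  have Xs: "X s \<omega> \<in> space E" if "0 \<le> s" "\<omega> \<in> space (Pr x)" for s \<omega>
    using measurable_space[OF X[OF that(1)] that(2)] .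
  have dm: "d \<xi> \<in> borel_measurable E" and d1: "\<And>y. y \<in> space E \<Longrightarrow> \<bar>d \<xi> y\<bar> \<le> 1" for \<xi>
    using dual unfolding dual_functions_def by auto
  define m where "m s \<xi> = (\<integral>\<omega>. d \<xi> (X s \<omega>) \<partial>Pr x)" for s \<xi>
  have int: "integrable (Pr x) (\<lambda>\<omega>. d \<xi> (X s \<omega>))" if "0 \<le> s" for s \<xi>
    by (rule integrable_const_bound[of _ 1]) (use d1 Xs[OF that] in \<open>auto intro: measurable_compose[OF X[OF that] dm]\<close>)
  have m1: "\<bar>m s \<xi>\<bar> \<le> 1" if s: "0 \<le> s" for s \<xi>
  proof -
    have "norm (m s \<xi>) \<le> (\<integral>\<omega>. norm (d \<xi> (X s \<omega>)) \<partial>Pr x)"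
      unfolding m_def by (rule integral_norm_bound)
    also have "\<dots> \<le> 1" by (rule integral_le_const) (use int[OF s] d1 Xs[OF s] in auto)
    finally show ?thesis by simp
  qed
  have hi: "((\<lambda>s. discrete_generator p (m s) \<xi>) has_integral m s \<xi> - m 0 \<xi>) {0..s}" if s: "0 \<le> s" for s \<xi>
  proof -
    obtain f B where f: "\<And>n. f n \<in> D \<and> f n \<in> borel_measurable E \<and> L (f n) \<in> borel_measurable E \<and>
        (\<forall>y\<in>space E. \<bar>f n y\<bar> \<le> B \<and> \<bar>L (f n) y\<bar> \<le> B \<and> (\<lambda>n. f n y) \<longlonglongrightarrow> d \<xi> y \<and>
           (\<lambda>n. L (f n) y) \<longlonglongrightarrow> discrete_generator p (\<lambda>\<xi>. d \<xi> y) \<xi>)"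
      using dual unfolding dual_functions_def by meson
    have "((\<lambda>s. \<integral>\<omega>. discrete_generator p (\<lambda>\<xi>. d \<xi> (X s \<omega>)) \<xi> \<partial>Pr x) has_integral m s \<xi> - m 0 \<xi>) {0..s}"
      unfolding m_def by (rule generator_extension[OF mp gen x, of f B _ B]) (use f s in auto)
    moreover have "(\<integral>\<omega>. discrete_generator p (\<lambda>\<xi>. d \<xi> (X s \<omega>)) \<xi> \<partial>Pr x) = discrete_generator p (m s) \<xi>" if "s \<in> {0..s'}" for s s'
      using that unfolding m_def[abs_def] by (intro integrable_discrete_generator(2) int) auto
    ultimately show ?thesis by (subst has_integral_cong) auto
  qed
  have cont: "continuous_on {0..T} (\<lambda>s. m s \<xi>)" for T \<xi>
  proof -
    have "(\<lambda>s. discrete_generator p (m s) \<xi>) integrable_on {0..T}"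
      using hi[of T \<xi>] by (cases "0 \<le> T") auto
    then have "continuous_on {0..T} (\<lambda>s. m 0 \<xi> + integral {0..s} (\<lambda>s. discrete_generator p (m s) \<xi>))"
      by (intro continuous_intros indefinite_integral_continuous_1)
    then show ?thesis
      by (rule continuous_on_eq) (simp add: integral_unique[OF hi])
  qed
  have contg: "continuous_on {0..T} (\<lambda>s. discrete_generator p (m s) \<xi>)" for T \<xi>
    unfolding discrete_generator_def by (intro continuous_intros cont)
  have deriv: "((\<lambda>s. m s \<xi>) has_real_derivative discrete_generator p (m s) \<xi>) (at s within {0..})" if s: "0 \<le> s" for s \<xi>
  proof -
    \<comment> \<open>The interval reaches beyond s, so that near s it coincides with the half-line
      and the derivative is not merely one from the left.\<close>
    have "((\<lambda>s. m 0 \<xi> + integral {0..s} (\<lambda>s. discrete_generator p (m s) \<xi>)) has_real_derivative 0 + discrete_generator p (m s) \<xi>) (at s within {0..s + 1})"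
      by (intro DERIV_add DERIV_const integral_has_real_derivative[OF contg]) (use s in auto)
    then have "((\<lambda>s. m s \<xi>) has_real_derivative discrete_generator p (m s) \<xi>) (at s within {0..s + 1})"
      by (rule has_field_derivative_transform_within[where d=1, THEN DERIV_cong]) (use s in \<open>auto simp: integral_unique[OF hi]\<close>)
    moreover have "at s within {0..s + 1} = at s within {0..}"
      by (rule at_within_nhd[of s "{..<s + 1}"]) auto
    ultimately show ?thesis by simp
  qed
  have m0: "m 0 = (\<lambda>\<xi>. d \<xi> x)"
  proof
    fix \<xi>
    have "AE \<omega> in Pr x. X 0 \<omega> = x" using mp x unfolding markov_process_def by blast
    then have "m 0 \<xi> = (\<integral>\<omega>. d \<xi> x \<partial>Pr x)"
      unfolding m_def by (intro integral_cong_AE) (auto intro: measurable_compose[OF X dm])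
    then show "m 0 \<xi> = d \<xi> x" by (simp add: prob_space)
  qed
  show ?thesis
    using bounded_solution_series[OF p deriv m1 t, of \<xi>] unfolding m0 by (simp add: m_def)
qed

text \<open>Iterates of the generator are finite sums in \<xi>, so integration over the starting
  point passes through them; the interchange with the series is dominated by the exponential series
  in K t.\<close>

lemma dual_functions_law_series:
  assumes mp: "markov_process E Pr X" and gen: "has_generator_on E Pr X D L"
    and dual: "dual_functions E p D L d" and p: "\<And>i j. 0 \<le> p i j"
    and \<mu>: "prob_space \<mu>" "sets \<mu> = sets E" and t: "0 \<le> t"
  shows "(\<lambda>n. t ^ n / fact n * (discrete_generator p ^^ n) (\<lambda>\<xi>. \<integral>x. d \<xi> x \<partial>\<mu>) \<xi>) sums (\<integral>x. (\<integral>\<omega>. d \<xi> (X t \<omega>) \<partial>Pr x) \<partial>\<mu>)"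
proof -
  interpret prob_space \<mu> by (rule \<mu>)
  have sp: "space \<mu> = space E" by (rule sets_eq_imp_space_eq[OF \<mu>(2)])
  have dm: "d \<xi> \<in> borel_measurable \<mu>" and d1: "\<And>y. y \<in> space \<mu> \<Longrightarrow> \<bar>d \<xi> y\<bar> \<le> 1" for \<xi>
    using dual unfolding dual_functions_def sp by (auto simp: measurable_cong_sets[OF \<mu>(2) refl])
  have int: "integrable \<mu> (d \<xi>)" for \<xi>
    by (rule integrable_const_bound[of _ 1]) (use d1 dm in auto)
  define K where "K = rate_bound p (particle_number \<xi>)"
  have K: "0 \<le> K" unfolding K_def rate_bound_def by (intro sum_nonneg mult_nonneg_nonneg p) auto
  let ?f = "\<lambda>n x. t ^ n / fact n * (discrete_generator p ^^ n) (\<lambda>\<xi>. d \<xi> x) \<xi>"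
  have fi: "integrable \<mu> (?f n)" for n
    using integrable_discrete_generator_funpow[of \<mu> d n p \<xi>] int by simp
  have fe: "(\<integral>x. ?f n x \<partial>\<mu>) = t ^ n / fact n * (discrete_generator p ^^ n) (\<lambda>\<xi>. \<integral>x. d \<xi> x \<partial>\<mu>) \<xi>" for n
    using integrable_discrete_generator_funpow[of \<mu> d n p \<xi>] int by simp
  have fK: "norm (?f n x) \<le> (K * t) ^ n / fact n" if x: "x \<in> space \<mu>" for n x
  proof -
    have e1: "\<bar>d \<xi>' x\<bar> \<le> 1" for \<xi>' using d1[OF x] .
    have "norm (?f n x) = t ^ n / fact n * \<bar>(discrete_generator p ^^ n) (\<lambda>\<xi>. d \<xi> x) \<xi>\<bar>"
      using t by (simp add: abs_mult)
    also have "\<dots> \<le> t ^ n / fact n * K ^ n"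
      unfolding K_def using t by (intro mult_left_mono discrete_generator_funpow_bound[OF p e1]) auto
    finally show ?thesis by (simp add: power_mult_distrib mult.commute)
  qed
  have sK: "summable (\<lambda>n. (K * t) ^ n / fact n)"
    using summable_exp[of "K * t"] by (simp add: divide_inverse mult.commute)
  have "(\<lambda>n. \<integral>x. ?f n x \<partial>\<mu>) sums (\<integral>x. (\<Sum>n. ?f n x) \<partial>\<mu>)"
  proof (rule sums_integral[OF fi])
    show "AE x in \<mu>. summable (\<lambda>n. norm (?f n x))"
      by (rule AE_I2, rule summable_comparison_test'[OF sK, of 0]) (use fK in auto)
    show "summable (\<lambda>n. \<integral>x. norm (?f n x) \<partial>\<mu>)"
    proof (rule summable_comparison_test'[OF sK, of 0])
      fix n
      have "(\<integral>x. norm (?f n x) \<partial>\<mu>) \<le> (K * t) ^ n / fact n"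
        by (rule integral_le_const[OF integrable_norm[OF fi]]) (use fK in auto)
      moreover have "0 \<le> (\<integral>x. norm (?f n x) \<partial>\<mu>)" by simp
      ultimately show "norm (\<integral>x. norm (?f n x) \<partial>\<mu>) \<le> (K * t) ^ n / fact n" by simp
    qed
  qed
  moreover have "(\<integral>x. (\<Sum>n. ?f n x) \<partial>\<mu>) = (\<integral>x. (\<integral>\<omega>. d \<xi> (X t \<omega>) \<partial>Pr x) \<partial>\<mu>)"
    using dual_functions_series[OF mp gen dual p _ t, of _ \<xi>] by (intro Bochner_Integration.integral_cong refl) (simp add: sp sums_iff)
  ultimately show ?thesis unfolding fe by simp
qed

section \<open>Dual functions of the three processes\<close>

lemma borel_measurable_vec_lambda:
  fixes f :: "'v::finite \<Rightarrow> 'a \<Rightarrow> real"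
  assumes "\<And>i. f i \<in> borel_measurable M"
  shows "(\<lambda>x. \<chi> i. f i x) \<in> borel_measurable M"
proof (subst borel_measurable_euclidean_space, rule ballI)
  fix b :: "real^'v" assume "b \<in> Basis"
  then obtain i where b: "b = axis i 1" by (auto simp: Basis_vec_def)
  show "(\<lambda>x. (\<chi> i. f i x) \<bullet> b) \<in> borel_measurable M"
    using assms by (simp add: b inner_axis)
qed

lemma borel_measurable_move_parameter:
  "(\<lambda>(\<theta>, u). move_parameter i j u \<theta>) \<in> borel_measurable (borel \<Otimes>\<^sub>M borel)"
  unfolding borel_prod move_parameter_def case_prod_beta'
  by (intro borel_measurable_continuous_onI continuous_intros)

lemma borel_measurable_move_mass:
  "(\<lambda>(\<zeta>, u). move_mass i j u \<zeta>) \<in> borel_measurable (borel \<Otimes>\<^sub>M borel)"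
  unfolding borel_prod move_mass_def case_prod_beta'
  by (intro borel_measurable_continuous_onI continuous_intros)

lemma borel_measurable_symmetric_generator:
  fixes m :: "'v::finite \<Rightarrow> 'v \<Rightarrow> real \<Rightarrow> real^'v \<Rightarrow> real^'v"
  assumes [measurable]: "f \<in> borel_measurable borel"
    and m: "\<And>i j. (\<lambda>(x, u). m i j u x) \<in> borel_measurable (borel \<Otimes>\<^sub>M borel)"
  shows "(\<lambda>x. \<Sum>i\<in>UNIV. \<Sum>j\<in>UNIV - {i}. p i j *
     (LBINT u:{0<..<1}. 1 / u * ((f (m i j u x) - f x) + (f (m j i u x) - f x)))) \<in> borel_measurable borel"
proof (intro borel_measurable_sum borel_measurable_times borel_measurable_const)
  fix i j
  have [measurable]: "(\<lambda>z. m i j (snd z) (fst z)) \<in> borel_measurable (borel \<Otimes>\<^sub>M borel)" for i j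
    using m[of i j] by (simp add: case_prod_beta')
  have [measurable]: "(\<lambda>z. f (m i j (snd z) (fst z))) \<in> borel_measurable (borel \<Otimes>\<^sub>M borel)" for i j
    by measurable
  show "(\<lambda>x. LBINT u:{0<..<1}. 1 / u * ((f (m i j u x) - f x) + (f (m j i u x) - f x))) \<in> borel_measurable borel"
    unfolding set_lebesgue_integral_def
    by (rule lborel.borel_measurable_lebesgue_integral) (simp add: case_prod_beta')
qed

lemma borel_measurable_hidden_generator:
  "f \<in> borel_measurable borel \<Longrightarrow> hidden_generator p f \<in> borel_measurable borel"
  unfolding hidden_generator_def[abs_def]
  by (rule borel_measurable_symmetric_generator[OF _ borel_measurable_move_parameter])

lemma borel_measurable_continuous_generator:
  "f \<in> borel_measurable borel \<Longrightarrow> continuous_generator p f \<in> borel_measurable borel"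
  unfolding continuous_generator_def[abs_def]
  by (rule borel_measurable_symmetric_generator[OF _ borel_measurable_move_mass])

lemma C1_compact_support_borel: "f \<in> C1_compact_support \<Longrightarrow> f \<in> borel_measurable borel"
  by (auto simp: C1_compact_support_def intro!: borel_measurable_continuous_onI continuous_at_imp_continuous_on
      dest: has_derivative_continuous)

lemma borel_measurable_tensor:
  assumes [measurable]: "\<And>n. w n \<in> borel_measurable borel"
  shows "(\<lambda>x. tensor w \<xi> (c *\<^sub>R x)) \<in> borel_measurable borel"
  unfolding tensor_def by simp

lemma borel_measurable_weights [measurable]:
  "geometric_weight n \<in> borel_measurable borel" "poisson_weight n \<in> borel_measurable borel"
  unfolding geometric_weight_def[abs_def] poisson_weight_def[abs_def] by measurable

lemma space_orthant_borel: "space orthant_borel = orthant"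
  by (simp add: space_restrict_space)

text \<open>For x > 0 the weights are point masses of the Poisson distribution.\<close>

lemma poisson_weight_bounds:
  assumes "0 \<le> x" shows "0 \<le> poisson_weight n x" "poisson_weight n x \<le> 1"
proof -
  show "0 \<le> poisson_weight n x" using assms by (simp add: poisson_weight_def)
  show "poisson_weight n x \<le> 1"
  proof (cases "x = 0")
    case True
    then show ?thesis by (cases n) (auto simp: poisson_weight_def)
  next
    case False
    then show ?thesis using pmf_le_1[of "poisson_pmf x" n] assms by (simp add: poisson_weight_def)
  qed
qed

text \<open>The cutoff radius runs through the positive integers. At each point of the orthant both
  approximating sequences are eventually constant.\<close>

lemma hidden_dual_functions:
  fixes p :: "'a::finite \<Rightarrow> 'a \<Rightarrow> real"
  assumes p: "\<And>i j. 0 \<le> p i j" and c: "0 < c"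
  shows "dual_functions orthant_borel p C1_compact_support (hidden_generator p)
    (\<lambda>\<xi> \<theta>. tensor geometric_weight \<xi> (c *\<^sub>R \<theta>))"
  unfolding dual_functions_def space_orthant_borel
proof (intro conjI allI ballI)
  fix \<xi> :: "'a \<Rightarrow> nat"
  show "(\<lambda>\<theta>. tensor geometric_weight \<xi> (c *\<^sub>R \<theta>)) \<in> borel_measurable orthant_borel"
    by (intro measurable_restrict_space1 borel_measurable_tensor) measurable
  show "\<bar>tensor geometric_weight \<xi> (c *\<^sub>R y)\<bar> \<le> 1" if "y \<in> orthant" for y
    by (rule tensor_bounds) (use that c geometric_weight_bounds in \<open>auto simp: orthant_def\<close>)
  define f where "f n = hidden_test (real (Suc n)) c \<xi>" for n
  define B where "B = 1 + (\<Sum>i\<in>UNIV. \<Sum>j\<in>UNIV - {i}. p i j * (real (\<xi> i) + real (\<xi> j) + 26))"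
  have B: "1 \<le> B" "(\<Sum>i\<in>UNIV. \<Sum>j\<in>UNIV - {i}. p i j * (real (\<xi> i) + real (\<xi> j) + 26)) \<le> B"
    unfolding B_def by (auto intro!: sum_nonneg mult_nonneg_nonneg p)
  have ev: "\<forall>\<^sub>F n in sequentially. \<forall>i. c * y $ i \<le> real (Suc n)" for y :: "real^'a"
  proof (rule eventually_all_finite)
    fix i
    obtain N where "c * y $ i \<le> real N" using real_arch_simple by blast
    then show "\<forall>\<^sub>F n in sequentially. c * y $ i \<le> real (Suc n)"
      by (intro eventually_sequentiallyI[of N]) auto
  qed
  show "\<exists>f B. \<forall>n. f n \<in> C1_compact_support \<and> f n \<in> borel_measurable orthant_borel \<and>
      hidden_generator p (f n) \<in> borel_measurable orthant_borel \<and>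
      (\<forall>y\<in>orthant. \<bar>f n y\<bar> \<le> B \<and> \<bar>hidden_generator p (f n) y\<bar> \<le> B \<and>
         (\<lambda>n. f n y) \<longlonglongrightarrow> tensor geometric_weight \<xi> (c *\<^sub>R y) \<and>
         (\<lambda>n. hidden_generator p (f n) y) \<longlonglongrightarrow> discrete_generator p (\<lambda>\<xi>. tensor geometric_weight \<xi> (c *\<^sub>R y)) \<xi>)"
  proof (intro exI[of _ f] exI[of _ B] allI conjI ballI)
    fix n
    show C: "f n \<in> C1_compact_support"
      unfolding f_def by (rule hidden_test_C1_compact_support[OF c]) simp
    show "f n \<in> borel_measurable orthant_borel" "hidden_generator p (f n) \<in> borel_measurable orthant_borel"
      by (intro measurable_restrict_space1 borel_measurable_hidden_generator C1_compact_support_borel C)+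
    fix y :: "real^'a" assume y: "y \<in> orthant"
    show "\<bar>f n y\<bar> \<le> B"
      using hidden_test_bound[OF y, of c "real (Suc n)" \<xi>] c B(1) unfolding f_def by simp
    show "\<bar>hidden_generator p (f n) y\<bar> \<le> B"
      using hidden_generator_test_bound[where p=p and \<theta>=y and c=c and R="real (Suc n)" and \<xi>=\<xi>] p y c B(2) unfolding f_def by simp
    show "(\<lambda>n. f n y) \<longlonglongrightarrow> tensor geometric_weight \<xi> (c *\<^sub>R y)"
      by (rule tendsto_eventually, rule eventually_mono[OF ev[of y]])
         (use y c in \<open>auto simp: f_def intro!: hidden_test_eq\<close>)
    show "(\<lambda>n. hidden_generator p (f n) y) \<longlonglongrightarrow> discrete_generator p (\<lambda>\<xi>. tensor geometric_weight \<xi> (c *\<^sub>R y)) \<xi>"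
      by (rule tendsto_eventually, rule eventually_mono[OF ev[of y]])
         (use y c in \<open>auto simp: f_def intro!: hidden_generator_test_eq\<close>)
  qed
qed

lemma continuous_dual_functions:
  fixes p :: "'a::finite \<Rightarrow> 'a \<Rightarrow> real"
  assumes p: "\<And>i j. 0 \<le> p i j" and c: "0 < c"
  shows "dual_functions orthant_borel p C1_compact_support (continuous_generator p)
    (\<lambda>\<xi> \<zeta>. tensor poisson_weight \<xi> (c *\<^sub>R \<zeta>))"
  unfolding dual_functions_def space_orthant_borel
proof (intro conjI allI ballI)
  fix \<xi> :: "'a \<Rightarrow> nat"
  show "(\<lambda>\<zeta>. tensor poisson_weight \<xi> (c *\<^sub>R \<zeta>)) \<in> borel_measurable orthant_borel"
    by (intro measurable_restrict_space1 borel_measurable_tensor) measurable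
  show t1: "\<bar>tensor poisson_weight \<xi> (c *\<^sub>R y)\<bar> \<le> 1" if "y \<in> orthant" for y \<xi>
    by (rule tensor_bounds) (use that c poisson_weight_bounds in \<open>auto simp: orthant_def\<close>)
  define f where "f n = continuous_test (real (Suc n)) c \<xi>" for n
  define B where "B = 1 + rate_bound p (particle_number \<xi>)"
  have B: "1 \<le> B" "rate_bound p (particle_number \<xi>) \<le> B"
    unfolding B_def rate_bound_def by (auto intro!: sum_nonneg mult_nonneg_nonneg p simp: mult.commute)
  have ev: "\<forall>\<^sub>F n in sequentially. cutoff (c / real (Suc n) * (\<Sum>i\<in>UNIV. y $ i)) = 1" for y :: "real^'a"
  proof -
    obtain N where N: "c * (\<Sum>i\<in>UNIV. y $ i) \<le> real N" using real_arch_simple by blast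
    show ?thesis
    proof (intro eventually_sequentiallyI[of N] cutoff_eq_1)
      fix n assume "N \<le> n"
      then have "c * (\<Sum>i\<in>UNIV. y $ i) \<le> real (Suc n)" using N by simp
      then show "c / real (Suc n) * (\<Sum>i\<in>UNIV. y $ i) \<le> 1" by (simp add: divide_le_eq)
    qed
  qed
  show "\<exists>f B. \<forall>n. f n \<in> C1_compact_support \<and> f n \<in> borel_measurable orthant_borel \<and>
      continuous_generator p (f n) \<in> borel_measurable orthant_borel \<and>
      (\<forall>y\<in>orthant. \<bar>f n y\<bar> \<le> B \<and> \<bar>continuous_generator p (f n) y\<bar> \<le> B \<and>
         (\<lambda>n. f n y) \<longlonglongrightarrow> tensor poisson_weight \<xi> (c *\<^sub>R y) \<and>
         (\<lambda>n. continuous_generator p (f n) y) \<longlonglongrightarrow> discrete_generator p (\<lambda>\<xi>. tensor poisson_weight \<xi> (c *\<^sub>R y)) \<xi>)"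
  proof (intro exI[of _ f] exI[of _ B] allI conjI ballI)
    fix n
    show C: "f n \<in> C1_compact_support"
      unfolding f_def by (rule continuous_test_C1_compact_support[OF c]) simp
    show "f n \<in> borel_measurable orthant_borel" "continuous_generator p (f n) \<in> borel_measurable orthant_borel"
      by (intro measurable_restrict_space1 borel_measurable_continuous_generator C1_compact_support_borel C)+
    fix y :: "real^'a" assume y: "y \<in> orthant"
    have c0: "0 \<le> c" using c by simp
    let ?k = "\<lambda>n. cutoff (c / real (Suc n) * (\<Sum>i\<in>UNIV. y $ i))"
    have f: "f n y = ?k n * tensor poisson_weight \<xi> (c *\<^sub>R y)"
      "continuous_generator p (f n) y = ?k n * discrete_generator p (\<lambda>\<xi>. tensor poisson_weight \<xi> (c *\<^sub>R y)) \<xi>" for n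
      unfolding f_def by (rule continuous_test_orthant[OF y c0] continuous_generator_test[OF y c0])+
    have k: "\<bar>?k n\<bar> \<le> 1" by (simp add: cutoff_bounds)
    have "\<bar>?k n\<bar> * \<bar>tensor poisson_weight \<xi> (c *\<^sub>R y)\<bar> \<le> 1 * 1"
      by (intro mult_mono k t1 y) auto
    then show "\<bar>f n y\<bar> \<le> B" using B(1) by (simp add: f abs_mult)
    have "\<bar>discrete_generator p (\<lambda>\<xi>. tensor poisson_weight \<xi> (c *\<^sub>R y)) \<xi>\<bar> \<le> rate_bound p (particle_number \<xi>) * 1"
      by (intro discrete_generator_bound p t1 y)
    then have "\<bar>?k n\<bar> * \<bar>discrete_generator p (\<lambda>\<xi>. tensor poisson_weight \<xi> (c *\<^sub>R y)) \<xi>\<bar> \<le> 1 * (rate_bound p (particle_number \<xi>) * 1)"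
      by (intro mult_mono k) auto
    then show "\<bar>continuous_generator p (f n) y\<bar> \<le> B" using B(2) by (simp add: f abs_mult)
    show "(\<lambda>n. f n y) \<longlonglongrightarrow> tensor poisson_weight \<xi> (c *\<^sub>R y)"
      unfolding f by (rule tendsto_eventually, rule eventually_mono[OF ev[of y]]) simp
    show "(\<lambda>n. continuous_generator p (f n) y) \<longlonglongrightarrow> discrete_generator p (\<lambda>\<xi>. tensor poisson_weight \<xi> (c *\<^sub>R y)) \<xi>"
      unfolding f by (rule tendsto_eventually, rule eventually_mono[OF ev[of y]]) simp
  qed
qed

text \<open>A jump of k particles is undone by a jump of the same k in the opposite direction. As
  the rate 1/k depends on k only, this is detailed balance for the counting measure.\<close>

lemma move_particles_inverse_iff:
  assumes ij: "i \<noteq> j"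
  shows "k \<le> \<eta> i \<and> move_particles i j k \<eta> = \<xi> \<longleftrightarrow> k \<le> \<xi> j \<and> move_particles j i k \<xi> = \<eta>"
proof -
  have *: "k \<le> \<xi> j \<and> move_particles j i k \<xi> = \<eta>" if "k \<le> \<eta> i \<and> move_particles i j k \<eta> = \<xi>" "i \<noteq> j" for i j :: 'a and \<xi> \<eta>
  proof -
    have \<xi>: "\<xi> = move_particles i j k \<eta>" and k: "k \<le> \<eta> i" using that by auto
    show ?thesis unfolding \<xi> using that(2) k by (auto simp: move_particles_def)
  qed
  show ?thesis using *[of \<eta> i j \<xi>] *[of \<xi> j i \<eta>] ij by blast
qed

text \<open>Symmetry of the generator for the counting measure, written for point masses: indicators
  are self-duality functions. The diagonal terms agree because they live on \<xi> = \<eta>.\<close>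

lemma discrete_generator_indicator:
  "discrete_generator p (indicator {\<xi>}) \<eta> = discrete_generator p (\<lambda>\<xi>'. indicator {\<xi>'} \<eta>) \<xi>"
proof -
  have *: "(\<Sum>k=1..\<eta> i. 1 / real k * indicator {\<xi>} (move_particles i j k \<eta>))
     = (\<Sum>k=1..\<xi> j. 1 / real k * indicator {move_particles j i k \<xi>} \<eta>)" if ij: "i \<noteq> j" for i j
  proof -
    have "(\<Sum>k=1..\<eta> i. 1 / real k * indicator {\<xi>} (move_particles i j k \<eta>))
      = (\<Sum>k\<in>{k\<in>{1..\<eta> i}. move_particles i j k \<eta> = \<xi>}. 1 / real k)"
      by (rule sum.mono_neutral_cong_right) auto
    also have "{k\<in>{1..\<eta> i}. move_particles i j k \<eta> = \<xi>} = {k\<in>{1..\<xi> j}. move_particles j i k \<xi> = \<eta>}"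
      using move_particles_inverse_iff[OF ij, of _ \<eta> \<xi>] by auto
    also have "(\<Sum>k\<in>{k\<in>{1..\<xi> j}. move_particles j i k \<xi> = \<eta>}. 1 / real k)
      = (\<Sum>k=1..\<xi> j. 1 / real k * indicator {move_particles j i k \<xi>} \<eta>)"
      by (rule sum.mono_neutral_cong_left) (auto simp: indicator_def)
    finally show ?thesis .
  qed
  have H: "(\<Sum>k=1..\<eta> i. 1 / real k) * indicator {\<xi>} \<eta> = (\<Sum>k=1..\<xi> i. 1 / real k) * (indicator {\<xi>} \<eta> :: real)" for i
    by (auto simp: indicator_def)
  show ?thesis
    unfolding discrete_generator_pair
  proof (intro sum.cong refl arg_cong2[of _ _ _ _ "(*)"])
    fix i j :: 'a assume "j \<in> UNIV - {i}"
    then have ij: "i \<noteq> j" "j \<noteq> i" by auto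
    show "pair_generator i j (indicator {\<xi>}) \<eta> = pair_generator i j (\<lambda>\<xi>'. indicator {\<xi>'} \<eta>) \<xi>"
      unfolding pair_generator_def right_diff_distrib sum_subtractf *[OF ij(1)] *[OF ij(2)] sum_distrib_right[symmetric] H
      by simp
  qed
qed

text \<open>Indicators of points already are test functions, so a constant approximating sequence
  suffices.\<close>

lemma discrete_dual_functions:
  fixes p :: "'a::finite \<Rightarrow> 'a \<Rightarrow> real"
  assumes p: "\<And>i j. 0 \<le> p i j"
  shows "dual_functions (count_space UNIV) p finite_support_functions (discrete_generator p)
    (\<lambda>\<xi>. indicator {\<xi>})"
  unfolding dual_functions_def
proof (intro conjI allI ballI)
  fix \<xi> :: "'a \<Rightarrow> nat"
  have b: "\<bar>discrete_generator p (indicator {\<xi>}) \<eta>\<bar> \<le> rate_bound p (particle_number \<xi>) * 1" for \<eta>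
    unfolding discrete_generator_indicator by (rule discrete_generator_bound[OF p]) (auto simp: indicator_def)
  have "0 \<le> rate_bound p (particle_number \<xi>)" unfolding rate_bound_def by (intro sum_nonneg mult_nonneg_nonneg p) auto
  then have B: "\<bar>discrete_generator p (indicator {\<xi>}) \<eta>\<bar> \<le> 1 + rate_bound p (particle_number \<xi>)" "\<bar>indicator {\<xi>} \<eta> :: real\<bar> \<le> 1 + rate_bound p (particle_number \<xi>)" for \<eta>
    using b[of \<eta>] by (auto simp: indicator_def)
  have "(indicator {\<xi>} :: _ \<Rightarrow> real) \<in> finite_support_functions"
    by (simp add: finite_support_functions_def indicator_def)
  then show "\<exists>f B. \<forall>n. f n \<in> finite_support_functions \<and> f n \<in> borel_measurable (count_space UNIV) \<and>
      discrete_generator p (f n) \<in> borel_measurable (count_space UNIV) \<and>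
      (\<forall>y\<in>space (count_space UNIV). \<bar>f n y\<bar> \<le> B \<and> \<bar>discrete_generator p (f n) y\<bar> \<le> B \<and>
         (\<lambda>n. f n y) \<longlonglongrightarrow> indicator {\<xi>} y \<and>
         (\<lambda>n. discrete_generator p (f n) y) \<longlonglongrightarrow> discrete_generator p (\<lambda>\<xi>. indicator {\<xi>} y) \<xi>)"
    using B
    by (intro exI[of _ "\<lambda>_. indicator {\<xi>}"] exI[of _ "1 + rate_bound p (particle_number \<xi>)"])
       (simp add: discrete_generator_indicator[symmetric])
qed (auto simp: indicator_def)

section \<open>Geometric and exponential mixing kernels\<close>

lemma pmf_geometric_product:
  assumes "\<theta> \<in> orthant"
  shows "pmf (Pi_pmf UNIV 0 (\<lambda>i. geometric_pmf (1 / (1 + \<theta> $ i)))) \<xi> = tensor geometric_weight \<xi> \<theta>"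
proof -
  have "pmf (geometric_pmf (1 / (1 + \<theta> $ i))) n = geometric_weight n (\<theta> $ i)" for i n
  proof -
    have t: "0 \<le> \<theta> $ i" using assms by (simp add: orthant_def)
    then have "1 - 1 / (1 + \<theta> $ i) = \<theta> $ i / (1 + \<theta> $ i)" by (simp add: field_simps)
    then show ?thesis using t by (simp add: geometric_weight_def)
  qed
  then show ?thesis by (simp add: pmf_Pi tensor_def)
qed

text \<open>The probability of a set is a series of measurable functions of \<theta>, treated as an
  integral over the counting measure.\<close>

lemma geometric_product_kernel: "(geometric_product :: real^'v::finite \<Rightarrow> _) \<in> orthant_borel \<rightarrow>\<^sub>M prob_algebra (count_space UNIV)"
proof (rule measurable_prob_algebraI)
  show "prob_space (geometric_product \<theta>)" for \<theta> :: "real^'v"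
    unfolding geometric_product_def by (rule prob_space_measure_pmf)
  show "(geometric_product :: real^'v::finite \<Rightarrow> _) \<in> orthant_borel \<rightarrow>\<^sub>M subprob_algebra (count_space UNIV)"
  proof (rule measurable_subprob_algebra)
    fix A :: "('v \<Rightarrow> nat) set"
    have e: "emeasure (geometric_product \<theta>) A = (\<integral>\<^sup>+\<xi>. ennreal (tensor geometric_weight \<xi> \<theta>) * indicator A \<xi> \<partial>count_space UNIV)"
      if "\<theta> \<in> space orthant_borel" for \<theta> :: "real^'v"
      using that unfolding geometric_product_def nn_integral_pmf[symmetric] space_orthant_borel
      by (simp add: nn_integral_count_space_indicator pmf_geometric_product)
    have "(\<lambda>(\<xi>, \<theta>). ennreal (tensor geometric_weight \<xi> \<theta>) * indicator A \<xi>) \<in> borel_measurable (count_space UNIV \<Otimes>\<^sub>M (orthant_borel :: (real^'v) measure))"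
    proof (rule measurable_pair_measure_countable1)
      fix \<xi> :: "'v \<Rightarrow> nat"
      have [measurable]: "(\<lambda>\<theta>. tensor geometric_weight \<xi> \<theta>) \<in> borel_measurable orthant_borel"
        using measurable_restrict_space1[OF borel_measurable_tensor[of geometric_weight \<xi> 1], of orthant] by simp
      show "(\<lambda>y. case (\<xi>, y) of (\<xi>, \<theta>) \<Rightarrow> ennreal (tensor geometric_weight \<xi> \<theta>) * indicator A \<xi>) \<in> borel_measurable orthant_borel"
        by simp
    qed simp
    from measurable_compose[OF measurable_pair_swap' this]
    have m: "(\<lambda>(\<theta>, \<xi>). ennreal (tensor geometric_weight \<xi> \<theta>) * indicator A \<xi>) \<in> borel_measurable ((orthant_borel :: (real^'v) measure) \<Otimes>\<^sub>M count_space UNIV)"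
      by (simp add: case_prod_beta')
    interpret sigma_finite_measure "count_space (UNIV :: ('v \<Rightarrow> nat) set)"
      by (rule sigma_finite_measure_count_space)
    show "(\<lambda>\<theta>. emeasure (geometric_product \<theta>) A) \<in> borel_measurable orthant_borel"
      by (subst measurable_cong[OF e], assumption) (rule borel_measurable_nn_integral[OF m])
  qed (auto simp: geometric_product_def measure_pmf.subprob_space_axioms)
qed

section \<open>Exponential laws as images of the standard exponential law\<close>

lemma sets_exponential_law [measurable_cong, simp]: "sets (exponential_law \<theta>) = sets borel"
  by (simp add: exponential_law_def)

lemma space_exponential_law [simp]: "space (exponential_law \<theta>) = UNIV"
  using sets_eq_imp_space_eq[OF sets_exponential_law] by simp

lemma prob_space_exponential_law: "0 \<le> \<theta> \<Longrightarrow> prob_space (exponential_law \<theta>)"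
  by (auto simp: exponential_law_def prob_space_return intro!: prob_space_exponential_density)

text \<open>Scaling also covers \<theta> = 0, where the image is the point mass at 0 and no density
  exists.\<close>

lemma exponential_law_scale:
  assumes "0 \<le> \<theta>"
  shows "exponential_law \<theta> = distr (exponential_law 1) borel (\<lambda>x. \<theta> * x)"
proof (cases "\<theta> = 0")
  case True
  interpret prob_space "exponential_law 1" by (rule prob_space_exponential_law) simp
  show ?thesis using True by (simp add: exponential_law_def[of 0] distr_const)
next
  case False
  interpret prob_space "exponential_law 1" by (rule prob_space_exponential_law) simp
  have "distributed (exponential_law 1) lborel (\<lambda>x. x) (exponential_density 1)"
    unfolding distributed_def by (auto simp: exponential_law_def distr_id2)
  then have "distributed (exponential_law 1) lborel (\<lambda>x. \<theta> * x) (exponential_density (1 / \<theta>))"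
    using False assms by (intro erlang_distributed_mult_const) auto
  then have "distr (exponential_law 1) lborel (\<lambda>x. \<theta> * x) = density lborel (\<lambda>x. ennreal (exponential_density (1 / \<theta>) x))"
    by (rule distributed_distr_eq_density)
  then show ?thesis
    using False by (simp add: exponential_law_def[of \<theta>] cong: distr_cong)
qed

lemma AE_exponential_law: "AE x in exponential_law 1. 0 \<le> x"
proof -
  have e: "exponential_law 1 = density lborel (\<lambda>x. ennreal (exponential_density 1 x))"
    by (simp add: exponential_law_def)
  show ?thesis
    unfolding e by (subst AE_density) (auto simp: exponential_density_def)
qed

definition standard_exponential :: "('v::finite \<Rightarrow> real) measure" where
  "standard_exponential = (\<Pi>\<^sub>M i\<in>UNIV. exponential_law 1)"

text \<open>The positive part makes the map land in the orthant at every point, not just almost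
  everywhere, as measurability into \<open>orthant_borel\<close> demands. Under the standard
  exponential law it changes nothing.\<close>

definition stretch :: "real^'v::finite \<Rightarrow> ('v \<Rightarrow> real) \<Rightarrow> real^'v" where
  "stretch \<theta> x = (\<chi> i. \<theta> $ i * max 0 (x i))"

lemma sets_orthant [measurable]: "orthant \<in> sets borel"
proof -
  have "closed (orthant :: (real^'a) set)"
    unfolding orthant_def Collect_all_eq by (intro closed_INT ballI closed_Collect_le continuous_intros)
  then show ?thesis by simp
qed

lemma measurable_stretch:
  "(\<lambda>z. stretch (fst z) (snd z)) \<in> (orthant_borel :: (real^'v::finite) measure) \<Otimes>\<^sub>M standard_exponential \<rightarrow>\<^sub>M orthant_borel"
proof (rule measurable_restrict_space2)
  show "(\<lambda>z. stretch (fst z) (snd z)) \<in> space ((orthant_borel :: (real^'v) measure) \<Otimes>\<^sub>M standard_exponential) \<rightarrow> orthant"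
    by (auto simp: space_pair_measure space_orthant_borel stretch_def orthant_def)
  have 1: "(\<lambda>x. x $ i) \<in> borel_measurable (orthant_borel :: (real^'v) measure)" for i :: 'v
    by (rule measurable_restrict_space1) measurable
  have 2: "(\<lambda>x. x i) \<in> borel_measurable (standard_exponential :: ('v \<Rightarrow> real) measure)" for i :: 'v
    using measurable_component_singleton[of i UNIV "\<lambda>i. exponential_law 1"]
    by (simp add: standard_exponential_def measurable_cong_sets[OF refl sets_exponential_law])
  have 3: "(\<lambda>z. fst z $ i) \<in> borel_measurable ((orthant_borel :: (real^'v) measure) \<Otimes>\<^sub>M standard_exponential)" for i :: 'v
    by (rule measurable_compose[OF measurable_fst 1])
  have 4: "(\<lambda>z. snd z i) \<in> borel_measurable ((orthant_borel :: (real^'v) measure) \<Otimes>\<^sub>M standard_exponential)" for i :: 'v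
    by (rule measurable_compose[OF measurable_snd 2])
  show "(\<lambda>z. stretch (fst z) (snd z)) \<in> borel_measurable ((orthant_borel :: (real^'v) measure) \<Otimes>\<^sub>M standard_exponential)"
    unfolding stretch_def
    by (rule borel_measurable_vec_lambda) (intro borel_measurable_times borel_measurable_max borel_measurable_const 3 4)
qed

lemma measurable_stretch':
  assumes "\<theta> \<in> orthant" shows "stretch \<theta> \<in> standard_exponential \<rightarrow>\<^sub>M orthant_borel"
  using measurable_compose[OF measurable_Pair1' measurable_stretch, of \<theta>] assms
  by (simp add: space_orthant_borel)

lemma prob_space_standard_exponential: "prob_space standard_exponential"
  unfolding standard_exponential_def by (intro prob_space_PiM prob_space_exponential_law) simp

lemma PiM_exponential_law:
  fixes \<theta> :: "real^'v::finite"
  assumes \<theta>: "\<theta> \<in> orthant"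
  shows "(\<Pi>\<^sub>M i\<in>UNIV. exponential_law (\<theta> $ i)) = distr standard_exponential (\<Pi>\<^sub>M i\<in>UNIV. exponential_law (\<theta> $ i)) (\<lambda>x i. \<theta> $ i * x i)"
proof -
  have pr: "prob_space (exponential_law (\<theta> $ i))" for i
    using \<theta> by (intro prob_space_exponential_law) (simp add: orthant_def)
  interpret T: product_prob_space "\<lambda>i. exponential_law (\<theta> $ i)" UNIV
    by (intro product_prob_spaceI pr)
  interpret S: product_prob_space "\<lambda>i :: 'v. exponential_law 1" UNIV
    by (intro product_prob_spaceI prob_space_exponential_law) simp
  have m: "(\<lambda>x i. \<theta> $ i * x i) \<in> standard_exponential \<rightarrow>\<^sub>M (\<Pi>\<^sub>M i\<in>UNIV. exponential_law (\<theta> $ i))"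
    unfolding standard_exponential_def
    by (rule measurable_PiM_single') (auto simp: space_PiM)
  show ?thesis
  proof (rule T.PiM_eqI[symmetric])
    fix A assume A: "\<And>i :: 'v. i \<in> UNIV \<Longrightarrow> A i \<in> sets (exponential_law (\<theta> $ i))"
    have Am: "(\<lambda>x. \<theta> $ i * x) -` A i \<in> sets (exponential_law 1)" for i
      using measurable_sets_borel[of "\<lambda>x. \<theta> $ i * x" borel "A i"] A[of i] by simp
    have "emeasure (distr standard_exponential (\<Pi>\<^sub>M i\<in>UNIV. exponential_law (\<theta> $ i)) (\<lambda>x i. \<theta> $ i * x i)) (Pi\<^sub>E UNIV A)
       = emeasure standard_exponential ((\<lambda>x i. \<theta> $ i * x i) -` (Pi\<^sub>E UNIV A) \<inter> space standard_exponential)"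
      by (rule emeasure_distr[OF m]) (use A in \<open>auto intro!: sets_PiM_I_finite\<close>)
    also have "(\<lambda>x i. \<theta> $ i * x i) -` (Pi\<^sub>E UNIV A) \<inter> space standard_exponential = Pi\<^sub>E UNIV (\<lambda>i. (\<lambda>x. \<theta> $ i * x) -` A i)"
      by (auto simp: standard_exponential_def space_PiM PiE_def)
    also have "emeasure standard_exponential \<dots> = (\<Prod>i\<in>UNIV. emeasure (exponential_law 1) ((\<lambda>x. \<theta> $ i * x) -` A i))"
      unfolding standard_exponential_def by (rule S.emeasure_PiM) (use Am in auto)
    also have "\<dots> = (\<Prod>i\<in>UNIV. emeasure (exponential_law (\<theta> $ i)) (A i))"
    proof (rule prod.cong)
      fix i
      have "emeasure (exponential_law (\<theta> $ i)) (A i) = emeasure (distr (exponential_law 1) borel (\<lambda>x. \<theta> $ i * x)) (A i)"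
        using \<theta> exponential_law_scale[of "\<theta> $ i"] by (simp add: orthant_def)
      also have "\<dots> = emeasure (exponential_law 1) ((\<lambda>x. \<theta> $ i * x) -` A i)"
        using A[of i] by (subst emeasure_distr) auto
      finally show "emeasure (exponential_law 1) ((\<lambda>x. \<theta> $ i * x) -` A i) = emeasure (exponential_law (\<theta> $ i)) (A i)" ..
    qed simp
    finally show "emeasure (distr standard_exponential (\<Pi>\<^sub>M i\<in>UNIV. exponential_law (\<theta> $ i)) (\<lambda>x i. \<theta> $ i * x i)) (Pi\<^sub>E UNIV A)
       = (\<Prod>i\<in>UNIV. emeasure (exponential_law (\<theta> $ i)) (A i))" .
  qed auto
qed

text \<open>All exponential products become images of one law under a map that is jointly measurable
  in parameter and point. This yields a measurable kernel on the whole orthant, including parameters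
  with vanishing coordinates.\<close>

lemma exponential_product_distr:
  fixes \<theta> :: "real^'v::finite"
  assumes \<theta>: "\<theta> \<in> orthant"
  shows "exponential_product \<theta> = distr standard_exponential orthant_borel (stretch \<theta>)"
proof (rule measure_eqI)
  let ?P = "\<Pi>\<^sub>M i\<in>UNIV. exponential_law (\<theta> $ i)"
  let ?v = "\<lambda>x :: 'v \<Rightarrow> real. (\<chi> i. x i) :: real^'v"
  interpret S: product_prob_space "\<lambda>i :: 'v. exponential_law 1" UNIV
    by (intro product_prob_spaceI prob_space_exponential_law) simp
  have c: "(\<lambda>x. x i) \<in> borel_measurable (\<Pi>\<^sub>M i\<in>UNIV. exponential_law (\<theta>' $ i))" for i :: 'v and \<theta>' :: "real^'v"
    using measurable_component_singleton[of i UNIV "\<lambda>i. exponential_law (\<theta>' $ i)"]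
    by (simp add: measurable_cong_sets[OF refl sets_exponential_law])
  have v: "?v \<in> borel_measurable ?P" by (rule borel_measurable_vec_lambda) (rule c)
  have s: "stretch \<theta> \<in> standard_exponential \<rightarrow>\<^sub>M orthant_borel" by (rule measurable_stretch'[OF \<theta>])
  show "sets (exponential_product \<theta>) = sets (distr standard_exponential orthant_borel (stretch \<theta>))"
    by (simp add: exponential_product_def sets_restrict_space)
  fix A assume "A \<in> sets (exponential_product \<theta>)"
  then have "A \<in> sets (orthant_borel :: (real^'v) measure)" by (simp add: exponential_product_def sets_restrict_space)
  then have A: "A \<subseteq> orthant" "A \<in> sets borel" by (auto simp: sets_restrict_space_iff)
  have m: "(\<lambda>x i. \<theta> $ i * x i) \<in> standard_exponential \<rightarrow>\<^sub>M ?P"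
    unfolding standard_exponential_def by (rule measurable_PiM_single') (auto simp: space_PiM)
  have "emeasure (exponential_product \<theta>) A = emeasure (distr ?P borel ?v) A"
    unfolding exponential_product_def using A by (intro emeasure_restrict_space) auto
  also have "\<dots> = emeasure (distr (distr standard_exponential ?P (\<lambda>x i. \<theta> $ i * x i)) borel ?v) A"
    by (subst PiM_exponential_law[OF \<theta>]) simp
  also have "\<dots> = emeasure (distr standard_exponential borel (?v \<circ> (\<lambda>x i. \<theta> $ i * x i))) A"
    by (subst distr_distr[OF v m]) simp
  also have "\<dots> = emeasure standard_exponential ((?v \<circ> (\<lambda>x i. \<theta> $ i * x i)) -` A \<inter> space standard_exponential)"
    by (rule emeasure_distr[OF measurable_comp[OF m v] A(2)])
  \<comment> \<open>The positive part is invisible here, since the coordinates are almost surely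
    nonnegative.\<close>
  also have "\<dots> = emeasure standard_exponential (stretch \<theta> -` A \<inter> space standard_exponential)"
  proof (rule emeasure_eq_AE)
    have "AE x in standard_exponential. \<forall>i\<in>UNIV. 0 \<le> x i"
      unfolding standard_exponential_def
      by (rule AE_finite_allI) (auto intro!: AE_PiM_component AE_exponential_law prob_space_exponential_law)
    then show "AE x in standard_exponential. (x \<in> (?v \<circ> (\<lambda>x i. \<theta> $ i * x i)) -` A \<inter> space standard_exponential) =
        (x \<in> stretch \<theta> -` A \<inter> space standard_exponential)"
      by eventually_elim (simp add: stretch_def max_def)
  qed (use measurable_sets[OF measurable_comp[OF m v] A(2)] measurable_sets[OF s] A in \<open>auto simp: sets_restrict_space_iff\<close>)
  also have "\<dots> = emeasure (distr standard_exponential orthant_borel (stretch \<theta>)) A"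
    using A by (intro emeasure_distr[symmetric] s) (auto simp: sets_restrict_space_iff)
  finally show "emeasure (exponential_product \<theta>) A = emeasure (distr standard_exponential orthant_borel (stretch \<theta>)) A" .
qed

lemma exponential_product_kernel: "exponential_product \<in> orthant_borel \<rightarrow>\<^sub>M prob_algebra orthant_borel"
proof (rule measurable_prob_algebraI)
  interpret prob_space standard_exponential by (rule prob_space_standard_exponential)
  show "prob_space (exponential_product \<theta>)" if "\<theta> \<in> space orthant_borel" for \<theta> :: "real^'a"
    using that unfolding space_orthant_borel
    by (simp add: exponential_product_distr prob_space_distr measurable_stretch')
  have "(\<lambda>\<theta> :: real^'a. distr standard_exponential orthant_borel (stretch \<theta>)) \<in> orthant_borel \<rightarrow>\<^sub>M subprob_algebra orthant_borel"
    by (rule measurable_distr2[OF measurable_stretch[folded case_prod_beta']])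
       (auto intro!: measurable_const simp: space_subprob_algebra subprob_space_axioms)
  then show "(exponential_product :: real^'a \<Rightarrow> _) \<in> orthant_borel \<rightarrow>\<^sub>M subprob_algebra orthant_borel"
    by (rule measurable_cong[THEN iffD1, rotated]) (simp add: space_orthant_borel exponential_product_distr)
qed

text \<open>The standard exponential density times the Poisson weight at ax is a multiple of x^n
  e^(-(1+a)x), an Erlang density of rate 1 + a; the multiple is the geometric weight at a.\<close>

lemma integral_exponential_poisson_weight:
  assumes a: "0 \<le> a"
  shows "integrable (exponential_law 1) (\<lambda>x. poisson_weight n (a * max 0 x))"
    and "(\<integral>x. poisson_weight n (a * max 0 x) \<partial>exponential_law 1) = geometric_weight n a"
proof -
  have e: "exponential_density 1 x * poisson_weight n (a * max 0 x) = geometric_weight n a * erlang_density n (1 + a) x" for x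
  proof (cases "x < 0")
    case False
    have g: "geometric_weight n a * (1 + a) ^ Suc n = a ^ n"
      using a by (simp add: geometric_weight_def power_divide)
    have "geometric_weight n a * erlang_density n (1 + a) x
       = (geometric_weight n a * (1 + a) ^ Suc n) * x ^ n * exp (- (1 + a) * x) / fact n"
      using False by (simp add: erlang_density_def)
    also have "exp (- (1 + a) * x) = exp (- x) * exp (- (a * x))"
      by (simp add: mult_exp_exp algebra_simps)
    finally show ?thesis
      unfolding g using False by (simp add: exponential_density_def poisson_weight_def power_mult_distrib)
  qed (simp add: exponential_density_def erlang_density_def)
  have E: "(\<integral>\<^sup>+x. ennreal (erlang_density n (1 + a) x) \<partial>lborel) = 1"
    using prob_space.emeasure_space_1[OF prob_space_erlang_density[of "1 + a" n]] a
    by (simp add: emeasure_density)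
  have h: "has_bochner_integral lborel (erlang_density n (1 + a)) 1"
    by (rule has_bochner_integral_nn_integral) (use a E in auto)
  have d: "exponential_law 1 = density lborel (\<lambda>x. ennreal (exponential_density 1 x))"
    by (simp add: exponential_law_def)
  show "integrable (exponential_law 1) (\<lambda>x. poisson_weight n (a * max 0 x))"
    unfolding d by (subst integrable_density) (use h in \<open>auto simp: e has_bochner_integral_iff\<close>)
  show "(\<integral>x. poisson_weight n (a * max 0 x) \<partial>exponential_law 1) = geometric_weight n a"
    unfolding d by (subst integral_density) (use h in \<open>auto simp: e has_bochner_integral_iff\<close>)
qed

lemma integral_exponential_product_tensor:
  fixes \<theta> :: "real^'v::finite"
  assumes \<theta>: "\<theta> \<in> orthant" and c: "0 \<le> c"
  shows "(\<integral>\<zeta>. tensor poisson_weight \<xi> (c *\<^sub>R \<zeta>) \<partial>exponential_product \<theta>) = tensor geometric_weight \<xi> (c *\<^sub>R \<theta>)"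
proof -
  interpret S: product_prob_space "\<lambda>i :: 'v. exponential_law 1" UNIV
    by (intro product_prob_spaceI prob_space_exponential_law) simp
  have "(\<integral>\<zeta>. tensor poisson_weight \<xi> (c *\<^sub>R \<zeta>) \<partial>exponential_product \<theta>)
     = (\<integral>x. tensor poisson_weight \<xi> (c *\<^sub>R stretch \<theta> x) \<partial>standard_exponential)"
    unfolding exponential_product_distr[OF \<theta>]
    by (intro integral_distr measurable_stretch'[OF \<theta>] measurable_restrict_space1 borel_measurable_tensor) measurable
  also have "\<dots> = (\<integral>x. (\<Prod>i\<in>UNIV. poisson_weight (\<xi> i) (c * \<theta> $ i * max 0 (x i))) \<partial>standard_exponential)"
    by (simp add: tensor_def stretch_def mult.assoc)
  also have "\<dots> = (\<Prod>i\<in>UNIV. \<integral>x. poisson_weight (\<xi> i) (c * \<theta> $ i * max 0 x) \<partial>exponential_law 1)"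
    unfolding standard_exponential_def
    by (rule S.product_integral_prod) (use \<theta> c in \<open>auto intro!: integral_exponential_poisson_weight simp: orthant_def\<close>)
  also have "\<dots> = tensor geometric_weight \<xi> (c *\<^sub>R \<theta>)"
    unfolding tensor_def
    by (intro prod.cong refl) (use \<theta> c in \<open>auto simp: integral_exponential_poisson_weight orthant_def\<close>)
  finally show ?thesis .
qed

section \<open>Poisson weights determine a measure\<close>

text \<open>The generating function of the Poisson weights is a Laplace transform, since e^(sx)
  e^(-x) = e^(-(1-s)x). Partial sums within [0,1] permit dominated convergence.\<close>

lemma poisson_weight_partial_sums:
  assumes x: "0 \<le> x" and s: "0 \<le> s" "s \<le> 1"
  shows "(\<lambda>N. \<Sum>n<N. s ^ n * poisson_weight n x) \<longlonglongrightarrow> exp (- ((1 - s) * x))"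
    and "0 \<le> (\<Sum>n<N. s ^ n * poisson_weight n x)" and "(\<Sum>n<N. s ^ n * poisson_weight n x) \<le> 1"
proof -
  have e: "(\<Sum>n<N. s ^ n * poisson_weight n x) = (\<Sum>n<N. inverse (fact n) *\<^sub>R (s * x) ^ n) * exp (- x)" for N
    unfolding sum_distrib_right
    by (intro sum.cong refl) (simp add: poisson_weight_def power_mult_distrib divide_inverse)
  have lim: "(\<lambda>N. \<Sum>n<N. inverse (fact n) *\<^sub>R (s * x) ^ n) \<longlonglongrightarrow> exp (s * x)"
    using exp_converges[of "s * x"] by (simp add: sums_def)
  have ex: "exp (s * x) * exp (- x) = exp (- ((1 - s) * x))"
    by (simp add: mult_exp_exp algebra_simps)
  show "(\<lambda>N. \<Sum>n<N. s ^ n * poisson_weight n x) \<longlonglongrightarrow> exp (- ((1 - s) * x))"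
    unfolding e ex[symmetric] by (intro tendsto_mult lim tendsto_const)
  show "0 \<le> (\<Sum>n<N. s ^ n * poisson_weight n x)"
    using x s by (intro sum_nonneg mult_nonneg_nonneg poisson_weight_bounds) auto
  have "(\<Sum>n<N. inverse (fact n) *\<^sub>R (s * x) ^ n) \<le> exp (s * x)"
    unfolding exp_def by (rule sum_le_suminf) (use summable_exp_generic[of "s * x"] x s in auto)
  then have "(\<Sum>n<N. inverse (fact n) *\<^sub>R (s * x) ^ n) * exp (- x) \<le> exp (s * x) * exp (- x)"
    by (intro mult_right_mono) auto
  also have "\<dots> \<le> 1" unfolding ex using x s by simp
  finally show "(\<Sum>n<N. s ^ n * poisson_weight n x) \<le> 1" unfolding e .
qed

text \<open>Maps the orthant injectively into the unit cube. Integer Laplace frequencies become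
  monomials, and polynomial approximation is available on a compact set.\<close>

definition exp_neg :: "real^'v::finite \<Rightarrow> real^'v" where
  "exp_neg \<zeta> = (\<chi> i. exp (- \<zeta> $ i))"

lemma measurable_exp_neg: "exp_neg \<in> borel_measurable orthant_borel"
  unfolding exp_neg_def[abs_def]
  by (rule borel_measurable_vec_lambda) (rule measurable_restrict_space1, measurable)

locale poisson_mixtures =
  fixes \<rho>\<^sub>1 \<rho>\<^sub>2 :: "(real^'v::finite) measure"
  assumes prob: "prob_space \<rho>\<^sub>1" "prob_space \<rho>\<^sub>2"
    and sets: "sets \<rho>\<^sub>1 = sets orthant_borel" "sets \<rho>\<^sub>2 = sets orthant_borel"
    and eq: "\<And>c \<xi>. 0 < c \<Longrightarrow> (\<integral>\<zeta>. tensor poisson_weight \<xi> (c *\<^sub>R \<zeta>) \<partial>\<rho>\<^sub>1) = (\<integral>\<zeta>. tensor poisson_weight \<xi> (c *\<^sub>R \<zeta>) \<partial>\<rho>\<^sub>2)"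
begin

lemma space: "space \<rho>\<^sub>1 = orthant" "space \<rho>\<^sub>2 = orthant"
  using sets[THEN sets_eq_imp_space_eq] by (simp_all add: space_orthant_borel)

lemma measurable_\<rho>:
  "f \<in> borel_measurable orthant_borel \<Longrightarrow> f \<in> borel_measurable \<rho>\<^sub>1"
  "f \<in> borel_measurable orthant_borel \<Longrightarrow> f \<in> borel_measurable \<rho>\<^sub>2"
  by (simp_all add: measurable_cong_sets[OF sets(1) refl] measurable_cong_sets[OF sets(2) refl])

lemma integrable_bounded:
  fixes f :: "real^'v \<Rightarrow> real"
  assumes "f \<in> borel_measurable orthant_borel" "\<And>x. x \<in> orthant \<Longrightarrow> \<bar>f x\<bar> \<le> B"
  shows "integrable \<rho>\<^sub>1 f" "integrable \<rho>\<^sub>2 f"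
proof -
  interpret P1: prob_space \<rho>\<^sub>1 by (rule prob)
  interpret P2: prob_space \<rho>\<^sub>2 by (rule prob)
  show "integrable \<rho>\<^sub>1 f"
    by (rule P1.integrable_const_bound[of _ B]) (use assms space in \<open>auto intro: measurable_\<rho>\<close>)
  show "integrable \<rho>\<^sub>2 f"
    by (rule P2.integrable_const_bound[of _ B]) (use assms space in \<open>auto intro: measurable_\<rho>\<close>)
qed

text \<open>At scale c and s = 1 - k/c the generating function of the Poisson weights tends to
  e^(-k\<zeta>). Having s in [0,1] requires k \<le> c, which is why the scale is adapted to the
  monomial.\<close>

lemma monomial_eq:
  "(\<integral>\<zeta>. (\<Prod>i\<in>UNIV. exp_neg \<zeta> $ i ^ k i) \<partial>\<rho>\<^sub>1) = (\<integral>\<zeta>. (\<Prod>i\<in>UNIV. exp_neg \<zeta> $ i ^ k i) \<partial>\<rho>\<^sub>2)"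
proof -
  interpret P1: prob_space \<rho>\<^sub>1 by (rule prob)
  interpret P2: prob_space \<rho>\<^sub>2 by (rule prob)
  \<comment> \<open>Dominates every \<open>k i\<close> and is positive even if all of them
    vanish.\<close>
  define c where "c = 1 + (\<Sum>i\<in>UNIV. real (k i))"
  have c: "0 < c" unfolding c_def by (simp add: add_pos_nonneg sum_nonneg)
  have kc: "real (k i) \<le> c" for i
    using member_le_sum[of i UNIV "\<lambda>i. real (k i)"] by (simp add: c_def)
  define s where "s i = 1 - real (k i) / c" for i
  have s: "0 \<le> s i" "s i \<le> 1" for i using c kc[of i] by (auto simp: s_def)
  define F where "F N \<zeta> = (\<Prod>i\<in>UNIV. \<Sum>n<N. s i ^ n * poisson_weight n (c * \<zeta> $ i))" for N and \<zeta> :: "real^'v"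
  \<comment> \<open>Expanding the product of partial sums leaves finitely many tensors of Poisson
    weights, whose integrals agree under both measures.\<close>
  have F: "F N \<zeta> = (\<Sum>\<xi>\<in>(UNIV \<rightarrow>\<^sub>E {..<N}). (\<Prod>i\<in>UNIV. s i ^ \<xi> i) * tensor poisson_weight \<xi> (c *\<^sub>R \<zeta>))" for N \<zeta>
    unfolding F_def by (subst prod_sum_PiE) (auto simp: tensor_def prod.distrib)
  have tm: "(\<lambda>\<zeta>. tensor poisson_weight \<xi> (c *\<^sub>R \<zeta>)) \<in> borel_measurable orthant_borel" for \<xi> :: "'v \<Rightarrow> nat"
    by (intro measurable_restrict_space1 borel_measurable_tensor) measurable
  have ti: "integrable \<rho>\<^sub>1 (\<lambda>\<zeta>. tensor poisson_weight \<xi> (c *\<^sub>R \<zeta>))" "integrable \<rho>\<^sub>2 (\<lambda>\<zeta>. tensor poisson_weight \<xi> (c *\<^sub>R \<zeta>))" for \<xi>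
    using c poisson_weight_bounds
    by (auto intro!: integrable_bounded[OF tm, of _ 1] tensor_bounds simp: orthant_def)
  have Fm: "F N \<in> borel_measurable orthant_borel" for N
    unfolding F[abs_def] by (intro borel_measurable_sum borel_measurable_times borel_measurable_const tm)
  have FE: "(\<integral>\<zeta>. F N \<zeta> \<partial>\<rho>\<^sub>1) = (\<integral>\<zeta>. F N \<zeta> \<partial>\<rho>\<^sub>2)" for N
    unfolding F by (simp add: ti eq[OF c])
  have F1: "\<bar>F N \<zeta>\<bar> \<le> 1" if "\<zeta> \<in> orthant" for N \<zeta>
  proof -
    have x: "0 \<le> c * \<zeta> $ i" for i using that c by (simp add: orthant_def)
    show ?thesis unfolding F_def abs_prod
      by (rule prod_le_1) (use poisson_weight_partial_sums(2,3)[OF x s] in auto)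
  qed
  have Flim: "(\<lambda>N. F N \<zeta>) \<longlonglongrightarrow> (\<Prod>i\<in>UNIV. exp_neg \<zeta> $ i ^ k i)" if "\<zeta> \<in> orthant" for \<zeta>
  proof -
    have x: "0 \<le> c * \<zeta> $ i" for i using that c by (simp add: orthant_def)
    have "exp (- ((1 - s i) * (c * \<zeta> $ i))) = exp_neg \<zeta> $ i ^ k i" for i
      using c by (simp add: s_def exp_neg_def exp_of_nat_mult[symmetric])
    then have "(\<lambda>N. \<Sum>n<N. s i ^ n * poisson_weight n (c * \<zeta> $ i)) \<longlonglongrightarrow> exp_neg \<zeta> $ i ^ k i" for i
      using poisson_weight_partial_sums(1)[OF x s, of i i] by simp
    then show ?thesis unfolding F_def by (intro tendsto_prod)
  qed
  have mm: "(\<lambda>\<zeta>. \<Prod>i\<in>UNIV. exp_neg \<zeta> $ i ^ k i) \<in> borel_measurable orthant_borel"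
    by (rule borel_measurable_LIMSEQ_real[where u=F]) (use Flim Fm in \<open>auto simp: space_orthant_borel\<close>)
  have "(\<lambda>N. \<integral>\<zeta>. F N \<zeta> \<partial>\<rho>\<^sub>1) \<longlonglongrightarrow> (\<integral>\<zeta>. (\<Prod>i\<in>UNIV. exp_neg \<zeta> $ i ^ k i) \<partial>\<rho>\<^sub>1)"
    by (rule integral_dominated_convergence[where w="\<lambda>_. 1"])
       (use Flim F1 space in \<open>auto intro!: measurable_\<rho> Fm mm\<close>)
  moreover have "(\<lambda>N. \<integral>\<zeta>. F N \<zeta> \<partial>\<rho>\<^sub>2) \<longlonglongrightarrow> (\<integral>\<zeta>. (\<Prod>i\<in>UNIV. exp_neg \<zeta> $ i ^ k i) \<partial>\<rho>\<^sub>2)"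
    by (rule integral_dominated_convergence[where w="\<lambda>_. 1"])
       (use Flim F1 space in \<open>auto intro!: measurable_\<rho> Fm mm\<close>)
  ultimately show ?thesis unfolding FE by (rule LIMSEQ_unique)
qed

text \<open>Agreement is demanded against every monomial and not just for g, so that the property is
  inherited under multiplication by a coordinate; boundedness keeps all products integrable.\<close>

definition indistinguishable :: "(real^'v \<Rightarrow> real) \<Rightarrow> bool" where
  "indistinguishable g \<longleftrightarrow> g \<in> borel_measurable orthant_borel \<and> (\<exists>B. \<forall>x\<in>orthant. \<bar>g x\<bar> \<le> B) \<and>
     (\<forall>k. (\<integral>\<zeta>. g \<zeta> * (\<Prod>i\<in>UNIV. exp_neg \<zeta> $ i ^ k i) \<partial>\<rho>\<^sub>1) = (\<integral>\<zeta>. g \<zeta> * (\<Prod>i\<in>UNIV. exp_neg \<zeta> $ i ^ k i) \<partial>\<rho>\<^sub>2))"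

lemma exp_neg_bounds: "x \<in> orthant \<Longrightarrow> 0 \<le> exp_neg x $ i" "x \<in> orthant \<Longrightarrow> exp_neg x $ i \<le> 1"
  by (auto simp: exp_neg_def orthant_def)

lemma monomial_measurable: "(\<lambda>\<zeta>. \<Prod>i\<in>UNIV. exp_neg \<zeta> $ i ^ k i) \<in> borel_measurable orthant_borel"
  by (intro borel_measurable_prod borel_measurable_power measurable_compose[OF measurable_exp_neg borel_measurable_nth])

lemma monomial_bound:
  fixes x :: "real^'v"
  assumes "x \<in> orthant" shows "\<bar>\<Prod>i\<in>UNIV. exp_neg x $ i ^ k i\<bar> \<le> 1"
  unfolding abs_prod
  by (rule prod_le_1) (use exp_neg_bounds[OF assms] in \<open>auto simp: power_le_one\<close>)

lemma indistinguishable_integrable: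
  assumes "indistinguishable g"
  shows "integrable \<rho>\<^sub>1 (\<lambda>\<zeta>. g \<zeta> * (\<Prod>i\<in>UNIV. exp_neg \<zeta> $ i ^ k i))" "integrable \<rho>\<^sub>2 (\<lambda>\<zeta>. g \<zeta> * (\<Prod>i\<in>UNIV. exp_neg \<zeta> $ i ^ k i))"
proof -
  from assms obtain B where g: "g \<in> borel_measurable orthant_borel" and B: "\<And>x. x \<in> orthant \<Longrightarrow> \<bar>g x\<bar> \<le> B"
    unfolding indistinguishable_def by blast
  have m: "(\<lambda>\<zeta>. g \<zeta> * (\<Prod>i\<in>UNIV. exp_neg \<zeta> $ i ^ k i)) \<in> borel_measurable orthant_borel"
    by (intro borel_measurable_times g monomial_measurable)
  have b: "\<bar>g x * (\<Prod>i\<in>UNIV. exp_neg x $ i ^ k i)\<bar> \<le> B * 1" if "x \<in> orthant" for x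
    unfolding abs_mult using B[OF that] by (intro mult_mono monomial_bound that) auto
  show "integrable \<rho>\<^sub>1 (\<lambda>\<zeta>. g \<zeta> * (\<Prod>i\<in>UNIV. exp_neg \<zeta> $ i ^ k i))" "integrable \<rho>\<^sub>2 (\<lambda>\<zeta>. g \<zeta> * (\<Prod>i\<in>UNIV. exp_neg \<zeta> $ i ^ k i))"
    using integrable_bounded[OF m b] by auto
qed

lemma indistinguishable_add:
  assumes "indistinguishable f" "indistinguishable g"
  shows "indistinguishable (\<lambda>x. f x + g x)"
  unfolding indistinguishable_def
proof (intro conjI allI)
  show "(\<lambda>x. f x + g x) \<in> borel_measurable orthant_borel"
    using assms unfolding indistinguishable_def by (intro borel_measurable_add) auto
  from assms obtain A B where "\<forall>x\<in>orthant. \<bar>f x\<bar> \<le> A" "\<forall>x\<in>orthant. \<bar>g x\<bar> \<le> B"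
    unfolding indistinguishable_def by blast
  then show "\<exists>B. \<forall>x\<in>orthant. \<bar>f x + g x\<bar> \<le> B"
    by (intro exI[of _ "A + B"]) (auto intro: order_trans[OF abs_triangle_ineq] add_mono)
  fix k
  show "(\<integral>\<zeta>. (f \<zeta> + g \<zeta>) * (\<Prod>i\<in>UNIV. exp_neg \<zeta> $ i ^ k i) \<partial>\<rho>\<^sub>1) = (\<integral>\<zeta>. (f \<zeta> + g \<zeta>) * (\<Prod>i\<in>UNIV. exp_neg \<zeta> $ i ^ k i) \<partial>\<rho>\<^sub>2)"
    unfolding distrib_right using assms
    by (simp add: indistinguishable_integrable) (simp add: indistinguishable_def)
qed

lemma indistinguishable_cmult:
  assumes "indistinguishable g"
  shows "indistinguishable (\<lambda>x. c * g x)"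
  unfolding indistinguishable_def
proof (intro conjI allI)
  show "(\<lambda>x. c * g x) \<in> borel_measurable orthant_borel"
    using assms unfolding indistinguishable_def by (intro borel_measurable_times) auto
  from assms obtain B where "\<forall>x\<in>orthant. \<bar>g x\<bar> \<le> B"
    unfolding indistinguishable_def by blast
  then show "\<exists>B. \<forall>x\<in>orthant. \<bar>c * g x\<bar> \<le> B"
    by (intro exI[of _ "\<bar>c\<bar> * B"]) (auto simp: abs_mult intro: mult_left_mono)
  fix k
  show "(\<integral>\<zeta>. (c * g \<zeta>) * (\<Prod>i\<in>UNIV. exp_neg \<zeta> $ i ^ k i) \<partial>\<rho>\<^sub>1) = (\<integral>\<zeta>. (c * g \<zeta>) * (\<Prod>i\<in>UNIV. exp_neg \<zeta> $ i ^ k i) \<partial>\<rho>\<^sub>2)"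
    using assms by (simp add: mult.assoc indistinguishable_def)
qed

lemma indistinguishable_coordinate:
  assumes "indistinguishable g"
  shows "indistinguishable (\<lambda>x. exp_neg x $ l * g x)"
  unfolding indistinguishable_def
proof (intro conjI allI)
  show "(\<lambda>x. exp_neg x $ l * g x) \<in> borel_measurable orthant_borel"
    using assms measurable_compose[OF measurable_exp_neg borel_measurable_nth[of l]] unfolding indistinguishable_def by (intro borel_measurable_times) auto
  from assms obtain B where B: "\<forall>x\<in>orthant. \<bar>g x\<bar> \<le> B"
    unfolding indistinguishable_def by blast
  have "\<bar>exp_neg x $ l * g x\<bar> \<le> 1 * B" if "x \<in> orthant" for x
    unfolding abs_mult using that B exp_neg_bounds[OF that, of l] by (intro mult_mono) auto
  then show "\<exists>B. \<forall>x\<in>orthant. \<bar>exp_neg x $ l * g x\<bar> \<le> B" by auto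
  fix k :: "'v \<Rightarrow> nat"
  have "(\<Prod>i\<in>UNIV. exp_neg \<zeta> $ i ^ (k(l := Suc (k l))) i) = exp_neg \<zeta> $ l * (\<Prod>i\<in>UNIV. exp_neg \<zeta> $ i ^ k i)" for \<zeta> :: "real^'v"
    by (simp add: prod.remove[of UNIV l])
  then have e: "(exp_neg \<zeta> $ l * g \<zeta>) * (\<Prod>i\<in>UNIV. exp_neg \<zeta> $ i ^ k i) = g \<zeta> * (\<Prod>i\<in>UNIV. exp_neg \<zeta> $ i ^ (k(l := Suc (k l))) i)" for \<zeta> :: "real^'v"
    by (simp only: mult_ac)
  show "(\<integral>\<zeta>. (exp_neg \<zeta> $ l * g \<zeta>) * (\<Prod>i\<in>UNIV. exp_neg \<zeta> $ i ^ k i) \<partial>\<rho>\<^sub>1) = (\<integral>\<zeta>. (exp_neg \<zeta> $ l * g \<zeta>) * (\<Prod>i\<in>UNIV. exp_neg \<zeta> $ i ^ k i) \<partial>\<rho>\<^sub>2)"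
    unfolding e using assms unfolding indistinguishable_def by blast
qed

lemma indistinguishable_sum:
  assumes "finite A" "\<And>i. i \<in> A \<Longrightarrow> indistinguishable (f i)"
  shows "indistinguishable (\<lambda>x. \<Sum>i\<in>A. f i x)"
  using assms
proof (induction A rule: finite_induct)
  case empty
  show ?case by (auto simp: indistinguishable_def)
next
  case (insert a A)
  then show ?case using indistinguishable_add by simp
qed

text \<open>Induction over polynomials with g general: in the product case one induction hypothesis
  is applied to the result of the other, which mere equality of integrals would not allow.\<close>

lemma indistinguishable_polynomial:
  assumes "real_polynomial_function P"
  shows "indistinguishable g \<Longrightarrow> indistinguishable (\<lambda>x. P (exp_neg x) * g x)"
  using assms
proof (induction P arbitrary: g rule: real_polynomial_function.induct)
  case (linear f)
  have f: "f x = (\<Sum>l\<in>UNIV. f (axis l 1) * x $ l)" for x :: "real^'v"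
  proof -
    interpret bounded_linear f by fact
    have "f x = f (\<Sum>l\<in>UNIV. x $ l *\<^sub>R axis l 1)"
      by (metis basis_expansion scalar_mult_eq_scaleR)
    then show ?thesis by (simp add: sum scaleR mult.commute)
  qed
  have "indistinguishable (\<lambda>x. \<Sum>l\<in>UNIV. f (axis l 1) * (exp_neg x $ l * g x))"
    by (intro indistinguishable_sum indistinguishable_cmult indistinguishable_coordinate linear) simp
  then show ?case by (subst f) (simp add: sum_distrib_right mult.assoc)
next
  case (const c)
  then show ?case by (rule indistinguishable_cmult)
next
  case (add f1 f2)
  then show ?case using indistinguishable_add[of "\<lambda>x. f1 (exp_neg x) * g x" "\<lambda>x. f2 (exp_neg x) * g x"]
    by (simp add: distrib_right)
next
  case (mult f1 f2)
  then show ?case by (simp add: mult.assoc)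
qed

text \<open>Stone-Weierstrass on the unit cube: a polynomial within a quarter of the supposed
  discrepancy leaves room for at most half of it.\<close>

lemma integral_continuous_eq:
  fixes F :: "real^'v \<Rightarrow> real"
  assumes F: "continuous_on UNIV F"
  shows "(\<integral>\<zeta>. F (exp_neg \<zeta>) \<partial>\<rho>\<^sub>1) = (\<integral>\<zeta>. F (exp_neg \<zeta>) \<partial>\<rho>\<^sub>2)"
proof (rule ccontr)
  interpret P1: prob_space \<rho>\<^sub>1 by (rule prob)
  interpret P2: prob_space \<rho>\<^sub>2 by (rule prob)
  let ?S = "cbox 0 (\<chi> i. 1) :: (real^'v) set"
  have S: "exp_neg x \<in> ?S" if "x \<in> orthant" for x
    using exp_neg_bounds[OF that] by (simp add: mem_box_cart)
  have m: "(\<lambda>\<zeta>. G (exp_neg \<zeta>)) \<in> borel_measurable orthant_borel" if "continuous_on UNIV G" for G :: "real^'v \<Rightarrow> real"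
    by (rule measurable_compose[OF measurable_exp_neg borel_measurable_continuous_onI[OF that]])
  have bdd: "\<exists>B. \<forall>x\<in>orthant. \<bar>G (exp_neg x)\<bar> \<le> B" if "continuous_on UNIV G" for G :: "real^'v \<Rightarrow> real"
  proof -
    have "compact (G ` ?S)" by (intro compact_continuous_image continuous_on_subset[OF that]) auto
    then obtain B where "\<forall>y\<in>G ` ?S. norm y \<le> B" using compact_imp_bounded bounded_iff by metis
    then show ?thesis using S by auto
  qed
  have int: "integrable \<rho>\<^sub>1 (\<lambda>\<zeta>. G (exp_neg \<zeta>))" "integrable \<rho>\<^sub>2 (\<lambda>\<zeta>. G (exp_neg \<zeta>))" if G: "continuous_on UNIV G" for G :: "real^'v \<Rightarrow> real"
    using bdd[OF G] integrable_bounded[OF m[OF G]] by auto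
  let ?d = "\<bar>(\<integral>\<zeta>. F (exp_neg \<zeta>) \<partial>\<rho>\<^sub>1) - (\<integral>\<zeta>. F (exp_neg \<zeta>) \<partial>\<rho>\<^sub>2)\<bar>"
  assume "(\<integral>\<zeta>. F (exp_neg \<zeta>) \<partial>\<rho>\<^sub>1) \<noteq> (\<integral>\<zeta>. F (exp_neg \<zeta>) \<partial>\<rho>\<^sub>2)"
  then have "0 < ?d / 4" by simp
  then obtain P where P: "real_polynomial_function P" and close: "\<And>x. x \<in> ?S \<Longrightarrow> \<bar>F x - P x\<bar> < ?d / 4"
    using Stone_Weierstrass_real_polynomial_function[of ?S F "?d / 4"] continuous_on_subset[OF F] by (metis compact_cbox subset_UNIV)
  have cP: "continuous_on UNIV P"
    using P by (intro continuous_at_imp_continuous_on ballI continuous_real_polymonial_function)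
  have "indistinguishable (\<lambda>x. 1)"
    using monomial_eq by (auto simp: indistinguishable_def intro: exI[of _ 1])
  from indistinguishable_polynomial[OF P this]
  have PE: "(\<integral>\<zeta>. P (exp_neg \<zeta>) \<partial>\<rho>\<^sub>1) = (\<integral>\<zeta>. P (exp_neg \<zeta>) \<partial>\<rho>\<^sub>2)"
    unfolding indistinguishable_def by (auto dest: spec[of _ "\<lambda>_. 0"])
  have 1: "\<bar>(\<integral>\<zeta>. F (exp_neg \<zeta>) \<partial>\<rho>\<^sub>1) - (\<integral>\<zeta>. P (exp_neg \<zeta>) \<partial>\<rho>\<^sub>1)\<bar> \<le> ?d / 4"
  proof -
    have "norm (\<integral>\<zeta>. F (exp_neg \<zeta>) - P (exp_neg \<zeta>) \<partial>\<rho>\<^sub>1) \<le> (\<integral>\<zeta>. norm (F (exp_neg \<zeta>) - P (exp_neg \<zeta>)) \<partial>\<rho>\<^sub>1)"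
      by (rule integral_norm_bound)
    also have "\<dots> \<le> ?d / 4"
      by (rule P1.integral_le_const)
         (use int F cP close S space in \<open>auto intro!: integrable_norm Bochner_Integration.integrable_diff less_imp_le\<close>)
    finally show ?thesis using int F cP by simp
  qed
  have 2: "\<bar>(\<integral>\<zeta>. F (exp_neg \<zeta>) \<partial>\<rho>\<^sub>2) - (\<integral>\<zeta>. P (exp_neg \<zeta>) \<partial>\<rho>\<^sub>2)\<bar> \<le> ?d / 4"
  proof -
    have "norm (\<integral>\<zeta>. F (exp_neg \<zeta>) - P (exp_neg \<zeta>) \<partial>\<rho>\<^sub>2) \<le> (\<integral>\<zeta>. norm (F (exp_neg \<zeta>) - P (exp_neg \<zeta>)) \<partial>\<rho>\<^sub>2)"
      by (rule integral_norm_bound)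
    also have "\<dots> \<le> ?d / 4"
      by (rule P2.integral_le_const)
         (use int F cP close S space in \<open>auto intro!: integrable_norm Bochner_Integration.integrable_diff less_imp_le\<close>)
    finally show ?thesis using int F cP by simp
  qed
  have "False" if "\<bar>a - c\<bar> \<le> \<bar>a - b\<bar> / 4" "\<bar>b - c\<bar> \<le> \<bar>a - b\<bar> / 4" "0 < \<bar>a - b\<bar> / 4" for a b c :: real
    using that by (auto simp: abs_if split: if_splits)
  from this[OF 1 _ \<open>0 < ?d / 4\<close>] 2 show False unfolding PE by blast
qed

text \<open>The images under \<open>exp_neg\<close> agree on open sets, whose indicators are limits
  of continuous functions, and hence everywhere. A Borel left inverse of \<open>exp_neg\<close>
  carries the equality back to the orthant.\<close>

lemma measures_eq: "\<rho>\<^sub>1 = \<rho>\<^sub>2"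
proof -
  interpret P1: prob_space \<rho>\<^sub>1 by (rule prob)
  interpret P2: prob_space \<rho>\<^sub>2 by (rule prob)
  have w: "exp_neg \<in> borel_measurable \<rho>\<^sub>1" "exp_neg \<in> borel_measurable \<rho>\<^sub>2"
    using measurable_exp_neg by (simp_all add: measurable_cong_sets[OF sets(1) refl] measurable_cong_sets[OF sets(2) refl])
  interpret D1: prob_space "distr \<rho>\<^sub>1 borel exp_neg" by (rule P1.prob_space_distr[OF w(1)])
  interpret D2: prob_space "distr \<rho>\<^sub>2 borel exp_neg" by (rule P2.prob_space_distr[OF w(2)])
  have open_eq: "measure (distr \<rho>\<^sub>1 borel exp_neg) U = measure (distr \<rho>\<^sub>2 borel exp_neg) U" if U: "open U" for U
  proof (cases "U = UNIV")
    case True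
    then show ?thesis using D1.prob_space D2.prob_space by simp
  next
    case False
    \<comment> \<open>Here U is not the whole space. For an empty complement \<open>infdist\<close>
      would be 0 by convention and the functions would not increase to the indicator.\<close>
    define F where "F n x = min 1 (real n * infdist x (- U))" for n x
    have cF: "continuous_on UNIV (F n)" for n unfolding F_def by (intro continuous_intros)
    have F1: "\<bar>F n x\<bar> \<le> 1" for n x by (auto simp: F_def infdist_nonneg min_def)
    have lim: "(\<lambda>n. F n x) \<longlonglongrightarrow> indicator U x" for x
    proof (cases "x \<in> U")
      case True
      then have "0 < infdist x (- U)"
        using U False in_closed_iff_infdist_zero[of "- U" x] infdist_nonneg[of x "- U"] by (auto simp: less_le)
      then obtain N where N: "1 < real N * infdist x (- U)" using reals_Archimedean3 by blast
      have "\<forall>\<^sub>F n in sequentially. F n x = 1"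
      proof (rule eventually_sequentiallyI[of N])
        fix n assume "N \<le> n"
        then have "real N * infdist x (- U) \<le> real n * infdist x (- U)"
          by (intro mult_right_mono infdist_nonneg) simp
        then show "F n x = 1" using N by (simp add: F_def)
      qed
      then show ?thesis using True by (auto intro: tendsto_eventually)
    next
      case False
      then show ?thesis by (simp add: F_def)
    qed
    have *: "(\<lambda>n. \<integral>\<zeta>. F n (exp_neg \<zeta>) \<partial>\<rho>) \<longlonglongrightarrow> measure (distr \<rho> borel exp_neg) U"
      if "prob_space \<rho>" and w: "exp_neg \<in> borel_measurable \<rho>" for \<rho>
    proof -
      interpret prob_space \<rho> by fact
      have "(\<lambda>n. \<integral>x. F n x \<partial>distr \<rho> borel exp_neg) \<longlonglongrightarrow> (\<integral>x. indicator U x \<partial>distr \<rho> borel exp_neg)"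
      proof (rule integral_dominated_convergence[where w="\<lambda>_. 1"])
        interpret D: prob_space "distr \<rho> borel exp_neg" by (rule prob_space_distr[OF w])
        show "integrable (distr \<rho> borel exp_neg) (\<lambda>_. 1::real)" by simp
      qed (use F1 lim U cF in \<open>auto intro: borel_measurable_continuous_onI\<close>)
      then show ?thesis
        using U by (simp add: integral_distr[OF w borel_measurable_continuous_onI[OF cF]])
    qed
    show ?thesis
      using *[OF prob(1) w(1)] *[OF prob(2) w(2)] unfolding integral_continuous_eq[OF cF] by (rule LIMSEQ_unique)
  qed
  have D: "distr \<rho>\<^sub>1 borel exp_neg = distr \<rho>\<^sub>2 borel exp_neg"
  proof (rule measure_eqI_generator_eq[where \<Omega>=UNIV and E="{U. open U}" and A="\<lambda>_. UNIV"])
    show "Int_stable {U :: (real^'v) set. open U}" by (auto simp: Int_stable_def)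
    show "emeasure (distr \<rho>\<^sub>1 borel exp_neg) X = emeasure (distr \<rho>\<^sub>2 borel exp_neg) X" if "X \<in> {U. open U}" for X
      using open_eq[of X] that by (simp add: D1.emeasure_eq_measure D2.emeasure_eq_measure)
    show "emeasure (distr \<rho>\<^sub>1 borel exp_neg) UNIV \<noteq> \<infinity>" for i :: nat by (simp add: D1.emeasure_eq_measure)
  qed (auto simp: borel_def)
  \<comment> \<open>The positive part makes this left inverse land in the orthant at every
    point.\<close>
  define v where "v y = (\<chi> i. max 0 (- ln (y $ i)))" for y :: "real^'v"
  have v: "v \<in> borel \<rightarrow>\<^sub>M orthant_borel"
  proof (rule measurable_restrict_space2)
    show "v \<in> borel_measurable borel"
      unfolding v_def[abs_def] by (rule borel_measurable_vec_lambda) measurable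
  qed (auto simp: v_def orthant_def)
  have vw: "v (exp_neg \<zeta>) = \<zeta>" if "\<zeta> \<in> orthant" for \<zeta>
    using that by (simp add: v_def exp_neg_def orthant_def vec_eq_iff)
  have recover: "distr (distr \<rho> borel exp_neg) orthant_borel v = \<rho>"
    if "sets \<rho> = sets orthant_borel" "exp_neg \<in> borel_measurable \<rho>" for \<rho>
  proof -
    have sp: "space \<rho> = orthant" using that(1)[THEN sets_eq_imp_space_eq] by (simp add: space_orthant_borel)
    have "distr (distr \<rho> borel exp_neg) orthant_borel v = distr \<rho> orthant_borel (v \<circ> exp_neg)"
      by (rule distr_distr[OF v that(2)])
    also have "\<dots> = distr \<rho> \<rho> (\<lambda>x. x)"
      by (rule distr_cong) (use that sp vw in auto)
    finally show ?thesis by (simp add: distr_id2)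
  qed
  have "\<rho>\<^sub>1 = distr (distr \<rho>\<^sub>1 borel exp_neg) orthant_borel v"
    by (rule recover[OF sets(1) w(1), symmetric])
  also have "\<dots> = distr (distr \<rho>\<^sub>2 borel exp_neg) orthant_borel v"
    by (simp only: D)
  also have "\<dots> = \<rho>\<^sub>2"
    by (rule recover[OF sets(2) w(2)])
  finally show ?thesis .
qed

end

section \<open>Laws of the processes\<close>

lemma integral_law_at:
  assumes mp: "markov_process E Pr X" and \<mu>: "prob_space \<mu>" "sets \<mu> = sets E" and t: "0 \<le> t"
    and f: "f \<in> borel_measurable E" "\<And>x. x \<in> space E \<Longrightarrow> \<bar>f x :: real\<bar> \<le> B"
  shows "(\<integral>x. f x \<partial>law_at E Pr X \<mu> t) = (\<integral>x. (\<integral>\<omega>. f (X t \<omega>) \<partial>Pr x) \<partial>\<mu>)"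
proof -
  interpret prob_space \<mu> by (rule \<mu>)
  have sp: "space \<mu> = space E" by (rule sets_eq_imp_space_eq[OF \<mu>(2)])
  have K: "transition E Pr X t \<in> E \<rightarrow>\<^sub>M prob_algebra E" using mp t unfolding markov_process_def by blast
  have K': "transition E Pr X t \<in> \<mu> \<rightarrow>\<^sub>M subprob_algebra E"
    using measurable_prob_algebraD[OF K] by (simp add: measurable_cong_sets[OF \<mu>(2) refl])
  have X: "X t \<in> Pr x \<rightarrow>\<^sub>M E" if "x \<in> space E" for x using mp that t unfolding markov_process_def by blast
  have "(\<integral>x. f x \<partial>law_at E Pr X \<mu> t) = (\<integral>x. (\<integral>y. f y \<partial>transition E Pr X t x) \<partial>\<mu>)"
    unfolding law_at_def
    by (rule integral_bind[OF f K', where B'=1])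
       (auto intro!: AE_I2 finite_measure_axioms subprob_space.subprob_emeasure_le_1 subprob_space_kernel[OF K'])
  also have "\<dots> = (\<integral>x. (\<integral>\<omega>. f (X t \<omega>) \<partial>Pr x) \<partial>\<mu>)"
    unfolding transition_def
    by (intro Bochner_Integration.integral_cong refl integral_distr X f) (simp add: sp)
  finally show ?thesis .
qed

text \<open>Both expectations are sums of one exponential series: on the left through the dual
  functions d averaged over \<open>\<kappa> \<theta>\<close>, on the right through the geometric
  weights along the hidden process. The assumption on d turns the initial values of the former into
  those of the latter.\<close>

lemma law_at_dual:
  fixes p :: "'v::finite \<Rightarrow> 'v \<Rightarrow> real" and \<kappa> :: "real^'v \<Rightarrow> 'x measure"
  assumes p: "\<And>i j. 0 \<le> p i j" and c: "0 < c" and t: "0 \<le> t" and \<theta>: "\<theta> \<in> orthant"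
    and X: "markov_process E Pr X" "has_generator_on E Pr X D L" "dual_functions E p D L d"
    and H: "hidden_parameter_process p Pr_h \<Theta>"
    and \<kappa>: "\<kappa> \<in> orthant_borel \<rightarrow>\<^sub>M prob_algebra E"
    and d: "\<And>\<theta> \<xi>. \<theta> \<in> orthant \<Longrightarrow> (\<integral>x. d \<xi> x \<partial>\<kappa> \<theta>) = tensor geometric_weight \<xi> (c *\<^sub>R \<theta>)"
  shows "(\<integral>x. d \<xi> x \<partial>law_at E Pr X (\<kappa> \<theta>) t) = (\<integral>x. d \<xi> x \<partial>(Pr_h \<theta> \<bind> (\<lambda>\<omega>. \<kappa> (\<Theta> t \<omega>))))"
    and "prob_space (law_at E Pr X (\<kappa> \<theta>) t)" and "prob_space (Pr_h \<theta> \<bind> (\<lambda>\<omega>. \<kappa> (\<Theta> t \<omega>)))"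
    and "sets (law_at E Pr X (\<kappa> \<theta>) t) = sets E" and "sets (Pr_h \<theta> \<bind> (\<lambda>\<omega>. \<kappa> (\<Theta> t \<omega>))) = sets E"
proof -
  have \<theta>s: "\<theta> \<in> space orthant_borel" using \<theta> by (simp add: space_orthant_borel)
  have Hm: "markov_process orthant_borel Pr_h \<Theta>" "has_generator_on orthant_borel Pr_h \<Theta> C1_compact_support (hidden_generator p)"
    using H by (auto simp: hidden_parameter_process_def)
  interpret P: prob_space "Pr_h \<theta>" using Hm(1) \<theta>s unfolding markov_process_def by blast
  have \<Theta>: "\<Theta> t \<in> Pr_h \<theta> \<rightarrow>\<^sub>M orthant_borel" using Hm(1) \<theta>s t unfolding markov_process_def by blast
  have \<kappa>\<theta>: "\<kappa> \<theta> \<in> space (prob_algebra E)" by (rule measurable_space[OF \<kappa> \<theta>s])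
  then have \<mu>: "prob_space (\<kappa> \<theta>)" "sets (\<kappa> \<theta>) = sets E" by (auto simp: space_prob_algebra)
  interpret M: prob_space "\<kappa> \<theta>" by (rule \<mu>)
  have dm: "d \<xi> \<in> borel_measurable E" and d1: "\<And>y. y \<in> space E \<Longrightarrow> \<bar>d \<xi> y\<bar> \<le> 1" for \<xi>
    using X(3) unfolding dual_functions_def by auto
  have \<kappa>\<Theta>: "(\<lambda>\<omega>. \<kappa> (\<Theta> t \<omega>)) \<in> Pr_h \<theta> \<rightarrow>\<^sub>M prob_algebra E" by (rule measurable_compose[OF \<Theta> \<kappa>])
  note \<kappa>\<Theta>' = measurable_prob_algebraD[OF \<kappa>\<Theta>]
  have K: "transition E Pr X t \<in> \<kappa> \<theta> \<rightarrow>\<^sub>M prob_algebra E"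
    using X(1) t unfolding markov_process_def by (simp add: measurable_cong_sets[OF \<mu>(2) refl])
  note K' = measurable_prob_algebraD[OF K]
  show "prob_space (law_at E Pr X (\<kappa> \<theta>) t)"
    unfolding law_at_def
    by (rule M.prob_space_bind[OF _ K']) (use measurable_space[OF K] in \<open>auto simp: space_prob_algebra\<close>)
  show "prob_space (Pr_h \<theta> \<bind> (\<lambda>\<omega>. \<kappa> (\<Theta> t \<omega>)))"
    by (rule P.prob_space_bind[OF _ \<kappa>\<Theta>']) (use measurable_space[OF \<kappa>\<Theta>] in \<open>auto simp: space_prob_algebra\<close>)
  show "sets (law_at E Pr X (\<kappa> \<theta>) t) = sets E"
    unfolding law_at_def by (rule sets_bind[OF sets_kernel[OF K'] M.not_empty])
  show "sets (Pr_h \<theta> \<bind> (\<lambda>\<omega>. \<kappa> (\<Theta> t \<omega>))) = sets E"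
    by (rule sets_bind[OF sets_kernel[OF \<kappa>\<Theta>'] P.not_empty])
  have 1: "(\<lambda>n. t ^ n / fact n * (discrete_generator p ^^ n) (\<lambda>\<xi>. tensor geometric_weight \<xi> (c *\<^sub>R \<theta>)) \<xi>)
      sums (\<integral>x. d \<xi> x \<partial>law_at E Pr X (\<kappa> \<theta>) t)"
    using dual_functions_law_series[OF X p \<mu> t, of \<xi>] d[OF \<theta>]
    by (simp add: integral_law_at[OF X(1) \<mu> t dm d1])
  have "(\<integral>x. d \<xi> x \<partial>(Pr_h \<theta> \<bind> (\<lambda>\<omega>. \<kappa> (\<Theta> t \<omega>)))) = (\<integral>\<omega>. (\<integral>x. d \<xi> x \<partial>\<kappa> (\<Theta> t \<omega>)) \<partial>Pr_h \<theta>)"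
    by (rule integral_bind[OF dm d1 \<kappa>\<Theta>', where B'=1])
       (auto intro!: AE_I2 P.finite_measure_axioms subprob_space.subprob_emeasure_le_1 subprob_space_kernel[OF \<kappa>\<Theta>'])
  also have "\<dots> = (\<integral>\<omega>. tensor geometric_weight \<xi> (c *\<^sub>R \<Theta> t \<omega>) \<partial>Pr_h \<theta>)"
    by (intro Bochner_Integration.integral_cong refl d) (use measurable_space[OF \<Theta>] in \<open>simp add: space_orthant_borel\<close>)
  finally have 2: "(\<lambda>n. t ^ n / fact n * (discrete_generator p ^^ n) (\<lambda>\<xi>. tensor geometric_weight \<xi> (c *\<^sub>R \<theta>)) \<xi>)
      sums (\<integral>x. d \<xi> x \<partial>(Pr_h \<theta> \<bind> (\<lambda>\<omega>. \<kappa> (\<Theta> t \<omega>))))"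
    using dual_functions_series[OF Hm hidden_dual_functions[OF p c] p \<theta>s t, of \<xi>] by simp
  show "(\<integral>x. d \<xi> x \<partial>law_at E Pr X (\<kappa> \<theta>) t) = (\<integral>x. d \<xi> x \<partial>(Pr_h \<theta> \<bind> (\<lambda>\<omega>. \<kappa> (\<Theta> t \<omega>))))"
    by (rule sums_unique2[OF 1 2])
qed

text \<open>Indicators of points are dual functions whose averages under the geometric product are
  the geometric weights at scale 1, so the two laws have equal point masses.\<close>

lemma discrete_process_law:
  fixes p :: "'v::finite \<Rightarrow> 'v \<Rightarrow> real"
  assumes p: "\<And>i j. 0 \<le> p i j" and X: "discrete_harmonic_process p Pr_d \<eta>" and H: "hidden_parameter_process p Pr_h \<Theta>"
    and \<theta>: "\<theta> \<in> orthant" and t: "0 \<le> t"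
  shows "law_at (count_space UNIV) Pr_d \<eta> (geometric_product \<theta>) t = Pr_h \<theta> \<bind> (\<lambda>\<omega>. geometric_product (\<Theta> t \<omega>))"
proof -
  have Xm: "markov_process (count_space UNIV) Pr_d \<eta>"
    "has_generator_on (count_space UNIV) Pr_d \<eta> finite_support_functions (discrete_generator p)"
    using X by (auto simp: discrete_harmonic_process_def)
  have d: "(\<integral>x. indicator {\<xi>} x \<partial>geometric_product \<theta>) = tensor geometric_weight \<xi> (1 *\<^sub>R \<theta>)"
    if "\<theta> \<in> orthant" for \<theta> :: "real^'v" and \<xi>
    using pmf_geometric_product[OF that, of \<xi>] by (simp add: geometric_product_def pmf.rep_eq)
  note L = law_at_dual[OF p zero_less_one t \<theta> Xm discrete_dual_functions[OF p] H geometric_product_kernel d]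
  let ?M = "law_at (count_space UNIV) Pr_d \<eta> (geometric_product \<theta>) t" and ?N = "Pr_h \<theta> \<bind> (\<lambda>\<omega>. geometric_product (\<Theta> t \<omega>))"
  interpret M: prob_space ?M by (rule L)
  interpret N: prob_space ?N by (rule L)
  have s: "sets ?M = Pow UNIV" "sets ?N = Pow UNIV" using L(4,5) by simp_all
  show ?thesis
  proof (rule measure_eqI_countable[OF s])
    fix \<xi> :: "'v \<Rightarrow> nat"
    have "measure ?M {\<xi>} = measure ?N {\<xi>}" using L(1)[of \<xi>] s by simp
    then show "emeasure ?M {\<xi>} = emeasure ?N {\<xi>}" by (simp add: M.emeasure_eq_measure N.emeasure_eq_measure)
  qed simp
qed

text \<open>The general comparison is used at every scale c > 0, which provides all the Poisson
  averages needed to identify the two mixtures.\<close>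

lemma continuous_process_law:
  fixes p :: "'v::finite \<Rightarrow> 'v \<Rightarrow> real"
  assumes p: "\<And>i j. 0 \<le> p i j" and X: "continuous_harmonic_process p Pr_c \<zeta>" and H: "hidden_parameter_process p Pr_h \<Theta>"
    and \<theta>: "\<theta> \<in> orthant" and t: "0 \<le> t"
  shows "law_at orthant_borel Pr_c \<zeta> (exponential_product \<theta>) t = Pr_h \<theta> \<bind> (\<lambda>\<omega>. exponential_product (\<Theta> t \<omega>))"
proof -
  have Xm: "markov_process orthant_borel Pr_c \<zeta>"
    "has_generator_on orthant_borel Pr_c \<zeta> C1_compact_support (continuous_generator p)"
    using X by (auto simp: continuous_harmonic_process_def)
  have "(\<integral>x. tensor poisson_weight \<xi> (c *\<^sub>R x) \<partial>exponential_product \<theta>) = tensor geometric_weight \<xi> (c *\<^sub>R \<theta>)"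
    if "0 < c" "\<theta> \<in> orthant" for c and \<theta> :: "real^'v" and \<xi>
    using that by (intro integral_exponential_product_tensor) auto
  note L = law_at_dual[OF p _ t \<theta> Xm continuous_dual_functions[OF p] H exponential_product_kernel this]
  interpret poisson_mixtures "law_at orthant_borel Pr_c \<zeta> (exponential_product \<theta>) t" "Pr_h \<theta> \<bind> (\<lambda>\<omega>. exponential_product (\<Theta> t \<omega>))"
  proof (rule poisson_mixtures.intro)
    show "(\<integral>\<zeta>. tensor poisson_weight \<xi> (c *\<^sub>R \<zeta>) \<partial>law_at orthant_borel Pr_c \<zeta> (exponential_product \<theta>) t) =
        (\<integral>\<zeta>. tensor poisson_weight \<xi> (c *\<^sub>R \<zeta>) \<partial>(Pr_h \<theta> \<bind> (\<lambda>\<omega>. exponential_product (\<Theta> t \<omega>))))" if c: "0 < c" for c \<xi>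
      by (rule L(1)[OF c c c])
    show "prob_space (law_at orthant_borel Pr_c \<zeta> (exponential_product \<theta>) t)"
      by (rule L(2)[OF zero_less_one zero_less_one zero_less_one])
    show "prob_space (Pr_h \<theta> \<bind> (\<lambda>\<omega>. exponential_product (\<Theta> t \<omega>)))"
      by (rule L(3)[OF zero_less_one zero_less_one zero_less_one])
    show "sets (law_at orthant_borel Pr_c \<zeta> (exponential_product \<theta>) t) = sets orthant_borel"
      by (rule L(4)[OF zero_less_one zero_less_one zero_less_one])
    show "sets (Pr_h \<theta> \<bind> (\<lambda>\<omega>. exponential_product (\<Theta> t \<omega>))) = sets orthant_borel"
      by (rule L(5)[OF zero_less_one zero_less_one zero_less_one])
  qed
  show ?thesis by (rule measures_eq)
qed

section \<open>The geometric intertwiner\<close>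

text \<open>Sums over configurations appear in two guises: as integrals over the counting measure
  for Fubini against Lebesgue measure, and as \<open>infsum\<close> for reindexing by the reversal
  of jumps.\<close>

lemma count_space_summable:
  fixes g :: "'a \<Rightarrow> real"
  shows "integrable (count_space UNIV) g \<longleftrightarrow> g summable_on UNIV"
    and "g summable_on UNIV \<Longrightarrow> (\<integral>x. g x \<partial>count_space UNIV) = (\<Sum>\<^sub>\<infinity>x. g x)"
proof -
  have 1: "g summable_on UNIV \<longleftrightarrow> Infinite_Set_Sum.abs_summable_on g UNIV"
    using summable_on_iff_abs_summable_on_real[of g UNIV] abs_summable_equivalent[of g UNIV] by blast
  show "integrable (count_space UNIV) g \<longleftrightarrow> g summable_on UNIV"
    unfolding 1 abs_summable_on_def ..
  show "(\<integral>x. g x \<partial>count_space UNIV) = (\<Sum>\<^sub>\<infinity>x. g x)" if "g summable_on UNIV"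
    using infsetsum_infsum[of g UNIV] that unfolding 1 infsetsum_def by simp
qed

lemma tensor_geometric_nonneg: "\<theta> \<in> orthant \<Longrightarrow> 0 \<le> tensor geometric_weight \<xi> \<theta>"
  unfolding tensor_def by (intro prod_nonneg ballI geometric_weight_bounds) (simp add: orthant_def)

lemma geometric_product_summable:
  assumes \<theta>: "\<theta> \<in> orthant"
  shows "integrable (geometric_product \<theta>) f \<longleftrightarrow> (\<lambda>\<xi>. tensor geometric_weight \<xi> \<theta> * f \<xi>) summable_on UNIV"
    and "(\<lambda>\<xi>. tensor geometric_weight \<xi> \<theta> * f \<xi>) summable_on UNIV \<Longrightarrow>
      (\<integral>\<eta>. f \<eta> \<partial>geometric_product \<theta>) = (\<Sum>\<^sub>\<infinity>\<xi>. tensor geometric_weight \<xi> \<theta> * f \<xi>)"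
proof -
  have e: "geometric_product \<theta> = density (count_space UNIV) (\<lambda>\<xi>. ennreal (tensor geometric_weight \<xi> \<theta>))"
    unfolding geometric_product_def measure_pmf_eq_density by (simp add: pmf_geometric_product[OF \<theta>])
  show "integrable (geometric_product \<theta>) f \<longleftrightarrow> (\<lambda>\<xi>. tensor geometric_weight \<xi> \<theta> * f \<xi>) summable_on UNIV"
    unfolding e count_space_summable(1)[symmetric]
    by (subst integrable_density) (auto simp: tensor_geometric_nonneg[OF \<theta>])
  show "(\<integral>\<eta>. f \<eta> \<partial>geometric_product \<theta>) = (\<Sum>\<^sub>\<infinity>\<xi>. tensor geometric_weight \<xi> \<theta> * f \<xi>)"
    if "(\<lambda>\<xi>. tensor geometric_weight \<xi> \<theta> * f \<xi>) summable_on UNIV"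
    unfolding e count_space_summable(2)[OF that, symmetric]
    by (subst integral_density) (auto simp: tensor_geometric_nonneg[OF \<theta>])
qed

section \<open>Domination by powers of the particle number\<close>

lemma tensor_power: "tensor (\<lambda>n x. z ^ n) \<xi> y = z ^ particle_number \<xi>"
  by (simp add: tensor_def particle_number_def power_sum)

lemma geometric_weight_le_power:
  assumes "0 \<le> \<theta>" "\<theta> \<le> T"
  shows "geometric_weight n \<theta> \<le> (T / (1 + T)) ^ n"
proof -
  have "\<theta> / (1 + \<theta>) \<le> T / (1 + T)" using assms by (simp add: field_simps)
  then have "(\<theta> / (1 + \<theta>)) ^ n \<le> (T / (1 + T)) ^ n" using assms by (intro power_mono) auto
  then have "(\<theta> / (1 + \<theta>)) ^ n * (1 / (1 + \<theta>)) \<le> (T / (1 + T)) ^ n * 1"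
    using assms by (intro mult_mono) auto
  then show ?thesis by (simp add: geometric_weight_def)
qed

lemma tensor_geometric_le_power:
  assumes "\<theta> \<in> orthant" "\<And>i. \<theta> $ i \<le> T"
  shows "tensor geometric_weight \<xi> \<theta> \<le> (T / (1 + T)) ^ particle_number \<xi>"
  unfolding tensor_power[symmetric, of _ _ \<theta>] tensor_def
  by (intro prod_mono conjI geometric_weight_le_power geometric_weight_bounds) (use assms in \<open>auto simp: orthant_def\<close>)

text \<open>The derivative is dominated termwise through w/(1+w) \<le> z for w \<le> T; the factor
  1/z restores the power of z lost in differentiating.\<close>

lemma geometric_weight_lipschitz:
  assumes T: "0 < T" and x: "0 \<le> x" "x \<le> T" and y: "0 \<le> y" "y \<le> T"
  defines "z \<equiv> T / (1 + T)"
  shows "\<bar>geometric_weight n x - geometric_weight n y\<bar> \<le> (real n + 1) / z * z ^ n * \<bar>x - y\<bar>"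
proof -
  have z: "0 < z" "z < 1" using T by (auto simp: z_def)
  have b: "\<bar>geometric_weight' n w\<bar> \<le> (real n + 1) / z * z ^ n" if w: "w \<in> {0..T}" for w
  proof -
    let ?q = "w / (1 + w)"
    have q: "0 \<le> ?q" "?q \<le> z" using w T by (auto simp: z_def field_simps)
    have r: "1 / (1 + w)\<^sup>2 \<le> 1" "1 / (1 + w) \<le> 1" "0 \<le> 1 / (1 + w)" using w one_le_power[of "1 + w" 2] by (auto simp: divide_le_eq_1)
    have 1: "real n * ?q ^ (n - 1) * (1 / (1 + w)\<^sup>2) * (1 / (1 + w)) \<le> real n * z ^ (n - 1) * 1 * 1"
      using q r w z by (intro mult_mono power_mono) auto
    have 2: "real n * z ^ (n - 1) = real n / z * z ^ n" using z by (cases n) auto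
    have 3: "?q ^ n * (1 / (1 + w)\<^sup>2) \<le> z ^ n * 1" using q r z by (intro mult_mono power_mono) auto
    have 4: "z ^ n \<le> 1 / z * z ^ n" using mult_right_mono[of 1 "1 / z" "z ^ n"] z by simp
    have "\<bar>geometric_weight' n w\<bar> \<le> real n * ?q ^ (n - 1) * (1 / (1 + w)\<^sup>2) * (1 / (1 + w)) + ?q ^ n * (1 / (1 + w)\<^sup>2)"
      unfolding geometric_weight'_def using q w by (intro order_trans[OF abs_triangle_ineq4]) (simp add: abs_mult)
    also have "\<dots> \<le> real n / z * z ^ n + 1 / z * z ^ n" using 1 2 3 4 by linarith
    also have "\<dots> = (real n + 1) / z * z ^ n" by (simp add: add_divide_distrib distrib_right)
    finally show ?thesis .
  qed
  have "norm (geometric_weight n x - geometric_weight n y) \<le> (real n + 1) / z * z ^ n * norm (x - y)"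
    by (rule field_differentiable_bound[of "{0..T}" _ "geometric_weight' n"])
       (use b x y in \<open>auto intro!: has_field_derivative_at_within[OF DERIV_geometric_weight]\<close>)
  then show ?thesis by simp
qed

text \<open>The updated coordinate is a convex combination in [0,T], so the Lipschitz bound applies,
  and the displacement of at most uT cancels the 1/u. The result is uniform in u and summable
  against f, as Fubini requires.\<close>

lemma hidden_jump_geometric_bound:
  fixes \<theta> :: "real^'v::finite"
  assumes \<theta>: "\<theta> \<in> orthant" and T: "0 < T" "\<And>i. \<theta> $ i \<le> T" and ij: "i \<noteq> j" and u: "0 < u" "u < 1"
  defines "z \<equiv> T / (1 + T)"
  shows "\<bar>1 / u * (tensor geometric_weight \<xi> (move_parameter i j u \<theta>) - tensor geometric_weight \<xi> \<theta>)\<bar>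
     \<le> T / z * ((real (particle_number \<xi>) + 1) * z ^ particle_number \<xi>)"
proof -
  have z: "0 < z" "z < 1" using T by (auto simp: z_def)
  let ?s = "\<theta> $ i" and ?t = "\<theta> $ j"
  let ?x = "(1 - u) * ?s + u * ?t"
  let ?R = "\<Prod>k\<in>UNIV - {i, j}. geometric_weight (\<xi> k) (\<theta> $ k)"
  have pos: "0 \<le> \<theta> $ k" for k using \<theta> by (simp add: orthant_def)
  have x: "0 \<le> ?x" "?x \<le> T"
  proof -
    show "0 \<le> ?x" using pos u by simp
    have "?x \<le> (1 - u) * T + u * T" using T u by (intro add_mono mult_left_mono) auto
    then show "?x \<le> T" by (simp add: algebra_simps)
  qed
  have "\<bar>?x - ?s\<bar> = u * \<bar>?t - ?s\<bar>"
  proof -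
    have "?x - ?s = u * (?t - ?s)" by (simp add: algebra_simps)
    then show ?thesis using u by (simp add: abs_mult)
  qed
  moreover have "\<bar>?t - ?s\<bar> \<le> T" using pos[of i] pos[of j] T(2)[of i] T(2)[of j] by linarith
  ultimately have xs: "\<bar>?x - ?s\<bar> \<le> u * T" using u by (simp add: mult_left_mono)
  have g: "\<bar>geometric_weight (\<xi> i) ?x - geometric_weight (\<xi> i) ?s\<bar> \<le> (real (\<xi> i) + 1) / z * z ^ \<xi> i * (u * T)"
    using geometric_weight_lipschitz[OF T(1) x pos[of i] T(2), of "\<xi> i"] xs z unfolding z_def[symmetric]
    by (elim order_trans) (intro mult_left_mono, auto)
  have R: "0 \<le> ?R" "?R \<le> (\<Prod>k\<in>UNIV - {i, j}. z ^ \<xi> k)"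
    unfolding z_def
    by (auto intro!: prod_nonneg prod_mono geometric_weight_bounds geometric_weight_le_power pos T)
  have j: "0 \<le> geometric_weight (\<xi> j) ?t" "geometric_weight (\<xi> j) ?t \<le> z ^ \<xi> j"
    unfolding z_def by (auto intro!: geometric_weight_bounds geometric_weight_le_power pos T)
  have e: "1 / u * (tensor geometric_weight \<xi> (move_parameter i j u \<theta>) - tensor geometric_weight \<xi> \<theta>)
      = 1 / u * (geometric_weight (\<xi> i) ?x - geometric_weight (\<xi> i) ?s) * (geometric_weight (\<xi> j) ?t * ?R)"
    using tensor_move_parameter[OF ij, of geometric_weight \<xi> 1 u \<theta>] unfolding tensor_split[OF ij]
    by (simp add: algebra_simps)
  have "\<bar>1 / u * (tensor geometric_weight \<xi> (move_parameter i j u \<theta>) - tensor geometric_weight \<xi> \<theta>)\<bar>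
     = 1 / u * \<bar>geometric_weight (\<xi> i) ?x - geometric_weight (\<xi> i) ?s\<bar> * (geometric_weight (\<xi> j) ?t * ?R)"
    unfolding e abs_mult using u R j by simp
  also have "\<dots> \<le> 1 / u * ((real (\<xi> i) + 1) / z * z ^ \<xi> i * (u * T)) * (z ^ \<xi> j * (\<Prod>k\<in>UNIV - {i, j}. z ^ \<xi> k))"
    using u R j g z T by (intro mult_mono) auto
  also have "\<dots> = T / z * ((real (\<xi> i) + 1) * (z ^ \<xi> i * z ^ \<xi> j * (\<Prod>k\<in>UNIV - {i, j}. z ^ \<xi> k)))"
  proof -
    have "1 / u * (a / z * b * (u * T)) * (c * d) = T / z * (a * (b * c * d))" for a b c d :: real
      using u by simp
    then show ?thesis .
  qed
  also have "z ^ \<xi> i * z ^ \<xi> j * (\<Prod>k\<in>UNIV - {i, j}. z ^ \<xi> k) = z ^ particle_number \<xi>"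
    using tensor_split[OF ij, of "\<lambda>n x. z ^ n" \<xi> \<theta>] by (simp add: tensor_power)
  also have "T / z * ((real (\<xi> i) + 1) * z ^ particle_number \<xi>) \<le> T / z * ((real (particle_number \<xi>) + 1) * z ^ particle_number \<xi>)"
    using T z le_particle_number[of \<xi> i] by (intro mult_left_mono mult_right_mono) auto
  finally show ?thesis .
qed

text \<open>Half of the decay of z^n absorbs the linear factor, the other half survives.\<close>

lemma linear_power_bound:
  fixes z :: real
  assumes "0 < z" "z < 1"
  obtains C where "0 \<le> C" "\<And>n. (real n + 1) * z ^ n \<le> C * sqrt z ^ n"
proof -
  have r: "0 < sqrt z" "sqrt z < 1" using assms by auto
  have "(\<lambda>n. real n * sqrt z ^ n + sqrt z ^ n) \<longlonglongrightarrow> 0 + 0"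
    by (intro tendsto_add powser_times_n_limit_0 LIMSEQ_realpow_zero) (use r in auto)
  then have "Bseq (\<lambda>n. real n * sqrt z ^ n + sqrt z ^ n)" by (rule convergent_imp_Bseq[OF convergentI])
  then obtain C where C: "0 < C" "\<And>n. norm (real n * sqrt z ^ n + sqrt z ^ n) \<le> C" by (auto simp: Bseq_def)
  show ?thesis
  proof (rule that[of C])
    fix n
    have "z ^ n = sqrt z ^ n * sqrt z ^ n" using assms by (simp flip: power_mult_distrib)
    then have "(real n + 1) * z ^ n = (real n * sqrt z ^ n + sqrt z ^ n) * sqrt z ^ n" by (simp add: algebra_simps)
    also have "\<dots> \<le> C * sqrt z ^ n" using C(2)[of n] r by (intro mult_right_mono) auto
    finally show "(real n + 1) * z ^ n \<le> C * sqrt z ^ n" .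
  qed (use C in auto)
qed

text \<open>T is chosen with T/(1+T) = sqrt z, so the geometric product with constant parameter T
  has weights proportional to (sqrt z)^N for N particles. Integrability of f at this larger
  parameter pays for the linear factor; here integrability at arbitrary positive parameters is
  used.\<close>

lemma summable_weighted:
  fixes f :: "('v::finite \<Rightarrow> nat) \<Rightarrow> real"
  assumes f: "\<forall>\<theta>\<in>pos_orthant. integrable (geometric_product \<theta>) f" and z: "0 < z" "z < 1"
  shows "(\<lambda>\<xi>. (real (particle_number \<xi>) + 1) * z ^ particle_number \<xi> * \<bar>f \<xi>\<bar>) summable_on UNIV"
proof -
  define r where "r = sqrt z"
  define T where "T = r / (1 - r)"
  have r: "0 < r" "r < 1" using z by (auto simp: r_def)
  have T: "0 < T" "T / (1 + T) = r" "1 / (1 + T) = 1 - r" using r by (auto simp: T_def field_simps)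
  obtain C where C: "0 \<le> C" "\<And>n. (real n + 1) * z ^ n \<le> C * r ^ n"
    using linear_power_bound[OF z] unfolding r_def by metis
  let ?\<theta> = "(\<chi> i. T) :: real^'v"
  have \<theta>: "?\<theta> \<in> pos_orthant" "?\<theta> \<in> orthant" using T(1) by (auto simp: pos_orthant_def orthant_def)
  have t: "tensor geometric_weight \<xi> ?\<theta> = r ^ particle_number \<xi> * (1 - r) ^ CARD('v)" for \<xi>
    by (simp add: tensor_def geometric_weight_def T prod.distrib particle_number_def power_sum)
  have "(\<lambda>\<xi>. tensor geometric_weight \<xi> ?\<theta> * f \<xi>) summable_on UNIV"
    using f \<theta> geometric_product_summable(1) by blast
  then have "(\<lambda>\<xi>. \<bar>tensor geometric_weight \<xi> ?\<theta> * f \<xi>\<bar>) summable_on UNIV"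
    using summable_on_iff_abs_summable_on_real[of "\<lambda>\<xi>. tensor geometric_weight \<xi> ?\<theta> * f \<xi>" UNIV] by simp
  then have s: "(\<lambda>\<xi>. C / (1 - r) ^ CARD('v) * \<bar>tensor geometric_weight \<xi> ?\<theta> * f \<xi>\<bar>) summable_on UNIV"
    by (rule summable_on_cmult_right)
  show ?thesis
  proof (rule summable_on_comparison_test[OF s])
    fix \<xi>
    have "(real (particle_number \<xi>) + 1) * z ^ particle_number \<xi> * \<bar>f \<xi>\<bar> \<le> C * r ^ particle_number \<xi> * \<bar>f \<xi>\<bar>"
      using C by (intro mult_right_mono) auto
    also have "\<dots> = C / (1 - r) ^ CARD('v) * \<bar>tensor geometric_weight \<xi> ?\<theta> * f \<xi>\<bar>"
      using r by (simp add: t abs_mult)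
    finally show "(real (particle_number \<xi>) + 1) * z ^ particle_number \<xi> * \<bar>f \<xi>\<bar> \<le> C / (1 - r) ^ CARD('v) * \<bar>tensor geometric_weight \<xi> ?\<theta> * f \<xi>\<bar>" .
    show "0 \<le> (real (particle_number \<xi>) + 1) * z ^ particle_number \<xi> * \<bar>f \<xi>\<bar>" using z by simp
  qed
qed

text \<open>The configuration and the jump size k are sent to the configuration after the jump with
  the same k, a bijection onto the possible reverse jumps. Summability over these pairs makes both
  iterated sums legitimate.\<close>

lemma move_particles_reversal:
  assumes ij: "i \<noteq> j"
    and s: "(\<lambda>(\<xi>, k). f \<xi> * (1 / real k * g (move_particles j i k \<xi>))) summable_on (SIGMA \<xi>:UNIV. {1..\<xi> j})"
  shows "(\<lambda>\<xi>. g \<xi> * (\<Sum>k=1..\<xi> i. 1 / real k * f (move_particles i j k \<xi>)) :: real) summable_on UNIV"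
    and "(\<lambda>\<xi>. f \<xi> * (\<Sum>k=1..\<xi> j. 1 / real k * g (move_particles j i k \<xi>))) summable_on UNIV"
    and "(\<Sum>\<^sub>\<infinity>\<xi>. g \<xi> * (\<Sum>k=1..\<xi> i. 1 / real k * f (move_particles i j k \<xi>)))
       = (\<Sum>\<^sub>\<infinity>\<xi>. f \<xi> * (\<Sum>k=1..\<xi> j. 1 / real k * g (move_particles j i k \<xi>)))"
proof -
  let ?F = "\<lambda>(\<xi>, k). f \<xi> * (1 / real k * g (move_particles j i k \<xi>))"
  let ?G = "\<lambda>(\<xi>, k). g \<xi> * (1 / real k * f (move_particles i j k \<xi>))"
  let ?h = "\<lambda>(\<xi>, k). (move_particles i j k \<xi>, k)"
  let ?S = "SIGMA \<xi>:UNIV. {1..\<xi> i}" and ?S' = "SIGMA \<xi>:UNIV. {1..\<xi> j}"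
  have inv: "k \<le> \<xi> i \<Longrightarrow> k \<le> move_particles i j k \<xi> j \<and> move_particles j i k (move_particles i j k \<xi>) = \<xi>"
    "k \<le> \<xi> j \<Longrightarrow> k \<le> move_particles j i k \<xi> i \<and> move_particles i j k (move_particles j i k \<xi>) = \<xi>" for k \<xi>
    using move_particles_inverse_iff[OF ij, of k \<xi>] move_particles_inverse_iff[OF ij[symmetric], of k \<xi>] by auto
  have bij: "bij_betw ?h ?S ?S'"
    by (rule bij_betw_byWitness[where f' = "\<lambda>(\<xi>, k). (move_particles j i k \<xi>, k)"]) (auto simp: inv)
  have eq: "?F (?h x) = ?G x" if "x \<in> ?S" for x using that by (auto simp: inv)
  have sG: "?G summable_on ?S"
    using s summable_on_reindex_bij_betw[OF bij, of ?F] summable_on_cong[of ?S "\<lambda>x. ?F (?h x)" ?G] eq by blast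
  have iG: "infsum ?G ?S = infsum ?F ?S'"
  proof -
    have "infsum ?G ?S = infsum (\<lambda>x. ?F (?h x)) ?S" by (rule infsum_cong) (rule eq[symmetric])
    also have "\<dots> = infsum ?F ?S'" by (rule infsum_reindex_bij_betw[OF bij])
    finally show ?thesis .
  qed
  have fin: "infsum (\<lambda>k. c * (1 / real k * H k)) {1..n} = c * (\<Sum>k=1..n. 1 / real k * H k)" for c n and H :: "nat \<Rightarrow> real"
    by (simp add: sum_distrib_left)
  show "(\<lambda>\<xi>. g \<xi> * (\<Sum>k=1..\<xi> i. 1 / real k * f (move_particles i j k \<xi>))) summable_on UNIV"
    using summable_on_Sigma_banach[OF sG] unfolding fin .
  show "(\<lambda>\<xi>. f \<xi> * (\<Sum>k=1..\<xi> j. 1 / real k * g (move_particles j i k \<xi>))) summable_on UNIV"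
    using summable_on_Sigma_banach[OF s] unfolding fin .
  show "(\<Sum>\<^sub>\<infinity>\<xi>. g \<xi> * (\<Sum>k=1..\<xi> i. 1 / real k * f (move_particles i j k \<xi>)))
       = (\<Sum>\<^sub>\<infinity>\<xi>. f \<xi> * (\<Sum>k=1..\<xi> j. 1 / real k * g (move_particles j i k \<xi>)))"
    using infsum_Sigma_banach[OF sG] infsum_Sigma_banach[OF s] iG unfolding case_prod_conv fin by simp
qed

text \<open>Jump terms and diagonal harmonic terms are summable separately: with N particles each
  inner sum has at most N terms, each bounded by z^N |f|. Jump terms are exchanged by reversal, and
  the diagonal ones are symmetric as they stand.\<close>

lemma pair_generator_symmetric:
  fixes f g :: "('v::finite \<Rightarrow> nat) \<Rightarrow> real"
  assumes ij: "i \<noteq> j" and z: "0 \<le> z"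
    and s: "(\<lambda>\<xi>. (real (particle_number \<xi>) + 1) * z ^ particle_number \<xi> * \<bar>f \<xi>\<bar>) summable_on UNIV"
    and g: "\<And>\<xi>. \<bar>g \<xi>\<bar> \<le> z ^ particle_number \<xi>"
  shows "(\<lambda>\<xi>. g \<xi> * pair_generator i j f \<xi>) summable_on UNIV"
    and "(\<lambda>\<xi>. f \<xi> * pair_generator i j g \<xi>) summable_on UNIV"
    and "(\<Sum>\<^sub>\<infinity>\<xi>. g \<xi> * pair_generator i j f \<xi>) = (\<Sum>\<^sub>\<infinity>\<xi>. f \<xi> * pair_generator i j g \<xi>)"
proof -
  have J: "(\<lambda>(\<xi>, k). f \<xi> * (1 / real k * g (move_particles j i k \<xi>))) summable_on (SIGMA \<xi>:UNIV. {1..\<xi> j})" if ij: "i \<noteq> j" for i j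
  proof -
    have "Infinite_Sum.abs_summable_on (\<lambda>(\<xi>, k). f \<xi> * (1 / real k * g (move_particles j i k \<xi>))) (SIGMA \<xi>:UNIV. {1..\<xi> j})"
    proof (rule Infinite_Sum.abs_summable_on_Sigma_iff[THEN iffD2], intro conjI ballI)
      show "Infinite_Sum.abs_summable_on (\<lambda>\<xi>. \<Sum>\<^sub>\<infinity>k\<in>{1..\<xi> j}. norm (case (\<xi>, k) of (\<xi>, k) \<Rightarrow> f \<xi> * (1 / real k * g (move_particles j i k \<xi>)))) UNIV"
        unfolding summable_on_iff_abs_summable_on_real[symmetric]
      proof (rule summable_on_comparison_test[OF s])
        fix \<xi>
        have "(\<Sum>k=1..\<xi> j. norm (f \<xi> * (1 / real k * g (move_particles j i k \<xi>)))) \<le> (\<Sum>k=1..\<xi> j. \<bar>f \<xi>\<bar> * (1 * z ^ particle_number \<xi>))"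
        proof (rule sum_mono)
          fix k assume k: "k \<in> {1..\<xi> j}"
          have "\<bar>g (move_particles j i k \<xi>)\<bar> \<le> z ^ particle_number \<xi>"
            using g[of "move_particles j i k \<xi>"] k ij by (simp add: particle_number_move_particles)
          then show "norm (f \<xi> * (1 / real k * g (move_particles j i k \<xi>))) \<le> \<bar>f \<xi>\<bar> * (1 * z ^ particle_number \<xi>)"
            unfolding norm_mult using k by (intro mult_mono) auto
        qed
        also have "\<dots> = real (\<xi> j) * (z ^ particle_number \<xi> * \<bar>f \<xi>\<bar>)" by simp
        also have "\<dots> \<le> (real (particle_number \<xi>) + 1) * (z ^ particle_number \<xi> * \<bar>f \<xi>\<bar>)"
          using le_particle_number[of \<xi> j] z by (intro mult_right_mono) auto
        finally show "(\<Sum>\<^sub>\<infinity>k\<in>{1..\<xi> j}. norm (case (\<xi>, k) of (\<xi>, k) \<Rightarrow> f \<xi> * (1 / real k * g (move_particles j i k \<xi>)))) \<le> (real (particle_number \<xi>) + 1) * z ^ particle_number \<xi> * \<bar>f \<xi>\<bar>"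
          by (simp add: mult.assoc)
        show "0 \<le> (\<Sum>\<^sub>\<infinity>k\<in>{1..\<xi> j}. norm (case (\<xi>, k) of (\<xi>, k) \<Rightarrow> f \<xi> * (1 / real k * g (move_particles j i k \<xi>))))"
          by (rule infsum_nonneg) auto
      qed
    qed auto
    then show ?thesis by (rule abs_summable_summable)
  qed
  have H: "(\<lambda>\<xi>. (\<Sum>k=1..\<xi> i. 1 / real k) * (g \<xi> * f \<xi>)) summable_on UNIV" for i
  proof -
    have "Infinite_Sum.abs_summable_on (\<lambda>\<xi>. (\<Sum>k=1..\<xi> i. 1 / real k) * (g \<xi> * f \<xi>)) UNIV"
    proof (rule summable_on_comparison_test[OF s])
      fix \<xi>
      have "(\<Sum>k=1..\<xi> i. 1 / real k) \<le> (\<Sum>k=1..\<xi> i. 1)" by (rule sum_mono) auto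
      also have "\<dots> \<le> real (particle_number \<xi>) + 1" using le_particle_number[of \<xi> i] by simp
      finally have h: "\<bar>\<Sum>k=1..\<xi> i. 1 / real k\<bar> \<le> real (particle_number \<xi>) + 1" by (simp add: sum_nonneg)
      have "\<bar>\<Sum>k=1..\<xi> i. 1 / real k\<bar> * (\<bar>g \<xi>\<bar> * \<bar>f \<xi>\<bar>) \<le> (real (particle_number \<xi>) + 1) * (z ^ particle_number \<xi> * \<bar>f \<xi>\<bar>)"
        by (intro mult_mono h g) (use z in auto)
      then show "norm ((\<Sum>k=1..\<xi> i. 1 / real k) * (g \<xi> * f \<xi>)) \<le> (real (particle_number \<xi>) + 1) * z ^ particle_number \<xi> * \<bar>f \<xi>\<bar>"
        by (simp add: abs_mult mult.assoc)
    qed simp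
    then show ?thesis by (rule abs_summable_summable)
  qed
  have ji: "j \<noteq> i" using ij by simp
  note A = move_particles_reversal[OF ij J[OF ij]] and B = move_particles_reversal[OF ji J[OF ji]]
  have e: "w \<xi> * pair_generator i j w' \<xi> =
      (w \<xi> * (\<Sum>k=1..\<xi> i. 1 / real k * w' (move_particles i j k \<xi>)) + w \<xi> * (\<Sum>k=1..\<xi> j. 1 / real k * w' (move_particles j i k \<xi>)))
      + - 1 * ((\<Sum>k=1..\<xi> i. 1 / real k) * (w \<xi> * w' \<xi>) + (\<Sum>k=1..\<xi> j. 1 / real k) * (w \<xi> * w' \<xi>))" for w w' :: "('v \<Rightarrow> nat) \<Rightarrow> real" and \<xi>
  proof -
    have "(\<Sum>k=1..n. 1 / real k * (F k - c)) = (\<Sum>k=1..n. 1 / real k * F k) - (\<Sum>k=1..n. 1 / real k) * c" for n F and c :: real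
      by (simp add: right_diff_distrib sum_subtractf sum_distrib_right)
    then show ?thesis unfolding pair_generator_def by (simp only: ring_distribs) (simp add: mult_ac)
  qed
  have H': "(\<lambda>\<xi>. (\<Sum>k=1..\<xi> i. 1 / real k) * (f \<xi> * g \<xi>)) summable_on UNIV" for i
    using H[of i] by (simp add: mult.commute)
  show "(\<lambda>\<xi>. g \<xi> * pair_generator i j f \<xi>) summable_on UNIV"
    unfolding e by (intro summable_on_cmult_right summable_on_add A B H)
  show "(\<lambda>\<xi>. f \<xi> * pair_generator i j g \<xi>) summable_on UNIV"
    unfolding e by (intro summable_on_cmult_right summable_on_add A B H')
  have fg: "f \<xi> * g \<xi> = g \<xi> * f \<xi>" for \<xi> by (rule mult.commute)
  show "(\<Sum>\<^sub>\<infinity>\<xi>. g \<xi> * pair_generator i j f \<xi>) = (\<Sum>\<^sub>\<infinity>\<xi>. f \<xi> * pair_generator i j g \<xi>)"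
    unfolding e
    by (subst (1 2) infsum_add; (intro summable_on_cmult_right summable_on_add A B H H')?)
       (simp only: infsum_cmult_right' infsum_add A B fg add.commute)
qed

lemma pos_orthant_orthant: "\<theta> \<in> pos_orthant \<Longrightarrow> \<theta> \<in> orthant"
  by (auto simp: pos_orthant_def orthant_def less_imp_le)

lemma move_parameter_pos_orthant:
  assumes "\<theta> \<in> pos_orthant" "i \<noteq> j" "0 < u" "u < 1"
  shows "move_parameter i j u \<theta> \<in> pos_orthant"
  using assms by (auto simp: pos_orthant_def move_parameter_component intro!: add_pos_pos)

text \<open>Exchanging the sum over configurations with the integral over u leaves the duality for a
  single tensor inside. The domination is the jump bound uniform in u.\<close>

lemma hidden_pair_geometric_intertwiner:
  fixes f :: "('v::finite \<Rightarrow> nat) \<Rightarrow> real"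
  assumes f: "\<forall>\<theta>\<in>pos_orthant. integrable (geometric_product \<theta>) f" and \<theta>: "\<theta> \<in> pos_orthant" and ij: "i \<noteq> j"
  defines "G \<equiv> geometric_intertwiner f"
  shows "(LBINT u:{0<..<1}. 1 / u * ((G (move_parameter i j u \<theta>) - G \<theta>) + (G (move_parameter j i u \<theta>) - G \<theta>)))
     = (\<integral>\<xi>. f \<xi> * pair_generator i j (\<lambda>\<xi>. tensor geometric_weight \<xi> \<theta>) \<xi> \<partial>count_space UNIV)"
proof -
  let ?\<Phi> = "\<lambda>\<xi> \<theta>. tensor geometric_weight \<xi> \<theta>"
  have ji: "j \<noteq> i" using ij by simp
  note \<theta>o = pos_orthant_orthant[OF \<theta>]
  \<comment> \<open>A common upper bound for all coordinates, inherited by their convex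
    combinations.\<close>
  define T where "T = 1 + (\<Sum>i\<in>UNIV. \<theta> $ i)"
  have T: "0 < T" "\<theta> $ i \<le> T" for i
    using \<theta>o member_le_sum[of i UNIV "\<lambda>i. \<theta> $ i"]
    by (auto simp: T_def orthant_def intro!: add_pos_nonneg sum_nonneg)
  define z where "z = T / (1 + T)"
  have z: "0 < z" "z < 1" using T by (auto simp: z_def)
  have Gi: "integrable (count_space UNIV) (\<lambda>\<xi>. ?\<Phi> \<xi> \<theta>' * f \<xi>)" "G \<theta>' = (\<integral>\<xi>. ?\<Phi> \<xi> \<theta>' * f \<xi> \<partial>count_space UNIV)" if "\<theta>' \<in> pos_orthant" for \<theta>'
  proof -
    have s: "(\<lambda>\<xi>. ?\<Phi> \<xi> \<theta>' * f \<xi>) summable_on UNIV"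
      using f that geometric_product_summable(1)[OF pos_orthant_orthant[OF that]] by blast
    then show "integrable (count_space UNIV) (\<lambda>\<xi>. ?\<Phi> \<xi> \<theta>' * f \<xi>)" unfolding count_space_summable(1) .
    show "G \<theta>' = (\<integral>\<xi>. ?\<Phi> \<xi> \<theta>' * f \<xi> \<partial>count_space UNIV)"
      unfolding G_def geometric_intertwiner_def geometric_product_summable(2)[OF pos_orthant_orthant[OF that] s]
      by (rule count_space_summable(2)[OF s, symmetric])
  qed
  define K where "K \<xi> u = indicator {0<..<1} u * (1 / u * ((?\<Phi> \<xi> (move_parameter i j u \<theta>) - ?\<Phi> \<xi> \<theta>) + (?\<Phi> \<xi> (move_parameter j i u \<theta>) - ?\<Phi> \<xi> \<theta>)))" for \<xi> and u :: real
  have Ki: "integrable lborel (K \<xi>)" and KI: "(\<integral>u. K \<xi> u \<partial>lborel) = pair_generator i j (\<lambda>\<xi>. ?\<Phi> \<xi> \<theta>) \<xi>" for \<xi>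
    using hidden_pair_tensor[OF ij \<theta>o, of 1 \<xi>]
    by (simp_all add: K_def[abs_def] set_integrable_def set_lebesgue_integral_def)
  have Kb: "\<bar>K \<xi> u\<bar> \<le> indicator {0<..<1} u * (2 * (T / z) * ((real (particle_number \<xi>) + 1) * z ^ particle_number \<xi>))" for \<xi> u
  proof (cases "u \<in> {0<..<1}")
    case True
    then have u: "0 < u" "u < 1" by auto
    have "\<bar>1 / u * (?\<Phi> \<xi> (move_parameter i j u \<theta>) - ?\<Phi> \<xi> \<theta>) + 1 / u * (?\<Phi> \<xi> (move_parameter j i u \<theta>) - ?\<Phi> \<xi> \<theta>)\<bar>
        \<le> T / z * ((real (particle_number \<xi>) + 1) * z ^ particle_number \<xi>) + T / z * ((real (particle_number \<xi>) + 1) * z ^ particle_number \<xi>)"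
      unfolding z_def
      by (rule order_trans[OF abs_triangle_ineq add_mono[OF hidden_jump_geometric_bound[OF \<theta>o T ij u] hidden_jump_geometric_bound[OF \<theta>o T ji u]]])
    moreover have "K \<xi> u = 1 / u * (?\<Phi> \<xi> (move_parameter i j u \<theta>) - ?\<Phi> \<xi> \<theta>) + 1 / u * (?\<Phi> \<xi> (move_parameter j i u \<theta>) - ?\<Phi> \<xi> \<theta>)"
      unfolding K_def distrib_left[symmetric] using True by simp
    ultimately have "\<bar>K \<xi> u\<bar> \<le> T / z * ((real (particle_number \<xi>) + 1) * z ^ particle_number \<xi>) + T / z * ((real (particle_number \<xi>) + 1) * z ^ particle_number \<xi>)"
      by (simp only:)
    also have "\<dots> = indicator {0<..<1} u * (2 * (T / z) * ((real (particle_number \<xi>) + 1) * z ^ particle_number \<xi>))"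
      unfolding indicator_simps(1)[OF True] by (simp only: mult_2[symmetric] mult.assoc mult_1)
    finally show ?thesis .
  qed (simp add: K_def)
  interpret C: sigma_finite_measure "count_space (UNIV :: ('v \<Rightarrow> nat) set)" by (rule sigma_finite_measure_count_space)
  interpret P: pair_sigma_finite "count_space (UNIV :: ('v \<Rightarrow> nat) set)" "lborel :: real measure" ..
  have int: "integrable (count_space UNIV \<Otimes>\<^sub>M lborel) (\<lambda>(\<xi>, u). K \<xi> u * f \<xi>)"
  proof (rule P.Fubini_integrable)
    show "(\<lambda>(\<xi>, u). K \<xi> u * f \<xi>) \<in> borel_measurable (count_space UNIV \<Otimes>\<^sub>M lborel)"
    proof (rule measurable_pair_measure_countable1)
      fix \<xi>
      have "K \<xi> \<in> borel_measurable lborel" using Ki[of \<xi>] by auto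
      then show "(\<lambda>u. case (\<xi>, u) of (\<xi>, u) \<Rightarrow> K \<xi> u * f \<xi>) \<in> borel_measurable lborel" by simp
    qed simp
    show "AE \<xi> in count_space UNIV. integrable lborel (\<lambda>u. case (\<xi>, u) of (\<xi>, u) \<Rightarrow> K \<xi> u * f \<xi>)"
      using Ki by simp
    have s: "integrable (count_space UNIV) (\<lambda>\<xi>. 2 * (T / z) * ((real (particle_number \<xi>) + 1) * z ^ particle_number \<xi> * \<bar>f \<xi>\<bar>))"
      unfolding count_space_summable(1) by (intro summable_on_cmult_right summable_weighted[OF f z])
    show "integrable (count_space UNIV) (\<lambda>\<xi>. \<integral>u. norm (case (\<xi>, u) of (\<xi>, u) \<Rightarrow> K \<xi> u * f \<xi>) \<partial>lborel)"
    proof (rule Bochner_Integration.integrable_bound[OF s])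
      show "AE \<xi> in count_space UNIV. norm (\<integral>u. norm (case (\<xi>, u) of (\<xi>, u) \<Rightarrow> K \<xi> u * f \<xi>) \<partial>lborel)
          \<le> norm (2 * (T / z) * ((real (particle_number \<xi>) + 1) * z ^ particle_number \<xi> * \<bar>f \<xi>\<bar>))"
      proof (rule AE_I2)
        fix \<xi>
        have "(\<integral>u. norm (K \<xi> u * f \<xi>) \<partial>lborel) \<le> (\<integral>u. indicator {0<..<1::real} u * (2 * (T / z) * ((real (particle_number \<xi>) + 1) * z ^ particle_number \<xi>)) * \<bar>f \<xi>\<bar> \<partial>lborel)"
        proof (rule integral_mono)
          show "integrable lborel (\<lambda>u. norm (K \<xi> u * f \<xi>))" using Ki by (intro integrable_norm) auto
          show "integrable lborel (\<lambda>u::real. indicator {0<..<1} u * (2 * (T / z) * ((real (particle_number \<xi>) + 1) * z ^ particle_number \<xi>)) * \<bar>f \<xi>\<bar>)"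
            by (intro integrable_mult_left integrable_real_indicator) auto
          show "norm (K \<xi> u * f \<xi>) \<le> indicator {0<..<1} u * (2 * (T / z) * ((real (particle_number \<xi>) + 1) * z ^ particle_number \<xi>)) * \<bar>f \<xi>\<bar>" for u
            unfolding real_norm_def abs_mult by (rule mult_right_mono[OF Kb]) simp
        qed
        also have "\<dots> = 2 * (T / z) * ((real (particle_number \<xi>) + 1) * z ^ particle_number \<xi> * \<bar>f \<xi>\<bar>)"
          by (simp add: mult.assoc)
        finally show "norm (\<integral>u. norm (case (\<xi>, u) of (\<xi>, u) \<Rightarrow> K \<xi> u * f \<xi>) \<partial>lborel)
          \<le> norm (2 * (T / z) * ((real (particle_number \<xi>) + 1) * z ^ particle_number \<xi> * \<bar>f \<xi>\<bar>))"
          using T z by (simp add: abs_mult)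
      qed
    qed simp
  qed
  have "(LBINT u:{0<..<1}. 1 / u * ((G (move_parameter i j u \<theta>) - G \<theta>) + (G (move_parameter j i u \<theta>) - G \<theta>)))
      = (\<integral>u. (\<integral>\<xi>. K \<xi> u * f \<xi> \<partial>count_space UNIV) \<partial>lborel)"
    unfolding set_lebesgue_integral_def
  proof (intro Bochner_Integration.integral_cong refl)
    fix u :: real
    show "indicat_real {0<..<1} u *\<^sub>R (1 / u * ((G (move_parameter i j u \<theta>) - G \<theta>) + (G (move_parameter j i u \<theta>) - G \<theta>)))
        = (\<integral>\<xi>. K \<xi> u * f \<xi> \<partial>count_space UNIV)"
    proof (cases "u \<in> {0<..<1}")
      case True
      then have u: "0 < u" "u < 1" by auto
      note g = Gi[OF \<theta>] Gi[OF move_parameter_pos_orthant[OF \<theta> ij u]] Gi[OF move_parameter_pos_orthant[OF \<theta> ji u]]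
      have "(\<integral>\<xi>. K \<xi> u * f \<xi> \<partial>count_space UNIV) = (\<integral>\<xi>. 1 / u * ((?\<Phi> \<xi> (move_parameter i j u \<theta>) * f \<xi> - ?\<Phi> \<xi> \<theta> * f \<xi>)
           + (?\<Phi> \<xi> (move_parameter j i u \<theta>) * f \<xi> - ?\<Phi> \<xi> \<theta> * f \<xi>)) \<partial>count_space UNIV)"
        using True by (intro Bochner_Integration.integral_cong refl) (simp add: K_def algebra_simps)
      also have "\<dots> = 1 / u * ((G (move_parameter i j u \<theta>) - G \<theta>) + (G (move_parameter j i u \<theta>) - G \<theta>))"
        using g by (simp only: integral_mult_right_zero Bochner_Integration.integral_add Bochner_Integration.integral_diff Bochner_Integration.integrable_diff)
      finally show ?thesis using True by simp
    qed (simp add: K_def)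
  qed
  also have "\<dots> = (\<integral>\<xi>. (\<integral>u. K \<xi> u * f \<xi> \<partial>lborel) \<partial>count_space UNIV)"
    by (rule P.Fubini_integral[OF int])
  also have "\<dots> = (\<integral>\<xi>. f \<xi> * pair_generator i j (\<lambda>\<xi>. ?\<Phi> \<xi> \<theta>) \<xi> \<partial>count_space UNIV)"
    by (simp add: KI mult.commute)
  finally show ?thesis .
qed

text \<open>Symmetry moves each pair generator from f to the geometric weights, where it equals the
  action of the parameter jumps.\<close>

lemma geometric_intertwining:
  fixes f :: "('v::finite \<Rightarrow> nat) \<Rightarrow> real"
  assumes f: "\<forall>\<theta>\<in>pos_orthant. integrable (geometric_product \<theta>) f" and \<theta>: "\<theta> \<in> pos_orthant"
  shows "geometric_intertwiner (discrete_generator p f) \<theta> = hidden_generator p (geometric_intertwiner f) \<theta>"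
proof -
  let ?\<Phi> = "\<lambda>\<xi>. tensor geometric_weight \<xi> \<theta>"
  note \<theta>o = pos_orthant_orthant[OF \<theta>]
  define T where "T = 1 + (\<Sum>i\<in>UNIV. \<theta> $ i)"
  have T: "0 < T" "\<theta> $ i \<le> T" for i
    using \<theta>o member_le_sum[of i UNIV "\<lambda>i. \<theta> $ i"]
    by (auto simp: T_def orthant_def intro!: add_pos_nonneg sum_nonneg)
  define z where "z = T / (1 + T)"
  have z: "0 < z" "z < 1" "0 \<le> z" using T by (auto simp: z_def)
  have g: "\<bar>?\<Phi> \<xi>\<bar> \<le> z ^ particle_number \<xi>" for \<xi>
    using tensor_geometric_le_power[OF \<theta>o T(2), of \<xi>] tensor_geometric_nonneg[OF \<theta>o, of \<xi>] by (simp add: z_def)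
  note S = pair_generator_symmetric[OF _ z(3) summable_weighted[OF f z(1,2)] g]
  have pi: "integrable (geometric_product \<theta>) (pair_generator i j f)" if "i \<noteq> j" for i j
    unfolding geometric_product_summable(1)[OF \<theta>o] by (rule S(1)[OF that])
  have pe: "(\<integral>\<eta>. pair_generator i j f \<eta> \<partial>geometric_product \<theta>) = (\<integral>\<xi>. f \<xi> * pair_generator i j ?\<Phi> \<xi> \<partial>count_space UNIV)" if ij: "i \<noteq> j" for i j
    unfolding geometric_product_summable(2)[OF \<theta>o S(1)[OF ij]] S(3)[OF ij] count_space_summable(2)[OF S(2)[OF ij]] ..
  have "geometric_intertwiner (discrete_generator p f) \<theta> = (\<integral>\<eta>. (\<Sum>i\<in>UNIV. \<Sum>j\<in>UNIV - {i}. p i j * pair_generator i j f \<eta>) \<partial>geometric_product \<theta>)"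
    unfolding geometric_intertwiner_def discrete_generator_pair ..
  also have "\<dots> = (\<Sum>i\<in>UNIV. \<integral>\<eta>. (\<Sum>j\<in>UNIV - {i}. p i j * pair_generator i j f \<eta>) \<partial>geometric_product \<theta>)"
    by (rule Bochner_Integration.integral_sum) (auto intro!: Bochner_Integration.integrable_sum integrable_mult_right pi)
  also have "\<dots> = (\<Sum>i\<in>UNIV. \<Sum>j\<in>UNIV - {i}. p i j * (\<integral>\<eta>. pair_generator i j f \<eta> \<partial>geometric_product \<theta>))"
    by (intro sum.cong refl) (subst Bochner_Integration.integral_sum; auto intro!: integrable_mult_right pi)
  also have "\<dots> = hidden_generator p (geometric_intertwiner f) \<theta>"
    unfolding hidden_generator_def
  proof (intro sum.cong refl arg_cong2[of _ _ _ _ "(*)"])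
    fix i j :: 'v assume "j \<in> UNIV - {i}"
    then have ij: "i \<noteq> j" by auto
    show "(\<integral>\<eta>. pair_generator i j f \<eta> \<partial>geometric_product \<theta>) =
       (LBINT u:{0<..<1}. 1 / u * ((geometric_intertwiner f (move_parameter i j u \<theta>) - geometric_intertwiner f \<theta>) +
          (geometric_intertwiner f (move_parameter j i u \<theta>) - geometric_intertwiner f \<theta>)))"
      by (simp only: pe[OF ij] hidden_pair_geometric_intertwiner[OF f \<theta> ij])
  qed
  finally show ?thesis .
qed

section \<open>Exponential densities under parameter updates\<close>

text \<open>The common kernel of both sides of the exponential intertwining: it arises from a
  parameter jump on integrating over u, and from mass jumps as a density ratio minus 1, divided by
  the transported amount.\<close>

definition exprel :: "real \<Rightarrow> real" where
  "exprel z = (if z = 0 then 1 else (exp z - 1) / z)"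

lemma exprel_mult: "exprel z * z = exp z - 1"
  by (simp add: exprel_def)

lemma isCont_exprel: "isCont exprel z"
proof (cases "z = 0")
  case True
  have "((\<lambda>h. (exp (0 + h) - exp 0) / h) \<longlongrightarrow> exp 0) (at (0::real))"
    using DERIV_exp[of "0::real"] unfolding DERIV_def .
  then have "((\<lambda>h. (exp h - 1) / h) \<longlongrightarrow> 1) (at (0::real))" by simp
  then have "(exprel \<longlongrightarrow> 1) (at 0)"
    by (rule Lim_transform_eventually) (auto simp: exprel_def eventually_at_filter)
  then show ?thesis using True by (simp add: isCont_def exprel_def)
next
  case False
  have "isCont (\<lambda>z. (exp z - 1) / z) z" using False by (intro continuous_intros)
  moreover have "\<forall>\<^sub>F w in nhds z. exprel w = (exp w - 1) / w"
    using t1_space_nhds[OF False] by (auto simp: exprel_def elim: eventually_mono)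
  ultimately show ?thesis by (simp add: isCont_cong)
qed

lemma exprel_antiderivative: "\<exists>Ein. \<forall>z. (Ein has_real_derivative exprel z) (at z)"
  using einterval_antiderivative[of "-\<infinity>" "\<infinity>" exprel] isCont_exprel
  by (auto simp: has_real_derivative_iff_has_vector_derivative)

text \<open>Determined only up to an additive constant; only its increments are used.\<close>

definition Ein :: "real \<Rightarrow> real" where
  "Ein = (SOME F. \<forall>z. (F has_real_derivative exprel z) (at z))"

lemma DERIV_Ein: "(Ein has_real_derivative exprel z) (at z)"
  using someI_ex[OF exprel_antiderivative] unfolding Ein_def by blast

lemma integral_exprel_kernel:
  fixes a c :: real
  assumes a: "0 \<le> a"
  shows "integrable lborel (\<lambda>v. if 0 < v \<and> v \<le> a then (exp (c * v) - 1) / v else 0)"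
    and "(\<integral>v. (if 0 < v \<and> v \<le> a then (exp (c * v) - 1) / v else 0) \<partial>lborel) = Ein (c * a) - Ein 0"
proof -
  have d: "((\<lambda>v. Ein (c * v)) has_real_derivative exprel (c * v) * c) (at v)" for v
    by (rule DERIV_chain2[OF DERIV_Ein]) (auto intro!: derivative_eq_intros)
  have "has_bochner_integral lborel (\<lambda>v. (exprel (c * v) * c) * indicator {0..a} v) (Ein (c * a) - Ein (c * 0))"
    by (rule has_bochner_integral_FTC_Icc_real[OF a d])
       (auto intro!: continuous_intros isCont_o2[OF _ isCont_exprel])
  then have 1: "has_bochner_integral lborel (\<lambda>v. (exprel (c * v) * c) * indicator {0..a} v) (Ein (c * a) - Ein 0)"
    by simp
  have e: "AE v in lborel. (exprel (c * v) * c) * indicator {0..a} v = (if 0 < v \<and> v \<le> a then (exp (c * v) - 1) / v else 0)"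
    using AE_lborel_singleton[of "0::real"]
  proof eventually_elim
    case (elim v)
    have "exprel (c * v) * c * v = exp (c * v) - 1" using exprel_mult[of "c * v"] by (simp add: mult.assoc)
    then have "exprel (c * v) * c = (exp (c * v) - 1) / v" using elim by (simp add: field_simps)
    then show ?case using elim by (auto simp: indicator_def)
  qed
  have m: "(\<lambda>v. if 0 < v \<and> v \<le> a then (exp (c * v) - 1) / v else 0) \<in> borel_measurable lborel"
    by measurable
  show "integrable lborel (\<lambda>v. if 0 < v \<and> v \<le> a then (exp (c * v) - 1) / v else 0)"
    using 1 e m by (auto simp: has_bochner_integral_iff intro: Bochner_Integration.integrable_cong_AE_imp)
  show "(\<integral>v. (if 0 < v \<and> v \<le> a then (exp (c * v) - 1) / v else 0) \<partial>lborel) = Ein (c * a) - Ein 0"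
    using 1 integral_cong_AE[OF _ m e] by (auto simp: has_bochner_integral_iff)
qed

text \<open>The exponential density continued to negative arguments, hence smooth in
  \<open>a\<close>; the restriction to the orthant is carried by the function it is multiplied
  with.\<close>

definition exponential_weight :: "real \<Rightarrow> real \<Rightarrow> real" where
  "exponential_weight \<theta> a = 1 / \<theta> * exp (- (a / \<theta>))"

text \<open>Relative to its value at s, the weight at \<theta>(u) = (1-u)s + ut is (s/\<theta>) e^z
  with z = a(1/s - 1/\<theta>). After division by u the part with e^z - 1 is \<open>exprel z\<close>
  times dz/du, and the rest is the derivative of -ln \<theta>. The former integrates to an increment
  of \<open>Ein\<close>, the latter to a logarithm that cancels once the reverse jump is
  added.\<close>

lemma exponential_weight_update:
  fixes s t a :: real
  assumes s: "0 < s" and t: "0 < t"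
  defines "k \<equiv> \<lambda>u. 1 / u * (exponential_weight ((1 - u) * s + u * t) a - exponential_weight s a)"
  shows "set_integrable lborel {0<..<1} k"
    and "(LBINT u:{0<..<1}. k u) = exponential_weight s a * (Ein (a * (1 / s - 1 / t)) - Ein 0 + ln s - ln t)"
proof -
  define \<theta> where "\<theta> u = (1 - u) * s + u * t" for u
  define z where "z u = a * (1 / s - 1 / \<theta> u)" for u
  define F where "F u = exponential_weight s a * (Ein (z u) - ln (\<theta> u))" for u
  define h where "h u = exponential_weight s a * (exprel (z u) * (a * ((t - s) / (\<theta> u)\<^sup>2)) - (t - s) / \<theta> u)" for u
  have \<theta>: "0 < \<theta> u" if "0 \<le> u" "u \<le> 1" for u
    using convex_bound_lt[of "- s" 0 "- t" "1 - u" u] s t that by (simp add: \<theta>_def algebra_simps)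
  have c\<theta>: "continuous_on {0..1} \<theta>" unfolding \<theta>_def by (intro continuous_intros)
  have nz: "\<forall>u\<in>{0..1}. \<theta> u \<noteq> 0" "\<forall>u\<in>{0..1}. (\<theta> u)\<^sup>2 \<noteq> 0" using \<theta> by force+
  have cz: "continuous_on {0..1} z" unfolding z_def by (intro continuous_intros c\<theta> nz)
  have ce: "continuous_on UNIV exprel" by (intro continuous_at_imp_continuous_on ballI isCont_exprel)
  have cont: "continuous_on {0..1} h"
    unfolding h_def by (intro continuous_intros c\<theta> nz continuous_on_compose2[OF ce cz]) auto
  have d\<theta>: "(\<theta> has_real_derivative (t - s)) (at u)" for u
    unfolding \<theta>_def[abs_def] by (auto intro!: derivative_eq_intros)
  have dz: "(z has_real_derivative a * ((t - s) / (\<theta> u)\<^sup>2)) (at u)" if "0 \<le> u" "u \<le> 1" for u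
  proof -
    have "- ((s - t) * a / q) = a * (t - s) / q" for q :: real
      by (cases "q = 0") (auto simp: field_simps)
    then show ?thesis
      unfolding z_def[abs_def] using \<theta>[OF that]
      by (auto intro!: derivative_eq_intros d\<theta> simp: power2_eq_square)
  qed
  have dF: "(F has_real_derivative h u) (at u)" if u: "0 \<le> u" "u \<le> 1" for u
  proof -
    have "((\<lambda>u. Ein (z u)) has_real_derivative exprel (z u) * (a * ((t - s) / (\<theta> u)\<^sup>2))) (at u)"
      by (rule DERIV_chain2[OF DERIV_Ein dz[OF u]])
    moreover have "((\<lambda>u. ln (\<theta> u)) has_real_derivative (t - s) / \<theta> u) (at u)"
      using \<theta>[OF u] by (auto intro!: derivative_eq_intros d\<theta>)
    ultimately show ?thesis
      unfolding F_def[abs_def] h_def by (intro DERIV_cmult DERIV_diff)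
  qed
  have eq: "k u = h u" if u: "0 < u" "u < 1" for u
  proof -
    have \<theta>0: "0 < \<theta> u" using \<theta>[of u] u by auto
    have \<theta>u: "\<theta> u = s + u * (t - s)" by (simp add: \<theta>_def algebra_simps)
    have "1 / s - 1 / \<theta> u = u * (t - s) / (s * \<theta> u)"
      using \<theta>0 s by (simp add: divide_simps) (simp add: \<theta>u algebra_simps)
    then have "a * ((t - s) / (\<theta> u)\<^sup>2) = z u * (s / (u * \<theta> u))"
      using u \<theta>0 s by (simp add: z_def power2_eq_square)
    then have "exprel (z u) * (a * ((t - s) / (\<theta> u)\<^sup>2)) = (exprel (z u) * z u) * (s / (u * \<theta> u))"
      by (simp only: mult.assoc)
    then have "h u = exponential_weight s a * ((exp (z u) - 1) * (s / (u * \<theta> u)) - (t - s) / \<theta> u)"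
      unfolding h_def exprel_mult by simp
    also have "\<dots> = 1 / u * ((exponential_weight s a * exp (z u)) * (s / \<theta> u) - exponential_weight s a * ((s + u * (t - s)) / \<theta> u))"
      using u \<theta>0 by (simp add: field_simps)
    also have "exponential_weight s a * exp (z u) = 1 / s * exp (- (a / \<theta> u))"
      by (simp add: exponential_weight_def z_def mult_exp_exp right_diff_distrib)
    also have "1 / s * exp (- (a / \<theta> u)) * (s / \<theta> u) = exponential_weight (\<theta> u) a"
      using s by (simp add: exponential_weight_def)
    also have "(s + u * (t - s)) / \<theta> u = 1" using \<theta>0 by (simp add: \<theta>u)
    finally show ?thesis by (simp add: k_def \<theta>_def)
  qed
  note * = LBINT_unit_interval_FTC[OF cont dF eq]
  show "set_integrable lborel {0<..<1} k" by (rule *)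
  have "(LBINT u:{0<..<1}. k u) = F 1 - F 0" by (rule *)
  then show "(LBINT u:{0<..<1}. k u) = exponential_weight s a * (Ein (a * (1 / s - 1 / t)) - Ein 0 + ln s - ln t)"
    using s by (simp add: F_def z_def \<theta>_def algebra_simps)
qed

text \<open>The derivative in the parameter w is e^(-a/w) (a/w^3 - 1/w^2). The powers are estimated
  at the smallest mean l and the exponential at the largest mean m; the decay e^(-a/m) decides at
  which parameter f has to be integrable.\<close>

lemma exponential_weight_lipschitz:
  assumes l: "0 < l" and x: "l \<le> x" "x \<le> m" and y: "l \<le> y" "y \<le> m" and a: "0 \<le> a"
  shows "\<bar>exponential_weight x a - exponential_weight y a\<bar> \<le> (1 / l\<^sup>2 + 1 / l ^ 3) * (1 + a) * exp (- (a / m)) * \<bar>x - y\<bar>"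
proof -
  define g where "g w = - (1 / w\<^sup>2) * exp (- (a / w)) + 1 / w * (exp (- (a / w)) * (a / w\<^sup>2))" for w
  have d: "((\<lambda>w. exponential_weight w a) has_real_derivative g w) (at w within {l..m})" if "w \<in> {l..m}" for w
  proof -
    have w: "w \<noteq> 0" using that l by auto
    have 1: "((\<lambda>w. 1 / w) has_real_derivative - (1 / w\<^sup>2)) (at w within {l..m})"
      using w by (auto intro!: derivative_eq_intros simp: power2_eq_square)
    have "((\<lambda>w. - (a / w)) has_real_derivative a / w\<^sup>2) (at w within {l..m})"
      using w by (auto intro!: derivative_eq_intros simp: power2_eq_square)
    then have 2: "((\<lambda>w. exp (- (a / w))) has_real_derivative exp (- (a / w)) * (a / w\<^sup>2)) (at w within {l..m})"
      by (rule DERIV_chain2[OF DERIV_exp])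
    show ?thesis
      unfolding exponential_weight_def g_def
      by (rule DERIV_cong[OF DERIV_mult[OF 1 2]]) simp
  qed
  have b: "norm (g w) \<le> (1 / l\<^sup>2 + 1 / l ^ 3) * (1 + a) * exp (- (a / m))" if "w \<in> {l..m}" for w
  proof -
    have w: "0 < w" "l \<le> w" "w \<le> m" using that l by auto
    have e: "exp (- (a / w)) \<le> exp (- (a / m))" using w a by (simp add: frac_le)
    have p: "1 / w\<^sup>2 \<le> 1 / l\<^sup>2" "1 / w ^ 3 \<le> 1 / l ^ 3" using w l by (auto intro!: divide_left_mono power_mono mult_pos_pos)
    have "norm (g w) \<le> 1 / w\<^sup>2 * exp (- (a / w)) + 1 / w ^ 3 * a * exp (- (a / w))"
    proof -
      have "g w = 1 / w ^ 3 * a * exp (- (a / w)) - 1 / w\<^sup>2 * exp (- (a / w))"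
        using w by (simp add: g_def power2_eq_square power3_eq_cube mult_ac)
      moreover have "0 \<le> 1 / w ^ 3 * a * exp (- (a / w))" "0 \<le> 1 / w\<^sup>2 * exp (- (a / w))" using w a by auto
      ultimately show ?thesis unfolding real_norm_def by linarith
    qed
    also have "\<dots> \<le> (1 / l\<^sup>2 + 1 / l ^ 3) * 1 * exp (- (a / m)) + (1 / l\<^sup>2 + 1 / l ^ 3) * a * exp (- (a / m))"
    proof -
      have "0 \<le> 1 / l\<^sup>2" "0 \<le> 1 / l ^ 3" using l by auto
      then have "1 / w\<^sup>2 \<le> 1 / l\<^sup>2 + 1 / l ^ 3" "1 / w ^ 3 \<le> 1 / l\<^sup>2 + 1 / l ^ 3" "0 \<le> 1 / l\<^sup>2 + 1 / l ^ 3"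
        using p by linarith+
      then have "1 / w\<^sup>2 * exp (- (a / w)) \<le> (1 / l\<^sup>2 + 1 / l ^ 3) * exp (- (a / m))"
        and "1 / w ^ 3 * a * exp (- (a / w)) \<le> (1 / l\<^sup>2 + 1 / l ^ 3) * a * exp (- (a / m))"
        using a by (intro mult_mono[OF _ e] mult_right_mono; simp)+
      then show ?thesis unfolding mult_1_right by (rule add_mono)
    qed
    also have "\<dots> = (1 / l\<^sup>2 + 1 / l ^ 3) * (1 + a) * exp (- (a / m))" by (simp only: distrib_left distrib_right)
    finally show ?thesis .
  qed
  have "norm (exponential_weight x a - exponential_weight y a) \<le> (1 / l\<^sup>2 + 1 / l ^ 3) * (1 + a) * exp (- (a / m)) * norm (x - y)"
    by (rule field_differentiable_bound[of "{l..m}" "\<lambda>w. exponential_weight w a" g]) (use d b x y in auto)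
  then show ?thesis by simp
qed

section \<open>Densities of exponential products with respect to Lebesgue measure\<close>

definition exponential_density_product :: "real^'v::finite \<Rightarrow> real^'v \<Rightarrow> real" where
  "exponential_density_product \<theta> \<zeta> = (\<Prod>i\<in>UNIV. exponential_weight (\<theta> $ i) (\<zeta> $ i))"

lemma lborel_vec: "distr (\<Pi>\<^sub>M i\<in>UNIV. lborel) borel (\<lambda>x. \<chi> i. x i) = (lborel :: (real^'v::finite) measure)"
proof (rule lborel_eqI[symmetric])
  interpret product_sigma_finite "\<lambda>i :: 'v. lborel :: real measure" by standard
  have c: "(\<lambda>x. x i) \<in> borel_measurable (\<Pi>\<^sub>M i\<in>UNIV. lborel :: real measure)" for i :: 'v
    using measurable_component_singleton[of i UNIV "\<lambda>i. lborel :: real measure"] by simp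
  have v: "(\<lambda>x. (\<chi> i. x i) :: real^'v) \<in> borel_measurable (\<Pi>\<^sub>M i\<in>UNIV. lborel)"
    by (rule borel_measurable_vec_lambda) (rule c)
  fix l u :: "real^'v" assume lu: "\<And>b. b \<in> Basis \<Longrightarrow> l \<bullet> b \<le> u \<bullet> b"
  have lu': "l $ i \<le> u $ i" for i
    using lu[of "axis i 1"] by (simp add: axis_in_Basis_iff inner_axis)
  have "emeasure (distr (\<Pi>\<^sub>M i\<in>UNIV. lborel) borel (\<lambda>x. (\<chi> i. x i) :: real^'v)) (box l u)
      = emeasure (\<Pi>\<^sub>M i\<in>UNIV. lborel) (Pi\<^sub>E UNIV (\<lambda>i. {l $ i <..< u $ i}))"
    by (subst emeasure_distr[OF v]) (auto simp: space_PiM PiE_def mem_box_cart Pi_def intro!: arg_cong[where f="emeasure _"])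
  also have "\<dots> = (\<Prod>i\<in>UNIV. emeasure lborel {l $ i <..< u $ i})"
    by (rule emeasure_PiM) auto
  also have "\<dots> = (\<Prod>i\<in>UNIV. ennreal (u $ i - l $ i))"
    using lu' by simp
  also have "\<dots> = ennreal (\<Prod>i\<in>UNIV. u $ i - l $ i)"
    using lu' by (intro prod_ennreal) simp
  also have "(\<Prod>i\<in>UNIV. u $ i - l $ i) = (\<Prod>b\<in>Basis. (u - l) \<bullet> b)"
  proof -
    have B: "(Basis :: (real^'v) set) = (\<lambda>i. axis i 1) ` UNIV" by (auto simp: Basis_vec_def)
    have "inj (\<lambda>i :: 'v. axis i (1::real))" by (auto simp: inj_on_def axis_eq_axis)
    then show ?thesis unfolding B by (subst prod.reindex) (auto simp: inner_axis)
  qed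
  finally show "emeasure (distr (\<Pi>\<^sub>M i\<in>UNIV. lborel) borel (\<lambda>x. (\<chi> i. x i) :: real^'v)) (box l u) = (\<Prod>b\<in>Basis. (u - l) \<bullet> b)" .
qed simp

lemma exponential_product_density:
  fixes \<theta> :: "real^'v::finite"
  assumes \<theta>: "\<theta> \<in> pos_orthant"
  shows "exponential_product \<theta> = restrict_space (density lborel (\<lambda>\<zeta>. \<Prod>i\<in>UNIV. ennreal (exponential_density (1 / \<theta> $ i) (\<zeta> $ i)))) orthant"
proof -
  let ?d = "\<lambda>i x. ennreal (exponential_density (1 / \<theta> $ i) x)"
  interpret L: product_sigma_finite "\<lambda>i :: 'v. lborel :: real measure" by standard
  have pos: "0 < \<theta> $ i" for i using \<theta> by (simp add: pos_orthant_def)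
  have law: "exponential_law (\<theta> $ i) = density lborel (?d i)" for i
    using pos[of i] by (simp add: exponential_law_def)
  interpret E: product_prob_space "\<lambda>i. exponential_law (\<theta> $ i)" UNIV
    using pos by (intro product_prob_spaceI prob_space_exponential_law) (simp add: less_imp_le)
  have c: "(\<lambda>x. x i) \<in> borel_measurable (\<Pi>\<^sub>M i\<in>UNIV. lborel :: real measure)" for i :: 'v
    using measurable_component_singleton[of i UNIV "\<lambda>i. lborel :: real measure"] by simp
  have v: "(\<lambda>x. (\<chi> i. x i) :: real^'v) \<in> borel_measurable (\<Pi>\<^sub>M i\<in>UNIV. lborel)"
    by (rule borel_measurable_vec_lambda) (rule c)
  have dm: "(\<lambda>x. \<Prod>i\<in>UNIV. ?d i (x i)) \<in> borel_measurable (\<Pi>\<^sub>M i\<in>UNIV. lborel :: real measure)"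
    by (intro borel_measurable_prod_ennreal measurable_compose[OF c]) measurable
  have P: "(\<Pi>\<^sub>M i\<in>UNIV. exponential_law (\<theta> $ i)) = density (\<Pi>\<^sub>M i\<in>UNIV. lborel) (\<lambda>x. \<Prod>i\<in>UNIV. ?d i (x i))"
  proof (rule E.PiM_eqI[symmetric])
    show "sets (density (\<Pi>\<^sub>M i\<in>UNIV. lborel) (\<lambda>x. \<Prod>i\<in>UNIV. ?d i (x i))) = sets (\<Pi>\<^sub>M i\<in>UNIV. exponential_law (\<theta> $ i))"
      by (simp cong: sets_PiM_cong)
    fix A assume "\<And>i :: 'v. i \<in> UNIV \<Longrightarrow> A i \<in> sets (exponential_law (\<theta> $ i))"
    then have A: "A i \<in> sets borel" for i by simp
    have "emeasure (density (\<Pi>\<^sub>M i\<in>UNIV. lborel) (\<lambda>x. \<Prod>i\<in>UNIV. ?d i (x i))) (Pi\<^sub>E UNIV A)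
       = (\<integral>\<^sup>+x. (\<Prod>i\<in>UNIV. ?d i (x i)) * indicator (Pi\<^sub>E UNIV A) x \<partial>(\<Pi>\<^sub>M i\<in>UNIV. lborel))"
      by (rule emeasure_density[OF dm]) (use A in \<open>auto intro!: sets_PiM_I_finite\<close>)
    also have "\<dots> = (\<integral>\<^sup>+x. (\<Prod>i\<in>UNIV. ?d i (x i) * indicator (A i) (x i)) \<partial>(\<Pi>\<^sub>M i\<in>UNIV. lborel))"
    proof (rule nn_integral_cong)
      fix x :: "'v \<Rightarrow> real"
      have "(indicator (Pi\<^sub>E UNIV A) x :: ennreal) = (\<Prod>i\<in>UNIV. indicator (A i) (x i))"
        by (auto simp: indicator_def PiE_def Pi_def prod_zero_iff)
      then show "(\<Prod>i\<in>UNIV. ?d i (x i)) * indicator (Pi\<^sub>E UNIV A) x = (\<Prod>i\<in>UNIV. ?d i (x i) * indicator (A i) (x i))"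
        by (simp add: prod.distrib)
    qed
    also have "\<dots> = (\<Prod>i\<in>UNIV. \<integral>\<^sup>+x. ?d i x * indicator (A i) x \<partial>lborel)"
      by (rule L.product_nn_integral_prod) (use A in auto)
    also have "\<dots> = (\<Prod>i\<in>UNIV. emeasure (exponential_law (\<theta> $ i)) (A i))"
      unfolding law using A by (intro prod.cong refl emeasure_density[symmetric]) auto
    finally show "emeasure (density (\<Pi>\<^sub>M i\<in>UNIV. lborel) (\<lambda>x. \<Prod>i\<in>UNIV. ?d i (x i))) (Pi\<^sub>E UNIV A)
       = (\<Prod>i\<in>UNIV. emeasure (exponential_law (\<theta> $ i)) (A i))" .
  qed simp
  have gm: "(\<lambda>\<zeta>. \<Prod>i\<in>UNIV. ?d i (\<zeta> $ i)) \<in> borel_measurable (borel :: (real^'v) measure)"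
    by (intro borel_measurable_prod_ennreal) measurable
  have "distr (\<Pi>\<^sub>M i\<in>UNIV. exponential_law (\<theta> $ i)) borel (\<lambda>x. (\<chi> i. x i) :: real^'v)
     = density (distr (\<Pi>\<^sub>M i\<in>UNIV. lborel) borel (\<lambda>x. \<chi> i. x i)) (\<lambda>\<zeta>. \<Prod>i\<in>UNIV. ?d i (\<zeta> $ i))"
    unfolding P using density_distr[OF gm v] by simp
  then show ?thesis
    unfolding exponential_product_def lborel_vec by simp
qed

lemma exponential_density_product_eq:
  assumes "\<theta> \<in> pos_orthant" "\<zeta> \<in> orthant"
  shows "(\<Prod>i\<in>UNIV. ennreal (exponential_density (1 / \<theta> $ i) (\<zeta> $ i))) = ennreal (exponential_density_product \<theta> \<zeta>)"
proof -
  have "exponential_density (1 / \<theta> $ i) (\<zeta> $ i) = exponential_weight (\<theta> $ i) (\<zeta> $ i)" for i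
  proof -
    have "\<not> \<zeta> $ i < 0" using assms(2) by (simp add: orthant_def not_less)
    then show ?thesis by (simp add: exponential_density_def exponential_weight_def)
  qed
  then show ?thesis
    unfolding exponential_density_product_def
    using assms by (subst prod_ennreal[symmetric]) (auto simp: exponential_weight_def pos_orthant_def less_imp_le)
qed

lemma borel_measurable_exponential_density_product [measurable]:
  "exponential_density_product \<theta> \<in> borel_measurable borel"
  unfolding exponential_density_product_def[abs_def] exponential_weight_def by measurable

lemma exponential_density_product_pos: "\<theta> \<in> pos_orthant \<Longrightarrow> 0 < exponential_density_product \<theta> \<zeta>"
  unfolding exponential_density_product_def exponential_weight_def
  by (intro prod_pos ballI) (simp add: pos_orthant_def)

lemma nn_integral_exponential_product:
  fixes h :: "real^'v::finite \<Rightarrow> ennreal"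
  assumes \<theta>: "\<theta> \<in> pos_orthant" and h: "h \<in> borel_measurable borel"
  shows "(\<integral>\<^sup>+\<zeta>. h \<zeta> \<partial>exponential_product \<theta>) = (\<integral>\<^sup>+\<zeta>. ennreal (exponential_density_product \<theta> \<zeta>) * (h \<zeta> * indicator orthant \<zeta>) \<partial>lborel)"
proof -
  have gm: "(\<lambda>\<zeta>. \<Prod>i\<in>UNIV. ennreal (exponential_density (1 / \<theta> $ i) (\<zeta> $ i))) \<in> borel_measurable (lborel :: (real^'v) measure)"
    by (intro borel_measurable_prod_ennreal) measurable
  have hm: "(\<lambda>\<zeta>. h \<zeta> * indicator orthant \<zeta>) \<in> borel_measurable lborel"
    using h sets_orthant by auto
  have "(\<integral>\<^sup>+\<zeta>. h \<zeta> \<partial>exponential_product \<theta>) = (\<integral>\<^sup>+\<zeta>. (\<Prod>i\<in>UNIV. ennreal (exponential_density (1 / \<theta> $ i) (\<zeta> $ i))) * (h \<zeta> * indicator orthant \<zeta>) \<partial>lborel)"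
    unfolding exponential_product_density[OF \<theta>]
    by (subst nn_integral_restrict_space) (auto simp: nn_integral_density[OF gm hm])
  also have "\<dots> = (\<integral>\<^sup>+\<zeta>. ennreal (exponential_density_product \<theta> \<zeta>) * (h \<zeta> * indicator orthant \<zeta>) \<partial>lborel)"
    by (rule nn_integral_cong) (auto simp: exponential_density_product_eq[OF \<theta>] indicator_def)
  finally show ?thesis .
qed

lemma integral_exponential_product:
  fixes f :: "real^'v::finite \<Rightarrow> real"
  assumes \<theta>: "\<theta> \<in> pos_orthant" and f: "(\<lambda>\<zeta>. indicator orthant \<zeta> * f \<zeta>) \<in> borel_measurable borel"
  shows "integrable (exponential_product \<theta>) f \<longleftrightarrow> integrable lborel (\<lambda>\<zeta>. exponential_density_product \<theta> \<zeta> * (indicator orthant \<zeta> * f \<zeta>))"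
    and "(\<integral>\<zeta>. f \<zeta> \<partial>exponential_product \<theta>) = (\<integral>\<zeta>. exponential_density_product \<theta> \<zeta> * (indicator orthant \<zeta> * f \<zeta>) \<partial>lborel)"
proof -
  let ?D = "\<lambda>\<zeta>. if \<zeta> \<in> orthant then exponential_density_product \<theta> \<zeta> else 0"
  have D0: "0 \<le> ?D \<zeta>" for \<zeta> using exponential_density_product_pos[OF \<theta>, of \<zeta>] by simp
  have Dm: "?D \<in> borel_measurable lborel" by measurable
  have dens: "exponential_product \<theta> = restrict_space (density lborel (\<lambda>\<zeta>. ennreal (?D \<zeta>))) orthant"
    unfolding exponential_product_density[OF \<theta>]
  proof (rule measure_eqI)
    fix A assume "A \<in> sets (restrict_space (density lborel (\<lambda>\<zeta>. \<Prod>i\<in>UNIV. ennreal (exponential_density (1 / \<theta> $ i) (\<zeta> $ i)))) orthant)"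
    then have A: "A \<subseteq> orthant" "A \<in> sets borel" by (auto simp: sets_restrict_space_iff)
    have gm: "(\<lambda>\<zeta>. \<Prod>i\<in>UNIV. ennreal (exponential_density (1 / \<theta> $ i) (\<zeta> $ i))) \<in> borel_measurable (lborel :: (real^'v) measure)"
      by (intro borel_measurable_prod_ennreal) measurable
    show "emeasure (restrict_space (density lborel (\<lambda>\<zeta>. \<Prod>i\<in>UNIV. ennreal (exponential_density (1 / \<theta> $ i) (\<zeta> $ i)))) orthant) A
       = emeasure (restrict_space (density lborel (\<lambda>\<zeta>. ennreal (?D \<zeta>))) orthant) A"
      using A gm Dm
      by (subst (1 2) emeasure_restrict_space)
         (auto simp: emeasure_density exponential_density_product_eq[OF \<theta>] indicator_def intro!: nn_integral_cong)
  qed (simp add: sets_restrict_space)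
  have e: "?D \<zeta> *\<^sub>R (indicator orthant \<zeta> *\<^sub>R f \<zeta>) = exponential_density_product \<theta> \<zeta> * (indicator orthant \<zeta> * f \<zeta>)" for \<zeta>
    by (simp add: indicator_def)
  have fm: "(\<lambda>\<zeta>. indicator orthant \<zeta> *\<^sub>R f \<zeta>) \<in> borel_measurable lborel" using f by simp
  have "integrable (exponential_product \<theta>) f \<longleftrightarrow> integrable (density lborel (\<lambda>\<zeta>. ennreal (?D \<zeta>))) (\<lambda>\<zeta>. indicator orthant \<zeta> *\<^sub>R f \<zeta>)"
    unfolding dens by (rule integrable_restrict_space) simp
  also have "\<dots> \<longleftrightarrow> integrable lborel (\<lambda>\<zeta>. ?D \<zeta> *\<^sub>R (indicator orthant \<zeta> *\<^sub>R f \<zeta>))"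
    by (rule integrable_density[OF fm Dm]) (use D0 in simp)
  finally show "integrable (exponential_product \<theta>) f \<longleftrightarrow> integrable lborel (\<lambda>\<zeta>. exponential_density_product \<theta> \<zeta> * (indicator orthant \<zeta> * f \<zeta>))"
    unfolding e .
  have "(\<integral>\<zeta>. f \<zeta> \<partial>exponential_product \<theta>) = (\<integral>\<zeta>. indicator orthant \<zeta> *\<^sub>R f \<zeta> \<partial>density lborel (\<lambda>\<zeta>. ennreal (?D \<zeta>)))"
    unfolding dens by (rule integral_restrict_space) simp
  also have "\<dots> = (\<integral>\<zeta>. ?D \<zeta> *\<^sub>R (indicator orthant \<zeta> *\<^sub>R f \<zeta>) \<partial>lborel)"
    by (rule integral_density[OF fm Dm]) (use D0 in simp)
  finally show "(\<integral>\<zeta>. f \<zeta> \<partial>exponential_product \<theta>) = (\<integral>\<zeta>. exponential_density_product \<theta> \<zeta> * (indicator orthant \<zeta> * f \<zeta>) \<partial>lborel)"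
    unfolding e .
qed

section \<open>The exponential intertwiner\<close>

text \<open>Transports an absolute amount v instead of a fraction u of the mass at i. Under v = u
  \<zeta>_i the kernel du/u becomes dv/v, and for fixed v the map is a translation preserving
  Lebesgue measure, which \<open>move_mass\<close> at fixed u does not.\<close>

definition shift_mass :: "'v::finite \<Rightarrow> 'v \<Rightarrow> real \<Rightarrow> real^'v \<Rightarrow> real^'v" where
  "shift_mass i j v \<zeta> = v *\<^sub>R (axis j 1 - axis i 1) + \<zeta>"

lemma move_mass_shift: "move_mass i j u \<zeta> = shift_mass i j (u * \<zeta> $ i) \<zeta>"
  by (simp add: move_mass_def shift_mass_def algebra_simps)

lemma shift_mass_component:
  assumes "i \<noteq> j"
  shows "shift_mass i j v \<zeta> $ k = (if k = i then \<zeta> $ i - v else if k = j then \<zeta> $ j + v else \<zeta> $ k)"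
  using assms by (auto simp: shift_mass_def axis_def)

lemma borel_measurable_shift_mass [measurable]:
  "(\<lambda>z. shift_mass i j (snd z) (fst z)) \<in> borel_measurable borel"
  unfolding shift_mass_def by (intro borel_measurable_continuous_onI continuous_intros)

lemma borel_measurable_fst_nth [measurable]:
  "(\<lambda>z. fst z $ i) \<in> borel_measurable (borel :: ((real^'v::finite) \<times> real) measure)"
  by (intro borel_measurable_continuous_onI continuous_intros)

lemma borel_measurable_snd' [measurable]:
  "(\<lambda>z. snd z) \<in> borel_measurable (borel :: ((real^'v::finite) \<times> real) measure)"
  by (intro borel_measurable_continuous_onI continuous_intros)

lemma borel_measurable_comp_fst:
  fixes g :: "real^'v::finite \<Rightarrow> real"
  assumes "g \<in> borel_measurable borel"
  shows "(\<lambda>z. g (fst z)) \<in> borel_measurable (borel :: ((real^'v) \<times> real) measure)"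
  by (rule measurable_compose[OF _ assms]) (intro borel_measurable_continuous_onI continuous_intros)

lemma shift_mass_measure_preserving:
  "distr lborel lborel (\<lambda>z. (shift_mass i j (snd z) (fst z), snd z)) = (lborel :: ((real^'v::finite) \<times> real) measure)"
proof (rule measure_eqI)
  let ?\<tau> = "\<lambda>z. (shift_mass i j (snd z) (fst z), snd z) :: (real^'v) \<times> real"
  have \<tau>: "?\<tau> \<in> lborel \<rightarrow>\<^sub>M lborel"
    unfolding shift_mass_def by (simp, intro borel_measurable_continuous_onI continuous_intros)
  fix A assume "A \<in> sets (distr lborel lborel ?\<tau>)"
  then have Al: "A \<in> sets lborel" by (simp only: sets_distr)
  then have A: "A \<in> sets (lborel \<Otimes>\<^sub>M lborel)" by (simp only: lborel_prod)
  have "?\<tau> -` A \<in> sets lborel" using measurable_sets[OF \<tau> Al] by simp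
  then have A': "?\<tau> -` A \<in> sets (lborel \<Otimes>\<^sub>M lborel)" by (simp only: lborel_prod)
  have "emeasure (distr lborel lborel ?\<tau>) A = emeasure (lborel \<Otimes>\<^sub>M lborel) (?\<tau> -` A)"
    using emeasure_distr[OF \<tau> Al] by (simp only: lborel_prod space_lborel space_borel Int_UNIV_right)
  also have "\<dots> = (\<integral>\<^sup>+v. emeasure lborel ((\<lambda>\<zeta>. (\<zeta>, v)) -` (?\<tau> -` A)) \<partial>lborel)"
    by (rule lborel_pair.emeasure_pair_measure_alt2[OF A'])
  also have "\<dots> = (\<integral>\<^sup>+v. emeasure lborel ((\<lambda>\<zeta>. (\<zeta>, v)) -` A) \<partial>lborel)"
  proof (rule nn_integral_cong)
    fix v :: real
    have S: "(\<lambda>\<zeta>. (\<zeta>, v)) -` A \<in> sets borel" using sets_Pair2[OF A, of v] by simp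
    have "(\<lambda>\<zeta>. (\<zeta>, v)) -` (?\<tau> -` A) = (+) (v *\<^sub>R (axis j 1 - axis i 1)) -` ((\<lambda>\<zeta>. (\<zeta>, v)) -` A)"
      by (auto simp: shift_mass_def)
    then have "emeasure lborel ((\<lambda>\<zeta>. (\<zeta>, v)) -` (?\<tau> -` A)) = emeasure (distr lborel borel ((+) (v *\<^sub>R (axis j 1 - axis i 1)))) ((\<lambda>\<zeta>. (\<zeta>, v)) -` A)"
      using S by (subst emeasure_distr) auto
    then show "emeasure lborel ((\<lambda>\<zeta>. (\<zeta>, v)) -` (?\<tau> -` A)) = emeasure lborel ((\<lambda>\<zeta>. (\<zeta>, v)) -` A)"
      by (simp only: lborel_distr_plus)
  qed
  also have "\<dots> = emeasure lborel A"
    using lborel_pair.emeasure_pair_measure_alt2[OF A] by (simp add: lborel_prod)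
  finally show "emeasure (distr lborel lborel ?\<tau>) A = emeasure lborel A" .
qed simp

lemma shift_mass_integral:
  fixes H :: "(real^'v::finite) \<times> real \<Rightarrow> real"
  assumes H: "H \<in> borel_measurable borel"
  shows "integrable lborel (\<lambda>z. H (shift_mass i j (snd z) (fst z), snd z)) \<longleftrightarrow> integrable lborel H"
    and "(\<integral>z. H (shift_mass i j (snd z) (fst z), snd z) \<partial>lborel) = (\<integral>z. H z \<partial>lborel)"
proof -
  let ?\<tau> = "\<lambda>z. (shift_mass i j (snd z) (fst z), snd z) :: (real^'v) \<times> real"
  have \<tau>: "?\<tau> \<in> lborel \<rightarrow>\<^sub>M lborel"
    unfolding shift_mass_def by (simp, intro borel_measurable_continuous_onI continuous_intros)
  have H': "H \<in> borel_measurable lborel" using H by simp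
  show "integrable lborel (\<lambda>z. H (?\<tau> z)) \<longleftrightarrow> integrable lborel H"
    using integrable_distr_eq[OF \<tau> H'] unfolding shift_mass_measure_preserving by simp
  show "(\<integral>z. H (?\<tau> z) \<partial>lborel) = (\<integral>z. H z \<partial>lborel)"
    using integral_distr[OF \<tau> H'] unfolding shift_mass_measure_preserving by simp
qed

text \<open>Tonelli: for given \<zeta> the admissible amounts v form an interval of length
  \<zeta>_i.\<close>

lemma integrable_strip:
  fixes h :: "(real^'v::finite) \<times> real \<Rightarrow> real"
  assumes h: "h \<in> borel_measurable borel"
    and b: "\<And>\<zeta> v. \<bar>h (\<zeta>, v)\<bar> \<le> (if 0 < v \<and> v \<le> \<zeta> $ i then g \<zeta> else 0)"
    and g: "integrable lborel (\<lambda>\<zeta>. \<zeta> $ i * g \<zeta>)"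
  shows "integrable lborel h"
proof (rule integrableI_bounded)
  show "h \<in> borel_measurable lborel" using h by simp
  have "(\<integral>\<^sup>+z. ennreal (norm (h z)) \<partial>lborel) = (\<integral>\<^sup>+\<zeta>. (\<integral>\<^sup>+v. ennreal (norm (h (\<zeta>, v))) \<partial>lborel) \<partial>lborel)"
    using h by (subst lborel.nn_integral_fst) (auto simp: lborel_prod)
  also have "\<dots> \<le> (\<integral>\<^sup>+\<zeta>. ennreal (norm (\<zeta> $ i * g \<zeta>)) \<partial>lborel)"
  proof (rule nn_integral_mono)
    fix \<zeta> :: "real^'v"
    show "(\<integral>\<^sup>+v. ennreal (norm (h (\<zeta>, v))) \<partial>lborel) \<le> ennreal (norm (\<zeta> $ i * g \<zeta>))"
    proof (cases "0 < \<zeta> $ i")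
      case True
      have g0: "0 \<le> g \<zeta>" using b[of \<zeta> "\<zeta> $ i"] True by simp
      have "(\<integral>\<^sup>+v. ennreal (norm (h (\<zeta>, v))) \<partial>lborel) \<le> (\<integral>\<^sup>+v. ennreal (g \<zeta>) * indicator {0<..\<zeta> $ i} v \<partial>lborel)"
      proof (rule nn_integral_mono)
        fix v :: real
        show "ennreal (norm (h (\<zeta>, v))) \<le> ennreal (g \<zeta>) * indicator {0<..\<zeta> $ i} v"
          using b[of \<zeta> v] by (cases "0 < v \<and> v \<le> \<zeta> $ i") (auto intro: ennreal_leI)
      qed
      also have "\<dots> = ennreal (g \<zeta>) * ennreal (\<zeta> $ i)"
        using True by (simp add: nn_integral_cmult_indicator)
      also have "\<dots> = ennreal (norm (\<zeta> $ i * g \<zeta>))"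
        using True g0 by (simp add: ennreal_mult' mult.commute abs_mult)
      finally show ?thesis .
    next
      case False
      then have "h (\<zeta>, v) = 0" for v using b[of \<zeta> v] by (auto split: if_splits)
      then show ?thesis by simp
    qed
  qed
  also have "\<dots> < \<infinity>" using g unfolding integrable_iff_bounded by blast
  finally show "(\<integral>\<^sup>+z. ennreal (norm (h z)) \<partial>lborel) < \<infinity>" .
qed

lemma exponential_density_product_split:
  "exponential_density_product \<theta> \<zeta> = exponential_weight (\<theta> $ i) (\<zeta> $ i) * (\<Prod>k\<in>UNIV - {i}. exponential_weight (\<theta> $ k) (\<zeta> $ k))"
  unfolding exponential_density_product_def by (rule prod.remove) auto

text \<open>The density ratio depends on v alone, through the difference of the exponential rates.
  It measures the failure of detailed balance and is 1 for equal parameters.\<close>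

lemma exponential_density_product_shift:
  assumes ij: "i \<noteq> j"
  shows "exponential_density_product \<theta> (shift_mass i j v \<zeta>) = exponential_density_product \<theta> \<zeta> * exp ((1 / \<theta> $ i - 1 / \<theta> $ j) * v)"
proof -
  have s: "exponential_density_product \<theta> \<zeta> = exponential_weight (\<theta> $ i) (\<zeta> $ i) * (exponential_weight (\<theta> $ j) (\<zeta> $ j) * (\<Prod>k\<in>UNIV - {i} - {j}. exponential_weight (\<theta> $ k) (\<zeta> $ k)))" for \<zeta>
    unfolding exponential_density_product_split[of \<theta> \<zeta> i] using ij by (subst prod.remove[of "UNIV - {i}" j]) auto
  have r: "(\<Prod>k\<in>UNIV - {i} - {j}. exponential_weight (\<theta> $ k) (shift_mass i j v \<zeta> $ k)) = (\<Prod>k\<in>UNIV - {i} - {j}. exponential_weight (\<theta> $ k) (\<zeta> $ k))"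
    by (rule prod.cong) (auto simp: shift_mass_component[OF ij])
  have 1: "exponential_weight s (a - v) = exponential_weight s a * exp (1 / s * v)" for s a
    by (simp add: exponential_weight_def mult_exp_exp diff_divide_distrib)
  have 2: "exponential_weight t (b + v) = exponential_weight t b * exp (- (1 / t * v))" for t b
    by (simp add: exponential_weight_def mult_exp_exp add_divide_distrib)
  have 3: "exp ((1 / \<theta> $ i - 1 / \<theta> $ j) * v) = exp (1 / \<theta> $ i * v) * exp (- (1 / \<theta> $ j * v))"
    by (simp add: mult_exp_exp left_diff_distrib)
  show ?thesis
    unfolding s r 3 using ij by (simp add: shift_mass_component 1 2 mult_ac)
qed

text \<open>F stands for f extended by 0 off the orthant, so that shifts, which may leave the
  orthant, act on a function on the whole space.\<close>

locale exponential_test =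
  fixes F :: "real^'v::finite \<Rightarrow> real"
  assumes F_borel: "F \<in> borel_measurable borel"
    and F_support: "\<And>\<zeta>. \<zeta> \<notin> orthant \<Longrightarrow> F \<zeta> = 0"
    and F_integrable: "\<And>\<theta>. \<theta> \<in> pos_orthant \<Longrightarrow> integrable lborel (\<lambda>\<zeta>. exponential_density_product \<theta> \<zeta> * F \<zeta>)"
begin

lemma F_borel' [measurable]: "(\<lambda>z. F (fst z)) \<in> borel_measurable (borel :: ((real^'v) \<times> real) measure)"
  by (rule borel_measurable_comp_fst[OF F_borel])

lemma E_borel' [measurable]: "(\<lambda>z. exponential_density_product \<theta> (fst z)) \<in> borel_measurable (borel :: ((real^'v) \<times> real) measure)"
  by (rule borel_measurable_comp_fst) measurable

text \<open>With s = \<theta>_i, the tilt replaces the decay e^(-x/s) by e^(-x/m). Integrability of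
  F at the parameter whose i-th coordinate is enlarged to 2m leaves a factor e^(x/(2m)) of room,
  which absorbs the linear term.\<close>

lemma weighted_integrable:
  assumes \<theta>: "\<theta> \<in> pos_orthant" and m: "\<theta> $ i \<le> m"
  shows "integrable lborel (\<lambda>\<zeta>. (1 + \<zeta> $ i) * exp ((1 / \<theta> $ i - 1 / m) * \<zeta> $ i) * (exponential_density_product \<theta> \<zeta> * F \<zeta>))"
proof -
  let ?s = "\<theta> $ i"
  have s: "0 < ?s" using \<theta> by (simp add: pos_orthant_def)
  then have m0: "0 < m" using m by simp
  define \<theta>' where "\<theta>' = (\<chi> k. if k = i then 2 * m else \<theta> $ k)"
  have \<theta>': "\<theta>' \<in> pos_orthant" using \<theta> m0 by (simp add: pos_orthant_def \<theta>'_def)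
  \<comment> \<open>From 1 + x \<le> (1 + 2m) e^(x/(2m)) and the ratio 2m/s of the normalising
    factors.\<close>
  define C where "C = (1 + 2 * m) * (2 * m / ?s)"
  have C: "0 \<le> C" using s m0 by (simp add: C_def)
  have "integrable lborel (\<lambda>\<zeta>. C * (exponential_density_product \<theta>' \<zeta> * F \<zeta>))"
    by (intro integrable_mult_right F_integrable[OF \<theta>'])
  then show ?thesis
  proof (rule Bochner_Integration.integrable_bound)
    show "(\<lambda>\<zeta>. (1 + \<zeta> $ i) * exp ((1 / \<theta> $ i - 1 / m) * \<zeta> $ i) * (exponential_density_product \<theta> \<zeta> * F \<zeta>)) \<in> borel_measurable lborel"
      using F_borel by simp
    show "AE \<zeta> in lborel. norm ((1 + \<zeta> $ i) * exp ((1 / \<theta> $ i - 1 / m) * \<zeta> $ i) * (exponential_density_product \<theta> \<zeta> * F \<zeta>))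
        \<le> norm (C * (exponential_density_product \<theta>' \<zeta> * F \<zeta>))"
    proof (rule AE_I2)
      fix \<zeta> :: "real^'v"
      show "norm ((1 + \<zeta> $ i) * exp ((1 / \<theta> $ i - 1 / m) * \<zeta> $ i) * (exponential_density_product \<theta> \<zeta> * F \<zeta>))
        \<le> norm (C * (exponential_density_product \<theta>' \<zeta> * F \<zeta>))"
      proof (cases "\<zeta> \<in> orthant")
        case False
        then show ?thesis by (simp add: F_support)
      next
        case True
        let ?x = "\<zeta> $ i" and ?P = "\<Prod>k\<in>UNIV - {i}. exponential_weight (\<theta> $ k) (\<zeta> $ k)"
        have x: "0 \<le> ?x" using True by (simp add: orthant_def)
        have P: "0 \<le> ?P" using \<theta> by (intro prod_nonneg) (auto simp: exponential_weight_def pos_orthant_def less_imp_le)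
        have P': "(\<Prod>k\<in>UNIV - {i}. exponential_weight (\<theta>' $ k) (\<zeta> $ k)) = ?P"
          by (rule prod.cong) (auto simp: \<theta>'_def)
        have e: "1 + ?x / (2 * m) \<le> exp (?x / (2 * m))" by (rule exp_ge_add_one_self)
        have "1 + ?x \<le> (1 + 2 * m) * (1 + ?x / (2 * m))" using m0 x by (simp add: field_simps)
        also have "\<dots> \<le> (1 + 2 * m) * exp (?x / (2 * m))" using e m0 by (intro mult_left_mono) auto
        finally have "(1 + ?x) * (1 / ?s * exp (- (?x / m))) \<le> (1 + 2 * m) * exp (?x / (2 * m)) * (1 / ?s * exp (- (?x / m)))"
          using s by (intro mult_right_mono) auto
        also have "\<dots> = (1 + 2 * m) * (1 / ?s) * (exp (?x / (2 * m)) * exp (- (?x / m)))" by simp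
        also have "exp (?x / (2 * m)) * exp (- (?x / m)) = exp (- (?x / (2 * m)))"
          using m0 by (simp add: mult_exp_exp field_simps)
        also have "(1 + 2 * m) * (1 / ?s) * exp (- (?x / (2 * m))) = C * exponential_weight (2 * m) ?x"
          using m0 by (simp add: C_def exponential_weight_def)
        finally have 1: "(1 + ?x) * (1 / ?s * exp (- (?x / m))) \<le> C * exponential_weight (2 * m) ?x" .
        have 2: "exp ((1 / ?s - 1 / m) * ?x) * exponential_weight ?s ?x = 1 / ?s * exp (- (?x / m))"
          by (simp add: exponential_weight_def mult_exp_exp left_diff_distrib)
        have "(1 + ?x) * exp ((1 / ?s - 1 / m) * ?x) * exponential_density_product \<theta> \<zeta> = (1 + ?x) * (1 / ?s * exp (- (?x / m))) * ?P"
          unfolding exponential_density_product_split[of \<theta> \<zeta> i] 2[symmetric] by (simp only: mult_ac)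
        also have "\<dots> \<le> C * exponential_weight (2 * m) ?x * ?P" by (rule mult_right_mono[OF 1 P])
        also have "\<dots> = C * exponential_density_product \<theta>' \<zeta>"
          unfolding exponential_density_product_split[of \<theta>' \<zeta> i] P' by (simp add: \<theta>'_def)
        finally have 3: "(1 + ?x) * exp ((1 / ?s - 1 / m) * ?x) * exponential_density_product \<theta> \<zeta> \<le> C * exponential_density_product \<theta>' \<zeta>" .
        have 4: "0 \<le> (1 + ?x) * exp ((1 / ?s - 1 / m) * ?x) * exponential_density_product \<theta> \<zeta>"
          using x exponential_density_product_pos[OF \<theta>, of \<zeta>] by simp
        have "norm ((1 + ?x) * exp ((1 / ?s - 1 / m) * ?x) * (exponential_density_product \<theta> \<zeta> * F \<zeta>))
           = ((1 + ?x) * exp ((1 / ?s - 1 / m) * ?x) * exponential_density_product \<theta> \<zeta>) * \<bar>F \<zeta>\<bar>"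
          unfolding mult.assoc[symmetric] using 4 by (simp only: real_norm_def abs_mult[of _ "F \<zeta>"] abs_of_nonneg)
        also have "\<dots> \<le> C * exponential_density_product \<theta>' \<zeta> * \<bar>F \<zeta>\<bar>" by (rule mult_right_mono[OF 3]) simp
        also have "\<dots> = norm (C * (exponential_density_product \<theta>' \<zeta> * F \<zeta>))"
          using C exponential_density_product_pos[OF \<theta>', of \<zeta>] by (simp add: abs_mult)
        finally show ?thesis .
      qed
    qed
  qed
qed

text \<open>What remains of a jump combined with its reversal: dv/v times the density ratio minus 1,
  with c the difference of the rates. Subtracting 1 removes the singularity at v = 0.\<close>

definition tilt_kernel :: "real^'v \<Rightarrow> real \<Rightarrow> 'v \<Rightarrow> (real^'v) \<times> real \<Rightarrow> real" where
  "tilt_kernel \<theta> c i z = (if 0 < snd z \<and> snd z \<le> fst z $ i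
     then (exp (c * snd z) - 1) / snd z * (exponential_density_product \<theta> (fst z) * F (fst z)) else 0)"

lemma borel_tilt_kernel [measurable]: "tilt_kernel \<theta> c i \<in> borel_measurable borel"
  unfolding tilt_kernel_def[abs_def] by measurable

text \<open>The bound |e^(cv) - 1| \<le> |c| v e^(d \<zeta>_i), with d = 1/\<theta>_i - 1/m, cancels
  the 1/v; the weighted integrability covers the remaining integral over the strip.\<close>

lemma tilt_kernel_integrable:
  assumes \<theta>: "\<theta> \<in> pos_orthant" and m: "\<theta> $ i \<le> m" and c: "c \<le> 1 / \<theta> $ i - 1 / m"
  shows "integrable lborel (tilt_kernel \<theta> c i)"
proof (rule integrable_strip[where i=i and g="\<lambda>\<zeta>. \<bar>c\<bar> * (exp ((1 / \<theta> $ i - 1 / m) * \<zeta> $ i) * \<bar>exponential_density_product \<theta> \<zeta> * F \<zeta>\<bar>)"])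
  have s: "0 < \<theta> $ i" using \<theta> by (simp add: pos_orthant_def)
  let ?d = "1 / \<theta> $ i - 1 / m"
  have d: "0 \<le> ?d" using s m by (simp add: frac_le)
  show "tilt_kernel \<theta> c i \<in> borel_measurable borel" by measurable
  show "\<bar>tilt_kernel \<theta> c i (\<zeta>, v)\<bar> \<le> (if 0 < v \<and> v \<le> \<zeta> $ i then \<bar>c\<bar> * (exp (?d * \<zeta> $ i) * \<bar>exponential_density_product \<theta> \<zeta> * F \<zeta>\<bar>) else 0)" for \<zeta> v
  proof (cases "0 < v \<and> v \<le> \<zeta> $ i")
    case True
    have "\<bar>exp (c * v) - 1\<bar> \<le> \<bar>c\<bar> * v * exp (?d * \<zeta> $ i)"
    proof (cases "0 \<le> c")
      case c0: True
      have "1 - c * v \<le> exp (- (c * v))" using exp_ge_add_one_self[of "- (c * v)"] by simp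
      then have "(1 - c * v) * exp (c * v) \<le> exp (- (c * v)) * exp (c * v)" by (intro mult_right_mono) auto
      then have "exp (c * v) - 1 \<le> c * v * exp (c * v)" by (simp add: mult_exp_exp algebra_simps)
      also have "\<dots> \<le> c * v * exp (?d * \<zeta> $ i)"
        using c0 True c d by (intro mult_left_mono) (auto intro!: mult_mono)
      finally show ?thesis using c0 True by simp
    next
      case False
      then have cv: "c * v \<le> 0" using True by (simp add: mult_nonpos_nonneg)
      have c1: "\<bar>c\<bar> * v * 1 = - (c * v)" using False by simp
      have "1 - exp (c * v) \<le> \<bar>c\<bar> * v * 1" unfolding c1 using exp_ge_add_one_self[of "c * v"] by linarith
      also have "\<dots> \<le> \<bar>c\<bar> * v * exp (?d * \<zeta> $ i)" using True d by (intro mult_left_mono) auto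
      finally show ?thesis using cv by simp
    qed
    then have "\<bar>(exp (c * v) - 1) / v\<bar> \<le> \<bar>c\<bar> * exp (?d * \<zeta> $ i)"
      using True by (simp add: abs_divide divide_le_eq mult_ac)
    then have "\<bar>(exp (c * v) - 1) / v\<bar> * \<bar>exponential_density_product \<theta> \<zeta> * F \<zeta>\<bar> \<le> \<bar>c\<bar> * exp (?d * \<zeta> $ i) * \<bar>exponential_density_product \<theta> \<zeta> * F \<zeta>\<bar>"
      by (rule mult_right_mono) simp
    then show ?thesis using True unfolding tilt_kernel_def by (simp only: abs_mult fst_conv snd_conv if_True mult.assoc simp_thms)
  next
    case False
    then show ?thesis by (auto simp: tilt_kernel_def)
  qed
  have "integrable lborel (\<lambda>\<zeta>. \<bar>c\<bar> * ((1 + \<zeta> $ i) * exp (?d * \<zeta> $ i) * (exponential_density_product \<theta> \<zeta> * F \<zeta>)))"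
    by (intro integrable_mult_right weighted_integrable[OF \<theta> m])
  then show "integrable lborel (\<lambda>\<zeta>. \<zeta> $ i * (\<bar>c\<bar> * (exp (?d * \<zeta> $ i) * \<bar>exponential_density_product \<theta> \<zeta> * F \<zeta>\<bar>)))"
  proof (rule Bochner_Integration.integrable_bound)
    show "(\<lambda>\<zeta>. \<zeta> $ i * (\<bar>c\<bar> * (exp (?d * \<zeta> $ i) * \<bar>exponential_density_product \<theta> \<zeta> * F \<zeta>\<bar>))) \<in> borel_measurable lborel"
      using F_borel by simp
    show "AE \<zeta> in lborel. norm (\<zeta> $ i * (\<bar>c\<bar> * (exp (?d * \<zeta> $ i) * \<bar>exponential_density_product \<theta> \<zeta> * F \<zeta>\<bar>)))
       \<le> norm (\<bar>c\<bar> * ((1 + \<zeta> $ i) * exp (?d * \<zeta> $ i) * (exponential_density_product \<theta> \<zeta> * F \<zeta>)))"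
    proof (rule AE_I2)
      fix \<zeta> :: "real^'v"
      show "norm (\<zeta> $ i * (\<bar>c\<bar> * (exp (?d * \<zeta> $ i) * \<bar>exponential_density_product \<theta> \<zeta> * F \<zeta>\<bar>)))
       \<le> norm (\<bar>c\<bar> * ((1 + \<zeta> $ i) * exp (?d * \<zeta> $ i) * (exponential_density_product \<theta> \<zeta> * F \<zeta>)))"
      proof (cases "\<zeta> \<in> orthant")
        case True
        then have x: "0 \<le> \<zeta> $ i" by (simp add: orthant_def)
        have "\<bar>\<zeta> $ i\<bar> * (\<bar>c\<bar> * (exp (?d * \<zeta> $ i) * \<bar>exponential_density_product \<theta> \<zeta> * F \<zeta>\<bar>))
          \<le> \<bar>1 + \<zeta> $ i\<bar> * (\<bar>c\<bar> * (exp (?d * \<zeta> $ i) * \<bar>exponential_density_product \<theta> \<zeta> * F \<zeta>\<bar>))"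
          using x by (intro mult_right_mono) auto
        then show ?thesis by (simp only: real_norm_def abs_mult abs_exp_cancel abs_abs mult_ac)
      qed (simp add: F_support)
    qed
  qed
qed

text \<open>Integrating out v gives the same increments of \<open>Ein\<close> as the update of an
  exponential density.\<close>

lemma tilt_kernel_integral:
  assumes \<theta>: "\<theta> \<in> pos_orthant" and m: "\<theta> $ i \<le> m" and c: "c \<le> 1 / \<theta> $ i - 1 / m"
  shows "(\<integral>z. tilt_kernel \<theta> c i z \<partial>lborel) = (\<integral>\<zeta>. (Ein (c * \<zeta> $ i) - Ein 0) * (exponential_density_product \<theta> \<zeta> * F \<zeta>) \<partial>lborel)"
    and "integrable lborel (\<lambda>\<zeta>. (Ein (c * \<zeta> $ i) - Ein 0) * (exponential_density_product \<theta> \<zeta> * F \<zeta>))"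
proof -
  have int: "integrable (lborel \<Otimes>\<^sub>M lborel) (tilt_kernel \<theta> c i)"
    using tilt_kernel_integrable[OF assms] by (simp add: lborel_prod)
  have e: "(\<integral>v. tilt_kernel \<theta> c i (\<zeta>, v) \<partial>lborel) = (Ein (c * \<zeta> $ i) - Ein 0) * (exponential_density_product \<theta> \<zeta> * F \<zeta>)" for \<zeta>
  proof (cases "\<zeta> \<in> orthant")
    case True
    then have x: "0 \<le> \<zeta> $ i" by (simp add: orthant_def)
    have "(\<integral>v. tilt_kernel \<theta> c i (\<zeta>, v) \<partial>lborel)
      = (\<integral>v. (if 0 < v \<and> v \<le> \<zeta> $ i then (exp (c * v) - 1) / v else 0) * (exponential_density_product \<theta> \<zeta> * F \<zeta>) \<partial>lborel)"
      by (intro Bochner_Integration.integral_cong refl) (simp add: tilt_kernel_def)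
    then show ?thesis by (simp add: integral_exprel_kernel[OF x])
  next
    case False
    then have "tilt_kernel \<theta> c i (\<zeta>, v) = 0" for v by (simp add: tilt_kernel_def F_support)
    then show ?thesis using False by (simp add: F_support)
  qed
  show "(\<integral>z. tilt_kernel \<theta> c i z \<partial>lborel) = (\<integral>\<zeta>. (Ein (c * \<zeta> $ i) - Ein 0) * (exponential_density_product \<theta> \<zeta> * F \<zeta>) \<partial>lborel)"
    using lborel_pair.integral_fst'[OF int] unfolding e lborel_prod by simp
  show "integrable lborel (\<lambda>\<zeta>. (Ein (c * \<zeta> $ i) - Ein 0) * (exponential_density_product \<theta> \<zeta> * F \<zeta>))"
    using lborel_pair.integrable_fst'[OF int] unfolding e .
qed

text \<open>The mass jumps from i to j in the coordinates (\<zeta>, v), weighted with the density of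
  the initial law.\<close>

definition jump_kernel :: "real^'v \<Rightarrow> 'v \<Rightarrow> 'v \<Rightarrow> (real^'v) \<times> real \<Rightarrow> real" where
  "jump_kernel \<theta> i j z = (if fst z \<in> orthant \<and> 0 < snd z \<and> snd z \<le> fst z $ i
     then 1 / snd z * (F (shift_mass i j (snd z) (fst z)) - F (fst z)) * exponential_density_product \<theta> (fst z) else 0)"

text \<open>The term with F at the departure point, for transported amounts above e, with positive
  sign. Without the truncation the factor 1/v would in general spoil integrability.\<close>

definition exit_kernel :: "real^'v \<Rightarrow> real \<Rightarrow> 'v \<Rightarrow> (real^'v) \<times> real \<Rightarrow> real" where
  "exit_kernel \<theta> e i z = (if e < snd z \<and> snd z \<le> fst z $ i
     then 1 / snd z * (exponential_density_product \<theta> (fst z) * F (fst z)) else 0)"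

text \<open>The term with F after the jump, seen from the arrival point: the exponential is the
  density at the departure point relative to that at the arrival point, and the amount v must now be
  present at j.\<close>

definition entrance_kernel :: "real^'v \<Rightarrow> real \<Rightarrow> 'v \<Rightarrow> 'v \<Rightarrow> (real^'v) \<times> real \<Rightarrow> real" where
  "entrance_kernel \<theta> e i j z = (if e < snd z \<and> snd z \<le> fst z $ j
     then 1 / snd z * (exponential_density_product \<theta> (fst z) * F (fst z)) * exp (- (1 / \<theta> $ i - 1 / \<theta> $ j) * snd z) else 0)"

lemma borel_kernels [measurable]:
  "jump_kernel \<theta> i j \<in> borel_measurable borel"
  "exit_kernel \<theta> e i \<in> borel_measurable borel"
  "entrance_kernel \<theta> e i j \<in> borel_measurable borel"
proof -
  have [measurable]: "(\<lambda>z. F (shift_mass i j (snd z) (fst z))) \<in> borel_measurable borel"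
    by (rule measurable_compose[OF borel_measurable_shift_mass F_borel])
  have f: "fst \<in> borel_measurable (borel :: ((real^'v) \<times> real) measure)"
    by (intro borel_measurable_continuous_onI continuous_intros)
  have [measurable]: "Measurable.pred borel (\<lambda>z :: (real^'v) \<times> real. fst z \<in> orthant)"
    by (rule pred_sets2[OF sets_orthant]) (use f in simp)
  show "jump_kernel \<theta> i j \<in> borel_measurable borel" unfolding jump_kernel_def[abs_def] by measurable
  show "exit_kernel \<theta> e i \<in> borel_measurable borel" unfolding exit_kernel_def[abs_def] by measurable
  show "entrance_kernel \<theta> e i j \<in> borel_measurable borel" unfolding entrance_kernel_def[abs_def] by measurable
qed

lemma exit_kernel_integrable:
  assumes \<theta>: "\<theta> \<in> pos_orthant" and e: "0 < e"
  shows "integrable lborel (exit_kernel \<theta> e i)"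
proof (rule integrable_strip[where i=i and g="\<lambda>\<zeta>. 1 / e * \<bar>exponential_density_product \<theta> \<zeta> * F \<zeta>\<bar>"])
  show "exit_kernel \<theta> e i \<in> borel_measurable borel" by measurable
  show "\<bar>exit_kernel \<theta> e i (\<zeta>, v)\<bar> \<le> (if 0 < v \<and> v \<le> \<zeta> $ i then 1 / e * \<bar>exponential_density_product \<theta> \<zeta> * F \<zeta>\<bar> else 0)" for \<zeta> v
  proof (cases "e < v \<and> v \<le> \<zeta> $ i")
    case True
    then have "1 / v * \<bar>exponential_density_product \<theta> \<zeta> * F \<zeta>\<bar> \<le> 1 / e * \<bar>exponential_density_product \<theta> \<zeta> * F \<zeta>\<bar>"
      using e by (intro mult_right_mono) (auto simp: frac_le)
    then show ?thesis using True e by (simp add: exit_kernel_def abs_mult)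
  next
    case False
    then show ?thesis using e by (simp add: exit_kernel_def)
  qed
  \<comment> \<open>With m = \<theta>_i the tilt is trivial and only the linear factor is
    used.\<close>
  have "integrable lborel (\<lambda>\<zeta>. 1 / e * ((1 + \<zeta> $ i) * exp ((1 / \<theta> $ i - 1 / \<theta> $ i) * \<zeta> $ i) * (exponential_density_product \<theta> \<zeta> * F \<zeta>)))"
    by (intro integrable_mult_right weighted_integrable[OF \<theta> order_refl])
  then show "integrable lborel (\<lambda>\<zeta>. \<zeta> $ i * (1 / e * \<bar>exponential_density_product \<theta> \<zeta> * F \<zeta>\<bar>))"
  proof (rule Bochner_Integration.integrable_bound)
    show "(\<lambda>\<zeta>. \<zeta> $ i * (1 / e * \<bar>exponential_density_product \<theta> \<zeta> * F \<zeta>\<bar>)) \<in> borel_measurable lborel"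
      using F_borel by simp
    show "AE \<zeta> in lborel. norm (\<zeta> $ i * (1 / e * \<bar>exponential_density_product \<theta> \<zeta> * F \<zeta>\<bar>))
        \<le> norm (1 / e * ((1 + \<zeta> $ i) * exp ((1 / \<theta> $ i - 1 / \<theta> $ i) * \<zeta> $ i) * (exponential_density_product \<theta> \<zeta> * F \<zeta>)))"
    proof (rule AE_I2)
      fix \<zeta> :: "real^'v"
      show "norm (\<zeta> $ i * (1 / e * \<bar>exponential_density_product \<theta> \<zeta> * F \<zeta>\<bar>))
        \<le> norm (1 / e * ((1 + \<zeta> $ i) * exp ((1 / \<theta> $ i - 1 / \<theta> $ i) * \<zeta> $ i) * (exponential_density_product \<theta> \<zeta> * F \<zeta>)))"
      proof (cases "\<zeta> \<in> orthant")
        case True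
        then have x: "0 \<le> \<zeta> $ i" by (simp add: orthant_def)
        have "\<bar>\<zeta> $ i\<bar> * \<bar>1 / e * \<bar>exponential_density_product \<theta> \<zeta> * F \<zeta>\<bar>\<bar> \<le> \<bar>1 + \<zeta> $ i\<bar> * \<bar>1 / e * \<bar>exponential_density_product \<theta> \<zeta> * F \<zeta>\<bar>\<bar>"
          using x by (intro mult_right_mono) auto
        then show ?thesis by (simp add: abs_mult mult_ac)
      qed (simp add: F_support)
    qed
  qed
qed

text \<open>Jump kernel plus exit kernel is the entrance kernel composed with the measure-preserving
  shift. The entrance kernel inherits its integrability through this identity, as F after the jump
  is controlled only through the jump kernel.\<close>

lemma truncated_jump_kernel:
  assumes \<theta>: "\<theta> \<in> pos_orthant" and ij: "i \<noteq> j" and e: "0 < e" and W: "integrable lborel (jump_kernel \<theta> i j)"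
  shows "integrable lborel (entrance_kernel \<theta> e i j)"
    and "(\<integral>z. (if e < snd z then jump_kernel \<theta> i j z else 0) \<partial>lborel) = (\<integral>z. entrance_kernel \<theta> e i j z \<partial>lborel) - (\<integral>z. exit_kernel \<theta> e i z \<partial>lborel)"
proof -
  let ?T = "\<lambda>z. if e < snd z then jump_kernel \<theta> i j z else 0"
  have T: "integrable lborel ?T"
    by (rule Bochner_Integration.integrable_bound[OF W]) auto
  have X: "integrable lborel (exit_kernel \<theta> e i)" by (rule exit_kernel_integrable[OF \<theta> e])
  have eq: "?T z + exit_kernel \<theta> e i z = entrance_kernel \<theta> e i j (shift_mass i j (snd z) (fst z), snd z)" for z
  proof -
    obtain \<zeta> v where z: "z = (\<zeta>, v)" by force
    let ?\<zeta> = "shift_mass i j v \<zeta>"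
    show ?thesis
    \<comment> \<open>The case in which the jump is possible: the arrival point lies in the orthant
      and the mass at j was nonnegative before, whence \<zeta> lies in the orthant and v \<le>
      \<zeta>_i.\<close>
    proof (cases "e < v \<and> ?\<zeta> \<in> orthant \<and> 0 \<le> \<zeta> $ j")
      case True
      have \<zeta>: "\<zeta> \<in> orthant" "v \<le> \<zeta> $ i"
        unfolding orthant_def
      proof (safe)
        have c: "0 \<le> ?\<zeta> $ k" for k using True by (simp add: orthant_def)
        show "v \<le> \<zeta> $ i" using c[of i] ij by (simp add: shift_mass_component)
        fix k
        show "0 \<le> \<zeta> $ k" using c[of k] ij True e by (auto simp: shift_mass_component split: if_splits)
      qed
      have j: "v \<le> ?\<zeta> $ j" using True ij by (simp add: shift_mass_component)
      have "exponential_density_product \<theta> ?\<zeta> * exp (- (1 / \<theta> $ i - 1 / \<theta> $ j) * v) = exponential_density_product \<theta> \<zeta>"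
      proof -
        have "exp (c * v) * exp (- c * v) = 1" for c by (simp add: mult_exp_exp)
        then show ?thesis unfolding exponential_density_product_shift[OF ij] by (simp only: mult.assoc mult_1_right)
      qed
      then have "entrance_kernel \<theta> e i j (?\<zeta>, v) = 1 / v * (exponential_density_product \<theta> \<zeta> * F ?\<zeta>)"
        using True j by (simp add: entrance_kernel_def mult_ac)
      then show ?thesis
        using True \<zeta> e by (simp add: z jump_kernel_def exit_kernel_def algebra_simps)
    next
      case False
      have N: "entrance_kernel \<theta> e i j (?\<zeta>, v) = 0"
        using False F_support[of ?\<zeta>] ij by (auto simp: entrance_kernel_def shift_mass_component)
      have "?T (\<zeta>, v) + exit_kernel \<theta> e i (\<zeta>, v) = 0"
      proof (cases "e < v \<and> v \<le> \<zeta> $ i \<and> \<zeta> \<in> orthant")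
        case True
        then have "?\<zeta> \<in> orthant" using ij e by (auto simp: orthant_def shift_mass_component)
        then have False using False True by (auto simp: orthant_def)
        then show ?thesis ..
      next
        case False
        then show ?thesis by (auto simp: jump_kernel_def exit_kernel_def F_support)
      qed
      then show ?thesis using N unfolding z by (simp only: fst_conv snd_conv)
    qed
  qed
  have TX: "integrable lborel (\<lambda>z. ?T z + exit_kernel \<theta> e i z)"
    by (rule Bochner_Integration.integrable_add[OF T X])
  note sh = shift_mass_integral[where H="entrance_kernel \<theta> e i j" and i=i and j=j]
  show "integrable lborel (entrance_kernel \<theta> e i j)"
    using TX sh(1) unfolding eq by simp
  have "(\<integral>z. ?T z \<partial>lborel) + (\<integral>z. exit_kernel \<theta> e i z \<partial>lborel) = (\<integral>z. entrance_kernel \<theta> e i j z \<partial>lborel)"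
    using Bochner_Integration.integral_add[OF T X] sh(2) unfolding eq by simp
  then show "(\<integral>z. ?T z \<partial>lborel) = (\<integral>z. entrance_kernel \<theta> e i j z \<partial>lborel) - (\<integral>z. exit_kernel \<theta> e i z \<partial>lborel)"
    by simp
qed

text \<open>Jumps from i to j enter j and jumps from j to i leave j, with the same truncation v > e;
  their 1/v singularities cancel up to the tilt.\<close>

lemma entrance_minus_exit:
  assumes e: "0 < e"
  shows "entrance_kernel \<theta> e i j z - exit_kernel \<theta> e j z = (if e < snd z then tilt_kernel \<theta> (1 / \<theta> $ j - 1 / \<theta> $ i) j z else 0)"
  using e by (auto simp: entrance_kernel_def exit_kernel_def tilt_kernel_def field_simps)

lemma max_rate:
  fixes s t :: real
  assumes "0 < s" "0 < t"
  shows "s \<le> max s t" "1 / s - 1 / t \<le> 1 / s - 1 / max s t"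
  using assms by (auto simp: frac_le max_def)

text \<open>
  Removing the jumps that transport a mass of at most \<open>e\<close> is symmetric under reversal of the jump, so
  the truncated exit rates of one direction compensate the truncated entrance rates of the other one
  and no singularity survives as \<open>e\<close> tends to 0. Removing the jumps with \<open>u \<le> e\<close> would
  leave logarithmic boundary terms.
\<close>

lemma jump_kernels_integral:
  assumes \<theta>: "\<theta> \<in> pos_orthant" and ij: "i \<noteq> j"
    and W: "integrable lborel (jump_kernel \<theta> i j)" "integrable lborel (jump_kernel \<theta> j i)"
  shows "(\<integral>z. jump_kernel \<theta> i j z \<partial>lborel) + (\<integral>z. jump_kernel \<theta> j i z \<partial>lborel)
    = (\<integral>z. tilt_kernel \<theta> (1 / \<theta> $ i - 1 / \<theta> $ j) i z \<partial>lborel) + (\<integral>z. tilt_kernel \<theta> (1 / \<theta> $ j - 1 / \<theta> $ i) j z \<partial>lborel)"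
proof -
  have pos: "0 < \<theta> $ k" for k using \<theta> by (simp add: pos_orthant_def)
  have V: "integrable lborel (tilt_kernel \<theta> (1 / \<theta> $ i - 1 / \<theta> $ j) i)" "integrable lborel (tilt_kernel \<theta> (1 / \<theta> $ j - 1 / \<theta> $ i) j)"
    using tilt_kernel_integrable[OF \<theta> max_rate[OF pos pos]] by auto
  have ji: "j \<noteq> i" using ij by simp
  define \<epsilon> where "\<epsilon> n = 1 / real (Suc n)" for n
  have \<epsilon>: "0 < \<epsilon> n" for n by (simp add: \<epsilon>_def)
  \<comment> \<open>Entrance into j is paired with exit from j, and likewise at i.\<close>
  have eq: "(\<integral>z. (if \<epsilon> n < snd z then jump_kernel \<theta> i j z else 0) \<partial>lborel) + (\<integral>z. (if \<epsilon> n < snd z then jump_kernel \<theta> j i z else 0) \<partial>lborel)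
    = (\<integral>z. (if \<epsilon> n < snd z then tilt_kernel \<theta> (1 / \<theta> $ i - 1 / \<theta> $ j) i z else 0) \<partial>lborel)
    + (\<integral>z. (if \<epsilon> n < snd z then tilt_kernel \<theta> (1 / \<theta> $ j - 1 / \<theta> $ i) j z else 0) \<partial>lborel)" for n
    unfolding truncated_jump_kernel(2)[OF \<theta> ij \<epsilon> W(1)] truncated_jump_kernel(2)[OF \<theta> ji \<epsilon> W(2)]
      entrance_minus_exit[OF \<epsilon>, symmetric]
    by (simp add: Bochner_Integration.integral_diff truncated_jump_kernel(1)[OF \<theta> ij \<epsilon> W(1)]
        truncated_jump_kernel(1)[OF \<theta> ji \<epsilon> W(2)] exit_kernel_integrable[OF \<theta> \<epsilon>])
  \<comment> \<open>All four kernels vanish for v \<le> 0, so dominated convergence removes the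
    truncation completely.\<close>
  have lim: "(\<lambda>n. \<integral>z. (if \<epsilon> n < snd z then h z else 0) \<partial>lborel) \<longlonglongrightarrow> (\<integral>z. h z \<partial>lborel)"
    if h: "integrable lborel h" and h0: "\<And>z. snd z \<le> 0 \<Longrightarrow> h z = 0" for h :: "(real^'v) \<times> real \<Rightarrow> real"
  proof (rule integral_dominated_convergence[where w="\<lambda>z. norm (h z)"])
    show "AE z in lborel. (\<lambda>n. if \<epsilon> n < snd z then h z else 0) \<longlonglongrightarrow> h z"
    proof (rule AE_I2)
      fix z :: "(real^'v) \<times> real"
      show "(\<lambda>n. if \<epsilon> n < snd z then h z else 0) \<longlonglongrightarrow> h z"
      proof (cases "0 < snd z")
        case True
        have "\<epsilon> \<longlonglongrightarrow> 0" unfolding \<epsilon>_def[abs_def] using LIMSEQ_inverse_real_of_nat by (simp add: inverse_eq_divide)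
        then have "\<forall>\<^sub>F n in sequentially. \<epsilon> n < snd z" using True by (rule order_tendstoD)
        then have "\<forall>\<^sub>F n in sequentially. (if \<epsilon> n < snd z then h z else 0) = h z" by (rule eventually_mono) simp
        then show ?thesis by (rule tendsto_eventually)
      next
        case False
        then have "h z = 0" by (intro h0) simp
        then have "(\<lambda>n. if \<epsilon> n < snd z then h z else 0) = (\<lambda>n. h z)" by auto
        then show ?thesis by simp
      qed
    qed
    have [measurable]: "h \<in> borel_measurable borel" using h by auto
    show "(\<lambda>z. if \<epsilon> n < snd z then h z else 0) \<in> borel_measurable lborel" for n by simp
  qed (use h in auto)
  have "(\<lambda>n. (\<integral>z. (if \<epsilon> n < snd z then jump_kernel \<theta> i j z else 0) \<partial>lborel) + (\<integral>z. (if \<epsilon> n < snd z then jump_kernel \<theta> j i z else 0) \<partial>lborel))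
     \<longlonglongrightarrow> (\<integral>z. jump_kernel \<theta> i j z \<partial>lborel) + (\<integral>z. jump_kernel \<theta> j i z \<partial>lborel)"
    by (intro tendsto_add lim W) (auto simp: jump_kernel_def)
  moreover have "(\<lambda>n. (\<integral>z. (if \<epsilon> n < snd z then tilt_kernel \<theta> (1 / \<theta> $ i - 1 / \<theta> $ j) i z else 0) \<partial>lborel)
      + (\<integral>z. (if \<epsilon> n < snd z then tilt_kernel \<theta> (1 / \<theta> $ j - 1 / \<theta> $ i) j z else 0) \<partial>lborel))
     \<longlonglongrightarrow> (\<integral>z. tilt_kernel \<theta> (1 / \<theta> $ i - 1 / \<theta> $ j) i z \<partial>lborel) + (\<integral>z. tilt_kernel \<theta> (1 / \<theta> $ j - 1 / \<theta> $ i) j z \<partial>lborel)"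
    by (intro tendsto_add lim V) (auto simp: tilt_kernel_def)
  ultimately show ?thesis unfolding eq by (rule LIMSEQ_unique)
qed

lemma exponential_density_product_move_parameter:
  assumes ij: "i \<noteq> j"
  shows "exponential_density_product (move_parameter i j u \<theta>) \<zeta>
    = exponential_weight ((1 - u) * \<theta> $ i + u * \<theta> $ j) (\<zeta> $ i) * (\<Prod>k\<in>UNIV - {i}. exponential_weight (\<theta> $ k) (\<zeta> $ k))"
  unfolding exponential_density_product_split[of _ _ i]
  using ij by (auto simp: move_parameter_component intro!: arg_cong2[of _ _ _ _ "(*)"] prod.cong)

text \<open>Fubini in \<zeta> and u, with the update of one exponential density inside. The
  \<open>Ein\<close> part is the tilt integral that mass jumps also produce; the logarithmic part is
  antisymmetric in i and j and disappears when both directions are added.\<close>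

lemma parameter_jump_integral:
  assumes \<theta>: "\<theta> \<in> pos_orthant" and ij: "i \<noteq> j"
  defines "G \<equiv> \<lambda>\<theta>. \<integral>\<zeta>. exponential_density_product \<theta> \<zeta> * F \<zeta> \<partial>lborel"
  shows "set_integrable lborel {0<..<1} (\<lambda>u. 1 / u * (G (move_parameter i j u \<theta>) - G \<theta>))"
    and "(LBINT u:{0<..<1}. 1 / u * (G (move_parameter i j u \<theta>) - G \<theta>))
     = (\<integral>z. tilt_kernel \<theta> (1 / \<theta> $ i - 1 / \<theta> $ j) i z \<partial>lborel) + (ln (\<theta> $ i) - ln (\<theta> $ j)) * G \<theta>"
proof -
  let ?s = "\<theta> $ i" and ?t = "\<theta> $ j"
  have pos: "0 < \<theta> $ k" for k using \<theta> by (simp add: pos_orthant_def)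
  define m l where "m = max ?s ?t" and "l = min ?s ?t"
  have l: "0 < l" "l \<le> ?s" "l \<le> ?t" and m: "?s \<le> m" "?t \<le> m" using pos by (auto simp: m_def l_def)
  have m0: "0 < m" using m(1) pos[of i] by linarith
  \<comment> \<open>The Lipschitz factor of the density, times the bound m for the displacement
    divided by u, times the mean at i to cancel the normalisation of the weight.\<close>
  define C where "C = (1 / l\<^sup>2 + 1 / l ^ 3) * m * ?s"
  have C: "0 \<le> C" using l pos m0 by (simp add: C_def less_imp_le)
  define k where "k \<zeta> u = (if 0 < u \<and> u < 1 then 1 / u * (exponential_density_product (move_parameter i j u \<theta>) \<zeta> - exponential_density_product \<theta> \<zeta>) * F \<zeta> else 0)" for \<zeta> and u :: real
  define g where "g \<zeta> = C * ((1 + \<zeta> $ i) * exp ((1 / ?s - 1 / m) * \<zeta> $ i) * (exponential_density_product \<theta> \<zeta> * F \<zeta>))" for \<zeta>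
  have g: "integrable lborel g"
    unfolding g_def by (intro integrable_mult_right weighted_integrable[OF \<theta> m(1)])
  have km: "(\<lambda>z. k (fst z) (snd z)) \<in> borel_measurable (borel :: ((real^'v) \<times> real) measure)"
    unfolding k_def exponential_density_product_move_parameter[OF ij] exponential_weight_def by measurable
  have kb: "\<bar>k \<zeta> u\<bar> \<le> \<bar>g \<zeta>\<bar> * indicator {0<..<1} u" for \<zeta> u
  proof (cases "0 < u \<and> u < 1 \<and> \<zeta> \<in> orthant")
    case True
    let ?x = "(1 - u) * ?s + u * ?t" and ?P = "\<Prod>k\<in>UNIV - {i}. exponential_weight (\<theta> $ k) (\<zeta> $ k)"
    have u: "0 < u" "u < 1" and a: "0 \<le> \<zeta> $ i" using True by (auto simp: orthant_def)
    have P: "0 \<le> ?P" using pos by (intro prod_nonneg) (auto simp: exponential_weight_def less_imp_le)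
    have x: "l \<le> ?x" "?x \<le> m"
    proof -
      have "(1 - u) * l + u * l \<le> ?x" using u l by (intro add_mono mult_left_mono) auto
      then show "l \<le> ?x" by (simp add: algebra_simps)
      have "?x \<le> (1 - u) * m + u * m" using u m by (intro add_mono mult_left_mono) auto
      then show "?x \<le> m" by (simp add: algebra_simps)
    qed
    have "?x - ?s = u * (?t - ?s)" by (simp add: algebra_simps)
    then have "\<bar>?x - ?s\<bar> = u * \<bar>?t - ?s\<bar>" using u by (simp add: abs_mult)
    also have "\<bar>?t - ?s\<bar> \<le> m" using pos[of i] pos[of j] m by linarith
    finally have xs: "\<bar>?x - ?s\<bar> \<le> u * m" using u by simp
    have "\<bar>exponential_weight ?x (\<zeta> $ i) - exponential_weight ?s (\<zeta> $ i)\<bar>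
        \<le> (1 / l\<^sup>2 + 1 / l ^ 3) * (1 + \<zeta> $ i) * exp (- (\<zeta> $ i / m)) * \<bar>?x - ?s\<bar>"
      by (rule exponential_weight_lipschitz[OF l(1) x l(2) m(1) a])
    also have "\<dots> \<le> (1 / l\<^sup>2 + 1 / l ^ 3) * (1 + \<zeta> $ i) * exp (- (\<zeta> $ i / m)) * (u * m)"
      using xs l a by (intro mult_left_mono) auto
    also have "\<dots> = u * (C * ((1 + \<zeta> $ i) * (exp ((1 / ?s - 1 / m) * \<zeta> $ i) * exponential_weight ?s (\<zeta> $ i))))"
    proof -
      have "exp ((1 / ?s - 1 / m) * \<zeta> $ i) * exponential_weight ?s (\<zeta> $ i) = 1 / ?s * exp (- (\<zeta> $ i / m))"
        by (simp add: exponential_weight_def mult_exp_exp left_diff_distrib)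
      then show ?thesis using pos[of i] by (simp add: C_def)
    qed
    finally have L: "\<bar>exponential_weight ?x (\<zeta> $ i) - exponential_weight ?s (\<zeta> $ i)\<bar>
        \<le> u * (C * ((1 + \<zeta> $ i) * (exp ((1 / ?s - 1 / m) * \<zeta> $ i) * exponential_weight ?s (\<zeta> $ i))))" .
    have "\<bar>k \<zeta> u\<bar> = 1 / u * \<bar>exponential_weight ?x (\<zeta> $ i) - exponential_weight ?s (\<zeta> $ i)\<bar> * (?P * \<bar>F \<zeta>\<bar>)"
    proof -
      have "k \<zeta> u = 1 / u * (exponential_weight ?x (\<zeta> $ i) - exponential_weight ?s (\<zeta> $ i)) * (?P * F \<zeta>)"
        using u unfolding k_def exponential_density_product_move_parameter[OF ij] exponential_density_product_split[of \<theta> \<zeta> i]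
        by (simp add: algebra_simps)
      then show ?thesis using u P by (simp add: abs_mult)
    qed
    also have "\<dots> \<le> 1 / u * (u * (C * ((1 + \<zeta> $ i) * (exp ((1 / ?s - 1 / m) * \<zeta> $ i) * exponential_weight ?s (\<zeta> $ i))))) * (?P * \<bar>F \<zeta>\<bar>)"
      using u P by (intro mult_right_mono mult_left_mono L) auto
    also have "\<dots> = C * ((1 + \<zeta> $ i) * exp ((1 / ?s - 1 / m) * \<zeta> $ i) * (exponential_density_product \<theta> \<zeta> * \<bar>F \<zeta>\<bar>))"
      unfolding exponential_density_product_split[of \<theta> \<zeta> i] using u by simp
    also have "\<dots> = \<bar>g \<zeta>\<bar>"
      using C a exponential_density_product_pos[OF \<theta>, of \<zeta>] by (simp add: g_def abs_mult)
    finally show ?thesis using u by simp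
  next
    case False
    then show ?thesis by (auto simp: k_def F_support)
  qed
  have kI: "integrable lborel (\<lambda>z. k (fst z) (snd z))"
  proof (rule Bochner_Integration.integrable_bound)
    show "integrable lborel (\<lambda>z :: (real^'v) \<times> real. \<bar>g (fst z)\<bar> * indicator {0<..<1} (snd z))"
    proof -
      have "integrable (lborel \<Otimes>\<^sub>M lborel) (\<lambda>z :: (real^'v) \<times> real. \<bar>g (fst z)\<bar> * indicator {0<..<1} (snd z))"
      proof (rule lborel_pair.Fubini_integrable)
        have [measurable]: "(\<lambda>z. g (fst z)) \<in> borel_measurable (borel :: ((real^'v) \<times> real) measure)"
          using g by (intro borel_measurable_comp_fst) auto
        show "(\<lambda>z :: (real^'v) \<times> real. \<bar>g (fst z)\<bar> * indicator {0<..<1} (snd z)) \<in> borel_measurable (lborel \<Otimes>\<^sub>M lborel)"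
          unfolding lborel_prod by simp
        show "AE \<zeta> in lborel. integrable lborel (\<lambda>u::real. \<bar>g (fst (\<zeta>, u))\<bar> * indicator {0<..<1} (snd (\<zeta>, u)))"
          by (rule AE_I2) (auto intro!: integrable_mult_right integrable_real_indicator)
        show "integrable lborel (\<lambda>\<zeta>. \<integral>u. norm (\<bar>g (fst (\<zeta>, u))\<bar> * indicator {0<..<1} (snd (\<zeta>, u))) \<partial>lborel)"
          using g by (simp add: abs_mult)
      qed
      then show ?thesis by (simp only: lborel_prod)
    qed
    show "(\<lambda>z. k (fst z) (snd z)) \<in> borel_measurable lborel" using km by simp
    show "AE z in lborel. norm (k (fst z) (snd z)) \<le> norm (\<bar>g (fst z)\<bar> * indicator {0<..<1} (snd z))"
      using kb by (intro AE_I2) (simp add: abs_mult)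
  qed
  have kI': "integrable (lborel \<Otimes>\<^sub>M lborel) (\<lambda>(\<zeta>, u). k \<zeta> u)"
    using kI by (simp add: case_prod_beta' lborel_prod)
  have ku: "(\<integral>\<zeta>. k \<zeta> u \<partial>lborel) = indicator {0<..<1} u *\<^sub>R (1 / u * (G (move_parameter i j u \<theta>) - G \<theta>))" for u
  proof (cases "0 < u \<and> u < 1")
    case True
    then have \<theta>u: "move_parameter i j u \<theta> \<in> pos_orthant" using \<theta> ij by (intro move_parameter_pos_orthant) auto
    have "(\<integral>\<zeta>. k \<zeta> u \<partial>lborel) = (\<integral>\<zeta>. 1 / u * (exponential_density_product (move_parameter i j u \<theta>) \<zeta> * F \<zeta> - exponential_density_product \<theta> \<zeta> * F \<zeta>) \<partial>lborel)"
      using True by (intro Bochner_Integration.integral_cong refl) (simp add: k_def left_diff_distrib)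
    also have "\<dots> = 1 / u * (G (move_parameter i j u \<theta>) - G \<theta>)"
      unfolding G_def by (simp only: integral_mult_right_zero Bochner_Integration.integral_diff[OF F_integrable[OF \<theta>u] F_integrable[OF \<theta>]])
    finally show ?thesis using True by simp
  next
    case False
    then have "k \<zeta> u = 0" for \<zeta> by (simp only: k_def if_False)
    moreover have "u \<notin> {0<..<1}" using False by simp
    ultimately show ?thesis by simp
  qed
  have k\<zeta>: "(\<integral>u. k \<zeta> u \<partial>lborel) = (Ein ((1 / ?s - 1 / ?t) * \<zeta> $ i) - Ein 0) * (exponential_density_product \<theta> \<zeta> * F \<zeta>)
      + (ln ?s - ln ?t) * (exponential_density_product \<theta> \<zeta> * F \<zeta>)" for \<zeta>
  proof -
    let ?P = "\<Prod>k\<in>UNIV - {i}. exponential_weight (\<theta> $ k) (\<zeta> $ k)"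
    have "(\<integral>u. k \<zeta> u \<partial>lborel) = (LBINT u:{0<..<1}. 1 / u * (exponential_weight ((1 - u) * ?s + u * ?t) (\<zeta> $ i) - exponential_weight ?s (\<zeta> $ i)) * (?P * F \<zeta>))"
      unfolding set_lebesgue_integral_def
      by (intro Bochner_Integration.integral_cong refl)
         (simp add: k_def exponential_density_product_move_parameter[OF ij] exponential_density_product_split[of \<theta> \<zeta> i] algebra_simps)
    also have "\<dots> = exponential_weight ?s (\<zeta> $ i) * (Ein (\<zeta> $ i * (1 / ?s - 1 / ?t)) - Ein 0 + ln ?s - ln ?t) * (?P * F \<zeta>)"
      unfolding set_integral_mult_left by (simp only: exponential_weight_update(2)[OF pos pos])
    also have "\<dots> = (Ein (\<zeta> $ i * (1 / ?s - 1 / ?t)) - Ein 0) * (exponential_density_product \<theta> \<zeta> * F \<zeta>)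
      + (ln ?s - ln ?t) * (exponential_density_product \<theta> \<zeta> * F \<zeta>)"
      unfolding exponential_density_product_split[of \<theta> \<zeta> i] by (simp only: algebra_simps)
    finally show ?thesis by (simp only: mult.commute[of "\<zeta> $ i"])
  qed
  show "set_integrable lborel {0<..<1} (\<lambda>u. 1 / u * (G (move_parameter i j u \<theta>) - G \<theta>))"
    using lborel_pair.integrable_snd[OF kI'] unfolding ku set_integrable_def .
  have "(LBINT u:{0<..<1}. 1 / u * (G (move_parameter i j u \<theta>) - G \<theta>)) = (\<integral>u. (\<integral>\<zeta>. k \<zeta> u \<partial>lborel) \<partial>lborel)"
    unfolding set_lebesgue_integral_def ku ..
  also have "\<dots> = (\<integral>\<zeta>. (\<integral>u. k \<zeta> u \<partial>lborel) \<partial>lborel)"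
    by (rule lborel_pair.Fubini_integral[OF kI'])
  also have "\<dots> = (\<integral>z. tilt_kernel \<theta> (1 / ?s - 1 / ?t) i z \<partial>lborel) + (ln ?s - ln ?t) * G \<theta>"
    unfolding k\<zeta> tilt_kernel_integral(1)[OF \<theta> max_rate[OF pos pos]] G_def
    by (subst Bochner_Integration.integral_add)
       (auto intro!: tilt_kernel_integral(2)[OF \<theta> max_rate[OF pos pos]] integrable_mult_right F_integrable[OF \<theta>])
  finally show "(LBINT u:{0<..<1}. 1 / u * (G (move_parameter i j u \<theta>) - G \<theta>))
     = (\<integral>z. tilt_kernel \<theta> (1 / ?s - 1 / ?t) i z \<partial>lborel) + (ln ?s - ln ?t) * G \<theta>" .
qed

end

section \<open>From transported amounts back to transported fractions\<close>

abbreviation unit_interval :: "real measure" where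
  "unit_interval \<equiv> restrict_space lborel {0<..<1}"

lemma finite_measure_unit_interval: "finite_measure unit_interval"
  by (rule finite_measureI) (simp add: emeasure_restrict_space space_restrict_space)

lemma unit_interval_integral:
  fixes g :: "real \<Rightarrow> real"
  shows "(\<integral>u. g u \<partial>unit_interval) = (LBINT u:{0<..<1}. g u)"
  unfolding set_lebesgue_integral_def by (rule integral_restrict_space) simp

text \<open>All exponential products share one sigma-algebra, so Borel measurability of f can be
  read off from integrability at the constant parameter 1.\<close>

lemma exponential_test_indicator:
  fixes f :: "real^'v::finite \<Rightarrow> real"
  assumes f: "\<forall>\<theta>\<in>pos_orthant. integrable (exponential_product \<theta>) f"
  shows "exponential_test (\<lambda>\<zeta>. indicator orthant \<zeta> * f \<zeta>)"
proof
  let ?one = "(\<chi> i. 1) :: real^'v"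
  have "?one \<in> pos_orthant" by (simp add: pos_orthant_def)
  then have "f \<in> borel_measurable (exponential_product ?one)" using f by blast
  moreover have S: "sets (exponential_product ?one) = sets orthant_borel"
    by (simp add: exponential_product_def sets_restrict_space)
  ultimately have "f \<in> borel_measurable orthant_borel" by (simp only: measurable_cong_sets[OF S refl])
  then show m: "(\<lambda>\<zeta>. indicator orthant \<zeta> * f \<zeta>) \<in> borel_measurable borel"
    using borel_measurable_restrict_space_iff[of orthant borel f] by simp
  show "integrable lborel (\<lambda>\<zeta>. exponential_density_product \<theta> \<zeta> * (indicator orthant \<zeta> * f \<zeta>))" if "\<theta> \<in> pos_orthant" for \<theta>
    using f that integral_exponential_product(1)[OF that m] by blast
qed simp

text \<open>For fixed \<zeta> the substitution v = u \<zeta>_i turns du/u into dv/v. The endpoint v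
  = \<zeta>_i corresponds to u = 1, a null set, and for \<zeta>_i = 0 both sides vanish. The
  substitution is made once for absolute values, which gives integrability, and once for the signed
  integrals.\<close>

lemma jump_kernel_integral:
  fixes f :: "real^'v::finite \<Rightarrow> real"
  assumes f: "\<forall>\<theta>\<in>pos_orthant. integrable (exponential_product \<theta>) f" and \<theta>: "\<theta> \<in> pos_orthant" and ij: "i \<noteq> j"
    and Q: "integrable (exponential_product \<theta> \<Otimes>\<^sub>M unit_interval) (\<lambda>(\<zeta>, u). 1 / u * (f (move_mass i j u \<zeta>) - f \<zeta>))"
  defines "F \<equiv> \<lambda>\<zeta>. indicator orthant \<zeta> * f \<zeta>"
  shows "integrable lborel (exponential_test.jump_kernel F \<theta> i j)"
    and "(\<integral>z. exponential_test.jump_kernel F \<theta> i j z \<partial>lborel)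
      = (\<integral>z. (case z of (\<zeta>, u) \<Rightarrow> 1 / u * (f (move_mass i j u \<zeta>) - f \<zeta>)) \<partial>(exponential_product \<theta> \<Otimes>\<^sub>M unit_interval))"
proof -
  interpret exponential_test F unfolding F_def by (rule exponential_test_indicator[OF f])
  interpret U: finite_measure unit_interval by (rule finite_measure_unit_interval)
  have "prob_space (exponential_product \<theta>)"
    using measurable_space[OF exponential_product_kernel, of \<theta>] pos_orthant_orthant[OF \<theta>]
    by (simp add: space_orthant_borel space_prob_algebra)
  then interpret N: prob_space "exponential_product \<theta>" .
  interpret P: pair_sigma_finite "exponential_product \<theta>" unit_interval ..
  let ?E = "exponential_density_product \<theta>" and ?W = "jump_kernel \<theta> i j"
  let ?Q = "\<lambda>\<zeta> u. 1 / u * (f (move_mass i j u \<zeta>) - f \<zeta>)"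
  \<comment> \<open>The integrand with u confined to the open interval and f replaced by its
    extension; on the orthant nothing changes, since jumps stay there.\<close>
  define q where "q \<zeta> u = (if 0 < u \<and> u < 1 then 1 / u * (F (move_mass i j u \<zeta>) - F \<zeta>) else 0)" for \<zeta> u
  have space: "space (exponential_product \<theta>) = orthant"
    by (simp add: exponential_product_def space_restrict_space)
  have E0: "0 < ?E \<zeta>" for \<zeta> by (rule exponential_density_product_pos[OF \<theta>])
  have Wm: "?W \<in> borel_measurable borel" by measurable
  have qm: "(\<lambda>z. q (fst z) (snd z)) \<in> borel_measurable (borel :: ((real^'v) \<times> real) measure)"
  proof -
    have "(\<lambda>z. move_mass i j (snd z) (fst z)) \<in> borel_measurable (borel :: ((real^'v) \<times> real) measure)"
      unfolding move_mass_def by (intro borel_measurable_continuous_onI continuous_intros)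
    then have [measurable]: "(\<lambda>z. F (move_mass i j (snd z) (fst z))) \<in> borel_measurable (borel :: ((real^'v) \<times> real) measure)"
      by (rule measurable_compose[OF _ F_borel])
    show ?thesis unfolding q_def by measurable
  qed
  have qm1: "q \<zeta> \<in> borel_measurable borel" for \<zeta>
    using measurable_compose[OF _ qm, of "\<lambda>u. (\<zeta>, u)" borel]
    by (simp add: borel_measurable_continuous_onI continuous_intros)
  have Wm1: "(\<lambda>v. ?W (\<zeta>, v)) \<in> borel_measurable borel" for \<zeta>
    using measurable_compose[OF _ Wm, of "\<lambda>u. (\<zeta>, u)" borel]
    by (simp add: borel_measurable_continuous_onI continuous_intros)
  have qQ: "indicator {0<..<1} u * ?Q \<zeta> u = q \<zeta> u" if \<zeta>: "\<zeta> \<in> orthant" for \<zeta> u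
    using that move_mass_orthant[OF \<zeta> ij, of u] by (auto simp: q_def F_def)
  have scale: "AE u in lborel. \<zeta> $ i * ?W (\<zeta>, 0 + \<zeta> $ i * u) = ?E \<zeta> * q \<zeta> u" if \<zeta>: "\<zeta> \<in> orthant" and a: "0 < \<zeta> $ i" for \<zeta>
    using AE_lborel_singleton[of "1::real"]
  proof eventually_elim
    case (elim u)
    have "0 < \<zeta> $ i * u \<and> \<zeta> $ i * u \<le> \<zeta> $ i \<longleftrightarrow> 0 < u \<and> u < 1"
      using a elim by (auto simp: zero_less_mult_iff mult_le_cancel_left1)
    then show ?case
      using \<zeta> a by (simp add: jump_kernel_def q_def move_mass_shift mult.commute)
  qed
  have zero: "?W (\<zeta>, v) = 0" "q \<zeta> u = 0" if "\<zeta> \<in> orthant" "\<not> 0 < \<zeta> $ i" for \<zeta> u v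
  proof -
    have "\<zeta> $ i = 0" using that by (simp add: orthant_def order.antisym not_less)
    then show "?W (\<zeta>, v) = 0" "q \<zeta> u = 0" by (auto simp: jump_kernel_def q_def move_mass_def)
  qed
  have WN: "(\<integral>\<^sup>+v. ennreal (norm (?W (\<zeta>, v))) \<partial>lborel) = ennreal (?E \<zeta>) * ((\<integral>\<^sup>+u. ennreal (norm (q \<zeta> u)) \<partial>lborel) * indicator orthant \<zeta>)" for \<zeta>
  proof (cases "\<zeta> \<in> orthant")
    case False
    then show ?thesis by (simp add: jump_kernel_def)
  next
    case \<zeta>: True
    show ?thesis
    proof (cases "0 < \<zeta> $ i")
      case True
      have "(\<integral>\<^sup>+v. ennreal (norm (?W (\<zeta>, v))) \<partial>lborel) = ennreal \<bar>\<zeta> $ i\<bar> * (\<integral>\<^sup>+u. ennreal (norm (?W (\<zeta>, 0 + \<zeta> $ i * u))) \<partial>lborel)"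
        using True Wm1[of \<zeta>] by (intro nn_integral_real_affine) auto
      also have "\<dots> = (\<integral>\<^sup>+u. ennreal \<bar>\<zeta> $ i\<bar> * ennreal (norm (?W (\<zeta>, 0 + \<zeta> $ i * u))) \<partial>lborel)"
        by (rule nn_integral_cmult[symmetric]) (use measurable_compose[OF _ Wm1[of \<zeta>], of "\<lambda>u. 0 + \<zeta> $ i * u" borel] in simp)
      also have "\<dots> = (\<integral>\<^sup>+u. ennreal (?E \<zeta>) * ennreal (norm (q \<zeta> u)) \<partial>lborel)"
      proof (rule nn_integral_cong_AE)
        show "AE u in lborel. ennreal \<bar>\<zeta> $ i\<bar> * ennreal (norm (?W (\<zeta>, 0 + \<zeta> $ i * u))) = ennreal (?E \<zeta>) * ennreal (norm (q \<zeta> u))"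
          using scale[OF \<zeta> True]
        proof eventually_elim
          case (elim u)
          have "\<bar>\<zeta> $ i\<bar> * norm (?W (\<zeta>, 0 + \<zeta> $ i * u)) = \<bar>\<zeta> $ i * ?W (\<zeta>, 0 + \<zeta> $ i * u)\<bar>" by (simp add: abs_mult)
          also have "\<dots> = ?E \<zeta> * norm (q \<zeta> u)" unfolding elim using E0[of \<zeta>] by (simp add: abs_mult)
          finally show ?case using E0[of \<zeta>] by (simp only: ennreal_mult'[symmetric] abs_ge_zero less_imp_le)
        qed
      qed
      also have "\<dots> = ennreal (?E \<zeta>) * (\<integral>\<^sup>+u. ennreal (norm (q \<zeta> u)) \<partial>lborel)"
        by (rule nn_integral_cmult) (use qm1[of \<zeta>] in simp)
      finally show ?thesis using \<zeta> by simp
    qed (simp add: zero \<zeta>)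
  qed
  have WB: "(\<integral>v. ?W (\<zeta>, v) \<partial>lborel) = ?E \<zeta> * (indicator orthant \<zeta> * (\<integral>u. q \<zeta> u \<partial>lborel))" for \<zeta>
  proof (cases "\<zeta> \<in> orthant")
    case False
    then show ?thesis by (simp add: jump_kernel_def)
  next
    case \<zeta>: True
    show ?thesis
    proof (cases "0 < \<zeta> $ i")
      case True
      have "(\<integral>v. ?W (\<zeta>, v) \<partial>lborel) = \<bar>\<zeta> $ i\<bar> *\<^sub>R (\<integral>u. ?W (\<zeta>, 0 + \<zeta> $ i * u) \<partial>lborel)"
        using True by (intro lborel_integral_real_affine) simp
      also have "\<dots> = (\<integral>u. \<zeta> $ i * ?W (\<zeta>, 0 + \<zeta> $ i * u) \<partial>lborel)" using True by simp
      also have "\<dots> = (\<integral>u. ?E \<zeta> * q \<zeta> u \<partial>lborel)"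
      proof (rule integral_cong_AE[OF _ _ scale[OF \<zeta> True]])
        show "(\<lambda>u. \<zeta> $ i * ?W (\<zeta>, 0 + \<zeta> $ i * u)) \<in> borel_measurable lborel"
          using measurable_compose[OF _ Wm1[of \<zeta>], of "\<lambda>u. 0 + \<zeta> $ i * u" borel] by simp
        show "(\<lambda>u. ?E \<zeta> * q \<zeta> u) \<in> borel_measurable lborel" using qm1[of \<zeta>] by simp
      qed
      finally show ?thesis using \<zeta> by simp
    qed (simp add: zero \<zeta>)
  qed
  have nU: "(\<integral>\<^sup>+u. ennreal (norm (?Q \<zeta> u)) \<partial>unit_interval) = (\<integral>\<^sup>+u. ennreal (norm (q \<zeta> u)) \<partial>lborel)" if \<zeta>: "\<zeta> \<in> orthant" for \<zeta>
  proof -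
    have "(\<integral>\<^sup>+u. ennreal (norm (?Q \<zeta> u)) \<partial>unit_interval) = (\<integral>\<^sup>+u. ennreal (norm (?Q \<zeta> u)) * indicator {0<..<1} u \<partial>lborel)"
      by (rule nn_integral_restrict_space) simp
    also have "\<dots> = (\<integral>\<^sup>+u. ennreal (norm (q \<zeta> u)) \<partial>lborel)"
      by (rule nn_integral_cong) (simp add: qQ[OF \<zeta>, symmetric] indicator_def)
    finally show ?thesis .
  qed
  have bU: "(\<integral>u. ?Q \<zeta> u \<partial>unit_interval) = (\<integral>u. q \<zeta> u \<partial>lborel)" if \<zeta>: "\<zeta> \<in> orthant" for \<zeta>
    unfolding unit_interval_integral set_lebesgue_integral_def
    by (rule Bochner_Integration.integral_cong) (simp_all add: qQ[OF \<zeta>, symmetric])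
  have qi: "(\<lambda>\<zeta>. \<integral>\<^sup>+u. ennreal (norm (q \<zeta> u)) \<partial>lborel) \<in> borel_measurable borel"
    using lborel.borel_measurable_nn_integral[of "\<lambda>\<zeta> u. ennreal (norm (q \<zeta> u))" "borel :: (real^'v) measure"] qm
    by (simp add: case_prod_beta' borel_prod lborel_prod measurable_cong_sets[OF sets_pair_measure_cong[OF refl sets_lborel] refl])
  have "(\<integral>\<^sup>+z. ennreal (norm (?W z)) \<partial>lborel) = (\<integral>\<^sup>+\<zeta>. (\<integral>\<^sup>+v. ennreal (norm (?W (\<zeta>, v))) \<partial>lborel) \<partial>lborel)"
    using Wm by (subst lborel.nn_integral_fst) (auto simp: lborel_prod)
  also have "\<dots> = (\<integral>\<^sup>+\<zeta>. (\<integral>\<^sup>+u. ennreal (norm (q \<zeta> u)) \<partial>lborel) \<partial>exponential_product \<theta>)"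
    unfolding WN by (rule nn_integral_exponential_product[OF \<theta> qi, symmetric])
  also have "\<dots> = (\<integral>\<^sup>+\<zeta>. (\<integral>\<^sup>+u. ennreal (norm (?Q \<zeta> u)) \<partial>unit_interval) \<partial>exponential_product \<theta>)"
    by (rule nn_integral_cong) (simp only: space nU)
  also have "\<dots> = (\<integral>\<^sup>+z. ennreal (norm (case z of (\<zeta>, u) \<Rightarrow> ?Q \<zeta> u)) \<partial>(exponential_product \<theta> \<Otimes>\<^sub>M unit_interval))"
  proof -
    have "(\<lambda>z. ennreal (norm (case z of (\<zeta>, u) \<Rightarrow> ?Q \<zeta> u))) \<in> borel_measurable (exponential_product \<theta> \<Otimes>\<^sub>M unit_interval)"
      using Q by auto
    from U.nn_integral_fst[OF this] show ?thesis by simp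
  qed
  also have "\<dots> < \<infinity>" using Q unfolding integrable_iff_bounded by blast
  finally show W: "integrable lborel ?W" using Wm by (intro integrableI_bounded) auto
  then have W': "integrable (lborel \<Otimes>\<^sub>M lborel) ?W" by (simp add: lborel_prod)
  have qim: "(\<lambda>\<zeta>. indicator orthant \<zeta> * (\<integral>u. q \<zeta> u \<partial>lborel)) \<in> borel_measurable borel"
  proof -
    have "(\<lambda>\<zeta>. \<integral>u. q \<zeta> u \<partial>lborel) \<in> borel_measurable (borel :: (real^'v) measure)"
      using lborel.borel_measurable_lebesgue_integral[of "\<lambda>\<zeta> u. q \<zeta> u" "borel :: (real^'v) measure"] qm
      by (simp add: case_prod_beta' borel_prod lborel_prod measurable_cong_sets[OF sets_pair_measure_cong[OF refl sets_lborel] refl])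
    then show ?thesis by simp
  qed
  have "(\<integral>z. ?W z \<partial>lborel) = (\<integral>\<zeta>. (\<integral>v. ?W (\<zeta>, v) \<partial>lborel) \<partial>lborel)"
    using lborel_pair.integral_fst'[OF W'] by (simp add: lborel_prod)
  also have "\<dots> = (\<integral>\<zeta>. (\<integral>u. q \<zeta> u \<partial>lborel) \<partial>exponential_product \<theta>)"
    unfolding WB by (rule integral_exponential_product(2)[OF \<theta> qim, symmetric])
  also have "\<dots> = (\<integral>\<zeta>. (\<integral>u. ?Q \<zeta> u \<partial>unit_interval) \<partial>exponential_product \<theta>)"
    by (rule Bochner_Integration.integral_cong[OF refl]) (simp only: space bU)
  also have "\<dots> = (\<integral>z. (case z of (\<zeta>, u) \<Rightarrow> ?Q \<zeta> u) \<partial>(exponential_product \<theta> \<Otimes>\<^sub>M unit_interval))"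
    using P.integral_fst'[OF Q] by simp
  finally show "(\<integral>z. ?W z \<partial>lborel) = (\<integral>z. (case z of (\<zeta>, u) \<Rightarrow> ?Q \<zeta> u) \<partial>(exponential_product \<theta> \<Otimes>\<^sub>M unit_interval))" .
qed

text \<open>On each edge the mass jumps reduce to tilt integrals, and so do the parameter jumps.
  Integrability is given for pairs of positive weight; symmetry of p provides it for the reverse
  jump, and pairs of weight 0 contribute nothing.\<close>

lemma exponential_intertwining:
  fixes f :: "real^'v::finite \<Rightarrow> real" and p :: "'v \<Rightarrow> 'v \<Rightarrow> real"
  assumes p: "\<And>i j. 0 \<le> p i j" "\<And>i j. p i j = p j i"
    and f: "\<forall>\<theta>\<in>pos_orthant. integrable (exponential_product \<theta>) f" and \<theta>: "\<theta> \<in> pos_orthant"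
    and C: "continuous_generator_integrable p f \<theta>"
  shows "exponential_intertwiner (continuous_generator p f) \<theta> = hidden_generator p (exponential_intertwiner f) \<theta>"
proof -
  define F where "F \<zeta> = indicator orthant \<zeta> * f \<zeta>" for \<zeta>
  interpret exponential_test F unfolding F_def[abs_def] by (rule exponential_test_indicator[OF f])
  interpret U: finite_measure unit_interval by (rule finite_measure_unit_interval)
  have "prob_space (exponential_product \<theta>)"
    using measurable_space[OF exponential_product_kernel, of \<theta>] pos_orthant_orthant[OF \<theta>]
    by (simp add: space_orthant_borel space_prob_algebra)
  then interpret N: prob_space "exponential_product \<theta>" .
  interpret P: pair_sigma_finite "exponential_product \<theta>" unit_interval ..
  let ?Q = "\<lambda>i j (\<zeta>, u). 1 / u * (f (move_mass i j u \<zeta>) - f \<zeta>)"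
  let ?h = "\<lambda>i j \<zeta>. LBINT u:{0<..<1}. 1 / u * ((f (move_mass i j u \<zeta>) - f \<zeta>) + (f (move_mass j i u \<zeta>) - f \<zeta>))"
  let ?G = "\<lambda>\<theta>. \<integral>\<zeta>. exponential_density_product \<theta> \<zeta> * F \<zeta> \<partial>lborel"
  have G: "exponential_intertwiner f \<theta>' = ?G \<theta>'" if "\<theta>' \<in> pos_orthant" for \<theta>'
    unfolding exponential_intertwiner_def F_def
    by (rule integral_exponential_product(2)[OF that]) (use F_borel in \<open>simp add: F_def[abs_def]\<close>)
  have pair: "integrable (exponential_product \<theta>) (?h i j)"
    "(\<integral>\<zeta>. ?h i j \<zeta> \<partial>exponential_product \<theta>) = (LBINT u:{0<..<1}. 1 / u *
       ((exponential_intertwiner f (move_parameter i j u \<theta>) - exponential_intertwiner f \<theta>)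
      + (exponential_intertwiner f (move_parameter j i u \<theta>) - exponential_intertwiner f \<theta>)))"
    if ij: "i \<noteq> j" and pij: "0 < p i j" for i j
  proof -
    have ji: "j \<noteq> i" and pji: "0 < p j i" using ij pij p(2)[of i j] by auto
    have Q: "integrable (exponential_product \<theta> \<Otimes>\<^sub>M unit_interval) (?Q i j)" "integrable (exponential_product \<theta> \<Otimes>\<^sub>M unit_interval) (?Q j i)"
      using C ij ji pij pji unfolding continuous_generator_integrable_def by auto
    note W = jump_kernel_integral[OF f \<theta> ij Q(1), folded F_def] jump_kernel_integral[OF f \<theta> ji Q(2), folded F_def]
    have Qs: "integrable (exponential_product \<theta> \<Otimes>\<^sub>M unit_interval) (\<lambda>z. ?Q i j z + ?Q j i z)"
      by (rule Bochner_Integration.integrable_add[OF Q])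
    have h: "?h i j \<zeta> = (\<integral>u. ?Q i j (\<zeta>, u) + ?Q j i (\<zeta>, u) \<partial>unit_interval)" for \<zeta>
      unfolding unit_interval_integral by (simp only: prod.case distrib_left)
    show "integrable (exponential_product \<theta>) (?h i j)"
      unfolding h by (rule P.integrable_fst'[OF Qs])
    have "(\<integral>\<zeta>. ?h i j \<zeta> \<partial>exponential_product \<theta>) = (\<integral>z. ?Q i j z + ?Q j i z \<partial>(exponential_product \<theta> \<Otimes>\<^sub>M unit_interval))"
      unfolding h by (rule P.integral_fst'[OF Qs])
    also have "\<dots> = (\<integral>z. jump_kernel \<theta> i j z \<partial>lborel) + (\<integral>z. jump_kernel \<theta> j i z \<partial>lborel)"
      using Bochner_Integration.integral_add[OF Q] W by simp
    also have "\<dots> = (\<integral>z. tilt_kernel \<theta> (1 / \<theta> $ i - 1 / \<theta> $ j) i z \<partial>lborel) + (\<integral>z. tilt_kernel \<theta> (1 / \<theta> $ j - 1 / \<theta> $ i) j z \<partial>lborel)"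
      by (rule jump_kernels_integral[OF \<theta> ij]) (use W in auto)
    \<comment> \<open>Both directions carry the same factor \<open>?G \<theta>\<close>, so the
      logarithms cancel.\<close>
    also have "\<dots> = (LBINT u:{0<..<1}. 1 / u * (?G (move_parameter i j u \<theta>) - ?G \<theta>)) + (LBINT u:{0<..<1}. 1 / u * (?G (move_parameter j i u \<theta>) - ?G \<theta>))"
      unfolding parameter_jump_integral(2)[OF \<theta> ij] parameter_jump_integral(2)[OF \<theta> ji] by (simp add: algebra_simps)
    also have "\<dots> = (LBINT u:{0<..<1}. 1 / u * (?G (move_parameter i j u \<theta>) - ?G \<theta>) + 1 / u * (?G (move_parameter j i u \<theta>) - ?G \<theta>))"
      by (rule set_integral_add(2)[OF parameter_jump_integral(1)[OF \<theta> ij] parameter_jump_integral(1)[OF \<theta> ji], symmetric])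
    also have "\<dots> = (LBINT u:{0<..<1}. 1 / u *
       ((exponential_intertwiner f (move_parameter i j u \<theta>) - exponential_intertwiner f \<theta>)
      + (exponential_intertwiner f (move_parameter j i u \<theta>) - exponential_intertwiner f \<theta>)))"
      by (rule set_lebesgue_integral_cong)
         (auto simp: G[OF \<theta>] G[OF move_parameter_pos_orthant[OF \<theta> ij]] G[OF move_parameter_pos_orthant[OF \<theta> ji]] add_divide_distrib diff_divide_distrib)
    finally show "(\<integral>\<zeta>. ?h i j \<zeta> \<partial>exponential_product \<theta>) = (LBINT u:{0<..<1}. 1 / u *
       ((exponential_intertwiner f (move_parameter i j u \<theta>) - exponential_intertwiner f \<theta>)
      + (exponential_intertwiner f (move_parameter j i u \<theta>) - exponential_intertwiner f \<theta>)))" .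
  qed
  have int: "integrable (exponential_product \<theta>) (\<lambda>\<zeta>. p i j * ?h i j \<zeta>)" if "i \<noteq> j" for i j
  proof (cases "p i j = 0")
    case False
    then have "0 < p i j" using p(1)[of i j] by simp
    from pair(1)[OF that this] show ?thesis by (rule integrable_mult_right)
  qed simp
  have "exponential_intertwiner (continuous_generator p f) \<theta> = (\<Sum>i\<in>UNIV. \<integral>\<zeta>. (\<Sum>j\<in>UNIV - {i}. p i j * ?h i j \<zeta>) \<partial>exponential_product \<theta>)"
    unfolding exponential_intertwiner_def continuous_generator_def
    by (intro Bochner_Integration.integral_sum Bochner_Integration.integrable_sum int) auto
  also have "\<dots> = (\<Sum>i\<in>UNIV. \<Sum>j\<in>UNIV - {i}. \<integral>\<zeta>. p i j * ?h i j \<zeta> \<partial>exponential_product \<theta>)"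
    by (intro sum.cong refl Bochner_Integration.integral_sum int) auto
  also have "\<dots> = hidden_generator p (exponential_intertwiner f) \<theta>"
    unfolding hidden_generator_def
  proof (intro sum.cong refl)
    fix i j :: 'v assume "j \<in> UNIV - {i}"
    then have ij: "i \<noteq> j" by auto
    show "(\<integral>\<zeta>. p i j * ?h i j \<zeta> \<partial>exponential_product \<theta>) = p i j * (LBINT u:{0<..<1}. 1 / u *
       ((exponential_intertwiner f (move_parameter i j u \<theta>) - exponential_intertwiner f \<theta>)
      + (exponential_intertwiner f (move_parameter j i u \<theta>) - exponential_intertwiner f \<theta>)))"
    proof (cases "p i j = 0")
      case False
      then have "0 < p i j" using p(1)[of i j] by simp
      then show ?thesis using pair(2)[OF ij] by (simp only: integral_mult_right_zero)
    qed simp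
  qed
  finally show ?thesis .
qed

theorem theorem3p2:
  fixes p :: "'v::finite \<Rightarrow> 'v \<Rightarrow> real"
    and Pr_d :: "('v \<Rightarrow> nat) \<Rightarrow> 'a measure" and \<eta> :: "real \<Rightarrow> 'a \<Rightarrow> 'v \<Rightarrow> nat"
    and Pr_c :: "real^'v \<Rightarrow> 'b measure" and \<zeta> :: "real \<Rightarrow> 'b \<Rightarrow> real^'v"
    and Pr_h :: "real^'v \<Rightarrow> 'c measure" and \<Theta> :: "real \<Rightarrow> 'c \<Rightarrow> real^'v"
  assumes "symmetric_irreducible_weights p"
  shows
    "(discrete_harmonic_process p Pr_d \<eta> \<and> hidden_parameter_process p Pr_h \<Theta> \<longrightarrow>
        (\<forall>\<theta>\<in>pos_orthant. \<forall>t>0.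
           law_at (count_space UNIV) Pr_d \<eta> (geometric_product \<theta>) t
           = Pr_h \<theta> \<bind> (\<lambda>\<omega>. geometric_product (\<Theta> t \<omega>)))) \<and>
     (\<forall>f. (\<forall>\<theta>\<in>pos_orthant. integrable (geometric_product \<theta>) f) \<longrightarrow>
        (\<forall>\<theta>\<in>pos_orthant.
           geometric_intertwiner (discrete_generator p f) \<theta>
           = hidden_generator p (geometric_intertwiner f) \<theta>)) \<and>
     (continuous_harmonic_process p Pr_c \<zeta> \<and> hidden_parameter_process p Pr_h \<Theta> \<longrightarrow>
        (\<forall>\<theta>\<in>pos_orthant. \<forall>t>0.
           law_at orthant_borel Pr_c \<zeta> (exponential_product \<theta>) t
           = Pr_h \<theta> \<bind> (\<lambda>\<omega>. exponential_product (\<Theta> t \<omega>)))) \<and>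
     (\<forall>f. (\<forall>\<theta>\<in>pos_orthant. integrable (exponential_product \<theta>) f) \<longrightarrow>
        (\<forall>\<theta>\<in>pos_orthant. continuous_generator_integrable p f \<theta> \<longrightarrow>
           exponential_intertwiner (continuous_generator p f) \<theta>
           = hidden_generator p (exponential_intertwiner f) \<theta>))"
proof -
  have p: "0 \<le> p i j" "p i j = p j i" for i j
    using assms unfolding symmetric_irreducible_weights_def by auto
  show ?thesis
  proof (intro conjI impI allI ballI)
    fix \<theta> :: "real^'v" and t :: real
    assume \<theta>: "\<theta> \<in> pos_orthant" and t: "0 < t"
    note \<theta>o = pos_orthant_orthant[OF \<theta>] and t0 = less_imp_le[OF t]
    show "law_at (count_space UNIV) Pr_d \<eta> (geometric_product \<theta>) t = Pr_h \<theta> \<bind> (\<lambda>\<omega>. geometric_product (\<Theta> t \<omega>))"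
      if "discrete_harmonic_process p Pr_d \<eta> \<and> hidden_parameter_process p Pr_h \<Theta>"
      using that by (intro discrete_process_law[OF p(1) _ _ \<theta>o t0]) auto
    show "law_at orthant_borel Pr_c \<zeta> (exponential_product \<theta>) t = Pr_h \<theta> \<bind> (\<lambda>\<omega>. exponential_product (\<Theta> t \<omega>))"
      if "continuous_harmonic_process p Pr_c \<zeta> \<and> hidden_parameter_process p Pr_h \<Theta>"
      using that by (intro continuous_process_law[OF p(1) _ _ \<theta>o t0]) auto
  qed (simp_all add: geometric_intertwining exponential_intertwining p)
qed

end
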